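(* Let $d\ge1$, $p\in(1,\infty)$, and let $\gamma_a=\gamma_a(d,\delta,K,p)>0$, $\gamma_b=\gamma_b(d,\delta,K,p,\varepsilon_0)>0$, $\lambda_0=\lambda_0(d,\delta,K,p,\varepsilon_0,\alpha)\ge0$ be constants for which the a priori estimate $$\lambda\|u\|_{L_p(\mathbb{R}^{d+1}_T)}+\|D^2u\|_{L_p(\mathbb{R}^{d+1}_T)}\le N\|Lu+\partial_tu-\lambda u\|_{L_p(\mathbb{R}^{d+1}_T)}$$ holds for all $T\in[-\infty,\infty)$, $u\in\mathcal{W}^2_p(T)$, $\lambda\ge\lambda_0$ whenever Assumptions P, B($\gamma_b$), A($\gamma_a$) hold (such constants exist). Suppose Assumptions P, B($\gamma_b$), A($\gamma_a$) and Assumption I are satisfied. Then for any $\lambda\ge\lambda_0$, $T\in[-\infty,\infty)$ and $f\in L_p(\mathbb{R}^{d+1}_T)$ there is a unique $u\in\mathcal{W}^2_p(T)$ such that $\partial_tu+Lu-\lambda u=f$ in $\mathbb{R}^{d+1}_T$.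
   Context: $q:=\max(d,p)$ if $p\ne d$; if $p=d$, $q$ is a fixed number with $q>d$. $B_\alpha=\{x\in\mathbb{R}^d:|x|<\alpha\}$. $Lu(t,x)=a^{ij}(t,x)D_{ij}u+b^i(t,x)D_iu-c(t,x)u$ (summation convention). $\mathbb{R}^{d+1}_T=[T,\infty)\times\mathbb{R}^d$ if $T\in\mathbb{R}$ and $\mathbb{R}^{d+1}$ if $T=-\infty$. $\mathcal{W}^2_p(T)$: measurable $u$ on $\mathbb{R}^{d+1}_T$ with $u,Du,D^2u\in L_p(\mathbb{R}^{d+1}_T)$ and $\partial_tu$ locally summable on $\mathbb{R}^{d+1}_T$. Assumption P: (i) $a^{ij},b^i,c$ measurable on $\mathbb{R}^{d+1}$, $a^{ij}=a^{ji}$, $c\ge0$, $\delta|\xi|^2\le a^{ij}\xi^i\xi^j\le K|\xi|^2$, $c\le K$; (ii) for any $x$ and $\alpha\in(0,1]$, $t\mapsto\int_{B_\alpha}|b(t,x+y)|dy$ is locally integrable to the power $p/(p-1)$. Assumption B($\gamma_b$): there exists $\alpha\in(0,1]$ such that a.e. on $\mathbb{R}^{d+1}$, $\alpha^{-d}\int_{B_\alpha}\int_{B_\alpha}|b(t,x+y)-b(t,x+z)|^q\,dy\,dz\le\gamma_b$. Assumption A($\gamma_a$): there exists $\varepsilon_0>0$ such that for all $\varepsilon\in(0,\varepsilon_0]$, $s\in\mathbb{R}$, $i,j$: $\varepsilon^{-2d-2}\int_s^{s+\varepsilon^2}\big(\sup_{x}\int_{B_\varepsilon}\int_{B_\varepsilon}|a^{ij}(t,x+y)-a^{ij}(t,x+z)|dydz\big)dt\le\gamma_a$.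 Exponents: if $p<d$, $q_1=\frac{pd}{(p-1)d+p}$, $r_1=\frac{(p-1)d+p}{(p-1)d}$; if $p\ge d$, $q_1\in(1,p)$ is a fixed number and $r_1=\frac{p}{(p-1)q_1}$. Assumption I: for all $s<t$ in $\mathbb{R}$ and $R\in(0,\infty)$, $\int_s^t\big(\int_{B_R}|b(\tau,x)|^{q_1}dx\big)^{r_1}d\tau<\infty$. *)

theory Defs
  imports "HOL-Analysis.Analysis"
begin

text \<open>Points of R^{d+1} are pairs (t, x) with t real and x in real^'n; d = CARD('n).\<close>
type_synonym 'n pt = "real \<times> (real ^ 'n)"

definition enn_powr :: "ennreal \<Rightarrow> real \<Rightarrow> ennreal" where
  "enn_powr x r = (if x = \<infinity> then \<infinity> else ennreal (enn2real x powr r))"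

definition dom_T :: "ereal \<Rightarrow> 'n::finite pt set" where
  "dom_T T = {z. T \<le> ereal (fst z)}"

definition int_T :: "ereal \<Rightarrow> 'n::finite pt set" where
  "int_T T = {z. T < ereal (fst z)}"

fun Ck_on :: "nat \<Rightarrow> 'a::euclidean_space set \<Rightarrow> ('a \<Rightarrow> real) \<Rightarrow> bool" where
  "Ck_on 0 S f = continuous_on S f"
| "Ck_on (Suc k) S f = (f differentiable_on S \<and> continuous_on S f \<and>
      (\<forall>v. Ck_on k S (\<lambda>z. frechet_derivative f (at z) v)))"

definition smooth_fn :: "('a::euclidean_space \<Rightarrow> real) \<Rightarrow> bool" where
  "smooth_fn f = (\<forall>k. Ck_on k UNIV f)"

definition test_fn :: "'a::euclidean_space set \<Rightarrow> ('a \<Rightarrow> real) \<Rightarrow> bool" where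
  "test_fn \<Omega> \<phi> = (smooth_fn \<phi> \<and> compact (closure {z. \<phi> z \<noteq> 0}) \<and> closure {z. \<phi> z \<noteq> 0} \<subseteq> \<Omega>)"

definition loc_integrable :: "'a::euclidean_space set \<Rightarrow> ('a \<Rightarrow> real) \<Rightarrow> bool" where
  "loc_integrable \<Omega> g = (\<forall>C. compact C \<and> C \<subseteq> \<Omega> \<longrightarrow> set_integrable lebesgue C g)"

definition weak_deriv :: "'a::euclidean_space set \<Rightarrow> ('a \<Rightarrow> real) \<Rightarrow> 'a \<Rightarrow> ('a \<Rightarrow> real) \<Rightarrow> bool" where
  "weak_deriv \<Omega> u e g = (loc_integrable \<Omega> u \<and> loc_integrable \<Omega> g \<and>
     (\<forall>\<phi>. test_fn \<Omega> \<phi> \<longrightarrow>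
        (LINT z:\<Omega>|lebesgue. u z * frechet_derivative \<phi> (at z) e)
          = - (LINT z:\<Omega>|lebesgue. g z * \<phi> z)))"

definition in_Lp :: "real \<Rightarrow> 'a::euclidean_space set \<Rightarrow> ('a \<Rightarrow> 'b::real_normed_vector) \<Rightarrow> bool" where
  "in_Lp p S f = ((\<lambda>z. indicator S z *\<^sub>R f z) \<in> borel_measurable lebesgue \<and>
     (\<integral>\<^sup>+ z\<in>S. ennreal (norm (f z) powr p) \<partial>lebesgue) < \<infinity>)"

definition Lp_norm :: "real \<Rightarrow> 'a::euclidean_space set \<Rightarrow> ('a \<Rightarrow> 'b::real_normed_vector) \<Rightarrow> ennreal" where
  "Lp_norm p S f = enn_powr (\<integral>\<^sup>+ z\<in>S. ennreal (norm (f z) powr p) \<partial>lebesgue) (1 / p)"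

definition e_t :: "'n::finite pt" where "e_t = (1, 0)"
definition e_x :: "'n::finite \<Rightarrow> 'n pt" where "e_x i = (0, axis i 1)"

text \<open>u in W^2_p(T), with ut = d_t u, Du = gradient, D2u = Hessian (weak derivatives).
  Frobenius norm is used for D2u (norm on real^'n^'n).\<close>
definition W2p :: "real \<Rightarrow> ereal \<Rightarrow> ('n::finite pt \<Rightarrow> real) \<Rightarrow> ('n pt \<Rightarrow> real)
     \<Rightarrow> ('n pt \<Rightarrow> real ^ 'n) \<Rightarrow> ('n pt \<Rightarrow> real ^ 'n ^ 'n) \<Rightarrow> bool" where
  "W2p p T u ut Du D2u =
     (in_Lp p (dom_T T) u \<and> in_Lp p (dom_T T) Du \<and> in_Lp p (dom_T T) D2u \<and>
      (\<forall>i. weak_deriv (int_T T) u (e_x i) (\<lambda>z. Du z $ i)) \<and>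
      (\<forall>i j. weak_deriv (int_T T) (\<lambda>z. Du z $ i) (e_x j) (\<lambda>z. D2u z $ i $ j)) \<and>
      weak_deriv (int_T T) u e_t ut \<and>
      (\<forall>R. set_integrable lebesgue (dom_T T \<inter> cball 0 R) ut))"

definition Lop :: "('n::finite pt \<Rightarrow> real ^ 'n ^ 'n) \<Rightarrow> ('n pt \<Rightarrow> real ^ 'n) \<Rightarrow> ('n pt \<Rightarrow> real)
     \<Rightarrow> ('n pt \<Rightarrow> real) \<Rightarrow> ('n pt \<Rightarrow> real ^ 'n) \<Rightarrow> ('n pt \<Rightarrow> real ^ 'n ^ 'n) \<Rightarrow> 'n pt \<Rightarrow> real" where
  "Lop a b c u Du D2u z = (\<Sum>i\<in>UNIV. \<Sum>j\<in>UNIV. a z $ i $ j * D2u z $ i $ j) + b z \<bullet> Du z - c z * u z"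

definition AssumpP :: "real \<Rightarrow> real \<Rightarrow> real \<Rightarrow> ('n::finite pt \<Rightarrow> real ^ 'n ^ 'n) \<Rightarrow> ('n pt \<Rightarrow> real ^ 'n)
     \<Rightarrow> ('n pt \<Rightarrow> real) \<Rightarrow> bool" where
  "AssumpP p \<delta> K a b c =
     ((\<forall>i j. (\<lambda>z. a z $ i $ j) \<in> borel_measurable lebesgue) \<and>
      (\<forall>i. (\<lambda>z. b z $ i) \<in> borel_measurable lebesgue) \<and> c \<in> borel_measurable lebesgue \<and>
      (\<forall>z i j. a z $ i $ j = a z $ j $ i) \<and> (\<forall>z. 0 \<le> c z \<and> c z \<le> K) \<and>
      (\<forall>z \<xi>. \<delta> * norm \<xi> ^ 2 \<le> (\<Sum>i\<in>UNIV. \<Sum>j\<in>UNIV. a z $ i $ j * \<xi> $ i * \<xi> $ j) \<and>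
              (\<Sum>i\<in>UNIV. \<Sum>j\<in>UNIV. a z $ i $ j * \<xi> $ i * \<xi> $ j) \<le> K * norm \<xi> ^ 2) \<and>
      (\<forall>x \<alpha> s t. 0 < \<alpha> \<and> \<alpha> \<le> 1 \<longrightarrow>
         (\<integral>\<^sup>+ \<tau>\<in>{s..t}. enn_powr (\<integral>\<^sup>+ y\<in>ball 0 \<alpha>. ennreal (norm (b (\<tau>, x + y))) \<partial>lebesgue) (p / (p - 1))
            \<partial>lebesgue) < \<infinity>))"

text \<open>Assumption B(gamma_b), with the radius alpha made explicit.\<close>
definition AssumpB :: "real \<Rightarrow> real \<Rightarrow> real \<Rightarrow> ('n::finite pt \<Rightarrow> real ^ 'n) \<Rightarrow> bool" where
  "AssumpB q \<alpha> \<gamma>b b =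
     (0 < \<alpha> \<and> \<alpha> \<le> 1 \<and>
      (AE z in lebesgue. ennreal (\<alpha> powr (- real CARD('n))) *
         (\<integral>\<^sup>+ y\<in>ball 0 \<alpha>. \<integral>\<^sup>+ w\<in>ball 0 \<alpha>.
             ennreal (norm (b (fst z, snd z + y) - b (fst z, snd z + w)) powr q) \<partial>lebesgue \<partial>lebesgue)
         \<le> ennreal \<gamma>b))"

text \<open>Assumption A(gamma_a), with epsilon_0 made explicit.\<close>
definition AssumpA :: "real \<Rightarrow> real \<Rightarrow> ('n::finite pt \<Rightarrow> real ^ 'n ^ 'n) \<Rightarrow> bool" where
  "AssumpA \<epsilon>0 \<gamma>a a =
     (0 < \<epsilon>0 \<and>
      (\<forall>\<epsilon> s i j. 0 < \<epsilon> \<and> \<epsilon> \<le> \<epsilon>0 \<longrightarrow>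
         ennreal (\<epsilon> powr (- 2 * real CARD('n) - 2)) *
         (\<integral>\<^sup>+ t\<in>{s..s + \<epsilon>\<^sup>2}.
            (SUP x. \<integral>\<^sup>+ y\<in>ball 0 \<epsilon>. \<integral>\<^sup>+ w\<in>ball 0 \<epsilon>.
                ennreal \<bar>a (t, x + y) $ i $ j - a (t, x + w) $ i $ j\<bar> \<partial>lebesgue \<partial>lebesgue) \<partial>lebesgue)
         \<le> ennreal \<gamma>a))"

definition AssumpI :: "real \<Rightarrow> real \<Rightarrow> ('n::finite pt \<Rightarrow> real ^ 'n) \<Rightarrow> bool" where
  "AssumpI q1 r1 b =
     (\<forall>s t R. s < t \<and> 0 < R \<longrightarrow>
        (\<integral>\<^sup>+ \<tau>\<in>{s..t}. enn_powr (\<integral>\<^sup>+ x\<in>ball 0 R. ennreal (norm (b (\<tau>, x)) powr q1) \<partial>lebesgue) r1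
           \<partial>lebesgue) < \<infinity>)"

end

theory Submission
  imports Defs
begin

text \<open>
  Uniqueness is immediate from the a priori estimate once \<open>lam0 > 0\<close>. Positivity of \<open>lam0\<close> is forced
  by the hypotheses: the drift \<open>- \<kappa> x\<close> with small \<open>\<kappa>\<close> is admissible, and for \<open>lam = \<kappa> d / p\<close> it has
  approximate solutions of the homogeneous equation that violate the estimate.

  For existence it suffices to treat the whole space, extending \<open>f\<close> by zero. The range of the heat
  operator \<open>\<partial>\<^sub>t + K \<Delta> - lam\<close> on compactly supported \<open>C\<^sup>2\<close> functions is dense in \<open>L\<^sub>p\<close>, because its
  resolvent is approximated by that of a random walk. For drifts truncated to a ball, which
  still satisfy the assumptions, the a priori estimate carries this density along the segment of
  operators joining the heat operator to \<open>L\<close>. This yields \<open>C\<^sup>2\<close> functions, bounded in \<open>W\<^sup>2\<^sub>p\<close>, whose images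
  under the truncated operators tend to \<open>f\<close>. Assumptions P and B bound \<open>b \<bullet> Du\<close> in \<open>L\<^sub>1\<close> on bounded sets
  by the \<open>L\<^sub>p\<close> norms of \<open>Du\<close> and \<open>D\<^sup>2u\<close>, so the truncation error vanishes locally in \<open>L\<^sub>1\<close>. The approximate
  solutions form decreasing convex sets, and near-minimisers of the \<open>W\<^sup>2\<^sub>p\<close> norm over them converge
  strongly, by uniform convexity, to a solution.
\<close>

text \<open>The obstacle is the integrability of the drift in time. Even for \<open>u\<close> in
  \<open>C2c\<close> the term b . Du is summable in time only to the power p/(p-1), which is less
  than p when p > 2. Hence L need not map \<open>C2c\<close> into L_p, and continuity along a
  segment cannot be run for L itself. Truncation is done by the projection onto a ball; being a
  contraction, it enlarges neither the means in P nor the oscillations in B, so one N serves every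
  truncation level and every point of the segment. The segment starts at K times the Laplacian
  because the matrix K I obeys the ellipticity bounds and has no oscillation. In the limit only
  local L_1 convergence of the equation survives: locally b is L_{p/(p-1)} in time with values in
  L_q, q \<ge> d, while Du is L_p in time with values in W^1_p, and a Sobolev-type pairing makes the
  product summable. This is also all that is asked of the time derivative. Strong convergence of the
  approximations is arranged so that no duality theory enters. Positivity of \<open>lam0\<close>
  matters because at lam = 0 the estimate does not see u itself.\<close>

subsection \<open>\<open>L\<^sub>p\<close> integrals\<close>

text \<open>The p-th power of the L_p norm, kept as an integral: averages over translates, Tonelli
  and convexity act on it directly, and no root has to be taken in \<open>ennreal\<close>. The price
  is a factor 2 powr p in every triangle inequality.\<close>

definition pint :: "real \<Rightarrow> ('a::euclidean_space \<Rightarrow> 'b::real_normed_vector) \<Rightarrow> ennreal" where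
  "pint p f = (\<integral>\<^sup>+z. ennreal (norm (f z) powr p) \<partial>lborel)"

text \<open>Unconditional in \<open>f\<close>: a simple function for the completion below the
  integrand becomes one for \<open>lborel\<close> after being set to zero on a null set. So
  \<open>pint\<close> can also be used for functions that are only Lebesgue measurable.\<close>

lemma pint_lebesgue: "(\<integral>\<^sup>+z. ennreal (norm (f z) powr p) \<partial>lebesgue) = pint p f"
  unfolding pint_def by (rule nn_integral_completion)

lemma pint_mono_AE:
  assumes "AE z in lborel. norm (f z) \<le> norm (g z)" "0 \<le> p"
  shows "pint p f \<le> pint p g"
  unfolding pint_def using assms
  by (intro nn_integral_mono_AE) (auto intro!: ennreal_leI powr_mono2)

lemma pint_mono:
  assumes "\<And>z. norm (f z) \<le> norm (g z)" "0 \<le> p"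
  shows "pint p f \<le> pint p g"
  using assms by (intro pint_mono_AE) auto

lemma pint_cong_AE:
  assumes "AE z in lborel. f z = g z"
  shows "pint p f = pint p g"
  unfolding pint_def using assms by (intro nn_integral_cong_AE) auto

lemma pint_zero [simp]: "pint p (\<lambda>_. 0) = 0"
  by (simp add: pint_def)

lemma powr_add_le:
  fixes x y p :: real
  assumes "0 \<le> x" "0 \<le> y" "0 \<le> p"
  shows "(x + y) powr p \<le> 2 powr p * (x powr p + y powr p)"
proof -
  have "(x + y) powr p \<le> (2 * max x y) powr p"
    using assms by (intro powr_mono2) auto
  also have "\<dots> = 2 powr p * max x y powr p"
    by (simp add: powr_mult)
  also have "\<dots> \<le> 2 powr p * (x powr p + y powr p)"
    by (intro mult_left_mono) (auto simp: max_def)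
  finally show ?thesis .
qed

lemma borel_measurable_pint [measurable]:
  assumes [measurable]: "f \<in> borel_measurable M"
  shows "(\<lambda>z. ennreal (norm (f z) powr p)) \<in> borel_measurable M"
  by measurable

lemma pint_add:
  fixes f g :: "'a::euclidean_space \<Rightarrow> 'b::euclidean_space"
  assumes [measurable]: "f \<in> borel_measurable borel" "g \<in> borel_measurable borel" and p: "0 \<le> p"
  shows "pint p (\<lambda>z. f z + g z) \<le> ennreal (2 powr p) * (pint p f + pint p g)"
proof -
  have "pint p (\<lambda>z. f z + g z)
      \<le> (\<integral>\<^sup>+z. ennreal (2 powr p) * (ennreal (norm (f z) powr p) + ennreal (norm (g z) powr p)) \<partial>lborel)"
    unfolding pint_def
  proof (intro nn_integral_mono)
    fix z
    have "norm (f z + g z) powr p \<le> (norm (f z) + norm (g z)) powr p"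
      using p by (intro powr_mono2 norm_triangle_ineq) auto
    also have "\<dots> \<le> 2 powr p * (norm (f z) powr p + norm (g z) powr p)"
      using p by (intro powr_add_le) auto
    finally show "ennreal (norm (f z + g z) powr p)
        \<le> ennreal (2 powr p) * (ennreal (norm (f z) powr p) + ennreal (norm (g z) powr p))"
      by (simp add: ennreal_mult[symmetric] ennreal_plus[symmetric] ennreal_leI del: ennreal_plus)
  qed
  also have "\<dots> = ennreal (2 powr p) * (pint p f + pint p g)"
    by (simp add: nn_integral_cmult nn_integral_add pint_def)
  finally show ?thesis .
qed

lemma pint_minus: "pint p (\<lambda>z. f z - g z) = pint p (\<lambda>z. g z - f z)"
  by (simp add: pint_def norm_minus_commute)

lemma pint_uminus [simp]: "pint p (\<lambda>z. - f z) = pint p f"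
  by (simp add: pint_def)

lemma pint_diff:
  fixes f g :: "'a::euclidean_space \<Rightarrow> 'b::euclidean_space"
  assumes "f \<in> borel_measurable borel" "g \<in> borel_measurable borel" "0 \<le> p"
  shows "pint p (\<lambda>z. f z - g z) \<le> ennreal (2 powr p) * (pint p f + pint p g)"
  using pint_add[of f "\<lambda>z. - g z" p] assms by simp

lemma pint_scaleR:
  fixes f :: "'a::euclidean_space \<Rightarrow> 'b::euclidean_space"
  assumes [measurable]: "f \<in> borel_measurable borel"
  shows "pint p (\<lambda>z. c *\<^sub>R f z) = ennreal (\<bar>c\<bar> powr p) * pint p f"
  by (simp add: pint_def powr_mult ennreal_mult nn_integral_cmult)

lemma pint_cmult:
  fixes f :: "'a::euclidean_space \<Rightarrow> real"
  assumes [measurable]: "f \<in> borel_measurable borel"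
  shows "pint p (\<lambda>z. c * f z) = ennreal (\<bar>c\<bar> powr p) * pint p f"
  using pint_scaleR[of f p c] by simp

text \<open>Bounding the norm of the sum by the number of terms times the largest one gives the
  constant for every p \<ge> 0, without convexity.\<close>

lemma pint_sum:
  fixes f :: "'i \<Rightarrow> 'a::euclidean_space \<Rightarrow> 'b::euclidean_space"
  assumes fin: "finite A" and [measurable]: "\<And>i. i \<in> A \<Longrightarrow> f i \<in> borel_measurable borel" and p: "0 \<le> p"
  shows "pint p (\<lambda>z. \<Sum>i\<in>A. f i z) \<le> ennreal (real (card A) powr p) * (\<Sum>i\<in>A. pint p (f i))"
proof -
  have "pint p (\<lambda>z. \<Sum>i\<in>A. f i z)
      \<le> (\<integral>\<^sup>+z. ennreal (real (card A) powr p) * (\<Sum>i\<in>A. ennreal (norm (f i z) powr p)) \<partial>lborel)"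
    unfolding pint_def
  proof (intro nn_integral_mono)
    fix z
    show "ennreal (norm (\<Sum>i\<in>A. f i z) powr p)
        \<le> ennreal (real (card A) powr p) * (\<Sum>i\<in>A. ennreal (norm (f i z) powr p))"
    proof (cases "A = {}")
      case False
      define m where "m = Max ((\<lambda>i. norm (f i z)) ` A)"
      have m: "\<And>i. i \<in> A \<Longrightarrow> norm (f i z) \<le> m"
        unfolding m_def using fin by auto
      have "m \<in> (\<lambda>i. norm (f i z)) ` A"
        unfolding m_def using fin False by (intro Max_in) auto
      then obtain j where j: "j \<in> A" "m = norm (f j z)" by auto
      have "norm (\<Sum>i\<in>A. f i z) \<le> real (card A) * m"
        using m by (intro order.trans[OF norm_sum] sum_bounded_above) auto
      then have "norm (\<Sum>i\<in>A. f i z) powr p \<le> (real (card A) * m) powr p"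
        using p by (intro powr_mono2) auto
      also have "\<dots> = real (card A) powr p * m powr p"
        by (simp add: powr_mult)
      also have "\<dots> \<le> real (card A) powr p * (\<Sum>i\<in>A. norm (f i z) powr p)"
        unfolding j(2) using j(1) fin by (intro mult_left_mono member_le_sum) auto
      finally show ?thesis
        by (simp add: ennreal_mult[symmetric] sum_ennreal sum_nonneg ennreal_leI)
    qed auto
  qed
  also have "\<dots> = ennreal (real (card A) powr p) * (\<Sum>i\<in>A. pint p (f i))"
    by (simp add: nn_integral_cmult nn_integral_sum pint_def del: sum_ennreal)
  finally show ?thesis .
qed

lemma nn_integral_shift:
  fixes f :: "'a::euclidean_space \<Rightarrow> ennreal"
  assumes [measurable]: "f \<in> borel_measurable borel"
  shows "(\<integral>\<^sup>+z. f (z + v) \<partial>lborel) = (\<integral>\<^sup>+z. f z \<partial>lborel)"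
proof -
  have "(\<integral>\<^sup>+z. f z \<partial>lborel) = (\<integral>\<^sup>+z. f z \<partial>distr lborel borel ((+) v))"
    by (simp add: lborel_distr_plus)
  also have "\<dots> = (\<integral>\<^sup>+z. f (z + v) \<partial>lborel)"
    by (subst nn_integral_distr) (auto simp: add.commute)
  finally show ?thesis ..
qed

lemma nn_integral_affine:
  fixes f :: "'a::euclidean_space \<Rightarrow> ennreal"
  assumes [measurable]: "f \<in> borel_measurable borel" and r: "0 < r"
  shows "(\<integral>\<^sup>+y. f (x + r *\<^sub>R y) \<partial>lborel) = ennreal (r powr (- real DIM('a))) * (\<integral>\<^sup>+z. f z \<partial>lborel)"
proof -
  have "(\<integral>\<^sup>+z. f z \<partial>lborel) = ennreal (r ^ DIM('a)) * (\<integral>\<^sup>+y. f (x + r *\<^sub>R y) \<partial>lborel)"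
    using r by (subst lborel_affine[of r x]) (auto simp: nn_integral_density nn_integral_distr nn_integral_cmult)
  then have "ennreal (r powr (- real DIM('a))) * (\<integral>\<^sup>+z. f z \<partial>lborel)
     = ennreal (r powr (- real DIM('a)) * r ^ DIM('a)) * (\<integral>\<^sup>+y. f (x + r *\<^sub>R y) \<partial>lborel)"
    using r by (simp add: ennreal_mult mult.assoc)
  also have "r powr (- real DIM('a)) * r ^ DIM('a) = 1"
    using r by (simp add: powr_minus powr_realpow)
  finally show ?thesis by simp
qed

lemma pint_shift:
  assumes [measurable]: "f \<in> borel_measurable borel"
  shows "pint p (\<lambda>z. f (z + v)) = pint p f"
  unfolding pint_def by (rule nn_integral_shift) simp

lemma powr_convex_comb:
  fixes x y p \<theta> :: real
  assumes "0 \<le> x" "0 \<le> y" "1 \<le> p" "0 \<le> \<theta>" "\<theta> \<le> 1"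
  shows "(\<theta> * x + (1 - \<theta>) * y) powr p \<le> \<theta> * x powr p + (1 - \<theta>) * y powr p"
proof -
  have aux: "(s * w) powr p \<le> s * w powr p" if "0 \<le> s" "s \<le> 1" "0 \<le> w" for s w
  proof (cases "s = 0")
    case False
    then have "s powr p \<le> s powr 1"
      using that assms by (intro powr_mono') auto
    then show ?thesis
      using that False by (simp add: powr_mult mult_right_mono)
  qed (use assms in auto)
  consider "x = 0" | "y = 0" | "0 < x" "0 < y" using assms by linarith
  then show ?thesis
  proof cases
    case 3
    then show ?thesis
      using convex_onD[OF powr_convex[OF assms(3)], of "1 - \<theta>" x y] assms
      by (auto simp: algebra_simps)
  qed (use aux[of "1 - \<theta>" y] aux[of \<theta> x] assms in auto)
qed

lemma norm_powr_convex_comb: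
  fixes x y :: "'b::real_normed_vector"
  assumes "1 \<le> p" "0 \<le> \<theta>" "\<theta> \<le> 1"
  shows "norm (\<theta> *\<^sub>R x + (1 - \<theta>) *\<^sub>R y) powr p \<le> \<theta> * norm x powr p + (1 - \<theta>) * norm y powr p"
proof -
  have "norm (\<theta> *\<^sub>R x + (1 - \<theta>) *\<^sub>R y) \<le> \<theta> * norm x + (1 - \<theta>) * norm y"
    using assms by (intro order.trans[OF norm_triangle_ineq]) auto
  then have "norm (\<theta> *\<^sub>R x + (1 - \<theta>) *\<^sub>R y) powr p \<le> (\<theta> * norm x + (1 - \<theta>) * norm y) powr p"
    using assms by (intro powr_mono2) auto
  also have "\<dots> \<le> \<theta> * norm x powr p + (1 - \<theta>) * norm y powr p"
    using assms by (intro powr_convex_comb) auto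
  finally show ?thesis .
qed

lemma pint_convex:
  fixes f g :: "'a::euclidean_space \<Rightarrow> 'b::euclidean_space"
  assumes [measurable]: "f \<in> borel_measurable borel" "g \<in> borel_measurable borel"
    and "1 \<le> p" "0 \<le> \<theta>" "\<theta> \<le> 1"
  shows "pint p (\<lambda>z. \<theta> *\<^sub>R f z + (1 - \<theta>) *\<^sub>R g z) \<le> ennreal \<theta> * pint p f + ennreal (1 - \<theta>) * pint p g"
proof -
  have "pint p (\<lambda>z. \<theta> *\<^sub>R f z + (1 - \<theta>) *\<^sub>R g z)
     \<le> (\<integral>\<^sup>+z. ennreal \<theta> * ennreal (norm (f z) powr p) + ennreal (1 - \<theta>) * ennreal (norm (g z) powr p) \<partial>lborel)"
    unfolding pint_def
  proof (intro nn_integral_mono)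
    fix z
    show "ennreal (norm (\<theta> *\<^sub>R f z + (1 - \<theta>) *\<^sub>R g z) powr p)
      \<le> ennreal \<theta> * ennreal (norm (f z) powr p) + ennreal (1 - \<theta>) * ennreal (norm (g z) powr p)"
      using norm_powr_convex_comb[of p \<theta> "f z" "g z"] assms(3-5)
      by (simp add: ennreal_mult[symmetric] ennreal_plus[symmetric] ennreal_leI del: ennreal_plus)
  qed
  also have "\<dots> = ennreal \<theta> * pint p f + ennreal (1 - \<theta>) * pint p g"
    by (simp add: nn_integral_cmult nn_integral_add pint_def)
  finally show ?thesis .
qed

lemma Lp_norm_UNIV: "Lp_norm p UNIV f = enn_powr (pint p f) (1 / p)"
  by (simp add: Lp_norm_def pint_lebesgue)

lemma enn_powr_mono:
  assumes "x \<le> y" "0 \<le> r"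
  shows "enn_powr x r \<le> enn_powr y r"
proof (cases "y = \<infinity>")
  case False
  then have "x \<noteq> \<infinity>" using assms(1) by (auto simp: top_unique)
  have "enn2real x \<le> enn2real y"
    using False assms(1) by (intro enn2real_mono) (auto simp: less_top)
  then show ?thesis
    using False \<open>x \<noteq> \<infinity>\<close> assms(2) by (auto simp: enn_powr_def intro!: ennreal_leI powr_mono2)
qed (simp add: enn_powr_def)

lemma enn_powr_ennreal: "0 \<le> x \<Longrightarrow> enn_powr (ennreal x) r = ennreal (x powr r)"
  by (simp add: enn_powr_def)

lemma enn_powr_zero [simp]: "enn_powr 0 r = 0"
  by (simp add: enn_powr_def)

text \<open>An infinite \<open>y\<close> is set aside: for C \<le> 0 the right-hand side would then
  be 0 times infinity, which is 0 in \<open>ennreal\<close>. The factor max 0 C reflects that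
  \<open>ennreal\<close> sends negative reals to 0.\<close>

lemma le_of_enn_powr_le:
  assumes le: "ennreal c * enn_powr x (1 / p) \<le> ennreal C * enn_powr y (1 / p)"
    and "0 < p" "0 < c"
  shows "x \<le> ennreal ((max 0 C / c) powr p) * y \<or> y = \<infinity>"
proof (cases "y = \<infinity>")
  case False
  define C' where "C' = max 0 C"
  have C': "ennreal C = ennreal C'" "0 \<le> C'" by (auto simp: C'_def max_def ennreal_neg)
  obtain r where r: "y = ennreal r" "0 \<le> r" using False by (cases y) auto
  have "ennreal c * enn_powr x (1 / p) < \<infinity>"
    using le r by (simp add: enn_powr_ennreal ennreal_mult[symmetric] C') (metis ennreal_less_top leD linorder_not_less top.not_eq_extremum)
  then have "x \<noteq> \<infinity>"
    using assms(3) by (auto simp: enn_powr_def ennreal_mult_eq_top_iff)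
  then obtain s where s: "x = ennreal s" "0 \<le> s" by (cases x) auto
  have "ennreal (c * s powr (1 / p)) \<le> ennreal (C' * r powr (1 / p))"
    using le r s assms(3) C' by (simp add: enn_powr_ennreal ennreal_mult[symmetric])
  then have "c * s powr (1 / p) \<le> C' * r powr (1 / p)"
    using C' by (subst (asm) ennreal_le_iff) auto
  then have "s powr (1 / p) \<le> C' / c * r powr (1 / p)"
    using assms(3) by (simp add: field_simps)
  then have "(s powr (1 / p)) powr p \<le> (C' / c * r powr (1 / p)) powr p"
    using assms(2) by (intro powr_mono2) auto
  moreover have "(w powr (1 / p)) powr p = w" if "0 \<le> w" for w
    using assms(2) that by (simp add: powr_powr)
  ultimately have "s \<le> (C' / c) powr p * r"
    using s r by (simp add: powr_mult del: times_divide_eq_left)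
  then show ?thesis
    using s r by (auto simp: ennreal_mult[symmetric] C'_def[symmetric] intro!: ennreal_leI)
qed simp

subsection \<open>Directional derivatives and compactly supported functions\<close>

definition dd :: "'a::euclidean_space \<Rightarrow> ('a \<Rightarrow> real) \<Rightarrow> 'a \<Rightarrow> real" where
  "dd e u z = frechet_derivative u (at z) e"

definition C1 :: "('a::euclidean_space \<Rightarrow> real) \<Rightarrow> bool" where
  "C1 u \<longleftrightarrow> (\<forall>z. u differentiable (at z)) \<and> (\<forall>e. continuous_on UNIV (dd e u))"

text \<open>Second order is the smoothness of all approximants: they are built from
  \<open>max 0 s ^ 3\<close>, which has two continuous derivatives and no third at 0. Derivatives in
  all directions stand for the partial ones, so no basis is chosen.\<close>

definition C2 :: "('a::euclidean_space \<Rightarrow> real) \<Rightarrow> bool" where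
  "C2 u \<longleftrightarrow> C1 u \<and> (\<forall>e. C1 (dd e u))"

definition bsupp :: "('a::euclidean_space \<Rightarrow> real) \<Rightarrow> bool" where
  "bsupp u \<longleftrightarrow> (\<exists>R>0. \<forall>z. R \<le> norm z \<longrightarrow> u z = 0)"

definition Cc :: "('a::euclidean_space \<Rightarrow> real) \<Rightarrow> bool" where
  "Cc u \<longleftrightarrow> continuous_on UNIV u \<and> bsupp u"

lemma dd_unique:
  assumes "(u has_derivative G) (at z)"
  shows "dd e u z = G e"
  using frechet_derivative_at[OF assms] by (simp add: dd_def)

lemma C1_has_derivative:
  assumes "C1 u"
  shows "(u has_derivative (\<lambda>e. dd e u z)) (at z)"
  using assms frechet_derivative_works[of u "at z"] by (simp add: C1_def dd_def[abs_def])

lemma C1I: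
  assumes "\<And>z. (u has_derivative G z) (at z)" "\<And>e. continuous_on UNIV (\<lambda>z. G z e)"
  shows "C1 u"
proof -
  have "dd e u = (\<lambda>z. G z e)" for e
    using dd_unique[OF assms(1)] by auto
  then show ?thesis
    using assms by (auto simp: C1_def differentiable_def)
qed

lemma C1_continuous: "C1 u \<Longrightarrow> continuous_on UNIV u"
  by (auto intro!: continuous_at_imp_continuous_on has_derivative_continuous[OF C1_has_derivative])

lemma C2I:
  assumes "\<And>z. (u has_derivative G z) (at z)" "\<And>e. C1 (\<lambda>z. G z e)"
  shows "C2 u"
proof -
  have dd: "dd e u = (\<lambda>z. G z e)" for e
    using dd_unique[OF assms(1)] by auto
  have "continuous_on UNIV (\<lambda>z. G z e)" for e
    by (rule C1_continuous[OF assms(2)])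
  then show ?thesis
    using assms C1I[OF assms(1)] by (auto simp: C2_def dd)
qed

lemma C1_dd_continuous: "C1 u \<Longrightarrow> continuous_on UNIV (dd e u)"
  by (simp add: C1_def)

lemma C2_C1: "C2 u \<Longrightarrow> C1 u"
  by (simp add: C2_def)

lemma C2_C1_dd: "C2 u \<Longrightarrow> C1 (dd e u)"
  by (simp add: C2_def)

lemma C1_const [simp]: "C1 (\<lambda>z. c)"
  by (rule C1I[where G = "\<lambda>_ _. 0"]) auto

lemma C2_const [simp]: "C2 (\<lambda>z. c)"
  by (rule C2I[where G = "\<lambda>_ _. 0"]) auto

lemma C1_add: assumes "C1 u" "C1 v" shows "C1 (\<lambda>z. u z + v z)"
proof (rule C1I)
  show "((\<lambda>z. u z + v z) has_derivative (\<lambda>e. dd e u z + dd e v z)) (at z)" for z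
    by (intro has_derivative_add C1_has_derivative assms)
qed (intro continuous_on_add C1_dd_continuous assms)

lemma C2_add: assumes "C2 u" "C2 v" shows "C2 (\<lambda>z. u z + v z)"
proof (rule C2I)
  show "((\<lambda>z. u z + v z) has_derivative (\<lambda>e. dd e u z + dd e v z)) (at z)" for z
    by (intro has_derivative_add C1_has_derivative assms C2_C1)
qed (rule C1_add[OF C2_C1_dd[OF assms(1)] C2_C1_dd[OF assms(2)]])

lemma C1_mult: assumes "C1 u" "C1 v" shows "C1 (\<lambda>z. u z * v z)"
proof (rule C1I)
  show "((\<lambda>z. u z * v z) has_derivative (\<lambda>e. u z * dd e v z + dd e u z * v z)) (at z)" for z
    by (intro has_derivative_mult C1_has_derivative assms)
qed (intro continuous_on_add continuous_on_mult C1_dd_continuous C1_continuous assms)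

lemma C2_mult: assumes "C2 u" "C2 v" shows "C2 (\<lambda>z. u z * v z)"
proof (rule C2I)
  show "((\<lambda>z. u z * v z) has_derivative (\<lambda>e. u z * dd e v z + dd e u z * v z)) (at z)" for z
    by (intro has_derivative_mult C1_has_derivative assms C2_C1)
  show "C1 (\<lambda>z. u z * dd e v z + dd e u z * v z)" for e
    by (rule C1_add[OF C1_mult[OF C2_C1[OF assms(1)] C2_C1_dd[OF assms(2)]]
          C1_mult[OF C2_C1_dd[OF assms(1)] C2_C1[OF assms(2)]]])
qed

lemma C2_cmult: "C2 u \<Longrightarrow> C2 (\<lambda>z. c * u z)"
  by (rule C2_mult[OF C2_const])

lemma C2_diff: assumes "C2 u" "C2 v" shows "C2 (\<lambda>z. u z - v z)"
  using C2_add[OF assms(1) C2_cmult[OF assms(2), of "-1"]] by simp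

lemma C1_inner [simp]: "C1 (\<lambda>z. z \<bullet> a)"
  by (rule C1I[where G = "\<lambda>_ e. e \<bullet> a"]) (auto intro!: derivative_eq_intros)

lemma C2_inner [simp]: "C2 (\<lambda>z. z \<bullet> a)"
  by (rule C2I[where G = "\<lambda>_ e. e \<bullet> a"]) (auto intro!: derivative_eq_intros)

lemma dd_add: assumes "C1 u" "C1 v" shows "dd e (\<lambda>z. u z + v z) z = dd e u z + dd e v z"
  by (rule dd_unique[OF has_derivative_add]) (intro C1_has_derivative assms)+

lemma dd_mult: assumes "C1 u" "C1 v" shows "dd e (\<lambda>z. u z * v z) z = u z * dd e v z + dd e u z * v z"
  by (rule dd_unique[OF has_derivative_mult]) (intro C1_has_derivative assms)+

lemma dd_cmult: assumes "C1 u" shows "dd e (\<lambda>z. c * u z) z = c * dd e u z"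
  by (rule dd_unique[OF has_derivative_mult_right]) (intro C1_has_derivative assms)+

lemma dd_zero [simp]: "dd e (\<lambda>z. 0) z = 0"
  by (rule dd_unique[where G = "\<lambda>_. 0"]) auto

lemma shift_has_derivative:
  assumes "(u has_derivative G) (at (z + v))"
  shows "((\<lambda>z. u (z + v)) has_derivative G) (at z)"
proof -
  have "((\<lambda>z. z + v) has_derivative (\<lambda>h. h)) (at z)"
    by (auto intro!: derivative_eq_intros)
  from has_derivative_compose[OF this assms] show ?thesis .
qed

lemma dd_shift: "C1 u \<Longrightarrow> dd e (\<lambda>z. u (z + v)) z = dd e u (z + v)"
  by (rule dd_unique[OF shift_has_derivative]) (intro C1_has_derivative)

lemma C1_shift: assumes "C1 u" shows "C1 (\<lambda>z. u (z + v))"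
proof (rule C1I[where G = "\<lambda>z e. dd e u (z + v)"])
  show "continuous_on UNIV (\<lambda>z. dd e u (z + v))" for e
    by (rule continuous_on_compose2[OF C1_dd_continuous[OF assms]]) (auto intro!: continuous_intros)
qed (intro shift_has_derivative C1_has_derivative assms)

lemma C2_shift: assumes "C2 u" shows "C2 (\<lambda>z. u (z + v))"
proof (rule C2I)
  show "((\<lambda>z. u (z + v)) has_derivative (\<lambda>e. dd e u (z + v))) (at z)" for z
    by (intro shift_has_derivative C1_has_derivative assms C2_C1)
qed (rule C1_shift[OF C2_C1_dd[OF assms]])

lemma C1_compose_real:
  fixes u :: "'a::euclidean_space \<Rightarrow> real"
  assumes "C1 u" "\<And>s. (\<psi> has_real_derivative \<psi>' s) (at s)" "continuous_on UNIV \<psi>'"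
  shows "C1 (\<lambda>z. \<psi> (u z))"
proof (rule C1I[where G = "\<lambda>z e. \<psi>' (u z) * dd e u z"])
  show "((\<lambda>z. \<psi> (u z)) has_derivative (\<lambda>e. \<psi>' (u z) * dd e u z)) (at z)" for z
    using has_derivative_compose[OF C1_has_derivative[OF assms(1)], of \<psi> "(*) (\<psi>' (u z))" z] assms(2)[of "u z"]
    by (simp add: has_field_derivative_def)
  show "continuous_on UNIV (\<lambda>z. \<psi>' (u z) * dd e u z)" for e
    by (intro continuous_intros C1_dd_continuous assms continuous_on_compose2[OF assms(3) C1_continuous]) auto
qed

lemma C2_compose_real:
  fixes u :: "'a::euclidean_space \<Rightarrow> real"
  assumes "C2 u" "\<And>s. (\<psi> has_real_derivative \<psi>' s) (at s)" "\<And>s. (\<psi>' has_real_derivative \<psi>'' s) (at s)"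
    "continuous_on UNIV \<psi>''"
  shows "C2 (\<lambda>z. \<psi> (u z))"
proof (rule C2I[where G = "\<lambda>z e. \<psi>' (u z) * dd e u z"])
  show "((\<lambda>z. \<psi> (u z)) has_derivative (\<lambda>e. \<psi>' (u z) * dd e u z)) (at z)" for z
    using has_derivative_compose[OF C1_has_derivative[OF C2_C1[OF assms(1)]], of \<psi> "(*) (\<psi>' (u z))" z] assms(2)[of "u z"]
    by (simp add: has_field_derivative_def)
  show "C1 (\<lambda>z. \<psi>' (u z) * dd e u z)" for e
    by (rule C1_mult[OF C1_compose_real[OF C2_C1[OF assms(1)] assms(3,4)] C2_C1_dd[OF assms(1)]])
qed

text \<open>At 0 the difference quotient is at most |h| to the power n + 1, which tends to 0 because
  the exponent is at least 2; away from 0 the function is locally zero or a monomial.\<close>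

lemma max0_power_deriv:
  fixes s :: real
  shows "((\<lambda>s. max 0 s ^ Suc (Suc n)) has_real_derivative real (Suc (Suc n)) * max 0 s ^ Suc n) (at s)"
proof -
  consider "s < 0" | "s = 0" | "0 < s" by linarith
  then show ?thesis
  proof cases
    case 1
    have "((\<lambda>s. 0) has_real_derivative real (Suc (Suc n)) * max 0 s ^ Suc n) (at s)"
      using 1 by simp
    then show ?thesis
      by (rule has_field_derivative_transform_within_open[where S = "{..<0}"]) (use 1 in auto)
  next
    case 2
    have "((\<lambda>h::real. max 0 h ^ Suc (Suc n) / h) \<longlongrightarrow> 0) (at 0)"
    proof (rule Lim_null_comparison)
      show "\<forall>\<^sub>F h in at 0. norm (max 0 h ^ Suc (Suc n) / h) \<le> \<bar>h\<bar> ^ Suc n"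
      proof (intro always_eventually allI)
        fix h :: real
        show "norm (max 0 h ^ Suc (Suc n) / h) \<le> \<bar>h\<bar> ^ Suc n"
          by (cases "0 < h") (auto simp: max_def intro!: mult_nonpos_nonneg)
      qed
      show "((\<lambda>h::real. \<bar>h\<bar> ^ Suc n) \<longlongrightarrow> 0) (at 0)"
        by (auto intro!: tendsto_eq_intros)
    qed
    then show ?thesis
      using 2 by (simp add: DERIV_def)
  next
    case 3
    have "((\<lambda>s. s ^ Suc (Suc n)) has_real_derivative real (Suc (Suc n)) * max 0 s ^ Suc n) (at s)"
      using 3 DERIV_pow[of "Suc (Suc n)" s UNIV] by (simp add: max_absorb2)
    then show ?thesis
      by (rule has_field_derivative_transform_within_open[where S = "{0<..}"]) (use 3 in auto)
  qed
qed

lemma dd_line: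
  assumes "C1 u"
  shows "((\<lambda>s. u (z + s *\<^sub>R e)) has_real_derivative dd e u (z + s *\<^sub>R e)) (at s)"
proof -
  interpret bounded_linear "\<lambda>h. dd h u (z + s *\<^sub>R e)"
    using C1_has_derivative[OF assms] by (rule has_derivative_bounded_linear)
  have "((\<lambda>s. z + s *\<^sub>R e) has_derivative (\<lambda>h. h *\<^sub>R e)) (at s)"
    by (auto intro!: derivative_eq_intros)
  from has_derivative_compose[OF this C1_has_derivative[OF assms]]
  show ?thesis
    by (simp add: has_field_derivative_def scaleR mult.commute[of _ "dd e u _"])
qed

lemma dd_linear:
  assumes "C1 u"
  shows "bounded_linear (\<lambda>h. dd h u z)"
  using C1_has_derivative[OF assms] by (rule has_derivative_bounded_linear)

lemma dd_of_line:
  assumes "C1 u" "((\<lambda>s. u (z + s *\<^sub>R e)) has_real_derivative D) (at 0)"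
  shows "dd e u z = D"
  using DERIV_unique[OF dd_line[OF assms(1), of z e 0]] assms(2) by simp

lemma bsupp_dd:
  assumes "bsupp u" "C1 u"
  shows "bsupp (dd e u)"
proof -
  obtain R where R: "R > 0" "\<And>z. R \<le> norm z \<Longrightarrow> u z = 0" using assms by (auto simp: bsupp_def)
  have "dd e u z = 0" if "R + 1 \<le> norm z" for z
  proof -
    have "((\<lambda>_. 0) has_derivative (\<lambda>_. 0)) (at z)" by simp
    then have "(u has_derivative (\<lambda>_. 0)) (at z)"
    proof (rule has_derivative_transform_within_open)
      show "open (- cball 0 R)" by auto
      show "z \<in> - cball 0 R" using that by auto
    qed (use R in \<open>auto simp: not_le\<close>)
    then show ?thesis by (rule dd_unique)
  qed
  then show ?thesis
    using R(1) by (auto simp: bsupp_def intro!: exI[of _ "R + 1"])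
qed

lemma bsupp_add: assumes "bsupp u" "bsupp v" shows "bsupp (\<lambda>z. u z + v z)"
proof -
  from assms obtain R S where "R > 0" "S > 0" "\<And>z. R \<le> norm z \<Longrightarrow> u z = 0" "\<And>z. S \<le> norm z \<Longrightarrow> v z = 0"
    by (auto simp: bsupp_def)
  then show ?thesis
    unfolding bsupp_def by (intro exI[of _ "max R S"]) auto
qed

lemma bsupp_mult1: "bsupp u \<Longrightarrow> bsupp (\<lambda>z. u z * v z)"
  by (auto simp: bsupp_def)

lemma bsupp_mult2: "bsupp u \<Longrightarrow> bsupp (\<lambda>z. v z * u z)"
  by (auto simp: bsupp_def)

lemma bsupp_zero [simp]: "bsupp (\<lambda>z. 0)"
  by (auto simp: bsupp_def intro: exI[of _ 1])

lemma bsupp_shift: assumes "bsupp u" shows "bsupp (\<lambda>z. u (z + v))"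
proof -
  from assms obtain R where R: "R > 0" "\<And>z. R \<le> norm z \<Longrightarrow> u z = 0"
    by (auto simp: bsupp_def)
  have "u (z + v) = 0" if "R + norm v \<le> norm z" for z
    using that norm_triangle_ineq4[of "z + v" v] by (intro R) simp
  then show ?thesis
    using R(1) unfolding bsupp_def by (intro exI[of _ "R + norm v"]) (auto simp: add_pos_nonneg)
qed

lemma Cc_bounded:
  assumes "Cc u"
  obtains B where "0 < B" "\<And>z. \<bar>u z\<bar> \<le> B"
proof -
  obtain R where R: "R > 0" "\<And>z. R \<le> norm z \<Longrightarrow> u z = 0" using assms by (auto simp: Cc_def bsupp_def)
  have "compact (u ` cball 0 R)"
    using assms by (intro compact_continuous_image) (auto simp: Cc_def intro: continuous_on_subset)
  then obtain B where B: "B > 0" "\<And>z. z \<in> cball 0 R \<Longrightarrow> norm (u z) \<le> B"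
    using bounded_pos by (metis compact_imp_bounded imageI)
  have "\<bar>u z\<bar> \<le> B" for z
    using B(2)[of z] R(2)[of z] B(1) by (cases "norm z \<le> R") auto
  with B(1) that show ?thesis by blast
qed

lemma Cc_measurable: "Cc u \<Longrightarrow> u \<in> borel_measurable borel"
  by (auto simp: Cc_def intro: borel_measurable_continuous_onI)

lemma Cc_pint_finite:
  fixes u :: "'a::euclidean_space \<Rightarrow> real"
  assumes "Cc u" "0 < p"
  shows "pint p u < \<infinity>"
proof -
  obtain R where R: "R > 0" "\<And>z. R \<le> norm z \<Longrightarrow> u z = 0" using assms by (auto simp: Cc_def bsupp_def)
  obtain B where B: "0 < B" "\<And>z. \<bar>u z\<bar> \<le> B" by (rule Cc_bounded[OF assms(1)]) auto
  have "pint p u \<le> (\<integral>\<^sup>+z. ennreal (B powr p) * indicator (cball 0 R) (z::'a) \<partial>lborel)"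
    unfolding pint_def
  proof (intro nn_integral_mono)
    fix z
    show "ennreal (norm (u z) powr p) \<le> ennreal (B powr p) * indicator (cball 0 R) z"
      using B(2)[of z] R(2)[of z] assms(2)
      by (cases "norm z \<le> R") (auto intro!: ennreal_leI powr_mono2)
  qed
  also have "\<dots> < \<infinity>"
    using emeasure_lborel_cball_finite[of "0::'a" R] by (simp add: nn_integral_cmult_indicator ennreal_mult_less_top)
  finally show ?thesis .
qed

lemma Cc_integrable:
  fixes u :: "'a::euclidean_space \<Rightarrow> real"
  assumes "Cc u"
  shows "integrable lborel u"
  using Cc_pint_finite[OF assms, of 1] Cc_measurable[OF assms]
  by (auto simp: integrable_iff_bounded pint_def)

text \<open>Each difference quotient of \<open>w\<close> has integral zero by translation invariance
  of \<open>lborel\<close>, and the quotients converge boundedly with supports in one ball. No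
  Fubini argument along \<open>e\<close> is involved.\<close>

lemma integral_dd_zero:
  assumes "C1 w" "bsupp w"
  shows "(\<integral>z. dd e w z \<partial>lborel) = 0"
proof -
  obtain R where R: "R > 0" "\<And>z. R \<le> norm z \<Longrightarrow> w z = 0" using assms by (auto simp: bsupp_def)
  have Cw: "Cc w" using assms C1_continuous by (auto simp: Cc_def)
  have Cdw: "Cc (dd e w)" using assms C1_dd_continuous bsupp_dd by (auto simp: Cc_def)
  obtain B where B: "0 < B" "\<And>z. \<bar>dd e w z\<bar> \<le> B" by (rule Cc_bounded[OF Cdw]) auto
  define h where "h n = 1 / real (Suc n)" for n
  have h: "0 < h n" "h n \<le> 1" for n by (auto simp: h_def)
  have h0: "h \<longlonglongrightarrow> 0" unfolding h_def by (rule LIMSEQ_Suc[OF lim_1_over_n])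
  define q where "q n z = (w (z + h n *\<^sub>R e) - w z) / h n" for n z
  have Cs: "Cc (\<lambda>z. w (z + v))" for v
    using C1_continuous[OF C1_shift[OF assms(1)]] bsupp_shift[OF assms(2)] by (auto simp: Cc_def)
  have [measurable]: "w \<in> borel_measurable borel" "dd e w \<in> borel_measurable borel"
    using Cc_measurable[OF Cw] Cc_measurable[OF Cdw] by auto
  have int0: "(\<integral>z. q n z \<partial>lborel) = 0" for n
  proof -
    have "(\<integral>z. w (z + v) \<partial>lborel) = (\<integral>z. w z \<partial>lborel)" for v
    proof -
      have "(\<integral>z. w z \<partial>lborel) = (\<integral>z. w z \<partial>distr lborel borel ((+) v))"
        by (simp add: lborel_distr_plus)
      also have "\<dots> = (\<integral>z. w (z + v) \<partial>lborel)"
        by (subst integral_distr) (auto simp: add.commute)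
      finally show ?thesis ..
    qed
    then show ?thesis
      unfolding q_def using Cc_integrable[OF Cs] Cc_integrable[OF Cw] by simp
  qed
  have "(\<lambda>n. \<integral>z. q n z \<partial>lborel) \<longlonglongrightarrow> (\<integral>z. dd e w z \<partial>lborel)"
  proof (rule integral_dominated_convergence[where w = "\<lambda>z. B * indicator (cball 0 (R + norm e)) z"])
    show "integrable lborel (\<lambda>z. B * indicator (cball 0 (R + norm e)) z :: real)"
      using emeasure_lborel_cball_finite[of 0 "R + norm e"] by auto
    show "AE z in lborel. (\<lambda>n. q n z) \<longlonglongrightarrow> dd e w z"
    proof (rule AE_I2)
      fix z
      have "((\<lambda>s. (w (z + s *\<^sub>R e) - w z) / s) \<longlongrightarrow> dd e w z) (at 0)"
        using dd_line[OF assms(1), of z e 0] by (simp add: DERIV_def)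
      moreover have "filterlim h (at 0) sequentially"
        using h(1) h0 by (simp add: filterlim_at less_imp_neq[THEN not_sym])
      ultimately show "(\<lambda>n. q n z) \<longlonglongrightarrow> dd e w z"
        unfolding q_def by (rule filterlim_compose)
    qed
    show "AE z in lborel. norm (q n z) \<le> B * indicator (cball 0 (R + norm e)) z" for n
    proof (rule AE_I2)
      fix z
      have "\<bar>q n z\<bar> \<le> B"
      proof -
        have "\<exists>s. 0 < s \<and> s < h n \<and> w (z + h n *\<^sub>R e) - w (z + 0 *\<^sub>R e) = (h n - 0) * dd e w (z + s *\<^sub>R e)"
          using h[of n] by (intro MVT2 dd_line assms) auto
        then obtain s where "w (z + h n *\<^sub>R e) - w z = h n * dd e w (z + s *\<^sub>R e)" by auto
        then have "q n z = dd e w (z + s *\<^sub>R e)" using h[of n] by (simp add: q_def)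
        then show ?thesis using B by simp
      qed
      moreover have "q n z = 0" if "R + norm e < norm z"
      proof -
        have "norm z \<le> norm (z + h n *\<^sub>R e) + norm (h n *\<^sub>R e)"
          using norm_triangle_ineq4[of "z + h n *\<^sub>R e" "h n *\<^sub>R e"] by simp
        also have "norm (h n *\<^sub>R e) \<le> norm e" using h[of n] by (simp add: mult_left_le_one_le)
        finally have "R \<le> norm (z + h n *\<^sub>R e)" using that by linarith
        moreover have "R \<le> norm z" using that norm_ge_zero[of e] by linarith
        ultimately show ?thesis using R(2) by (simp add: q_def)
      qed
      ultimately show "norm (q n z) \<le> B * indicator (cball 0 (R + norm e)) z"
        by (auto simp: indicator_def)
    qed
  qed (auto simp: q_def)
  with int0 show ?thesis by (simp add: LIMSEQ_const_iff)
qed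

lemma test_fn_C1: assumes "test_fn \<Omega> \<phi>" shows "C1 \<phi>" "bsupp \<phi>"
proof -
  have "Ck_on (Suc 0) UNIV \<phi>" using assms by (auto simp: test_fn_def smooth_fn_def)
  then show "C1 \<phi>" by (auto simp: C1_def dd_def[abs_def] differentiable_on_def)
  have "bounded {z. \<phi> z \<noteq> 0}"
    using assms by (auto simp: test_fn_def intro: bounded_subset[OF compact_imp_bounded closure_subset])
  then obtain R where "R > 0" "\<And>z. \<phi> z \<noteq> 0 \<Longrightarrow> norm z \<le> R" by (auto simp: bounded_pos)
  then show "bsupp \<phi>" unfolding bsupp_def by (intro exI[of _ "R + 1"]) force
qed

lemma integration_by_parts:
  assumes "C1 u" "C1 \<phi>" "bsupp \<phi>"
  shows "(\<integral>z. u z * dd e \<phi> z \<partial>lborel) = - (\<integral>z. dd e u z * \<phi> z \<partial>lborel)"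
proof -
  have 1: "Cc (\<lambda>z. u z * dd e \<phi> z)" "Cc (\<lambda>z. dd e u z * \<phi> z)"
    unfolding Cc_def
    using continuous_on_mult[OF C1_continuous[OF assms(1)] C1_dd_continuous[OF assms(2)]]
      continuous_on_mult[OF C1_dd_continuous[OF assms(1)] C1_continuous[OF assms(2)]]
      bsupp_mult2[OF bsupp_dd[OF assms(3,2)]] bsupp_mult2[OF assms(3)] by auto
  have "0 = (\<integral>z. dd e (\<lambda>z. u z * \<phi> z) z \<partial>lborel)"
    by (rule integral_dd_zero[OF C1_mult[OF assms(1,2)] bsupp_mult2[OF assms(3)], symmetric])
  also have "\<dots> = (\<integral>z. u z * dd e \<phi> z + dd e u z * \<phi> z \<partial>lborel)"
    using assms by (simp add: dd_mult)
  also have "\<dots> = (\<integral>z. u z * dd e \<phi> z \<partial>lborel) + (\<integral>z. dd e u z * \<phi> z \<partial>lborel)"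
    using 1 by (intro Bochner_Integration.integral_add Cc_integrable)
  finally show ?thesis by simp
qed

subsection \<open>Density of compactly supported \<open>C\<^sup>2\<close> functions in \<open>L\<^sub>p\<close>\<close>

definition C2c :: "('a::euclidean_space \<Rightarrow> real) \<Rightarrow> bool" where
  "C2c u \<longleftrightarrow> C2 u \<and> bsupp u"

lemma C2c_zero [simp]: "C2c (\<lambda>z. 0)"
  by (simp add: C2c_def)

lemma C2c_add: "C2c u \<Longrightarrow> C2c v \<Longrightarrow> C2c (\<lambda>z. u z + v z)"
  using C2_add bsupp_add by (auto simp: C2c_def)

lemma C2c_cmult: "C2c u \<Longrightarrow> C2c (\<lambda>z. c * u z)"
  using C2_cmult bsupp_mult2 by (auto simp: C2c_def)

lemma C2c_mult: "C2c u \<Longrightarrow> C2c v \<Longrightarrow> C2c (\<lambda>z. u z * v z)"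
  using C2_mult bsupp_mult1 by (auto simp: C2c_def)

lemma C2c_diff: assumes "C2c u" "C2c v" shows "C2c (\<lambda>z. u z - v z)"
  using C2c_add[OF assms(1) C2c_cmult[OF assms(2), of "-1"]] by simp

lemma C2c_shift: "C2c u \<Longrightarrow> C2c (\<lambda>z. u (z + v))"
  using C2_shift bsupp_shift by (auto simp: C2c_def)

lemma C2c_sum: "finite A \<Longrightarrow> (\<And>i. i \<in> A \<Longrightarrow> C2c (u i)) \<Longrightarrow> C2c (\<lambda>z. \<Sum>i\<in>A. u i z)"
  by (induction A rule: finite_induct) (auto intro: C2c_add)

lemma C2c_Cc: "C2c u \<Longrightarrow> Cc u"
  by (auto simp: C2c_def Cc_def C1_continuous C2_C1)

lemma C2c_dd_Cc: "C2c u \<Longrightarrow> Cc (dd e u)"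
  by (auto simp: C2c_def Cc_def C1_dd_continuous C2_C1 bsupp_dd)

lemma C2c_dd2_Cc: "C2c u \<Longrightarrow> Cc (dd e (dd f u))"
  by (auto simp: C2c_def Cc_def C1_dd_continuous C2_C1_dd C2_C1 bsupp_dd)

lemma C2c_measurable [measurable]:
  assumes "C2c u"
  shows "u \<in> borel_measurable borel" "dd e u \<in> borel_measurable borel" "dd e (dd f u) \<in> borel_measurable borel"
  using assms by (auto intro: Cc_measurable C2c_Cc C2c_dd_Cc C2c_dd2_Cc)

lemma pint_dominated:
  fixes f :: "nat \<Rightarrow> 'a::euclidean_space \<Rightarrow> 'b::euclidean_space" and g :: "'a \<Rightarrow> 'c::euclidean_space"
  assumes [measurable]: "\<And>n. f n \<in> borel_measurable borel" "g \<in> borel_measurable borel"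
    and "\<And>n z. norm (f n z) \<le> norm (g z)" "AE z in lborel. (\<lambda>n. f n z) \<longlonglongrightarrow> 0"
    and "pint p g < \<infinity>" "0 < p"
  shows "(\<lambda>n. pint p (f n)) \<longlonglongrightarrow> 0"
proof -
  have "(\<lambda>n. \<integral>\<^sup>+z. ennreal (norm (f n z) powr p) \<partial>lborel) \<longlonglongrightarrow> (\<integral>\<^sup>+(z::'a). 0 \<partial>lborel)"
  proof (rule nn_integral_dominated_convergence[where w = "\<lambda>z. ennreal (norm (g z) powr p)"])
    show "AE z in lborel. (\<lambda>n. ennreal (norm (f n z) powr p)) \<longlonglongrightarrow> 0"
      using assms(4)
    proof eventually_elim
      case (elim z)
      have "(\<lambda>n. norm (f n z) powr p) \<longlonglongrightarrow> 0"
        using tendsto_powr'[OF tendsto_norm[OF elim] tendsto_const[of p]] assms(6) by auto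
      then show ?case
        using tendsto_ennrealI by fastforce
    qed
    show "AE z in lborel. ennreal (norm (f j z) powr p) \<le> ennreal (norm (g z) powr p)" for j
      using assms(3,6) by (auto intro!: ennreal_leI powr_mono2)
  qed (use assms(5) in \<open>auto simp: pint_def\<close>)
  then show ?thesis by (simp add: pint_def)
qed

lemma C2_quadratic: "C2 (\<lambda>z::'a::euclidean_space. (z - a) \<bullet> (z - a))"
proof -
  have "C2 (\<lambda>z::'a. z \<bullet> z)"
  proof (rule C2I)
    show "((\<lambda>z::'a. z \<bullet> z) has_derivative (\<lambda>e. 2 * (z \<bullet> e))) (at z)" for z
      by (auto intro!: derivative_eq_intros simp: inner_commute)
  qed (rule C1_mult[OF C1_const C1_inner])
  from C2_shift[OF this, of "-a"] show ?thesis by simp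
qed

text \<open>The witness is the cube of the positive part of 1 - |z - a|^2 / r^2: the squared
  distance is a polynomial, hence smooth at the centre, and the cube is the first integer power
  whose positive part is C2.\<close>

lemma bump_ball:
  fixes a :: "'a::euclidean_space"
  assumes "0 < r"
  obtains \<phi> where "C2c \<phi>" "\<And>z. 0 \<le> \<phi> z \<and> \<phi> z \<le> 1" "\<And>z. 0 < \<phi> z \<longleftrightarrow> z \<in> ball a r"
proof -
  define \<phi> where "\<phi> z = max 0 (1 - ((z - a) \<bullet> (z - a)) / r\<^sup>2) ^ 3" for z
  have "C2 (\<lambda>z. 1 - (1 / r\<^sup>2) * ((z - a) \<bullet> (z - a)))"
    by (rule C2_diff[OF C2_const C2_cmult[OF C2_quadratic]])
  moreover have "((\<lambda>s. max 0 s ^ 3) has_real_derivative 3 * max 0 s ^ 2) (at s)" for s :: real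
    using max0_power_deriv[of 1 s] by (simp add: numeral_2_eq_2 numeral_3_eq_3)
  moreover have "((\<lambda>s. 3 * max 0 s ^ 2) has_real_derivative 6 * max 0 s) (at s)" for s :: real
    using DERIV_cmult[OF max0_power_deriv[of 0 s], of 3] by (simp add: numeral_2_eq_2)
  moreover have "continuous_on UNIV (\<lambda>s::real. 6 * max 0 s)"
    by (intro continuous_intros)
  ultimately have c2: "C2 \<phi>"
    unfolding \<phi>_def using C2_compose_real[of "\<lambda>z. 1 - (1 / r\<^sup>2) * ((z - a) \<bullet> (z - a))" "\<lambda>s. max 0 s ^ 3"
        "\<lambda>s. 3 * max 0 s ^ 2" "\<lambda>s. 6 * max 0 s"] by simp
  have eq: "(z - a) \<bullet> (z - a) / r\<^sup>2 = (dist a z / r)\<^sup>2" for z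
    by (simp add: dist_norm norm_minus_commute power_divide dot_square_norm)
  have pos: "0 < \<phi> z \<longleftrightarrow> z \<in> ball a r" for z
  proof -
    have "0 < \<phi> z \<longleftrightarrow> (dist a z / r)\<^sup>2 < 1"
      unfolding \<phi>_def eq by (auto simp: max_def zero_less_power_eq)
    also have "\<dots> \<longleftrightarrow> dist a z / r < 1"
      using assms by (subst abs_square_less_1) simp
    also have "\<dots> \<longleftrightarrow> z \<in> ball a r"
      using assms by simp
    finally show ?thesis .
  qed
  have rng: "0 \<le> \<phi> z \<and> \<phi> z \<le> 1" for z
    unfolding \<phi>_def eq by (auto intro!: power_le_one)
  have "\<phi> z = 0" if "norm a + r \<le> norm z" for z
  proof -
    have "z \<notin> ball a r"
      using that norm_triangle_ineq2[of z a] by (simp add: dist_norm norm_minus_commute)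
    then show ?thesis using pos[of z] rng[of z] by linarith
  qed
  then have "bsupp \<phi>"
    unfolding bsupp_def using assms by (intro exI[of _ "norm a + r"]) (auto simp: add_nonneg_pos)
  with c2 rng pos show ?thesis by (intro that[of \<phi>]) (auto simp: C2c_def)
qed

text \<open>\<open>w\<close> is chosen so that 1 - w is the product of 1 - u and 1 - v. This unites
  the sets of positivity, keeps the range in [0,1] and, applied repeatedly to one bump \<phi>,
  produces 1 - (1 - \<phi>)^m.\<close>

lemma bump_union:
  fixes u v :: "'a::euclidean_space \<Rightarrow> real"
  assumes "C2c u" "C2c v" "\<And>z. 0 \<le> u z \<and> u z \<le> 1" "\<And>z. 0 \<le> v z \<and> v z \<le> 1"
  defines "w \<equiv> \<lambda>z. u z + v z - u z * v z"
  shows "C2c w" "\<And>z. 0 \<le> w z \<and> w z \<le> 1" "\<And>z. 0 < w z \<longleftrightarrow> 0 < u z \<or> 0 < v z"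
    and "\<And>z. 1 - w z = (1 - u z) * (1 - v z)"
proof -
  show "C2c w" unfolding w_def by (rule C2c_diff[OF C2c_add[OF assms(1,2)] C2c_mult[OF assms(1,2)]])
  show eq: "1 - w z = (1 - u z) * (1 - v z)" for z by (simp add: w_def algebra_simps)
  show "0 \<le> w z \<and> w z \<le> 1" for z
  proof -
    have "0 \<le> (1 - u z) * (1 - v z)" "(1 - u z) * (1 - v z) \<le> 1"
      using assms(3,4)[of z] by (auto intro: mult_le_one)
    then show ?thesis using eq[of z] by linarith
  qed
  show "0 < w z \<longleftrightarrow> 0 < u z \<or> 0 < v z" for z
  proof -
    have "w z = u z * (1 - v z) + v z" "w z = u z + v z * (1 - u z)" by (auto simp: w_def algebra_simps)
    then show ?thesis
      using assms(3,4)[of z] mult_nonneg_nonneg[of "u z" "1 - v z"] mult_nonneg_nonneg[of "v z" "1 - u z"]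
      by (cases "u z = 0"; cases "v z = 0") (auto simp: add_pos_nonneg add_nonneg_pos)
  qed
qed

lemma bump_finite_union:
  fixes F :: "('a::euclidean_space \<times> real) set"
  assumes "finite F" "\<And>a r. (a, r) \<in> F \<Longrightarrow> 0 < r"
  shows "\<exists>\<phi>. C2c \<phi> \<and> (\<forall>z. 0 \<le> \<phi> z \<and> \<phi> z \<le> 1) \<and> (\<forall>z. 0 < \<phi> z \<longleftrightarrow> z \<in> (\<Union>(a, r)\<in>F. ball a r))"
  using assms
proof (induction F rule: finite_induct)
  case empty
  show ?case by (intro exI[of _ "\<lambda>_. 0"]) auto
next
  case (insert x F)
  obtain a r where x: "x = (a, r)" by (cases x)
  obtain \<phi> where phi: "C2c \<phi>" "\<And>z. 0 \<le> \<phi> z \<and> \<phi> z \<le> 1" "\<And>z. 0 < \<phi> z \<longleftrightarrow> z \<in> (\<Union>(a, r)\<in>F. ball a r)"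
    using insert by blast
  obtain \<psi> where psi: "C2c \<psi>" "\<And>z. 0 \<le> \<psi> z \<and> \<psi> z \<le> 1" "\<And>z. 0 < \<psi> z \<longleftrightarrow> z \<in> ball a r"
    using bump_ball[of r a] insert.prems[of a r] x by auto
  show ?case
    by (rule exI, intro conjI allI, rule bump_union(1)[OF phi(1) psi(1) phi(2) psi(2)])
      (use bump_union(2,3)[OF phi(1) psi(1) phi(2) psi(2)] phi(3) psi(3) x in auto)
qed

definition C2c_approx :: "real \<Rightarrow> ('a::euclidean_space \<Rightarrow> real) \<Rightarrow> bool" where
  "C2c_approx p f \<longleftrightarrow> (\<forall>\<epsilon>>0. \<exists>u. C2c u \<and> pint p (\<lambda>z. u z - f z) < ennreal \<epsilon>)"

lemma C2c_approx_close:
  fixes f :: "'a::euclidean_space \<Rightarrow> real"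
  assumes [measurable]: "f \<in> borel_measurable borel" and p: "0 \<le> p"
    and "\<And>\<epsilon>. 0 < \<epsilon> \<Longrightarrow> \<exists>g. g \<in> borel_measurable borel \<and> C2c_approx p g \<and> pint p (\<lambda>z. g z - f z) < ennreal \<epsilon>"
  shows "C2c_approx p f"
  unfolding C2c_approx_def
proof (intro allI impI)
  fix \<epsilon> :: real assume e: "0 < \<epsilon>"
  define e where "e = \<epsilon> / (2 * 2 powr p)"
  have "0 < e" using e by (simp add: e_def)
  obtain g where g [measurable]: "g \<in> borel_measurable borel" and ga: "C2c_approx p g" "pint p (\<lambda>z. g z - f z) < ennreal e"
    using assms(3)[OF \<open>0 < e\<close>] by blast
  obtain u where u: "C2c u" "pint p (\<lambda>z. u z - g z) < ennreal e"
    using \<open>0 < e\<close> ga by (auto simp: C2c_approx_def)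
  note C2c_measurable(1)[OF u(1), measurable]
  have "pint p (\<lambda>z. u z - f z) = pint p (\<lambda>z. (u z - g z) + (g z - f z))" by simp
  also have "\<dots> \<le> ennreal (2 powr p) * (pint p (\<lambda>z. u z - g z) + pint p (\<lambda>z. g z - f z))"
    using p by (intro pint_add) auto
  also have "\<dots> < ennreal (2 powr p) * (ennreal e + ennreal e)"
    using u(2) ga by (intro ennreal_mult_strict_left_mono add_strict_mono) auto
  also have "\<dots> = ennreal \<epsilon>"
    using \<open>0 < e\<close> by (simp add: ennreal_mult[symmetric] ennreal_plus[symmetric] e_def del: ennreal_plus)
  finally show "\<exists>u. C2c u \<and> pint p (\<lambda>z. u z - f z) < ennreal \<epsilon>" using u(1) by blast
qed

lemma C2c_approx_add:
  fixes f g :: "'a::euclidean_space \<Rightarrow> real"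
  assumes [measurable]: "f \<in> borel_measurable borel" "g \<in> borel_measurable borel" and p: "0 \<le> p"
    and "C2c_approx p f" "C2c_approx p g"
  shows "C2c_approx p (\<lambda>z. f z + g z)"
  unfolding C2c_approx_def
proof (intro allI impI)
  fix \<epsilon> :: real assume e: "0 < \<epsilon>"
  define e where "e = \<epsilon> / (2 * 2 powr p)"
  have "0 < e" using e by (simp add: e_def)
  obtain u where u: "C2c u" "pint p (\<lambda>z. u z - f z) < ennreal e"
    using \<open>0 < e\<close> assms(4) by (auto simp: C2c_approx_def)
  obtain v where v: "C2c v" "pint p (\<lambda>z. v z - g z) < ennreal e"
    using \<open>0 < e\<close> assms(5) by (auto simp: C2c_approx_def)
  note C2c_measurable(1)[OF u(1), measurable] C2c_measurable(1)[OF v(1), measurable]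
  have "pint p (\<lambda>z. (u z + v z) - (f z + g z)) = pint p (\<lambda>z. (u z - f z) + (v z - g z))"
    by (simp add: algebra_simps)
  also have "\<dots> \<le> ennreal (2 powr p) * (pint p (\<lambda>z. u z - f z) + pint p (\<lambda>z. v z - g z))"
    using p by (intro pint_add) auto
  also have "\<dots> < ennreal (2 powr p) * (ennreal e + ennreal e)"
    using u(2) v(2) by (intro ennreal_mult_strict_left_mono add_strict_mono) auto
  also have "\<dots> = ennreal \<epsilon>"
    using \<open>0 < e\<close> by (simp add: ennreal_mult[symmetric] ennreal_plus[symmetric] e_def del: ennreal_plus)
  finally show "\<exists>u. C2c u \<and> pint p (\<lambda>z. u z - (f z + g z)) < ennreal \<epsilon>"
    using C2c_add[OF u(1) v(1)] by blast
qed

lemma C2c_approx_cmult: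
  fixes f :: "'a::euclidean_space \<Rightarrow> real"
  assumes [measurable]: "f \<in> borel_measurable borel" and "C2c_approx p f"
  shows "C2c_approx p (\<lambda>z. c * f z)"
  unfolding C2c_approx_def
proof (intro allI impI)
  fix \<epsilon> :: real assume e: "0 < \<epsilon>"
  define e where "e = \<epsilon> / (\<bar>c\<bar> powr p + 1)"
  have "0 < e" using e by (simp add: e_def add_nonneg_pos)
  obtain u where u: "C2c u" "pint p (\<lambda>z. u z - f z) < ennreal e"
    using \<open>0 < e\<close> assms(2) by (auto simp: C2c_approx_def)
  note C2c_measurable(1)[OF u(1), measurable]
  have "pint p (\<lambda>z. c * u z - c * f z) = ennreal (\<bar>c\<bar> powr p) * pint p (\<lambda>z. u z - f z)"
    by (simp add: pint_cmult right_diff_distrib[symmetric])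
  also have "\<dots> \<le> ennreal (\<bar>c\<bar> powr p) * ennreal e"
    using u by (intro mult_left_mono) auto
  also have "\<dots> < ennreal \<epsilon>"
    using e by (auto simp: ennreal_mult[symmetric] e_def field_simps intro!: ennreal_lessI)
      (simp add: add_pos_nonneg pos_less_divide_eq field_simps)
  finally show "\<exists>u. C2c u \<and> pint p (\<lambda>z. u z - c * f z) < ennreal \<epsilon>"
    using C2c_cmult[OF u(1)] by blast
qed

text \<open>The functions 1 - (1 - \<phi>)^(m+1) tend to 1 where \<phi> > 0 and are 0 elsewhere, so
  they converge to the indicator of the set of positivity of \<phi>, and they are dominated by
  it.\<close>

lemma C2c_approx_indicator_balls:
  fixes F :: "('a::euclidean_space \<times> real) set"
  assumes "finite F" "\<And>a r. (a, r) \<in> F \<Longrightarrow> 0 < r" and p: "0 < p"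
  shows "C2c_approx p (indicator (\<Union>(a, r)\<in>F. ball a r))"
proof -
  define V where "V = (\<Union>(a, r)\<in>F. ball a r)"
  obtain \<phi> where phi: "C2c \<phi>" "\<And>z. 0 \<le> \<phi> z \<and> \<phi> z \<le> 1" "\<And>z. 0 < \<phi> z \<longleftrightarrow> z \<in> V"
    using bump_finite_union[OF assms(1)] assms(2) unfolding V_def by blast
  define w where "w m z = 1 - (1 - \<phi> z) ^ Suc m" for m z
  have w01: "0 \<le> w m z \<and> w m z \<le> 1" for m z
    using phi(2)[of z] by (auto simp: w_def intro!: mult_le_one power_le_one)
  have wc: "C2c (w m)" for m
  proof (induction m)
    case 0
    show ?case using phi(1) by (simp add: w_def)
  next
    case (Suc m)
    have "w (Suc m) = (\<lambda>z. w m z + \<phi> z - w m z * \<phi> z)"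
      by (auto simp: w_def algebra_simps)
    then show ?case
      using bump_union(1)[OF Suc phi(1) w01 phi(2)] by simp
  qed
  have [measurable]: "V \<in> sets borel" unfolding V_def by (intro borel_open) auto
  note C2c_measurable(1)[OF wc, measurable]
  have "bounded V" unfolding V_def using assms(1) by auto
  have lim: "(\<lambda>m. pint p (\<lambda>z. w m z - indicator V z)) \<longlonglongrightarrow> 0"
  proof (rule pint_dominated[where g = "\<lambda>z. indicator V z :: real"])
    show "norm (w m z - indicator V z) \<le> norm (indicator V z :: real)" for m z
      using w01[of m z] phi(2,3)[of z] by (cases "z \<in> V") (auto simp: w_def)
    show "AE z in lborel. (\<lambda>m. w m z - indicator V z) \<longlonglongrightarrow> 0"
    proof (rule AE_I2)
      fix z
      show "(\<lambda>m. w m z - indicator V z) \<longlonglongrightarrow> 0"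
      proof (cases "z \<in> V")
        case True
        then have "(\<lambda>m. (1 - \<phi> z) ^ Suc m) \<longlonglongrightarrow> 0"
          using phi(2,3)[of z] by (intro LIMSEQ_Suc LIMSEQ_power_zero) auto
        from tendsto_minus[OF this] True show ?thesis by (simp add: w_def)
      next
        case False
        then have "\<phi> z = 0" using phi(2,3)[of z] by auto
        then show ?thesis using False by (simp add: w_def)
      qed
    qed
    have "pint p (\<lambda>z. indicator V z :: real) = (\<integral>\<^sup>+z. indicator V z \<partial>lborel)"
      unfolding pint_def using p by (intro nn_integral_cong) (auto simp: indicator_def)
    also have "\<dots> = emeasure lborel V"
      by simp
    also have "\<dots> < \<infinity>" using emeasure_bounded_finite[OF \<open>bounded V\<close>] .
    finally show "pint p (\<lambda>z. indicator V z :: real) < \<infinity>" .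
  qed (use p in auto)
  show ?thesis
    unfolding C2c_approx_def V_def[symmetric]
  proof (intro allI impI)
    fix \<epsilon> :: real assume "0 < \<epsilon>"
    then have "\<forall>\<^sub>F m in sequentially. pint p (\<lambda>z. w m z - indicator V z) < ennreal \<epsilon>"
      using lim by (intro order_tendstoD(2)) auto
    then show "\<exists>u. C2c u \<and> pint p (\<lambda>z. u z - indicator V z) < ennreal \<epsilon>"
      using wc by (auto simp: eventually_sequentially)
  qed
qed

text \<open>Regularity of Lebesgue measure gives a compact K inside S and an open T around it. A
  finite union V of balls that covers K and stays in T differs from S only inside T - S and S - K,
  both of small measure.\<close>

lemma C2c_approx_indicator:
  fixes S :: "'a::euclidean_space set"
  assumes [measurable]: "S \<in> sets borel" and "bounded S" and p: "0 < p"
  shows "C2c_approx p (indicator S)"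
proof (rule C2c_approx_close)
  fix \<epsilon> :: real assume e: "0 < \<epsilon>"
  have S: "S \<in> sets lebesgue" by simp
  obtain T where T: "open T" "S \<subseteq> T" "emeasure lebesgue (T - S) < ennreal (\<epsilon> / 2)"
    using sets_lebesgue_outer_open[OF S half_gt_zero[OF e]] by metis
  obtain K where K: "closed K" "K \<subseteq> S" "emeasure lebesgue (S - K) < ennreal (\<epsilon> / 2)"
    using sets_lebesgue_inner_closed[OF S half_gt_zero[OF e]] by metis
  have "compact K" using K assms(2) bounded_subset compact_eq_bounded_closed by blast
  have "\<exists>r>0. ball x r \<subseteq> T" if "x \<in> K" for x
  proof -
    have "x \<in> T" using that K(2) T(2) by blast
    then show ?thesis using T(1) by (meson openE)
  qed
  then obtain r where r: "\<And>x. x \<in> K \<Longrightarrow> 0 < r x \<and> ball x (r x) \<subseteq> T" by metis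
  obtain D where D: "D \<subseteq> K" "finite D" "K \<subseteq> (\<Union>x\<in>D. ball x (r x))"
    by (rule compactE_image[OF \<open>compact K\<close>, of K "\<lambda>x. ball x (r x)"]) (use r in auto)
  define F where "F = (\<lambda>x. (x, r x)) ` D"
  define V where "V = (\<Union>(a, r)\<in>F. ball a r)"
  have V: "V = (\<Union>x\<in>D. ball x (r x))" by (auto simp: V_def F_def)
  have [measurable]: "V \<in> sets borel" unfolding V by (intro borel_open) auto
  have [measurable]: "T \<in> sets borel" "K \<in> sets borel" using T K by auto
  have VT: "V \<subseteq> T" using r D by (auto simp: V)
  have ap: "C2c_approx p (indicator V)"
    unfolding V_def using r D p by (intro C2c_approx_indicator_balls) (auto simp: F_def)
  have "pint p (\<lambda>z. indicator V z - indicator S z :: real)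
      \<le> (\<integral>\<^sup>+z. indicator (T - S) z + indicator (S - K) z \<partial>lborel)"
    unfolding pint_def
  proof (intro nn_integral_mono)
    fix z
    have "z \<in> K \<Longrightarrow> z \<in> V" "z \<in> V \<Longrightarrow> z \<in> T" using D(3) VT unfolding V by blast+
    then show "ennreal (norm (indicator V z - indicator S z :: real) powr p) \<le> indicator (T - S) z + indicator (S - K) z"
      using p by (auto simp: indicator_def)
  qed
  also have "\<dots> = emeasure lborel (T - S) + emeasure lborel (S - K)"
    by (subst nn_integral_add) auto
  also have "\<dots> < ennreal (\<epsilon> / 2) + ennreal (\<epsilon> / 2)"
    using T(3) K(3) by (intro add_strict_mono) auto
  also have "\<dots> = ennreal \<epsilon>" using e by (simp add: ennreal_plus[symmetric] del: ennreal_plus)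
  finally show "\<exists>g. g \<in> borel_measurable borel \<and> C2c_approx p g \<and> pint p (\<lambda>z. g z - indicator S z) < ennreal \<epsilon>"
    using ap by (intro exI[of _ "indicator V"]) simp
qed (use p in simp_all)

lemma C2c_approx_Lp_bounded_support:
  fixes f :: "'a::euclidean_space \<Rightarrow> real"
  assumes [measurable]: "f \<in> borel_measurable borel" and p: "0 < p" and fin: "pint p f < \<infinity>"
    and R: "\<And>z. R < norm z \<Longrightarrow> f z = 0"
  shows "C2c_approx p f"
proof -
  obtain s where s: "\<And>i. simple_function lborel (s i)" "\<And>z. (\<lambda>i. s i z) \<longlonglongrightarrow> f z"
    "\<And>i z. norm (s i z) \<le> 2 * norm (f z)"
    using borel_measurable_implies_sequence_metric[of f lborel 0] by (auto simp: dist_norm)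
  have [measurable]: "s i \<in> borel_measurable borel" for i
    using borel_measurable_simple_function[OF s(1)[of i]] by simp
  have sa: "C2c_approx p (s i)" for i
  proof -
    have fr: "finite (range (s i))" using s(1)[of i] by (auto simp: simple_function_def)
    \<comment> \<open>The value 0 is removed because its level set is unbounded; every other level
      set lies where f is nonzero, hence in the ball of radius R.\<close>
    have "s i z = (\<Sum>y\<in>range (s i) - {0}. y * indicator (s i -` {y}) z)" for z
    proof -
      have "(\<Sum>y\<in>range (s i) - {0}. y * indicator (s i -` {y}) z) = (\<Sum>y\<in>range (s i). y * indicator (s i -` {y}) z)"
        using fr by (intro sum.mono_neutral_left) auto
      also have "\<dots> = (\<Sum>y\<in>range (s i). if y = s i z then y else 0)"
        by (intro sum.cong) (auto simp: indicator_def)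
      also have "\<dots> = s i z" using fr by (simp add: sum.delta)
      finally show ?thesis ..
    qed
    moreover have "C2c_approx p (\<lambda>z. \<Sum>y\<in>A. y * indicator (s i -` {y}) z)" if "finite A" "0 \<notin> A" for A
      using that
    proof (induction A rule: finite_induct)
      case empty
      then show ?case by (auto simp: C2c_approx_def intro!: exI[of _ "\<lambda>_. 0"])
    next
      case (insert y A)
      have m: "s i -` {y} \<in> sets borel" for y
        using measurable_sets[of "s i" borel borel "{y}"] by simp
      have "bounded (s i -` {y})"
      proof (rule bounded_subset[OF bounded_cball[of 0 R]], rule subsetI)
        fix z assume "z \<in> s i -` {y}"
        then have "s i z \<noteq> 0" using insert.prems by auto
        then have "f z \<noteq> 0" using s(3)[of i z] by auto
        then show "z \<in> cball 0 R" using R[of z] by (auto simp: not_less[symmetric])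
      qed
      then have "C2c_approx p (\<lambda>z. y * indicator (s i -` {y}) z)"
        using m p by (intro C2c_approx_cmult C2c_approx_indicator) auto
      moreover have "C2c_approx p (\<lambda>z. \<Sum>y\<in>A. y * indicator (s i -` {y}) z)"
        using insert by simp
      ultimately have "C2c_approx p (\<lambda>z. y * indicator (s i -` {y}) z + (\<Sum>y\<in>A. y * indicator (s i -` {y}) z))"
        using p m by (intro C2c_approx_add borel_measurable_sum borel_measurable_times
            borel_measurable_indicator borel_measurable_const) simp_all
      then show ?case
        by (simp only: sum.insert[OF insert.hyps])
    qed
    ultimately show ?thesis
      using fr by (metis (no_types, lifting) Diff_iff ext finite_Diff insertI1)
  qed
  have "(\<lambda>i. pint p (\<lambda>z. s i z - f z)) \<longlonglongrightarrow> 0"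
  proof (rule pint_dominated[where g = "\<lambda>z. 3 * f z"])
    show "norm (s n z - f z) \<le> norm (3 * f z)" for n z
      using s(3)[of n z] by (auto simp: abs_mult)
    show "AE z in lborel. (\<lambda>n. s n z - f z) \<longlonglongrightarrow> 0"
      using s(2) by (auto simp: LIM_zero)
    show "pint p (\<lambda>z. 3 * f z) < \<infinity>"
      using fin by (simp add: pint_cmult ennreal_mult_less_top)
  qed (use p in auto)
  then have ex: "\<exists>i. pint p (\<lambda>z. s i z - f z) < ennreal \<epsilon>" if "0 < \<epsilon>" for \<epsilon>
    using eventually_happens[OF order_tendstoD(2), of _ 0 sequentially "ennreal \<epsilon>"] that by auto
  show ?thesis
  proof (rule C2c_approx_close)
    fix \<epsilon> :: real assume "0 < \<epsilon>"
    from ex[OF this] sa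
    show "\<exists>g. g \<in> borel_measurable borel \<and> C2c_approx p g \<and> pint p (\<lambda>z. g z - f z) < ennreal \<epsilon>"
      by (metis \<open>\<And>i. s i \<in> borel_measurable borel\<close>)
  qed (use p in simp_all)
qed

theorem C2c_dense_Lp:
  fixes f :: "'a::euclidean_space \<Rightarrow> real"
  assumes [measurable]: "f \<in> borel_measurable borel" and p: "0 < p" and fin: "pint p f < \<infinity>"
  shows "C2c_approx p f"
proof -
  define g where "g n z = (if norm z \<le> real n then f z else 0)" for n z
  have [measurable]: "g n \<in> borel_measurable borel" for n unfolding g_def by measurable
  have ga: "C2c_approx p (g n)" for n
  proof (rule C2c_approx_Lp_bounded_support[where R = "real n"])
    have "pint p (g n) \<le> pint p f" using p by (intro pint_mono) (auto simp: g_def)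
    then show "pint p (g n) < \<infinity>" using fin by (rule le_less_trans)
  qed (use p in \<open>auto simp: g_def\<close>)
  have "(\<lambda>i. pint p (\<lambda>z. g i z - f z)) \<longlonglongrightarrow> 0"
  proof (rule pint_dominated[where g = f])
    show "AE z in lborel. (\<lambda>n. g n z - f z) \<longlonglongrightarrow> 0"
    proof (rule AE_I2)
      fix z :: 'a
      obtain N where "norm z \<le> real N" using real_arch_simple by blast
      then have "\<forall>\<^sub>F n in sequentially. g n z - f z = 0"
        unfolding eventually_sequentially g_def by (intro exI[of _ N]) auto
      then show "(\<lambda>n. g n z - f z) \<longlonglongrightarrow> 0" by (rule tendsto_eventually)
    qed
  qed (use p fin in \<open>auto simp: g_def\<close>)
  then have ex: "\<exists>i. pint p (\<lambda>z. g i z - f z) < ennreal \<epsilon>" if "0 < \<epsilon>" for \<epsilon>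
    using eventually_happens[OF order_tendstoD(2), of _ 0 sequentially "ennreal \<epsilon>"] that by auto
  show ?thesis
  proof (rule C2c_approx_close)
    fix \<epsilon> :: real assume "0 < \<epsilon>"
    from ex[OF this] ga
    show "\<exists>g. g \<in> borel_measurable borel \<and> C2c_approx p g \<and> pint p (\<lambda>z. g z - f z) < ennreal \<epsilon>"
      by (metis \<open>\<And>n. g n \<in> borel_measurable borel\<close>)
  qed (use p in simp_all)
qed

subsection \<open>Density of the range of the heat operator\<close>

definition Lp_dense :: "real \<Rightarrow> (('a::euclidean_space \<Rightarrow> real) \<Rightarrow> 'a \<Rightarrow> real) \<Rightarrow> bool" where
  "Lp_dense p \<L> \<longleftrightarrow> (\<forall>f \<epsilon>. f \<in> borel_measurable borel \<longrightarrow> pint p f < \<infinity> \<longrightarrow> 0 < \<epsilon> \<longrightarrow>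
     (\<exists>u. C2c u \<and> pint p (\<lambda>z. \<L> u z - f z) < ennreal \<epsilon>))"

definition C2c_operator :: "real \<Rightarrow> (('a::euclidean_space \<Rightarrow> real) \<Rightarrow> 'a \<Rightarrow> real) \<Rightarrow> bool" where
  "C2c_operator p \<L> \<longleftrightarrow>
     (\<forall>u. C2c u \<longrightarrow> \<L> u \<in> borel_measurable borel \<and> pint p (\<L> u) < \<infinity>) \<and>
     (\<forall>u v z. C2c u \<longrightarrow> C2c v \<longrightarrow> \<L> (\<lambda>z. u z + v z) z = \<L> u z + \<L> v z) \<and>
     (\<forall>u c z. C2c u \<longrightarrow> \<L> (\<lambda>z. c * u z) z = c * \<L> u z)"

lemma C2c_operatorD:
  assumes "C2c_operator p \<L>" "C2c u"
  shows "\<L> u \<in> borel_measurable borel" "pint p (\<L> u) < \<infinity>"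
    "C2c v \<Longrightarrow> \<L> (\<lambda>z. u z + v z) z = \<L> u z + \<L> v z" "\<L> (\<lambda>z. c * u z) z = c * \<L> u z"
  using assms by (auto simp: C2c_operator_def)

lemma C2c_operator_zero: "C2c_operator p \<L> \<Longrightarrow> \<L> (\<lambda>z. 0) z = 0"
  using C2c_operatorD(4)[of p \<L> "\<lambda>z. 0" 0 z] by simp

lemma C2c_operator_sum:
  assumes "C2c_operator p \<L>" "finite A" "\<And>i. i \<in> A \<Longrightarrow> C2c (u i)"
  shows "\<L> (\<lambda>z. \<Sum>i\<in>A. u i z) z = (\<Sum>i\<in>A. \<L> (u i) z)"
  using assms(2,3)
proof (induction A rule: finite_induct)
  case empty
  then show ?case using C2c_operator_zero[OF assms(1)] by simp
next
  case (insert i A)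
  then show ?case
    using C2c_operatorD(3)[OF assms(1), of "u i" "\<lambda>z. \<Sum>i\<in>A. u i z"] C2c_sum[of A u] by simp
qed

section \<open>Resolvents of random walks\<close>

lemma pint_convex_sum:
  fixes f :: "'i \<Rightarrow> 'a::euclidean_space \<Rightarrow> real"
  assumes A: "finite A" "A \<noteq> {}" and [measurable]: "\<And>i. f i \<in> borel_measurable borel"
    and w: "\<And>i. i \<in> A \<Longrightarrow> 0 \<le> w i" "(\<Sum>i\<in>A. w i) = 1" and p: "1 \<le> p"
  shows "pint p (\<lambda>z. \<Sum>i\<in>A. w i * f i z) \<le> (\<Sum>i\<in>A. ennreal (w i) * pint p (f i))"
proof -
  have cvx: "convex_on UNIV (\<lambda>x::real. norm x powr p)"
  proof (rule convex_onI)
    fix t x y :: real assume "0 < t" "t < 1"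
    then show "norm ((1 - t) *\<^sub>R x + t *\<^sub>R y) powr p \<le> (1 - t) * norm x powr p + t * norm y powr p"
      using norm_powr_convex_comb[OF p, of "1 - t" x y] by simp
  qed simp
  have "pint p (\<lambda>z. \<Sum>i\<in>A. w i * f i z) \<le> (\<integral>\<^sup>+z. (\<Sum>i\<in>A. ennreal (w i) * ennreal (norm (f i z) powr p)) \<partial>lborel)"
    unfolding pint_def
  proof (intro nn_integral_mono)
    fix z
    have "norm (\<Sum>i\<in>A. w i *\<^sub>R f i z) powr p \<le> (\<Sum>i\<in>A. w i * norm (f i z) powr p)"
      using A w by (intro convex_on_sum[OF _ _ cvx]) auto
    then show "ennreal (norm (\<Sum>i\<in>A. w i * f i z) powr p) \<le> (\<Sum>i\<in>A. ennreal (w i) * ennreal (norm (f i z) powr p))"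
      using w(1) by (simp add: ennreal_mult[symmetric] sum_ennreal ennreal_leI cong: sum.cong)
  qed
  also have "\<dots> = (\<Sum>i\<in>A. ennreal (w i) * pint p (f i))"
    by (simp add: nn_integral_sum nn_integral_cmult pint_def)
  finally show ?thesis .
qed

text \<open>The transition operator of a random walk contracts L_p, by convexity of the power and
  invariance under translation. The bound does not depend on the number or the length of the
  jumps.\<close>

lemma pint_shift_average:
  fixes u :: "'a::euclidean_space \<Rightarrow> real" and v :: "'i \<Rightarrow> 'a"
  assumes A: "finite A" "A \<noteq> {}" and [measurable]: "u \<in> borel_measurable borel"
    and w: "\<And>i. i \<in> A \<Longrightarrow> 0 \<le> w i" "(\<Sum>i\<in>A. w i) = 1" and p: "1 \<le> p"
  shows "pint p (\<lambda>z. \<Sum>i\<in>A. w i * u (z + v i)) \<le> pint p u"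
proof -
  have "pint p (\<lambda>z. \<Sum>i\<in>A. w i * u (z + v i)) \<le> (\<Sum>i\<in>A. ennreal (w i) * pint p (\<lambda>z. u (z + v i)))"
    using A w p by (intro pint_convex_sum) auto
  also have "\<dots> = (\<Sum>i\<in>A. ennreal (w i)) * pint p u"
    by (simp add: pint_shift sum_distrib_right)
  also have "(\<Sum>i\<in>A. ennreal (w i)) = 1"
    using w by (simp add: sum_ennreal)
  finally show ?thesis by simp
qed

text \<open>The iteration solves the resolvent equation for the generator of a random walk; the error
  operator commutes with the walk, so it suffices to control it on the right-hand side.\<close>

lemma neumann_approximation:
  fixes \<L> :: "('a::euclidean_space \<Rightarrow> real) \<Rightarrow> 'a \<Rightarrow> real" and v :: "'i \<Rightarrow> 'a"
  assumes op: "C2c_operator p \<L>"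
    and shift: "\<And>u v z. C2c u \<Longrightarrow> \<L> (\<lambda>z. u (z + v)) z = \<L> u (z + v)"
    and A: "finite A" "A \<noteq> {}" and w: "\<And>i. i \<in> A \<Longrightarrow> 0 \<le> w i" and W: "(\<Sum>i\<in>A. w i) = W" "0 < W"
    and p: "1 \<le> p" and lam: "0 < lam" and f: "C2c f" and eps: "0 < \<epsilon>"
  defines "E \<equiv> \<lambda>u z. \<L> u z + lam * u z - ((\<Sum>i\<in>A. w i * u (z + v i)) - W * u z)"
  shows "\<exists>u. C2c u \<and> pint p (\<lambda>z. \<L> u z + f z)
    \<le> ennreal (2 powr p) * (ennreal ((1 / lam) powr p) * pint p (E f) + ennreal \<epsilon>)"
proof -
  \<comment> \<open>\<open>P\<close> is the jump part of the walk, W its total rate and P - W its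
    generator; \<open>E\<close> is L + lam minus this generator, that is, the consistency
    error.\<close>
  define P where "P u z = (\<Sum>i\<in>A. w i * u (z + v i))" for u z
  define \<rho> where "\<rho> = lam + W"
  have rho: "0 < \<rho>" using lam W by (simp add: \<rho>_def)
  have PC: "C2c (P u)" if "C2c u" for u
    unfolding P_def using A that by (intro C2c_sum C2c_cmult C2c_shift)
  have E_add: "E (\<lambda>z. u z + v z) z = E u z + E v z" if "C2c u" "C2c v" for u v z
    using C2c_operatorD(3)[OF op that(1,2)] by (simp add: E_def algebra_simps sum.distrib)
  have E_cmult: "E (\<lambda>z. c * u z) z = c * E u z" if "C2c u" for u c z
    using C2c_operatorD(4)[OF op that] by (simp add: E_def algebra_simps sum_distrib_left)
  have E_P: "E (P u) z = P (E u) z" if "C2c u" for u z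
  proof -
    have 1: "\<L> (P u) z = P (\<L> u) z"
      unfolding P_def using A that
      by (subst C2c_operator_sum[OF op])
        (auto simp: C2c_cmult C2c_shift C2c_operatorD(4)[OF op] shift intro!: sum.cong)
    have 2: "(\<Sum>i\<in>A. w i * P u (z + v i)) = P (P u) z" by (simp add: P_def)
    show ?thesis
      unfolding E_def 1 2 by (simp add: P_def algebra_simps sum.distrib sum_subtractf sum_distrib_left)
  qed
  have E_meas: "E u \<in> borel_measurable borel" if "C2c u" for u
    unfolding E_def P_def[symmetric]
    using C2c_operatorD(1)[OF op that] C2c_measurable(1)[OF that] C2c_measurable(1)[OF PC[OF that]] by measurable
  have P_pint: "pint p (\<lambda>z. P u z / W) \<le> pint p u" if "u \<in> borel_measurable borel" for u
  proof -
    have "(\<lambda>z. P u z / W) = (\<lambda>z. \<Sum>i\<in>A. (w i / W) * u (z + v i))"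
      by (simp add: P_def sum_divide_distrib)
    then show ?thesis
      using pint_shift_average[OF A that, of "\<lambda>i. w i / W" p v] w W p by (simp add: sum_divide_distrib[symmetric])
  qed
  \<comment> \<open>Fixed-point iteration for \<rho> U = f + P U, that is, lam U minus the generator
    applied to U equals f. The contraction ratio is W / \<rho> < 1; it may be close to 1, so it must
    not enter the final constants.\<close>
  define U where "U = rec_nat (\<lambda>z. 0) (\<lambda>n u z. (1 / \<rho>) * (f z + P u z))"
  have U0: "U 0 = (\<lambda>z. 0)" and US: "U (Suc n) = (\<lambda>z. (1 / \<rho>) * (f z + P (U n) z))" for n
    by (auto simp: U_def)
  have UC: "C2c (U n)" for n
  proof (induction n)
    case (Suc n)
    show ?case unfolding US by (rule C2c_cmult[OF C2c_add[OF f PC[OF Suc]]])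
  qed (simp add: U0)
  define r where "r n z = f z - \<rho> * U n z + P (U n) z" for n z
  have rS: "r (Suc n) = (\<lambda>z. (W / \<rho>) * (P (r n) z / W))" for n
  proof
    fix z
    have "r n z = \<rho> * (U (Suc n) z - U n z)" for z
      using rho by (simp add: r_def US field_simps)
    then have "r n = (\<lambda>z. \<rho> * (U (Suc n) z - U n z))" by blast
    then have "P (r n) z = \<rho> * (P (U (Suc n)) z - P (U n) z)"
      by (simp only:) (simp add: P_def sum_distrib_left sum_subtractf algebra_simps)
    moreover have "r (Suc n) z = P (U (Suc n)) z - P (U n) z"
      using rho by (simp add: r_def US)
    ultimately show "r (Suc n) z = (W / \<rho>) * (P (r n) z / W)"
      using rho W by simp
  qed
  have r_meas [measurable]: "r n \<in> borel_measurable borel" for n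
    unfolding r_def using C2c_measurable(1)[OF f] C2c_measurable(1)[OF UC] C2c_measurable(1)[OF PC[OF UC]] by measurable
  have P_meas [measurable]: "P u \<in> borel_measurable borel" if [measurable]: "u \<in> borel_measurable borel" for u
    unfolding P_def by measurable
  have r_le: "pint p (r n) \<le> ennreal (((W / \<rho>) powr p) ^ n) * pint p f" for n
  proof (induction n)
    case 0
    show ?case by (simp add: r_def[abs_def] U0 P_def)
  next
    case (Suc n)
    have "pint p (r (Suc n)) = ennreal ((W / \<rho>) powr p) * pint p (\<lambda>z. P (r n) z / W)"
      unfolding rS using W rho by (subst pint_cmult) auto
    also have "\<dots> \<le> ennreal ((W / \<rho>) powr p) * (ennreal (((W / \<rho>) powr p) ^ n) * pint p f)"
      by (intro mult_left_mono order.trans[OF P_pint Suc]) auto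
    finally show ?case by (simp add: ennreal_mult mult.assoc)
  qed
  \<comment> \<open>\<open>E\<close> commutes with \<open>P\<close>, so lam E (U n) runs through the
    same iteration with E f as source: each step is a convex combination, with weights lam / \<rho>
    and W / \<rho>, of lam-scaled data E f and an average of translates. The bound is therefore free
    of W.\<close>
  have e_le: "pint p (\<lambda>z. lam * E (U n) z) \<le> pint p (E f)" for n
  proof (induction n)
    case 0
    have "E (\<lambda>z. 0) z = 0" for z using E_cmult[OF C2c_zero, of 0 z] by simp
    then show ?case by (simp add: U0)
  next
    case (Suc n)
    have eq: "lam * E (U (Suc n)) z = (lam / \<rho>) *\<^sub>R E f z + (1 - lam / \<rho>) *\<^sub>R (P (\<lambda>z. lam * E (U n) z) z / W)" for z
    proof -
      have 1: "E (U (Suc n)) z = (1 / \<rho>) * (E f z + P (E (U n)) z)"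
        unfolding US using f UC by (simp add: E_cmult[OF C2c_add[OF f PC[OF UC]]] E_add[OF f PC[OF UC]] E_P del: times_divide_eq_left)
      have 2: "P (\<lambda>z. lam * E (U n) z) z = lam * P (E (U n)) z"
        by (simp add: P_def sum_distrib_left mult.left_commute)
      have 3: "1 - lam / \<rho> = W / \<rho>" using rho by (simp add: \<rho>_def field_simps)
      show ?thesis unfolding 1 2 3 using W(2) by (simp add: add_divide_distrib distrib_left)
    qed
    have m: "E f \<in> borel_measurable borel" "(\<lambda>z. lam * E (U n) z) \<in> borel_measurable borel"
      using E_meas f UC by auto
    have m2: "(\<lambda>z. P (\<lambda>z. lam * E (U n) z) z / W) \<in> borel_measurable borel"
      using P_meas[OF m(2)] by measurable
    have rng: "0 \<le> lam / \<rho>" "lam / \<rho> \<le> 1" using lam W rho by (auto simp: \<rho>_def)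
    have "pint p (\<lambda>z. lam * E (U (Suc n)) z)
        \<le> ennreal (lam / \<rho>) * pint p (E f) + ennreal (1 - lam / \<rho>) * pint p (\<lambda>z. P (\<lambda>z. lam * E (U n) z) z / W)"
      unfolding eq by (rule pint_convex[OF m(1) m2 p rng])
    also have "\<dots> \<le> ennreal (lam / \<rho>) * pint p (E f) + ennreal (1 - lam / \<rho>) * pint p (E f)"
      by (intro add_mono mult_left_mono order.trans[OF P_pint[OF m(2)] Suc]) auto
    also have "\<dots> = ennreal (lam / \<rho> + (1 - lam / \<rho>)) * pint p (E f)"
      using rng by (subst ennreal_plus) (auto simp: distrib_right)
    finally show ?case by simp
  qed
  \<comment> \<open>The total error is the sum of the consistency error and the residual of the
    iteration. With this sign the function U n solves L u = - f approximately.\<close>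
  have Ef_eq: "\<L> (U n) z + f z = E (U n) z + r n z" for n z
    by (simp add: E_def r_def P_def \<rho>_def algebra_simps)
  have "(\<lambda>n. ((W / \<rho>) powr p) ^ n * enn2real (pint p f)) \<longlonglongrightarrow> 0 * enn2real (pint p f)"
  proof (intro tendsto_mult LIMSEQ_power_zero tendsto_const)
    have "(W / \<rho>) powr p < 1 powr p"
      using W lam p by (intro powr_less_mono2) (auto simp: \<rho>_def)
    then show "norm ((W / \<rho>) powr p) < 1" by simp
  qed
  then have "\<forall>\<^sub>F n in sequentially. ((W / \<rho>) powr p) ^ n * enn2real (pint p f) < \<epsilon>"
    using eps by (intro order_tendstoD(2)) auto
  then obtain n where n: "((W / \<rho>) powr p) ^ n * enn2real (pint p f) < \<epsilon>"
    using eventually_happens by force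
  have "pint p f < \<infinity>" using Cc_pint_finite[OF C2c_Cc[OF f]] p by simp
  then have "ennreal (((W / \<rho>) powr p) ^ n) * pint p f = ennreal (((W / \<rho>) powr p) ^ n * enn2real (pint p f))"
    by (simp add: ennreal_mult less_top)
  also have "\<dots> \<le> ennreal \<epsilon>" using n by (intro ennreal_leI) auto
  finally have rn: "pint p (r n) \<le> ennreal \<epsilon>" using r_le[of n] by (rule order.trans[rotated])
  have En: "pint p (E (U n)) \<le> ennreal ((1 / lam) powr p) * pint p (E f)"
  proof -
    have "E (U n) = (\<lambda>z. (1 / lam) * (lam * E (U n) z))" using lam by auto
    then have "pint p (E (U n)) = pint p (\<lambda>z. (1 / lam) * (lam * E (U n) z))" by metis
    also have "\<dots> = ennreal ((1 / lam) powr p) * pint p (\<lambda>z. lam * E (U n) z)"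
      using lam E_meas[OF UC[of n]] by (subst pint_cmult) auto
    finally show ?thesis using e_le[of n] by (simp add: mult_left_mono)
  qed
  have "pint p (\<lambda>z. \<L> (U n) z + f z) \<le> ennreal (2 powr p) * (pint p (E (U n)) + pint p (r n))"
    unfolding Ef_eq using p by (intro pint_add E_meas UC r_meas) auto
  also have "\<dots> \<le> ennreal (2 powr p) * (ennreal ((1 / lam) powr p) * pint p (E f) + ennreal \<epsilon>)"
    by (intro mult_left_mono add_mono En rn) auto
  finally show ?thesis using UC by blast
qed

section \<open>Consistency of finite differences for the heat operator\<close>

lemma Cc_uniformly_continuous:
  assumes "Cc g" "0 < \<eta>"
  obtains \<delta> where "0 < \<delta>" "\<And>z w. dist z w < \<delta> \<Longrightarrow> \<bar>g z - g w\<bar> < \<eta>"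
proof -
  obtain R where R: "R > 0" "\<And>z. R \<le> norm z \<Longrightarrow> g z = 0" using assms by (auto simp: Cc_def bsupp_def)
  have "uniformly_continuous_on (cball 0 (R + 1)) g"
    using assms(1) by (intro compact_uniformly_continuous) (auto simp: Cc_def intro: continuous_on_subset)
  then obtain d where d: "d > 0" "\<And>z w. z \<in> cball 0 (R + 1) \<Longrightarrow> w \<in> cball 0 (R + 1) \<Longrightarrow> dist w z < d \<Longrightarrow> dist (g w) (g z) < \<eta>"
    using assms(2) unfolding uniformly_continuous_on_def by meson
  show ?thesis
  proof (rule that[of "min d 1"])
    fix z w :: 'a assume zw: "dist z w < min d 1"
    have "norm z \<le> norm w + dist z w" "norm w \<le> norm z + dist z w"
      using norm_triangle_ineq2[of z w] norm_triangle_ineq2[of w z] by (auto simp: dist_norm norm_minus_commute)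
    then show "\<bar>g z - g w\<bar> < \<eta>"
      using R(2)[of z] R(2)[of w] d(2)[of w z] zw assms(2)
      by (cases "R \<le> norm z \<and> R \<le> norm w") (auto simp: dist_real_def dist_commute)
  qed (use d in auto)
qed

lemma dd_minus: "C1 u \<Longrightarrow> dd (- e) u z = - dd e u z"
  using linear_neg[OF bounded_linear.linear[OF dd_linear], of u e z] by simp

text \<open>Second-order Maclaurin expansion of the even function s -> f(z + s e) + f(z - s e): its
  first derivative vanishes at 0, so the remainder is the whole of the difference.\<close>

lemma second_difference:
  assumes "C2 f" "0 < h"
  obtains \<xi> where "0 < \<xi>" "\<xi> < h"
    "(f (z + h *\<^sub>R e) + f (z + (- h) *\<^sub>R e) - 2 * f z) / h\<^sup>2 = (dd e (dd e f) (z + \<xi> *\<^sub>R e) + dd e (dd e f) (z + (- \<xi>) *\<^sub>R e)) / 2"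
proof -
  define df where "df m s = (if m = 0 then f (z + s *\<^sub>R e) + f (z + s *\<^sub>R (- e))
     else if m = Suc 0 then dd e f (z + s *\<^sub>R e) + (-1) * dd e f (z + s *\<^sub>R (- e))
     else dd e (dd e f) (z + s *\<^sub>R e) + dd e (dd e f) (z + s *\<^sub>R (- e)))" for m :: nat and s :: real
  have C: "C1 f" "C1 (dd e f)" using assms C2_C1 C2_C1_dd by auto
  have "(df m has_real_derivative df (Suc m) t) (at t)" if "m < 2" for m t
  proof -
    have "m = 0 \<or> m = Suc 0" using that by auto
    then show ?thesis
    proof
      assume "m = 0"
      then show ?thesis
        using DERIV_add[OF dd_line[OF C(1), of z e t] dd_line[OF C(1), of z "- e" t]]
        by (simp add: df_def[abs_def] dd_minus[OF C(1)])
    next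
      assume "m = Suc 0"
      then show ?thesis
        using DERIV_add[OF dd_line[OF C(2), of z e t] DERIV_cmult[OF dd_line[OF C(2), of z "- e" t], of "-1"]]
        by (simp add: df_def[abs_def] dd_minus[OF C(2)])
    qed
  qed
  then have "\<exists>t>0. t < h \<and> df 0 h = (\<Sum>m<2. df m 0 / fact m * h ^ m) + df 2 t / fact 2 * h ^ 2"
    using assms(2) by (intro Maclaurin) auto
  then obtain t where t: "0 < t" "t < h" "df 0 h = (\<Sum>m<2. df m 0 / fact m * h ^ m) + df 2 t / fact 2 * h ^ 2"
    by auto
  have "(\<Sum>m<2. df m 0 / fact m * h ^ m) = 2 * f z"
    by (simp add: numeral_2_eq_2 df_def)
  then have "(df 0 h - 2 * f z) / h\<^sup>2 = df 2 t / 2"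
    using t(3) assms(2) by (simp add: fact_2)
  then show ?thesis
    using t(1,2) that[of t] by (simp add: df_def)
qed

text \<open>The directions are arbitrary vectors of one Euclidean space, so that time and space need
  not be separated in the density argument. With \<open>e_x\<close> and \<open>e_t\<close> it is the
  time derivative plus K times the Laplacian minus lam.\<close>

definition heat_op :: "('i::finite \<Rightarrow> 'a::euclidean_space) \<Rightarrow> 'a \<Rightarrow> real \<Rightarrow> real \<Rightarrow> ('a \<Rightarrow> real) \<Rightarrow> 'a \<Rightarrow> real" where
  "heat_op e e0 K lam u z = (\<Sum>i\<in>UNIV. K * dd (e i) (dd (e i) u) z) + dd e0 u z - lam * u z"

lemma heat_op_Cc:
  assumes "C2c u"
  shows "Cc (heat_op e e0 K lam u)"
proof -
  have "continuous_on UNIV (heat_op e e0 K lam u)"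
    unfolding heat_op_def using C2c_Cc[OF assms] C2c_dd_Cc[OF assms] C2c_dd2_Cc[OF assms]
    by (intro continuous_intros) (auto simp: Cc_def)
  moreover have "bsupp (\<lambda>z. (\<Sum>i\<in>S. K * dd (e i) (dd (e i) u) z))" if "finite S" for S
    using that C2c_dd2_Cc[OF assms] by (induction S) (auto intro!: bsupp_add bsupp_mult2 simp: Cc_def)
  from bsupp_add[OF bsupp_add[OF this[of UNIV] conjunct2[OF C2c_dd_Cc[OF assms, unfolded Cc_def]]] bsupp_mult2[of u "\<lambda>_. - lam"]]
  have "bsupp (heat_op e e0 K lam u)"
    using assms by (simp add: heat_op_def[abs_def] C2c_def)
  ultimately show ?thesis by (simp add: Cc_def)
qed

lemma heat_op_operator:
  assumes "0 < p"
  shows "C2c_operator p (heat_op e e0 K lam)"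
  unfolding C2c_operator_def
proof (intro conjI allI impI)
  fix u v :: "'a \<Rightarrow> real" and z c
  assume u: "C2c u"
  show "heat_op e e0 K lam u \<in> borel_measurable borel" "pint p (heat_op e e0 K lam u) < \<infinity>"
    using Cc_measurable[OF heat_op_Cc[OF u]] Cc_pint_finite[OF heat_op_Cc[OF u] assms] by auto
  have cu: "C1 u" "C1 (dd e u)" for e using u C2_C1 C2_C1_dd by (auto simp: C2c_def)
  have "dd e (\<lambda>z. c * u z) = (\<lambda>z. c * dd e u z)" for e using dd_cmult[OF cu(1)] by blast
  then show "heat_op e e0 K lam (\<lambda>z. c * u z) z = c * heat_op e e0 K lam u z"
    by (simp add: heat_op_def dd_cmult cu algebra_simps sum_distrib_left)
  assume v: "C2c v"
  have cv: "C1 v" "C1 (dd e v)" for e using v C2_C1 C2_C1_dd by (auto simp: C2c_def)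
  have "dd e (\<lambda>z. u z + v z) = (\<lambda>z. dd e u z + dd e v z)" for e using dd_add[OF cu(1) cv(1)] by blast
  then show "heat_op e e0 K lam (\<lambda>z. u z + v z) z = heat_op e e0 K lam u z + heat_op e e0 K lam v z"
    by (simp add: heat_op_def dd_add cu cv algebra_simps sum.distrib)
qed

lemma heat_op_shift:
  assumes "C2c u"
  shows "heat_op e e0 K lam (\<lambda>z. u (z + v)) z = heat_op e e0 K lam u (z + v)"
proof -
  have cu: "C1 u" "C1 (dd e u)" for e using assms C2_C1 C2_C1_dd by (auto simp: C2c_def)
  have "dd e (\<lambda>z. u (z + v)) = (\<lambda>z. dd e u (z + v))" for e using dd_shift[OF cu(1)] by blast
  then show ?thesis by (simp add: heat_op_def dd_shift cu)
qed

text \<open>The jumps of the walk are indexed by an option type: \<open>None\<close> is the step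
  along e0, and \<open>Some (i, s)\<close> is the step along e i, forward or backward according to
  s.\<close>

lemma sum_option_UNIV:
  fixes g :: "('i::finite \<times> bool) option \<Rightarrow> real"
  shows "(\<Sum>k\<in>UNIV. g k) = g None + (\<Sum>i\<in>UNIV. g (Some (i, True)) + g (Some (i, False)))"
proof -
  have "(\<Sum>k\<in>UNIV. g k) = g None + (\<Sum>k\<in>UNIV. g (Some k))"
    unfolding UNIV_option_conv by (subst sum.insert) (auto simp: sum.reindex)
  also have "(\<Sum>k\<in>UNIV. g (Some k)) = (\<Sum>i\<in>UNIV. \<Sum>s\<in>UNIV. g (Some (i, s)))"
    by (simp add: sum.cartesian_product UNIV_Times_UNIV[symmetric] del: UNIV_Times_UNIV)
  finally show ?thesis by (simp add: UNIV_bool add.commute)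
qed

text \<open>Difference quotients are values of the derivatives at nearby points, so uniform
  continuity bounds the error pointwise; as the error vanishes outside a fixed ball, the bound
  passes to L_p.\<close>

lemma heat_consistency:
  fixes f :: "'a::euclidean_space \<Rightarrow> real" and e :: "'i::finite \<Rightarrow> 'a" and e0 :: 'a
  assumes f: "C2c f" and K: "0 \<le> K" and eta: "0 < \<eta>" and p: "0 < p"
  defines "D \<equiv> \<lambda>h z. (\<Sum>i\<in>UNIV. K * (dd (e i) (dd (e i) f) z - (f (z + h *\<^sub>R e i) + f (z + (- h) *\<^sub>R e i) - 2 * f z) / h\<^sup>2))
      + (dd e0 f z - (f (z + h *\<^sub>R e0) - f z) / h)"
  shows "\<exists>h>0. pint p (D h) < ennreal \<eta>"
proof -
  obtain R where R: "R > 0" "\<And>z. R \<le> norm z \<Longrightarrow> f z = 0" using f by (auto simp: C2c_def bsupp_def)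
  have C: "C1 f" "C2 f" using f C2_C1 by (auto simp: C2c_def)
  \<comment> \<open>The summand 1 keeps m positive even if all directions vanish. For h \<le> 1 the
    displacements enlarge the support of f by at most m.\<close>
  define m where "m = (\<Sum>i\<in>UNIV. norm (e i)) + norm e0 + 1"
  have m: "norm (e i) \<le> m" "norm e0 \<le> m" "1 \<le> m" for i
  proof -
    have 1: "norm (e i) \<le> (\<Sum>i\<in>UNIV. norm (e i))" by (rule member_le_sum) auto
    have 2: "0 \<le> (\<Sum>i\<in>UNIV. norm (e i))" by (rule sum_nonneg) simp
    show "norm (e i) \<le> m" "norm e0 \<le> m" "1 \<le> m"
      using 1 2 norm_ge_zero[of e0] unfolding m_def by linarith+
  qed
  define V where "V = measure lborel (cball (0::'a) (R + m))"
  have V: "emeasure lborel (cball (0::'a) (R + m)) = ennreal V"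
    unfolding V_def using emeasure_lborel_cball_finite[of "0::'a" "R + m"]
    by (intro emeasure_eq_ennreal_measure) auto
  define C where "C = K * real CARD('i) + 1"
  have C0: "0 < C" using K by (auto simp: C_def add_nonneg_pos)
  \<comment> \<open>Chosen so that (C \<zeta>)^p = \<eta> / (V + 1), whose product with the volume V
    stays strictly below \<eta>.\<close>
  define \<zeta> where "\<zeta> = (\<eta> / (V + 1)) powr (1 / p) / C"
  have V0: "0 \<le> V" by (simp add: V_def)
  have z0: "0 < \<zeta>" using eta V0 C0 by (simp add: \<zeta>_def)
  have "\<exists>\<delta>>0. \<forall>z w. dist z w < \<delta> \<longrightarrow> \<bar>dd (e i) (dd (e i) f) z - dd (e i) (dd (e i) f) w\<bar> < \<zeta>" for i
    by (rule Cc_uniformly_continuous[OF C2c_dd2_Cc[OF f] z0]) blast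
  then obtain d where d: "\<And>i. 0 < d i" "\<And>i z w. dist z w < d i \<Longrightarrow> \<bar>dd (e i) (dd (e i) f) z - dd (e i) (dd (e i) f) w\<bar> < \<zeta>"
    by metis
  obtain d0 where d0: "0 < d0" "\<And>z w. dist z w < d0 \<Longrightarrow> \<bar>dd e0 f z - dd e0 f w\<bar> < \<zeta>"
    by (rule Cc_uniformly_continuous[OF C2c_dd_Cc[OF f] z0]) blast
  define dm where "dm = Min (insert d0 (range d))"
  have dm: "0 < dm" "dm \<le> d0" "\<And>i. dm \<le> d i" using d d0 by (auto simp: dm_def intro: min.coboundedI2)
  define h where "h = min (dm / (2 * m)) (1/2)"
  have h: "0 < h" "h < 1" using dm m by (auto simp: h_def)
  have hm: "s * norm v < dm" if "0 \<le> s" "s \<le> h" "norm v \<le> m" for s v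
  proof -
    have "s * norm v \<le> h * m" using that h m by (intro mult_mono) auto
    also have "\<dots> \<le> dm / (2 * m) * m" using m by (intro mult_right_mono) (auto simp: h_def)
    also have "\<dots> < dm" using m dm by simp
    finally show ?thesis .
  qed
  have b1: "\<bar>dd (e i) (dd (e i) f) z - (f (z + h *\<^sub>R e i) + f (z + (- h) *\<^sub>R e i) - 2 * f z) / h\<^sup>2\<bar> \<le> \<zeta>" for i z
  proof -
    obtain \<xi> where xi: "0 < \<xi>" "\<xi> < h"
      "(f (z + h *\<^sub>R e i) + f (z + (- h) *\<^sub>R e i) - 2 * f z) / h\<^sup>2 = (dd (e i) (dd (e i) f) (z + \<xi> *\<^sub>R e i) + dd (e i) (dd (e i) f) (z + (- \<xi>) *\<^sub>R e i)) / 2"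
      by (rule second_difference[OF C(2) h(1)])
    have "dist z (z + \<xi> *\<^sub>R e i) < d i" "dist z (z + (- \<xi>) *\<^sub>R e i) < d i"
      using hm[of \<xi> "e i"] xi m dm(3)[of i] by (auto simp: dist_norm)
    from d(2)[OF this(1)] d(2)[OF this(2)] show ?thesis
      unfolding xi(3) abs_le_iff abs_less_iff by (auto simp: field_simps)
  qed
  have b2: "\<bar>dd e0 f z - (f (z + h *\<^sub>R e0) - f z) / h\<bar> \<le> \<zeta>" for z
  proof -
    have "\<exists>s. 0 < s \<and> s < h \<and> f (z + h *\<^sub>R e0) - f (z + 0 *\<^sub>R e0) = (h - 0) * dd e0 f (z + s *\<^sub>R e0)"
      using h by (intro MVT2 dd_line C) auto
    then obtain s where s: "0 < s" "s < h" "f (z + h *\<^sub>R e0) - f z = h * dd e0 f (z + s *\<^sub>R e0)" by auto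
    have "dist z (z + s *\<^sub>R e0) < d0"
      using hm[of s e0] s m dm(2) by (auto simp: dist_norm)
    from d0(2)[OF this] show ?thesis using s(3) h by simp
  qed
  have bound: "\<bar>D h z\<bar> \<le> C * \<zeta>" for z
  proof -
    have "\<bar>D h z\<bar> \<le> (\<Sum>i\<in>(UNIV::'i set). K * \<zeta>) + \<zeta>"
      unfolding D_def
      by (intro order.trans[OF abs_triangle_ineq] add_mono b2 order.trans[OF sum_abs] sum_mono)
        (use K b1 in \<open>auto simp: abs_mult intro!: mult_left_mono\<close>)
    then show ?thesis by (simp add: C_def algebra_simps)
  qed
  have zero: "D h z = 0" if "R + m < norm z" for z
  proof -
    have f0: "f (z + s *\<^sub>R v) = 0" if "\<bar>s\<bar> \<le> 1" "norm v \<le> m" for s v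
    proof (rule R(2))
      have "\<bar>s\<bar> * norm v \<le> 1 * m" using that by (intro mult_mono) auto
      then have "norm (s *\<^sub>R v) \<le> m" by simp
      then show "R \<le> norm (z + s *\<^sub>R v)"
        using norm_diff_ineq[of z "s *\<^sub>R v"] \<open>R + m < norm z\<close> by linarith
    qed
    have fz: "f z = 0" using f0[of 0 0] m by simp
    have ev: "\<forall>\<^sub>F w in nhds z. f w = 0"
    proof -
      have "\<forall>\<^sub>F w in nhds z. w \<in> - cball 0 R"
        using that m by (intro eventually_nhds_in_open) auto
      then show ?thesis by eventually_elim (use R in auto)
    qed
    have dz: "dd v f w = 0" if "w \<in> - cball 0 R" for v w
    proof (rule dd_unique[where G = "\<lambda>_. 0"])
      have "((\<lambda>_. 0) has_derivative (\<lambda>_. 0)) (at w)" by simp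
      then show "(f has_derivative (\<lambda>_. 0)) (at w)"
        by (rule has_derivative_transform_within_open[OF _ open_Compl[OF closed_cball[of 0 R]]]) (use that R in auto)
    qed
    have zin: "z \<in> - cball 0 R" using that m by auto
    have dz2: "dd v (dd v f) z = 0" for v
    proof (rule dd_unique[where G = "\<lambda>_. 0"])
      have "((\<lambda>_. 0) has_derivative (\<lambda>_. 0)) (at z)" by simp
      then show "(dd v f has_derivative (\<lambda>_. 0)) (at z)"
        by (rule has_derivative_transform_within_open[OF _ open_Compl[OF closed_cball[of 0 R]]]) (use zin dz in auto)
    qed
    show ?thesis
      unfolding D_def using f0[of h] f0[of "- h"] h m fz dz[OF zin] dz2 by simp
  qed
  have "pint p (D h) \<le> (\<integral>\<^sup>+z. ennreal ((C * \<zeta>) powr p) * indicator (cball 0 (R + m)) (z::'a) \<partial>lborel)"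
    unfolding pint_def
  proof (intro nn_integral_mono)
    fix z
    show "ennreal (norm (D h z) powr p) \<le> ennreal ((C * \<zeta>) powr p) * indicator (cball 0 (R + m)) z"
      using bound[of z] zero[of z] p by (cases "R + m < norm z") (auto intro!: ennreal_leI powr_mono2)
  qed
  also have "\<dots> = ennreal ((C * \<zeta>) powr p * V)"
    by (simp add: nn_integral_cmult_indicator V ennreal_mult V0)
  also have "(C * \<zeta>) powr p * V = \<eta> / (V + 1) * V"
    using C0 p eta V0 by (simp add: \<zeta>_def powr_powr)
  also have "ennreal \<dots> < ennreal \<eta>"
    using eta V0 by (intro ennreal_lessI) (auto simp: field_simps)
  finally show ?thesis using h by blast
qed

theorem heat_op_dense:
  fixes e :: "'i::finite \<Rightarrow> 'a::euclidean_space"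
  assumes K: "0 \<le> K" and lam: "0 < lam" and p: "1 \<le> p"
  shows "Lp_dense p (heat_op e e0 K lam)"
  unfolding Lp_dense_def
proof (intro allI impI)
  fix g :: "'a \<Rightarrow> real" and \<epsilon> :: real
  assume [measurable]: "g \<in> borel_measurable borel" and g: "pint p g < \<infinity>" and eps: "0 < \<epsilon>"
  have p0: "0 < p" using p by simp
  define q where "q = 2 powr p"
  have q0: "0 < q" by (simp add: q_def)
  \<comment> \<open>e1 is spent inside the resolvent approximation; e2 = 2 q e1 bounds both its
    outcome and the density error. The factor q = 2 powr p enters once at each of two triangle
    inequalities.\<close>
  define e1 where "e1 = \<epsilon> / (4 * q * q)"
  have e1: "0 < e1" using eps q0 by (simp add: e1_def)
  define e2 where "e2 = \<epsilon> / (2 * q)"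
  have e2: "0 < e2" using eps q0 by (simp add: e2_def)
  \<comment> \<open>\<open>f\<close> approximates - g because the walk approximation solves L u = -
    f.\<close>
  obtain f where f: "C2c f" "pint p (\<lambda>z. f z - (- g z)) < ennreal e2"
    using C2c_dense_Lp[of "\<lambda>z. - g z" p] g p0 e2 by (auto simp: C2c_approx_def)
  define L where "L = (1 / lam) powr p"
  have L0: "0 < L" using lam by (simp add: L_def)
  obtain h where h: "0 < h"
    "pint p (\<lambda>z. (\<Sum>i\<in>UNIV. K * (dd (e i) (dd (e i) f) z - (f (z + h *\<^sub>R e i) + f (z + (- h) *\<^sub>R e i) - 2 * f z) / h\<^sup>2))
      + (dd e0 f z - (f (z + h *\<^sub>R e0) - f z) / h)) < ennreal (e1 / L)"
    using heat_consistency[OF f(1) K _ p0, of "e1 / L" e e0] e1 L0 by auto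
  \<comment> \<open>Jump rates: 1/h for the step h e0, and K/h^2 for each of the steps along e i of
    signed length h and - h. The generator is then the finite-difference form of the operator
    without its term - lam u.\<close>
  define w where "w k = (case k of None \<Rightarrow> 1 / h | Some _ \<Rightarrow> K / h\<^sup>2)" for k :: "('i \<times> bool) option"
  define v where "v k = (case k of None \<Rightarrow> h *\<^sub>R e0 | Some (i, s) \<Rightarrow> (if s then h else - h) *\<^sub>R e i)" for k
  define W where "W = (\<Sum>k\<in>UNIV. w k)"
  have W: "W = 1 / h + (\<Sum>i\<in>(UNIV::'i set). 2 * (K / h\<^sup>2))"
    unfolding W_def sum_option_UNIV by (simp add: w_def)
  have W0: "0 < W" unfolding W using h(1) K by (intro add_pos_nonneg sum_nonneg) auto
  have w0: "0 \<le> w k" for k using h(1) K by (simp add: w_def split: option.split)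
  have E: "heat_op e e0 K lam f z + lam * f z - ((\<Sum>k\<in>UNIV. w k * f (z + v k)) - W * f z)
     = (\<Sum>i\<in>UNIV. K * (dd (e i) (dd (e i) f) z - (f (z + h *\<^sub>R e i) + f (z + (- h) *\<^sub>R e i) - 2 * f z) / h\<^sup>2))
      + (dd e0 f z - (f (z + h *\<^sub>R e0) - f z) / h)" for z
  proof -
    have 1: "(\<Sum>k\<in>UNIV. w k * f (z + v k))
      = f (z + h *\<^sub>R e0) / h + (\<Sum>i\<in>UNIV. K / h\<^sup>2 * f (z + h *\<^sub>R e i) + K / h\<^sup>2 * f (z + (- h) *\<^sub>R e i))"
      unfolding sum_option_UNIV by (simp add: w_def v_def)
    have 2: "W * f z = f z / h + (\<Sum>i\<in>(UNIV::'i set). 2 * (K / h\<^sup>2) * f z)"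
      unfolding W by (simp add: algebra_simps)
    have 3: "K * (x - (y1 + y2 - 2 * y3) / h\<^sup>2) = K * x - ((K / h\<^sup>2 * y1 + K / h\<^sup>2 * y2) - 2 * (K / h\<^sup>2) * y3)" for x y1 y2 y3 :: real
      by (simp add: field_simps add_divide_distrib diff_divide_distrib)
    show ?thesis
      unfolding heat_op_def 1 2 3 sum_subtractf by (simp add: diff_divide_distrib)
  qed
  have "\<exists>u. C2c u \<and> pint p (\<lambda>z. heat_op e e0 K lam u z + f z)
    \<le> ennreal (2 powr p) * (ennreal ((1 / lam) powr p) * pint p (\<lambda>z. heat_op e e0 K lam f z + lam * f z - ((\<Sum>k\<in>UNIV. w k * f (z + v k)) - W * f z)) + ennreal e1)"
    by (rule neumann_approximation[where w = w and v = v and W = W, OF heat_op_operator[OF p0] heat_op_shift finite UNIV_not_empty w0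
          W_def[symmetric] W0 p lam f(1) e1])
  then obtain u where u: "C2c u" "pint p (\<lambda>z. heat_op e e0 K lam u z + f z)
    \<le> ennreal (2 powr p) * (ennreal ((1 / lam) powr p) * pint p (\<lambda>z. heat_op e e0 K lam f z + lam * f z - ((\<Sum>k\<in>UNIV. w k * f (z + v k)) - W * f z)) + ennreal e1)"
    by blast
  have "pint p (\<lambda>z. heat_op e e0 K lam u z + f z) \<le> ennreal q * (ennreal L * ennreal (e1 / L) + ennreal e1)"
    using h(2) unfolding q_def L_def
    by (intro order.trans[OF u(2)] mult_left_mono add_mono) (auto simp: E less_imp_le)
  also have "ennreal L * ennreal (e1 / L) = ennreal e1"
    using e1 L0 by (simp add: ennreal_mult[symmetric])
  also have "ennreal q * (ennreal e1 + ennreal e1) = ennreal (q * (e1 + e1))"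
    using e1 q0 by (simp add: ennreal_mult[symmetric] ennreal_plus[symmetric] del: ennreal_plus)
  also have "q * (e1 + e1) = e2"
    using q0 by (simp add: e1_def e2_def)
  finally have 1: "pint p (\<lambda>z. heat_op e e0 K lam u z + f z) \<le> ennreal e2" .
  note [measurable] = C2c_measurable(1)[OF f(1)] C2c_operatorD(1)[OF heat_op_operator[OF p0] u(1)]
  have "pint p (\<lambda>z. heat_op e e0 K lam u z - g z) = pint p (\<lambda>z. (heat_op e e0 K lam u z + f z) - (f z - (- g z)))"
    by simp
  also have "\<dots> \<le> ennreal q * (pint p (\<lambda>z. heat_op e e0 K lam u z + f z) + pint p (\<lambda>z. f z - (- g z)))"
    unfolding q_def using p0 by (intro pint_diff) auto
  also have "\<dots> < ennreal q * (ennreal e2 + ennreal e2)"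
  proof (intro ennreal_mult_strict_left_mono)
    show "pint p (\<lambda>z. heat_op e e0 K lam u z + f z) + pint p (\<lambda>z. f z - (- g z)) < ennreal e2 + ennreal e2"
      using f(2) by (intro le_less_trans[OF add_right_mono[OF 1]]) (simp add: ennreal_add_left_cancel_less)
  qed (use q0 in auto)
  also have "\<dots> = ennreal \<epsilon>"
    using e2 q0 by (simp add: ennreal_mult[symmetric] ennreal_plus[symmetric] e2_def del: ennreal_plus)
  finally show "\<exists>u. C2c u \<and> pint p (\<lambda>z. heat_op e e0 K lam u z - g z) < ennreal \<epsilon>" using u(1) by blast
qed

lemma Lp_dense_perturb:
  fixes L0 L1 :: "('a::euclidean_space \<Rightarrow> real) \<Rightarrow> 'a \<Rightarrow> real"
  assumes op: "C2c_operator p L0" "C2c_operator p L1" and d0: "Lp_dense p L0" and p: "1 \<le> p"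
    and kap: "0 \<le> \<kappa>" "\<kappa> \<le> 1 / (8 * 2 powr p * 2 powr p)"
    and le: "\<And>u. C2c u \<Longrightarrow> pint p (\<lambda>z. L1 u z - L0 u z) \<le> ennreal \<kappa> * pint p (L0 u)"
  shows "Lp_dense p L1"
proof -
  define q where "q = 2 powr p"
  have q0: "0 < q" by (simp add: q_def)
  have q1: "1 \<le> q" unfolding q_def using p by (intro ge_one_powr_ge_zero) auto
  have half: "\<exists>u. C2c u \<and> pint p (\<lambda>z. L1 u z - f z) \<le> ennreal (1 / 2) * pint p f"
    if fm [measurable]: "f \<in> borel_measurable borel" and f: "pint p f < \<infinity>" for f
  proof (cases "pint p f = 0")
    case True
    then show ?thesis
      using C2c_operator_zero[OF op(2)] by (intro exI[of _ "\<lambda>_. 0"]) simp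
  next
    case False
    obtain F where F: "pint p f = ennreal F" "0 \<le> F" using f by (cases "pint p f") auto
    with False have F0: "0 < F" by auto
    have e0: "0 < F / (4 * q)" using F0 q0 by simp
    obtain u where u: "C2c u" "pint p (\<lambda>z. L0 u z - f z) < ennreal (F / (4 * q))"
      using d0 f e0 fm unfolding Lp_dense_def by blast
    note [measurable] = C2c_operatorD(1)[OF op(1) u(1)] C2c_operatorD(1)[OF op(2) u(1)]
    have "pint p (L0 u) = pint p (\<lambda>z. (L0 u z - f z) + f z)" by simp
    also have "\<dots> \<le> ennreal q * (pint p (\<lambda>z. L0 u z - f z) + pint p f)"
      unfolding q_def using p by (intro pint_add) auto
    also have "\<dots> \<le> ennreal q * (ennreal F + ennreal F)"
    proof (intro mult_left_mono add_mono)
      have "F / (4 * q) \<le> F" using F0 q1 by (simp add: field_simps)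
      then show "pint p (\<lambda>z. L0 u z - f z) \<le> ennreal F"
        using u(2) by (meson ennreal_leI less_imp_le order.trans)
    qed (use F in auto)
    also have "\<dots> = ennreal (2 * q * F)"
      using F q0 by (simp add: ennreal_mult[symmetric] ennreal_plus[symmetric] algebra_simps del: ennreal_plus)
    finally have L0u: "pint p (L0 u) \<le> ennreal (2 * q * F)" .
    have "pint p (\<lambda>z. L1 u z - f z) = pint p (\<lambda>z. (L1 u z - L0 u z) + (L0 u z - f z))" by simp
    also have "\<dots> \<le> ennreal q * (pint p (\<lambda>z. L1 u z - L0 u z) + pint p (\<lambda>z. L0 u z - f z))"
      unfolding q_def using p by (intro pint_add) auto
    also have "\<dots> \<le> ennreal q * (ennreal \<kappa> * ennreal (2 * q * F) + ennreal (F / (4 * q)))"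
      using L0u u(2) by (intro mult_left_mono add_mono order.trans[OF le[OF u(1)]]) auto
    also have "\<dots> = ennreal (q * (\<kappa> * (2 * q * F) + F / (4 * q)))"
      using F q0 kap by (simp add: ennreal_mult[symmetric] ennreal_plus[symmetric] del: ennreal_plus)
    also have "\<dots> \<le> ennreal (1 / 2 * F)"
    proof (rule ennreal_leI)
      have "\<kappa> * (8 * q * q) \<le> 1" using kap(2) q0 unfolding q_def[symmetric] by (simp add: field_simps)
      then have "(\<kappa> * (8 * q * q)) * F \<le> 1 * F" using F by (intro mult_right_mono) auto
      moreover have "q * (\<kappa> * (2 * q * F) + F / (4 * q)) = (\<kappa> * (8 * q * q)) * F / 4 + F / 4"
        using q0 by (simp add: field_simps)
      ultimately show "q * (\<kappa> * (2 * q * F) + F / (4 * q)) \<le> 1 / 2 * F"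
        by linarith
    qed
    also have "\<dots> = ennreal (1 / 2) * pint p f" using F by (simp only: ennreal_mult)
    finally show ?thesis using u(1) by blast
  qed
  have iter: "\<exists>u. C2c u \<and> pint p (\<lambda>z. L1 u z - f z) \<le> ennreal ((1 / 2) ^ n) * pint p f"
    if f: "f \<in> borel_measurable borel" "pint p f < \<infinity>" for f n
  proof (induction n)
    case 0
    show ?case using C2c_operator_zero[OF op(2)] by (intro exI[of _ "\<lambda>_. 0"]) simp
  next
    case (Suc n)
    then obtain u where u: "C2c u" "pint p (\<lambda>z. L1 u z - f z) \<le> ennreal ((1 / 2) ^ n) * pint p f" by blast
    define g where "g z = f z - L1 u z" for z
    have g: "g \<in> borel_measurable borel" unfolding g_def using C2c_operatorD(1)[OF op(2) u(1)] f by measurable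
    have gl: "pint p g \<le> ennreal ((1 / 2) ^ n) * pint p f"
      using u(2) by (simp add: g_def[abs_def] pint_minus)
    have "pint p g < \<infinity>" using f(2) by (intro le_less_trans[OF gl]) (simp add: ennreal_mult_less_top)
    from half[OF g this] obtain v where v: "C2c v" "pint p (\<lambda>z. L1 v z - g z) \<le> ennreal (1 / 2) * pint p g" by blast
    have "pint p (\<lambda>z. L1 (\<lambda>z. u z + v z) z - f z) = pint p (\<lambda>z. L1 v z - g z)"
      using C2c_operatorD(3)[OF op(2) u(1) v(1)] by (simp add: g_def algebra_simps)
    also have "\<dots> \<le> ennreal (1 / 2) * (ennreal ((1 / 2) ^ n) * pint p f)"
      using v(2) gl by (meson mult_left_mono order.trans zero_le)
    also have "\<dots> = ennreal ((1 / 2) ^ Suc n) * pint p f"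
    proof -
      have "ennreal ((1 / 2) ^ Suc n) = ennreal (1 / 2) * ennreal ((1 / 2) ^ n)"
        unfolding power_Suc by (rule ennreal_mult) auto
      then show ?thesis by (simp only: mult.assoc)
    qed
    finally show ?case using C2c_add[OF u(1) v(1)] by blast
  qed
  show ?thesis
    unfolding Lp_dense_def
  proof (intro allI impI)
    fix f :: "'a \<Rightarrow> real" and \<epsilon> :: real
    assume f: "f \<in> borel_measurable borel" "pint p f < \<infinity>" and eps: "0 < \<epsilon>"
    obtain F where F: "pint p f = ennreal F" "0 \<le> F" using f by (cases "pint p f") auto
    have "(\<lambda>n. (1 / 2) ^ n * F) \<longlonglongrightarrow> 0 * F"
      by (intro tendsto_mult LIMSEQ_power_zero tendsto_const) auto
    then have "\<forall>\<^sub>F n in sequentially. (1 / 2) ^ n * F < \<epsilon>"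
      using eps by (intro order_tendstoD(2)) auto
    then obtain n where n: "(1 / 2) ^ n * F < \<epsilon>" using eventually_happens by force
    obtain u where u: "C2c u" "pint p (\<lambda>z. L1 u z - f z) \<le> ennreal ((1 / 2) ^ n) * pint p f"
      using iter[OF f] by blast
    note u(2)
    also have "ennreal ((1 / 2) ^ n) * pint p f = ennreal ((1 / 2) ^ n * F)" using F by (simp add: ennreal_mult[symmetric])
    also have "\<dots> < ennreal \<epsilon>" using n F by (intro ennreal_lessI) (auto simp: eps)
    finally show "\<exists>u. C2c u \<and> pint p (\<lambda>z. L1 u z - f z) < ennreal \<epsilon>" using u(1) by blast
  qed
qed

section \<open>Interpolation of first derivatives between u and its second derivatives\<close>

lemma jensen_unit_interval:
  fixes g :: "real \<Rightarrow> real"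
  assumes g: "continuous_on UNIV g" "\<And>s. 0 \<le> g s" and p: "1 < p"
  shows "ennreal ((integral {0..1} g) powr p) \<le> (\<integral>\<^sup>+s\<in>{0..1}. ennreal (g s powr p) \<partial>lborel)"
proof -
  define m where "m = integral {0..1} g"
  have c: "continuous_on {0..1} g" using g(1) by (rule continuous_on_subset) auto
  have cp: "continuous_on {0..1} (\<lambda>s. g s powr p)"
    using g(2) p by (intro continuous_on_powr' c continuous_intros) auto
  have int: "g integrable_on {0..1}" "(\<lambda>s. g s powr p) integrable_on {0..1}"
    by (rule integrable_continuous_real[OF c], rule integrable_continuous_real[OF cp])
  have m0: "0 \<le> m" unfolding m_def using int g(2) by (intro integral_nonneg) auto
  have key: "m powr p \<le> integral {0..1} (\<lambda>s. g s powr p)"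
  proof (cases "m = 0")
    case True
    then show ?thesis using p g(2) int by (auto intro!: integral_nonneg)
  next
    case False
    with m0 have m0: "0 < m" by simp
    define r where "r = p / (p - 1)"
    have r: "0 < r" "1 / p + 1 / r = 1" "1 < r" using p by (auto simp: r_def field_simps)
    have pr: "(m powr (p - 1)) powr r = m powr p" using p by (simp add: powr_powr r_def)
    \<comment> \<open>Young's inequality with m^(p-1) as second factor: after integration the
      left-hand side is m^p, and m^p / r is absorbed, leaving m^p / p.\<close>
    have young: "g s * m powr (p - 1) \<le> g s powr p / p + m powr p / r" for s
      using Youngs_inequality[of p r "g s" "m powr (p - 1)"] p r g(2)[of s] pr by simp
    have "m * m powr (p - 1) = integral {0..1} (\<lambda>s. g s * m powr (p - 1))"
      unfolding m_def by (rule integral_mult_left[symmetric])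
    also have "\<dots> \<le> integral {0..1} (\<lambda>s. g s powr p / p + m powr p / r)"
      using int young by (intro integral_le integrable_add integrable_on_divide integrable_on_mult_left) auto
    also have "\<dots> = integral {0..1} (\<lambda>s. g s powr p) / p + m powr p / r"
      using int by (subst Henstock_Kurzweil_Integration.integral_add) (auto intro!: integrable_on_divide)
    also have "m * m powr (p - 1) = m powr p" using m0 p by (simp add: powr_diff)
    finally have "m powr p \<le> integral {0..1} (\<lambda>s. g s powr p) / p + m powr p / r" .
    moreover have "m powr p / r = m powr p - m powr p / p"
    proof -
      have "1 / r = 1 - 1 / p" using r(2) by linarith
      then have "m powr p * (1 / r) = m powr p * (1 - 1 / p)" by (rule arg_cong)
      then show ?thesis by (simp add: right_diff_distrib)
    qed
    ultimately have "m powr p / p \<le> integral {0..1} (\<lambda>s. g s powr p) / p" by linarith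
    then show ?thesis using p by (simp add: divide_le_cancel)
  qed
  show ?thesis
  proof (cases "(\<integral>\<^sup>+s\<in>{0..1}. ennreal (g s powr p) \<partial>lborel) < \<infinity>")
    case True
    have "(\<integral>\<^sup>+s\<in>{0..1}. ennreal (g s powr p) \<partial>lborel) = ennreal (integral {0..1} (\<lambda>s. g s powr p))"
      using True borel_measurable_continuous_onI[OF g(1)]
      by (intro set_nn_integral_lborel_eq_integral) (auto simp: set_borel_measurable_def)
    then show ?thesis using key by (simp add: m_def ennreal_leI)
  qed (simp add: top_unique not_less)
qed

text \<open>The difference over the step e is the derivative at some point of the segment, and the
  derivative at z differs from that value by at most the integral of the second derivative. There is
  no small parameter, since only boundedness is wanted.\<close>

lemma dd_interpolation_pointwise:
  assumes u: "C2 u"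
  shows "\<bar>dd e u z\<bar> \<le> \<bar>u (z + e)\<bar> + \<bar>u z\<bar> + integral {0..1} (\<lambda>s. \<bar>dd e (dd e u) (z + s *\<^sub>R e)\<bar>)"
proof -
  have C: "C1 u" "C1 (dd e u)" using u C2_C1 C2_C1_dd by auto
  have c: "continuous_on UNIV (\<lambda>s. dd e (dd e u) (z + s *\<^sub>R e))"
    by (rule continuous_on_compose2[OF C1_dd_continuous[OF C(2)]]) (auto intro!: continuous_intros)
  have "\<exists>s. 0 < s \<and> s < 1 \<and> u (z + 1 *\<^sub>R e) - u (z + 0 *\<^sub>R e) = (1 - 0) * dd e u (z + s *\<^sub>R e)"
    by (intro MVT2 dd_line C) auto
  then obtain t where t: "0 < t" "t < 1" "u (z + e) - u z = dd e u (z + t *\<^sub>R e)" by auto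
  have "((\<lambda>s. dd e (dd e u) (z + s *\<^sub>R e)) has_integral (dd e u (z + t *\<^sub>R e) - dd e u (z + 0 *\<^sub>R e))) {0..t}"
    using t dd_line[OF C(2)]
    by (intro fundamental_theorem_of_calculus) (auto simp: has_real_derivative_iff_has_vector_derivative[symmetric] intro: has_field_derivative_at_within)
  then have "dd e u (z + t *\<^sub>R e) - dd e u z = integral {0..t} (\<lambda>s. dd e (dd e u) (z + s *\<^sub>R e))"
    by (simp add: integral_unique)
  also have "\<bar>\<dots>\<bar> \<le> integral {0..t} (\<lambda>s. \<bar>dd e (dd e u) (z + s *\<^sub>R e)\<bar>)"
  proof -
    have "continuous_on {0..t} (\<lambda>s. dd e (dd e u) (z + s *\<^sub>R e))" using c by (rule continuous_on_subset) simp
    then have "norm (integral {0..t} (\<lambda>s. dd e (dd e u) (z + s *\<^sub>R e))) \<le> integral {0..t} (\<lambda>s. \<bar>dd e (dd e u) (z + s *\<^sub>R e)\<bar>)"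
      by (intro integral_norm_bound_integral integrable_continuous_real continuous_on_rabs) auto
    then show ?thesis by simp
  qed
  also have "\<dots> \<le> integral {0..1} (\<lambda>s. \<bar>dd e (dd e u) (z + s *\<^sub>R e)\<bar>)"
    using t by (intro integral_subset_le integrable_continuous_real continuous_on_rabs continuous_on_subset[OF c]) auto
  finally show ?thesis using t(3) by linarith
qed

text \<open>Supplies the bound on first derivatives, which the a priori estimate, stated for u and
  D2u, does not contain. The integral term is handled by Jensen on [0,1] and then by Tonelli and
  translation invariance.\<close>

lemma dd_interpolation:
  fixes u :: "'a::euclidean_space \<Rightarrow> real"
  assumes u: "C2c u" and p: "1 < p"
  shows "pint p (dd e u) \<le> ennreal (2 powr p * 2 powr p * 2) * (pint p u + pint p (dd e (dd e u)))"
proof -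
  note [measurable] = C2c_measurable[OF u]
  define J where "J z = integral {0..1} (\<lambda>s. \<bar>dd e (dd e u) (z + s *\<^sub>R e)\<bar>)" for z
  define q where "q = 2 powr p"
  have cont: "continuous_on UNIV (dd e (dd e u))" using C2c_dd2_Cc[OF u] by (auto simp: Cc_def)
  have J0: "0 \<le> J z" for z
    unfolding J_def by (intro integral_nonneg integrable_continuous_real continuous_intros continuous_on_compose2[OF cont]) auto
  have le: "ennreal (norm (dd e u z) powr p)
      \<le> ennreal q * (ennreal q * (ennreal (norm (u (z + e)) powr p) + ennreal (norm (u z) powr p))
         + (\<integral>\<^sup>+s\<in>{0..1}. ennreal (norm (dd e (dd e u) (z + s *\<^sub>R e)) powr p) \<partial>lborel))" for z
  proof -
    have "\<bar>dd e u z\<bar> powr p \<le> ((\<bar>u (z + e)\<bar> + \<bar>u z\<bar>) + J z) powr p"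
      using dd_interpolation_pointwise[of u e z] u p by (intro powr_mono2) (auto simp: C2c_def J_def)
    also have "\<dots> \<le> q * ((\<bar>u (z + e)\<bar> + \<bar>u z\<bar>) powr p + J z powr p)"
      unfolding q_def using J0 p by (intro powr_add_le) auto
    also have "\<dots> \<le> q * (q * (\<bar>u (z + e)\<bar> powr p + \<bar>u z\<bar> powr p) + J z powr p)"
      unfolding q_def using p by (intro mult_left_mono add_mono powr_add_le) auto
    finally have "ennreal (norm (dd e u z) powr p)
        \<le> ennreal q * (ennreal q * (ennreal (norm (u (z + e)) powr p) + ennreal (norm (u z) powr p)) + ennreal (J z powr p))"
      by (simp add: q_def ennreal_mult[symmetric] ennreal_plus[symmetric] ennreal_leI del: ennreal_plus)
    also have "ennreal (J z powr p) \<le> (\<integral>\<^sup>+s\<in>{0..1}. ennreal (\<bar>dd e (dd e u) (z + s *\<^sub>R e)\<bar> powr p) \<partial>lborel)"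
      unfolding J_def using p
      by (intro jensen_unit_interval continuous_intros continuous_on_compose2[OF cont]) auto
    finally show ?thesis by (simp add: mult_left_mono add_left_mono)
  qed
  have [measurable]: "(\<lambda>(z, s). dd e (dd e u) (z + s *\<^sub>R e)) \<in> borel_measurable (borel \<Otimes>\<^sub>M borel)"
    by measurable
  have tonelli: "(\<integral>\<^sup>+z. (\<integral>\<^sup>+s\<in>{0..1::real}. ennreal (norm (dd e (dd e u) (z + s *\<^sub>R e)) powr p) \<partial>lborel) \<partial>lborel)
     = pint p (dd e (dd e u))"
  proof -
    have "(\<integral>\<^sup>+z. (\<integral>\<^sup>+s\<in>{0..1::real}. ennreal (norm (dd e (dd e u) (z + s *\<^sub>R e)) powr p) \<partial>lborel) \<partial>lborel)
       = (\<integral>\<^sup>+s. (\<integral>\<^sup>+z. ennreal (norm (dd e (dd e u) (z + s *\<^sub>R e)) powr p) * indicator {0..1} s \<partial>lborel) \<partial>(lborel::real measure))"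
      by (intro lborel_pair.Fubini') simp
    also have "\<dots> = (\<integral>\<^sup>+s. pint p (dd e (dd e u)) * indicator {0..1} s \<partial>(lborel::real measure))"
    proof (intro nn_integral_cong)
      fix s :: real
      show "(\<integral>\<^sup>+z. ennreal (norm (dd e (dd e u) (z + s *\<^sub>R e)) powr p) * indicator {0..1} s \<partial>lborel) = pint p (dd e (dd e u)) * indicator {0..1} s"
        using pint_shift[of "dd e (dd e u)" p "s *\<^sub>R e"] by (subst nn_integral_multc) (simp_all add: pint_def)
    qed
    also have "\<dots> = pint p (dd e (dd e u))" by (subst nn_integral_cmult_indicator) auto
    finally show ?thesis .
  qed
  have "pint p (dd e u) \<le> (\<integral>\<^sup>+z. ennreal q * (ennreal q * (ennreal (norm (u (z + e)) powr p) + ennreal (norm (u z) powr p))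
         + (\<integral>\<^sup>+s\<in>{0..1}. ennreal (norm (dd e (dd e u) (z + s *\<^sub>R e)) powr p) \<partial>lborel)) \<partial>lborel)"
    unfolding pint_def by (intro nn_integral_mono le)
  also have "\<dots> = ennreal q * (ennreal q * (pint p (\<lambda>z. u (z + e)) + pint p u) + pint p (dd e (dd e u)))"
    unfolding pint_def tonelli[unfolded pint_def, symmetric]
    by (simp add: nn_integral_cmult nn_integral_add)
  also have "\<dots> = ennreal (q * q * 2) * pint p u + ennreal q * pint p (dd e (dd e u))"
  proof -
    have alg: "x * (x * (y + y) + w) = x * x * 2 * y + x * w" for x y w :: ennreal
      unfolding mult_2[symmetric] distrib_left by (simp only: mult_ac)
    have "pint p (\<lambda>z. u (z + e)) = pint p u" by (rule pint_shift) simp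
    moreover have "ennreal (q * q * 2) = ennreal q * ennreal q * 2" by (simp add: q_def ennreal_mult)
    ultimately show ?thesis by (simp only: alg)
  qed
  also have "\<dots> \<le> ennreal (q * q * 2) * (pint p u + pint p (dd e (dd e u)))"
  proof -
    have "1 \<le> q" unfolding q_def using p by (intro ge_one_powr_ge_zero) auto
    then have "q * 1 \<le> q * (q * 2)" by (intro mult_left_mono) auto
    then show ?thesis
      unfolding distrib_left by (intro add_mono mult_right_mono ennreal_leI) (auto simp: q_def)
  qed
  finally show ?thesis by (simp add: q_def)
qed

subsection \<open>Weak derivatives as limits\<close>

definition gradx :: "('n::finite pt \<Rightarrow> real) \<Rightarrow> 'n pt \<Rightarrow> real ^ 'n" where
  "gradx u z = (\<chi> i. dd (e_x i) u z)"

text \<open>The order of differentiation follows \<open>W2p\<close>, where the entry i j of D2u is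
  the weak derivative of Du $ i in direction j.\<close>

definition hessx :: "('n::finite pt \<Rightarrow> real) \<Rightarrow> 'n pt \<Rightarrow> real ^ 'n ^ 'n" where
  "hessx u z = (\<chi> i j. dd (e_x j) (dd (e_x i) u) z)"

definition opL :: "('n::finite pt \<Rightarrow> real ^ 'n ^ 'n) \<Rightarrow> ('n pt \<Rightarrow> real ^ 'n) \<Rightarrow> ('n pt \<Rightarrow> real) \<Rightarrow> real
    \<Rightarrow> ('n pt \<Rightarrow> real) \<Rightarrow> 'n pt \<Rightarrow> real" where
  "opL a b c lam u z = Lop a b c u (gradx u) (hessx u) z + dd e_t u z - lam * u z"

text \<open>The L_1 seminorm on a ball about the origin of space-time. The drift term is summable
  only locally, so this is the mode of convergence in which the equation passes to the
  limit.\<close>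

definition lint :: "real \<Rightarrow> ('a::euclidean_space \<Rightarrow> 'b::real_normed_vector) \<Rightarrow> ennreal" where
  "lint R f = (\<integral>\<^sup>+z\<in>cball 0 R. ennreal (norm (f z)) \<partial>lborel)"

lemma cball_borel_measurable [measurable]: "cball (x::'a::euclidean_space) R \<in> sets borel"
  "ball (x::'a::euclidean_space) R \<in> sets borel"
  by simp_all

lemma lint_mono: "(\<And>z. norm (f z) \<le> norm (g z)) \<Longrightarrow> lint R f \<le> lint R g"
  unfolding lint_def by (intro nn_integral_mono mult_right_mono ennreal_leI) auto

lemma lint_add:
  fixes f g :: "'a::euclidean_space \<Rightarrow> 'b::euclidean_space"
  assumes [measurable]: "f \<in> borel_measurable borel" "g \<in> borel_measurable borel"
  shows "lint R (\<lambda>z. f z + g z) \<le> lint R f + lint R g"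
proof -
  have "lint R (\<lambda>z. f z + g z) \<le> (\<integral>\<^sup>+z. ennreal (norm (f z)) * indicator (cball 0 R) z + ennreal (norm (g z)) * indicator (cball 0 R) z \<partial>lborel)"
    unfolding lint_def
  proof (intro nn_integral_mono)
    fix z
    show "ennreal (norm (f z + g z)) * indicator (cball 0 R) z
       \<le> ennreal (norm (f z)) * indicator (cball 0 R) z + ennreal (norm (g z)) * indicator (cball 0 R) z"
      unfolding distrib_right[symmetric]
      by (intro mult_right_mono) (auto simp: ennreal_plus[symmetric] norm_triangle_ineq ennreal_leI simp del: ennreal_plus)
  qed
  also have "\<dots> = lint R f + lint R g"
    unfolding lint_def by (intro nn_integral_add) auto
  finally show ?thesis .
qed

lemma lint_cmult:
  fixes f :: "'a::euclidean_space \<Rightarrow> real"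
  assumes [measurable]: "f \<in> borel_measurable borel"
  shows "lint R (\<lambda>z. c * f z) = ennreal \<bar>c\<bar> * lint R f"
  unfolding lint_def by (simp add: abs_mult ennreal_mult mult.assoc nn_integral_cmult)

lemma lint_minus: "lint R (\<lambda>z. f z - g z) = lint R (\<lambda>z. g z - f z)"
  by (simp add: lint_def norm_minus_commute)

text \<open>Where |f| \<le> \<eta> use \<eta>, elsewhere |f| \<le> \<eta>^(1-p) |f|^p. The free
  parameter \<eta> does the work of Hoelder's inequality without roots.\<close>

lemma lint_le_pint:
  fixes f :: "'a::euclidean_space \<Rightarrow> 'b::euclidean_space"
  assumes [measurable]: "f \<in> borel_measurable borel" and "0 < \<eta>" "1 \<le> p"
  shows "lint R f \<le> ennreal \<eta> * emeasure lborel (cball (0::'a) R) + ennreal (\<eta> powr (1 - p)) * pint p f"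
proof -
  have "lint R f \<le> (\<integral>\<^sup>+z. ennreal \<eta> * indicator (cball 0 R) z + ennreal (\<eta> powr (1 - p)) * ennreal (norm (f z) powr p) \<partial>lborel)"
    unfolding lint_def
  proof (intro nn_integral_mono)
    fix z
    have "norm (f z) \<le> \<eta> + \<eta> powr (1 - p) * norm (f z) powr p"
    proof (cases "norm (f z) \<le> \<eta>")
      case False
      have "norm (f z) = norm (f z) powr (1 - p) * norm (f z) powr p"
        using False assms(2) by (simp add: powr_add[symmetric])
      also have "\<dots> \<le> \<eta> powr (1 - p) * norm (f z) powr p"
        using False assms by (intro mult_right_mono powr_mono2') auto
      finally show ?thesis using assms(2) by linarith
    qed (auto simp: add_increasing2)
    then show "ennreal (norm (f z)) * indicator (cball 0 R) z \<le> ennreal \<eta> * indicator (cball 0 R) z + ennreal (\<eta> powr (1 - p)) * ennreal (norm (f z) powr p)"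
      using assms(2) by (auto simp: indicator_def ennreal_mult[symmetric] ennreal_plus[symmetric] simp del: ennreal_plus intro!: ennreal_leI)
  qed
  also have "\<dots> = ennreal \<eta> * emeasure lborel (cball (0::'a) R) + ennreal (\<eta> powr (1 - p)) * pint p f"
    by (simp add: nn_integral_add nn_integral_cmult nn_integral_cmult_indicator pint_def)
  finally show ?thesis .
qed

lemma lint_finite_pint:
  fixes f :: "'a::euclidean_space \<Rightarrow> 'b::euclidean_space"
  assumes "f \<in> borel_measurable borel" "1 \<le> p" "pint p f < \<infinity>"
  shows "lint R f < \<infinity>"
proof -
  have "lint R f \<le> ennreal 1 * emeasure lborel (cball (0::'a) R) + ennreal (1 powr (1 - p)) * pint p f"
    using assms by (intro lint_le_pint) auto
  also have "\<dots> < \<infinity>" using emeasure_lborel_cball_finite[of "0::'a" R] assms(3) by simp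
  finally show ?thesis .
qed

lemma lint_tendsto_pint:
  fixes f :: "nat \<Rightarrow> 'a::euclidean_space \<Rightarrow> 'b::euclidean_space"
  assumes [measurable]: "\<And>n. f n \<in> borel_measurable borel" and "1 \<le> p" "(\<lambda>n. pint p (f n)) \<longlonglongrightarrow> 0"
  shows "(\<lambda>n. lint R (f n)) \<longlonglongrightarrow> 0"
proof (rule order_tendstoI)
  fix e :: ennreal assume e: "0 < e"
  obtain \<epsilon> where eps: "0 < \<epsilon>" "ennreal \<epsilon> \<le> e"
  proof (cases e)
    case (real r)
    then show ?thesis using that[of r] e by auto
  next
    case top
    then show ?thesis using that[of 1] by auto
  qed
  obtain V where V: "emeasure lborel (cball (0::'a) R) = ennreal V" "0 \<le> V"
    using emeasure_lborel_cball_finite[of "0::'a" R] by (cases "emeasure lborel (cball (0::'a) R)") auto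
  \<comment> \<open>This makes \<eta> V less than \<epsilon>/2; the other half of \<epsilon> is left
    for the term with \<open>pint\<close>.\<close>
  define \<eta> where "\<eta> = \<epsilon> / (2 * (V + 1))"
  have eta: "0 < \<eta>" using eps V by (simp add: \<eta>_def)
  define c where "c = \<eta> powr (1 - p)"
  have c: "0 < c" using eta by (simp add: c_def)
  have "\<forall>\<^sub>F n in sequentially. pint p (f n) < ennreal (\<epsilon> / (2 * c))"
    using assms(3) eps c by (intro order_tendstoD(2)) auto
  then show "\<forall>\<^sub>F n in sequentially. lint R (f n) < e"
  proof eventually_elim
    case (elim n)
    have "lint R (f n) \<le> ennreal \<eta> * ennreal V + ennreal c * pint p (f n)"
      using lint_le_pint[of "f n" \<eta> p R] eta assms(2) V by (simp add: c_def)
    also have "\<dots> \<le> ennreal \<eta> * ennreal V + ennreal c * ennreal (\<epsilon> / (2 * c))"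
      using elim by (intro add_mono mult_left_mono) auto
    also have "\<dots> = ennreal (\<eta> * V + \<epsilon> / 2)"
      using eta V c eps by (simp add: ennreal_mult[symmetric] ennreal_plus[symmetric] del: ennreal_plus)
    also have "\<dots> < ennreal \<epsilon>"
    proof (rule ennreal_lessI)
      show "\<eta> * V + \<epsilon> / 2 < \<epsilon>" using eps V by (simp add: \<eta>_def field_simps)
    qed (use eps in simp)
    finally show ?case using eps(2) by (rule less_le_trans)
  qed
qed auto

lemma lint_pairing:
  fixes f :: "nat \<Rightarrow> 'a::euclidean_space \<Rightarrow> real"
  assumes [measurable]: "\<And>n. f n \<in> borel_measurable borel" "g \<in> borel_measurable borel"
    and fin: "\<And>R. lint R g < \<infinity>" "\<And>n R. lint R (f n) < \<infinity>"
    and lim: "\<And>R. (\<lambda>n. lint R (\<lambda>z. f n z - g z)) \<longlonglongrightarrow> 0" and psi: "Cc \<psi>"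
  shows "(\<lambda>n. \<integral>z. f n z * \<psi> z \<partial>lborel) \<longlonglongrightarrow> (\<integral>z. g z * \<psi> z \<partial>lborel)"
    "integrable lborel (\<lambda>z. g z * \<psi> z)"
proof -
  obtain R where R: "R > 0" "\<And>z. R \<le> norm z \<Longrightarrow> \<psi> z = 0" using psi by (auto simp: Cc_def bsupp_def)
  obtain B where B: "0 < B" "\<And>z. \<bar>\<psi> z\<bar> \<le> B" by (rule Cc_bounded[OF psi]) auto
  note [measurable] = Cc_measurable[OF psi]
  have bd: "(\<integral>\<^sup>+z. ennreal (norm (h z * \<psi> z)) \<partial>lborel) \<le> ennreal B * lint R h"
    if [measurable]: "h \<in> borel_measurable borel" for h :: "'a \<Rightarrow> real"
  proof -
    have "(\<integral>\<^sup>+z. ennreal (norm (h z * \<psi> z)) \<partial>lborel) \<le> (\<integral>\<^sup>+z. ennreal B * (ennreal (norm (h z)) * indicator (cball 0 R) z) \<partial>lborel)"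
    proof (intro nn_integral_mono)
      fix z
      have "\<bar>h z\<bar> * \<bar>\<psi> z\<bar> \<le> B * \<bar>h z\<bar>" using B(2)[of z] mult_right_mono[of "\<bar>\<psi> z\<bar>" B "\<bar>h z\<bar>"] by (simp add: mult.commute)
      then show "ennreal (norm (h z * \<psi> z)) \<le> ennreal B * (ennreal (norm (h z)) * indicator (cball 0 R) z)"
        using R(2)[of z] B(1) by (cases "norm z \<le> R") (auto simp: abs_mult ennreal_mult[symmetric] intro!: ennreal_leI)
    qed
    then show ?thesis by (simp add: lint_def nn_integral_cmult)
  qed
  have int: "integrable lborel (\<lambda>z. h z * \<psi> z)" if [measurable]: "h \<in> borel_measurable borel" and "lint R h < \<infinity>" for h :: "'a \<Rightarrow> real"
    unfolding integrable_iff_bounded using le_less_trans[OF bd[OF that(1)]] that(2) by (auto simp: ennreal_mult_less_top)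
  show "integrable lborel (\<lambda>z. g z * \<psi> z)" using int fin by simp
  have le: "ennreal \<bar>(\<integral>z. f n z * \<psi> z \<partial>lborel) - (\<integral>z. g z * \<psi> z \<partial>lborel)\<bar> \<le> ennreal B * lint R (\<lambda>z. f n z - g z)" for n
  proof -
    have "(\<integral>z. f n z * \<psi> z \<partial>lborel) - (\<integral>z. g z * \<psi> z \<partial>lborel) = (\<integral>z. (f n z - g z) * \<psi> z \<partial>lborel)"
      using int[of "f n"] int[of g] fin by (subst Bochner_Integration.integral_diff[symmetric]) (auto simp: algebra_simps)
    moreover have "integrable lborel (\<lambda>z. (f n z - g z) * \<psi> z)"
      using int[of "f n"] int[of g] fin by (simp add: left_diff_distrib)
    from integral_norm_bound_ennreal[OF this] have "ennreal \<bar>\<integral>z. (f n z - g z) * \<psi> z \<partial>lborel\<bar> \<le> (\<integral>\<^sup>+z. ennreal (norm ((f n z - g z) * \<psi> z)) \<partial>lborel)"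
      by simp
    ultimately show ?thesis using bd[of "\<lambda>z. f n z - g z"] by (auto intro: order.trans)
  qed
  have "(\<lambda>n. ennreal B * lint R (\<lambda>z. f n z - g z)) \<longlonglongrightarrow> ennreal B * 0"
    by (rule ennreal_tendsto_cmult[OF _ lim]) simp
  then have lim0: "(\<lambda>n. ennreal B * lint R (\<lambda>z. f n z - g z)) \<longlonglongrightarrow> 0" by simp
  have "(\<lambda>n. ennreal \<bar>(\<integral>z. f n z * \<psi> z \<partial>lborel) - (\<integral>z. g z * \<psi> z \<partial>lborel)\<bar>) \<longlonglongrightarrow> 0"
    by (rule tendsto_sandwich[OF always_eventually[rule_format] always_eventually[rule_format] tendsto_const lim0])
      (use le in simp_all)
  then have "(\<lambda>n. \<bar>(\<integral>z. f n z * \<psi> z \<partial>lborel) - (\<integral>z. g z * \<psi> z \<partial>lborel)\<bar>) \<longlonglongrightarrow> 0"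
    by (subst (asm) ennreal_0[symmetric], subst (asm) tendsto_ennreal_iff) auto
  then show "(\<lambda>n. \<integral>z. f n z * \<psi> z \<partial>lborel) \<longlonglongrightarrow> (\<integral>z. g z * \<psi> z \<partial>lborel)"
    by (simp add: tendsto_rabs_zero_iff LIM_zero_iff)
qed

lemma lint_set_integrable:
  fixes g :: "'a::euclidean_space \<Rightarrow> real"
  assumes [measurable]: "g \<in> borel_measurable borel" and "lint R g < \<infinity>"
  shows "set_integrable lebesgue (cball 0 R) g"
proof -
  have "integrable lborel (\<lambda>z. indicator (cball 0 R) z *\<^sub>R g z)"
    unfolding integrable_iff_bounded using assms(2)
    by (auto simp: lint_def abs_mult ennreal_mult ennreal_indicator mult.commute)
  then show ?thesis unfolding set_integrable_def by (subst integrable_completion) auto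
qed

lemma lint_loc_integrable:
  fixes g :: "'a::euclidean_space \<Rightarrow> real"
  assumes "g \<in> borel_measurable borel" "\<And>R. lint R g < \<infinity>"
  shows "loc_integrable UNIV g"
  unfolding loc_integrable_def
proof (intro allI impI, elim conjE)
  fix C :: "'a set" assume "compact C"
  then obtain R where "\<forall>z\<in>C. norm z \<le> R" using compact_imp_bounded[of C] unfolding bounded_iff by blast
  then have "C \<subseteq> cball 0 R" by auto
  then show "set_integrable lebesgue C g"
    by (rule set_integrable_subset[OF lint_set_integrable[OF assms(1) assms(2)[of R]], rotated])
      (use lmeasurable_compact[OF \<open>compact C\<close>] in \<open>simp add: fmeasurableD\<close>)
qed

text \<open>The integration by parts for \<open>v n\<close> passes to the limit on both sides,
  because a test function and its derivative are bounded with bounded support. Convergence in L_1 on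
  balls suffices, which is all that will be known for time derivatives.\<close>

lemma weak_deriv_limit:
  fixes u g :: "'a::euclidean_space \<Rightarrow> real"
  assumes un: "\<And>n. C1 (v n)" "\<And>n. bsupp (v n)"
    and [measurable]: "u \<in> borel_measurable borel" "g \<in> borel_measurable borel"
    and limu: "\<And>R. (\<lambda>n. lint R (\<lambda>z. v n z - u z)) \<longlonglongrightarrow> 0"
    and limg: "\<And>R. (\<lambda>n. lint R (\<lambda>z. dd e (v n) z - g z)) \<longlonglongrightarrow> 0"
  shows "weak_deriv UNIV u e g"
proof -
  have Cc: "Cc (v n)" "Cc (dd e (v n))" for n
    using un C1_continuous[OF un(1)] C1_dd_continuous[OF un(1)] bsupp_dd[OF un(2,1)] by (auto simp: Cc_def)
  note [measurable] = Cc_measurable[OF Cc(1)] Cc_measurable[OF Cc(2)]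
  have fv: "lint R (v n) < \<infinity>" "lint R (dd e (v n)) < \<infinity>" for n R
    using Cc_pint_finite[OF Cc(1), of 1] Cc_pint_finite[OF Cc(2), of 1]
    by (auto intro!: lint_finite_pint[where p = 1, simplified])
  have fin: "lint R h < \<infinity>"
    if [measurable]: "h \<in> borel_measurable borel" "\<And>n. w n \<in> borel_measurable borel" and "\<And>n. lint R (w n) < \<infinity>"
      and "(\<lambda>n. lint R (\<lambda>z. w n z - h z)) \<longlonglongrightarrow> 0" for h :: "'a \<Rightarrow> real" and w R
  proof -
    have "\<forall>\<^sub>F n in sequentially. lint R (\<lambda>z. w n z - h z) < 1"
      using that(4) by (intro order_tendstoD(2)) auto
    then obtain n where n: "lint R (\<lambda>z. w n z - h z) < 1" using eventually_happens by force
    have "lint R h = lint R (\<lambda>z. (h z - w n z) + w n z)" by simp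
    also have "\<dots> \<le> lint R (\<lambda>z. h z - w n z) + lint R (w n)" by (intro lint_add) auto
    also have "\<dots> < \<infinity>" using n that(3)[of n] less_trans[of _ 1 "\<infinity>::ennreal"] by (simp add: lint_minus[of R h])
    finally show ?thesis .
  qed
  have fu: "lint R u < \<infinity>" for R by (rule fin[of u v]) (use fv limu in auto)
  have fg: "lint R g < \<infinity>" for R by (rule fin[of g "\<lambda>n. dd e (v n)"]) (use fv limg in auto)
  show ?thesis
    unfolding weak_deriv_def
  proof (intro conjI allI impI lint_loc_integrable fu fg)
    fix \<phi> :: "'a \<Rightarrow> real" assume t: "test_fn UNIV \<phi>"
    note phi = test_fn_C1[OF t]
    have C: "Cc \<phi>" "Cc (dd e \<phi>)" using phi C1_continuous C1_dd_continuous bsupp_dd by (auto simp: Cc_def)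
    note [measurable] = Cc_measurable[OF C(1)] Cc_measurable[OF C(2)]
    have 1: "(\<lambda>n. \<integral>z. v n z * dd e \<phi> z \<partial>lborel) \<longlonglongrightarrow> (\<integral>z. u z * dd e \<phi> z \<partial>lborel)"
      by (rule lint_pairing(1)) (use fu fv limu C in auto)
    have 2: "(\<lambda>n. \<integral>z. dd e (v n) z * \<phi> z \<partial>lborel) \<longlonglongrightarrow> (\<integral>z. g z * \<phi> z \<partial>lborel)"
      by (rule lint_pairing(1)) (use fg fv limg C in auto)
    have "(\<integral>z. v n z * dd e \<phi> z \<partial>lborel) = - (\<integral>z. dd e (v n) z * \<phi> z \<partial>lborel)" for n
      by (rule integration_by_parts[OF un(1) phi])
    with 1 have "(\<lambda>n. - (\<integral>z. dd e (v n) z * \<phi> z \<partial>lborel)) \<longlonglongrightarrow> (\<integral>z. u z * dd e \<phi> z \<partial>lborel)" by simp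
    with tendsto_minus[OF 2] have "(\<integral>z. u z * dd e \<phi> z \<partial>lborel) = - (\<integral>z. g z * \<phi> z \<partial>lborel)"
      using LIMSEQ_unique by blast
    then show "(LINT z:UNIV|lebesgue. u z * frechet_derivative \<phi> (at z) e) = - (LINT z:UNIV|lebesgue. g z * \<phi> z)"
      unfolding set_lebesgue_integral_def dd_def[symmetric] by (simp add: integral_completion)
  qed simp_all
qed

lemma dom_T_MInf [simp]: "dom_T (-\<infinity>) = UNIV" "int_T (-\<infinity>) = UNIV"
  by (auto simp: dom_T_def int_T_def)

lemma in_Lp_borel:
  fixes f :: "'a::euclidean_space \<Rightarrow> 'b::euclidean_space"
  assumes "f \<in> borel_measurable borel" "pint p f < \<infinity>"
  shows "in_Lp p UNIV f"
  using assms by (auto simp: in_Lp_def pint_lebesgue intro: measurable_completion)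

lemma gradx_continuous: "C2c u \<Longrightarrow> continuous_on UNIV (gradx u)"
  unfolding gradx_def[abs_def] using C2c_dd_Cc by (auto simp: Cc_def intro!: continuous_on_vec_lambda)

lemma hessx_continuous: "C2c u \<Longrightarrow> continuous_on UNIV (hessx u)"
  unfolding hessx_def[abs_def] using C2c_dd2_Cc by (auto simp: Cc_def intro!: continuous_on_vec_lambda)

lemma gradx_measurable: "C2c u \<Longrightarrow> gradx u \<in> borel_measurable borel"
  by (rule borel_measurable_continuous_onI[OF gradx_continuous])

lemma hessx_measurable: "C2c u \<Longrightarrow> hessx u \<in> borel_measurable borel"
  by (rule borel_measurable_continuous_onI[OF hessx_continuous])

lemma norm_vec_le_sum: "norm (x :: real ^ 'n) \<le> (\<Sum>i\<in>UNIV. \<bar>x $ i\<bar>)"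
  by (rule norm_le_l1_cart)

lemma norm_mat_le_sum: "norm (x :: real ^ 'n ^ 'n) \<le> (\<Sum>i\<in>UNIV. \<Sum>j\<in>UNIV. \<bar>x $ i $ j\<bar>)"
proof -
  have "norm x \<le> (\<Sum>i\<in>UNIV. norm (x $ i))"
    unfolding norm_vec_def by (rule L2_set_le_sum) simp
  also have "\<dots> \<le> (\<Sum>i\<in>UNIV. \<Sum>j\<in>UNIV. \<bar>x $ i $ j\<bar>)"
    by (intro sum_mono norm_le_l1_cart)
  finally show ?thesis .
qed

lemma mat_component_le: "\<bar>(x :: real ^ 'n ^ 'n) $ i $ j\<bar> \<le> norm x"
  using component_le_norm_cart[of "x $ i" j] Finite_Cartesian_Product.norm_nth_le[of x i] by linarith

lemma pint_vec:
  fixes f :: "'a::euclidean_space \<Rightarrow> real ^ 'n"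
  assumes [measurable]: "\<And>i. (\<lambda>z. f z $ i) \<in> borel_measurable borel" and "0 \<le> p"
  shows "pint p f \<le> ennreal (real CARD('n) powr p) * (\<Sum>i\<in>UNIV. pint p (\<lambda>z. f z $ i))"
proof -
  have "pint p f \<le> pint p (\<lambda>z. \<Sum>i\<in>UNIV. \<bar>f z $ i\<bar>)"
    using assms(2) by (intro pint_mono) (auto simp: sum_nonneg norm_vec_le_sum)
  also have "\<dots> \<le> ennreal (real CARD('n) powr p) * (\<Sum>i\<in>UNIV. pint p (\<lambda>z. \<bar>f z $ i\<bar>))"
    using assms(2) by (intro pint_sum) auto
  finally show ?thesis by (simp add: pint_def)
qed

lemma C2c_grad_finite:
  assumes "C2c u" "0 < p"
  shows "pint p (gradx u) < \<infinity>"
proof -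
  have "pint p (gradx u) \<le> ennreal (real CARD('a) powr p) * (\<Sum>i\<in>UNIV. pint p (\<lambda>z. gradx u z $ i))"
    using assms by (intro pint_vec) (auto simp: gradx_def C2c_measurable)
  also have "\<dots> < \<infinity>"
    using Cc_pint_finite[OF C2c_dd_Cc[OF assms(1)] assms(2)] by (auto simp: ennreal_mult_less_top gradx_def)
  finally show ?thesis .
qed

lemma C2c_hess_finite:
  fixes u :: "'n::finite pt \<Rightarrow> real"
  assumes "C2c u" "0 < p"
  shows "pint p (hessx u) < \<infinity>"
proof -
  note [measurable] = C2c_measurable[OF assms(1)]
  have "pint p (hessx u) \<le> pint p (\<lambda>z. \<Sum>(i, j)\<in>(UNIV :: ('n \<times> 'n) set). \<bar>dd (e_x j) (dd (e_x i) u) z\<bar>)"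
    using assms(2) norm_mat_le_sum[of "hessx u z" for z]
    by (intro pint_mono) (auto simp: hessx_def sum_nonneg sum.cartesian_product intro: order.trans[OF _ abs_ge_self])
  also have "\<dots> \<le> ennreal (real CARD('n \<times> 'n) powr p) * (\<Sum>(i, j)\<in>(UNIV :: ('n \<times> 'n) set). pint p (\<lambda>z. \<bar>dd (e_x j) (dd (e_x i) u) z\<bar>))"
    using assms(2) pint_sum[of UNIV "\<lambda>(i, j) z. \<bar>dd (e_x j) (dd (e_x i) u) z\<bar>" p]
    by (auto simp: case_prod_beta')
  also have "\<dots> < \<infinity>"
    using Cc_pint_finite[OF C2c_dd2_Cc[OF assms(1)] assms(2)]
    by (auto simp: ennreal_mult_less_top pint_def)
  finally show ?thesis .
qed

lemma C2c_W2p: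
  assumes u: "C2c u" and p: "1 \<le> p"
  shows "W2p p (-\<infinity>) u (dd e_t u) (gradx u) (hessx u)"
proof -
  have p0: "0 < p" using p by simp
  have C: "C1 u" "bsupp u" "C1 (dd e u)" "bsupp (dd e u)" for e
    using u C2_C1[of u] C2_C1_dd[of u e] bsupp_dd[of u e] by (auto simp: C2c_def)
  note [measurable] = C2c_measurable[OF u]
  \<comment> \<open>A constant sequence turns the limit lemma into the statement that classical
    derivatives are weak ones.\<close>
  have w: "weak_deriv UNIV u e (dd e u)" for e
    by (rule weak_deriv_limit[where v = "\<lambda>_. u"]) (use C in \<open>auto simp: lint_def\<close>)
  have w2: "weak_deriv UNIV (dd f u) e (dd e (dd f u))" for e f
    by (rule weak_deriv_limit[where v = "\<lambda>_. dd f u"]) (use C in \<open>auto simp: lint_def\<close>)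
  have "set_integrable lebesgue (cball 0 R) (dd e_t u)" for R
    using Cc_pint_finite[OF C2c_dd_Cc[OF u, of e_t] p0] p
    by (intro lint_set_integrable lint_finite_pint[where p = p]) simp_all
  then show ?thesis
    unfolding W2p_def using w w2 C2c_grad_finite[OF u p0] C2c_hess_finite[OF u p0] Cc_pint_finite[OF C2c_Cc[OF u] p0]
      gradx_measurable[OF u] hessx_measurable[OF u]
    by (auto simp: gradx_def hessx_def intro!: in_Lp_borel)
qed

subsection \<open>The method of continuity\<close>

lemma gradx_interpolation:
  assumes p: "1 < p"
  obtains C where "0 < C" "\<And>u::'n::finite pt \<Rightarrow> real. C2c u \<Longrightarrow> pint p (gradx u) \<le> ennreal C * (pint p u + pint p (hessx u))"
proof -
  define q where "q = 2 powr p * 2 powr p * (2::real)"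
  have q: "0 < q" by (simp add: q_def)
  define n where "n = real CARD('n)"
  have n: "0 < n" by (simp add: n_def)
  have "pint p (gradx u) \<le> ennreal (n powr p * (n * q)) * (pint p u + pint p (hessx u))" if u: "C2c u" for u :: "'n pt \<Rightarrow> real"
  proof -
    have comp: "pint p (\<lambda>z. gradx u z $ i) \<le> ennreal q * (pint p u + pint p (hessx u))" for i
    proof -
      have "pint p (\<lambda>z. gradx u z $ i) \<le> ennreal q * (pint p u + pint p (dd (e_x i) (dd (e_x i) u)))"
        using dd_interpolation[OF u p, of "e_x i"] by (simp add: gradx_def q_def)
      also have "\<dots> \<le> ennreal q * (pint p u + pint p (hessx u))"
      proof (intro mult_left_mono add_left_mono pint_mono)
        fix z
        show "norm (dd (e_x i) (dd (e_x i) u) z) \<le> norm (hessx u z)"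
          using mat_component_le[of "hessx u z" i i] by (simp add: hessx_def)
      qed (use p in auto)
      finally show ?thesis .
    qed
    have "pint p (gradx u) \<le> ennreal (n powr p) * (\<Sum>i\<in>(UNIV::'n set). pint p (\<lambda>z. gradx u z $ i))"
      unfolding n_def using p by (intro pint_vec) (auto simp: gradx_def C2c_measurable[OF u])
    also have "\<dots> \<le> ennreal (n powr p) * (\<Sum>i\<in>(UNIV::'n set). ennreal q * (pint p u + pint p (hessx u)))"
      by (intro mult_left_mono sum_mono comp) auto
    also have "\<dots> = ennreal (n powr p * (n * q)) * (pint p u + pint p (hessx u))"
      using n q by (simp add: ennreal_mult n_def ennreal_of_nat_eq_real_of_nat mult.assoc)
    finally show ?thesis .
  qed
  moreover have "0 < n powr p * (n * q)" using n q by simp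
  ultimately show ?thesis using that by blast
qed

text \<open>The direction of the segment from the heat operator to L: it contains the full
  second-order difference a - K I along with the terms of lower order.\<close>

definition lowop :: "('n::finite pt \<Rightarrow> real ^ 'n ^ 'n) \<Rightarrow> ('n pt \<Rightarrow> real ^ 'n) \<Rightarrow> ('n pt \<Rightarrow> real) \<Rightarrow> real
    \<Rightarrow> ('n pt \<Rightarrow> real) \<Rightarrow> 'n pt \<Rightarrow> real" where
  "lowop a b c K u z = (\<Sum>i\<in>UNIV. \<Sum>j\<in>UNIV. (a z $ i $ j - (if i = j then K else 0)) * hessx u z $ i $ j)
     + b z \<bullet> gradx u z - c z * u z"

text \<open>Along the segment the operator is affine in \<theta>, and at each \<theta> it is again
  of the form \<open>opL\<close>, with convex combinations as coefficients. The first fact drives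
  the continuity argument, the second gives access to the a priori estimate.\<close>

lemma opL_path:
  fixes a :: "'n::finite pt \<Rightarrow> real ^ 'n ^ 'n"
  shows "opL (\<lambda>z. \<chi> i j. \<theta> * a z $ i $ j + (1 - \<theta>) * (if i = j then K else 0)) (\<lambda>z. \<theta> *\<^sub>R b z) (\<lambda>z. \<theta> * c z) lam u z
    = heat_op e_x e_t K lam u z + \<theta> * lowop a b c K u z"
proof -
  have 1: "(\<Sum>i\<in>UNIV. \<Sum>j\<in>UNIV. (\<theta> * a z $ i $ j + (1 - \<theta>) * (if i = j then K else 0)) * hessx u z $ i $ j)
     = (\<Sum>i\<in>UNIV. \<Sum>j\<in>UNIV. if i = j then K * hessx u z $ i $ j else 0)
       + \<theta> * (\<Sum>i\<in>UNIV. \<Sum>j\<in>UNIV. (a z $ i $ j - (if i = j then K else 0)) * hessx u z $ i $ j)"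
    unfolding sum_distrib_left sum.distrib[symmetric]
    by (intro sum.cong) (auto simp: algebra_simps)
  have 2: "(\<Sum>i\<in>UNIV. \<Sum>j\<in>UNIV. if i = j then K * hessx u z $ i $ j else 0) = (\<Sum>i\<in>UNIV. K * dd (e_x i) (dd (e_x i) u) z)"
    by (simp add: hessx_def)
  show ?thesis
    unfolding opL_def Lop_def heat_op_def lowop_def vec_lambda_beta 1 2 by (simp add: algebra_simps)
qed

lemma opL_lowop:
  "opL a b c lam u z = heat_op e_x e_t K lam u z + lowop a b c K u z"
  using opL_path[of 1 a K b c lam u z] by simp

lemma gradx_add: "C2c u \<Longrightarrow> C2c v \<Longrightarrow> gradx (\<lambda>z. u z + v z) z = gradx u z + gradx v z"
  by (simp add: gradx_def vec_eq_iff dd_add C2c_def C2_C1)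

lemma gradx_cmult: "C2c u \<Longrightarrow> gradx (\<lambda>z. c * u z) z = c *\<^sub>R gradx u z"
  by (simp add: gradx_def vec_eq_iff dd_cmult C2c_def C2_C1)

lemma hessx_add:
  assumes "C2c u" "C2c v"
  shows "hessx (\<lambda>z. u z + v z) z = hessx u z + hessx v z"
proof -
  have "dd e (\<lambda>z. u z + v z) = (\<lambda>z. dd e u z + dd e v z)" for e
    using assms by (auto simp: dd_add C2c_def C2_C1)
  then show ?thesis
    using assms by (simp add: hessx_def vec_eq_iff dd_add C2c_def C2_C1_dd)
qed

lemma hessx_cmult:
  assumes "C2c u"
  shows "hessx (\<lambda>z. c * u z) z = c *\<^sub>R hessx u z"
proof -
  have "dd e (\<lambda>z. c * u z) = (\<lambda>z. c * dd e u z)" for e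
    using assms by (auto simp: dd_cmult C2c_def C2_C1)
  then show ?thesis
    using assms by (simp add: hessx_def vec_eq_iff dd_cmult C2c_def C2_C1_dd)
qed

lemma gradx_diff: assumes "C2c u" "C2c v" shows "gradx (\<lambda>z. u z - v z) z = gradx u z - gradx v z"
  using gradx_add[OF assms(1) C2c_cmult[OF assms(2), of "-1"], of z] gradx_cmult[OF assms(2), of "-1" z] by simp

lemma hessx_diff: assumes "C2c u" "C2c v" shows "hessx (\<lambda>z. u z - v z) z = hessx u z - hessx v z"
  using hessx_add[OF assms(1) C2c_cmult[OF assms(2), of "-1"], of z] hessx_cmult[OF assms(2), of "-1" z] by simp

lemma mat_pairing_le:
  fixes A H :: "real ^ 'n ^ 'n"
  assumes "\<And>i j. \<bar>A $ i $ j\<bar> \<le> B"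
  shows "\<bar>\<Sum>i\<in>UNIV. \<Sum>j\<in>UNIV. A $ i $ j * H $ i $ j\<bar> \<le> real (CARD('n) * CARD('n)) * B * norm H"
proof -
  have "0 \<le> B" using assms[of undefined undefined] by linarith
  have "\<bar>\<Sum>i\<in>UNIV. \<Sum>j\<in>UNIV. A $ i $ j * H $ i $ j\<bar> \<le> (\<Sum>i\<in>(UNIV::'n set). \<Sum>j\<in>(UNIV::'n set). B * norm H)"
    by (intro order.trans[OF sum_abs] sum_mono)
      (auto simp: abs_mult intro!: mult_mono assms mat_component_le \<open>0 \<le> B\<close>)
  then show ?thesis by simp
qed

lemma lowop_bound:
  fixes a :: "'n::finite pt \<Rightarrow> real ^ 'n ^ 'n"
  assumes "\<And>z i j. \<bar>a z $ i $ j\<bar> \<le> B" "\<And>z. norm (b z) \<le> B" "\<And>z. \<bar>c z\<bar> \<le> B" "0 \<le> K"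
  shows "\<bar>lowop a b c K u z\<bar> \<le> (real (CARD('n) * CARD('n)) * (B + K)) * ((norm (hessx u z) + norm (gradx u z)) + \<bar>u z\<bar>)"
proof -
  have B: "0 \<le> B" using assms(3)[of undefined] by linarith
  define m where "m = real (CARD('n) * CARD('n))"
  have m: "1 \<le> m" unfolding m_def by (metis of_nat_1 of_nat_mono one_le_mult_iff Suc_leI One_nat_def zero_less_card_finite)
  have BK: "B \<le> m * (B + K)"
    using mult_mono[of 1 m B "B + K"] m B assms(4) by simp
  have 1: "\<bar>\<Sum>i\<in>UNIV. \<Sum>j\<in>UNIV. (a z $ i $ j - (if i = j then K else 0)) * hessx u z $ i $ j\<bar> \<le> m * (B + K) * norm (hessx u z)"
  proof -
    have "\<bar>a z $ i $ j - (if i = j then K else 0)\<bar> \<le> B + K" for i j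
      using assms(1)[of z i j] assms(4) by auto
    then show ?thesis
      using mat_pairing_le[of "\<chi> i j. a z $ i $ j - (if i = j then K else 0)" "B + K" "hessx u z"]
      unfolding m_def vec_lambda_beta by blast
  qed
  have 2: "\<bar>b z \<bullet> gradx u z\<bar> \<le> m * (B + K) * norm (gradx u z)"
    using BK assms(2)[of z] by (intro order.trans[OF Cauchy_Schwarz_ineq2] mult_right_mono) auto
  have 3: "\<bar>c z * u z\<bar> \<le> m * (B + K) * \<bar>u z\<bar>"
    unfolding abs_mult using BK assms(3)[of z] by (intro mult_right_mono) auto
  show ?thesis
    using 1 2 3 unfolding lowop_def m_def[symmetric] distrib_left by linarith
qed

lemma lowop_pint:
  fixes a :: "'n::finite pt \<Rightarrow> real ^ 'n ^ 'n"
  assumes u: "C2c u" and p: "1 < p"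
    and "\<And>z i j. \<bar>a z $ i $ j\<bar> \<le> B" "\<And>z. norm (b z) \<le> B" "\<And>z. \<bar>c z\<bar> \<le> B" "0 \<le> K"
  shows "pint p (lowop a b c K u) \<le> ennreal ((real (CARD('n) * CARD('n)) * (B + K)) powr p * (2 powr p * 2 powr p))
     * (pint p (hessx u) + pint p (gradx u) + pint p u)"
proof -
  define C where "C = real (CARD('n) * CARD('n)) * (B + K)"
  have B: "0 \<le> B" using assms(5)[of undefined] by linarith
  have C: "0 \<le> C" unfolding C_def using B assms(6) by simp
  define q where "q = 2 powr p"
  have q: "1 \<le> q" unfolding q_def using p by (intro ge_one_powr_ge_zero) auto
  note [measurable] = gradx_measurable[OF u] hessx_measurable[OF u] C2c_measurable(1)[OF u]
  have "pint p (lowop a b c K u) \<le> pint p (\<lambda>z. C * ((norm (hessx u z) + norm (gradx u z)) + \<bar>u z\<bar>))"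
  proof (intro pint_mono)
    fix z
    have "\<bar>lowop a b c K u z\<bar> \<le> C * ((norm (hessx u z) + norm (gradx u z)) + \<bar>u z\<bar>)"
      unfolding C_def by (rule lowop_bound[of a B b c K u z, OF assms(3-6)])
    then show "norm (lowop a b c K u z) \<le> norm (C * ((norm (hessx u z) + norm (gradx u z)) + \<bar>u z\<bar>))"
      using C by (simp add: abs_mult)
  qed (use p in simp)
  also have "\<dots> = ennreal (C powr p) * pint p (\<lambda>z. (norm (hessx u z) + norm (gradx u z)) + \<bar>u z\<bar>)"
    using C by (subst pint_cmult) auto
  also have "\<dots> \<le> ennreal (C powr p) * (ennreal q * (pint p (\<lambda>z. norm (hessx u z) + norm (gradx u z)) + pint p (\<lambda>z. \<bar>u z\<bar>)))"
    unfolding q_def using p by (intro mult_left_mono pint_add) auto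
  also have "\<dots> \<le> ennreal (C powr p) * (ennreal q * (ennreal q * (pint p (\<lambda>z. norm (hessx u z)) + pint p (\<lambda>z. norm (gradx u z))) + ennreal q * pint p (\<lambda>z. \<bar>u z\<bar>)))"
  proof -
    have "1 * pint p (\<lambda>z. \<bar>u z\<bar>) \<le> ennreal q * pint p (\<lambda>z. \<bar>u z\<bar>)"
      using q by (intro mult_right_mono) (auto simp: ennreal_ge_1)
    then show ?thesis
      using p unfolding q_def by (intro mult_left_mono add_mono pint_add) auto
  qed
  also have "\<dots> = ennreal (C powr p * (q * q)) * (pint p (hessx u) + pint p (gradx u) + pint p u)"
    using q by (simp add: ennreal_mult distrib_left[symmetric] mult.assoc pint_def)
  finally show ?thesis by (simp add: C_def q_def)
qed

lemma lowop_measurable: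
  assumes u: "C2c u" and [measurable]: "\<And>i j. (\<lambda>z. a z $ i $ j) \<in> borel_measurable borel"
    "b \<in> borel_measurable borel" "c \<in> borel_measurable borel"
  shows "lowop a b c K u \<in> borel_measurable borel"
proof -
  note [measurable] = gradx_measurable[OF u] C2c_measurable(1)[OF u] C2c_measurable(3)[OF u]
  have [measurable]: "(\<lambda>z. hessx u z $ i $ j) \<in> borel_measurable borel" for i j
    by (simp add: hessx_def)
  show ?thesis unfolding lowop_def by measurable
qed

lemma lowop_linear:
  assumes "C2c u"
  shows "lowop a b c K (\<lambda>z. k * u z) z = k * lowop a b c K u z"
    and "C2c v \<Longrightarrow> lowop a b c K (\<lambda>z. u z + v z) z = lowop a b c K u z + lowop a b c K v z"
  using assms unfolding lowop_def
  by (simp_all add: gradx_cmult hessx_cmult gradx_add hessx_add algebra_simps inner_add_right sum.distrib sum_distrib_left sum_subtractf)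

text \<open>The estimate is uniform in \<theta>, hence so is the bound of \<open>lowop\<close>
  relative to the operator at \<theta>; finitely many steps of equal length 1/m then carry density
  from \<theta> = 0 to \<theta> = 1. Boundedness of b is what places the images in L_p.\<close>

theorem dense_bounded_coefficients:
  fixes a :: "'n::finite pt \<Rightarrow> real ^ 'n ^ 'n"
  assumes p: "1 < p" and lam: "0 < lam" and K: "0 \<le> K"
    and meas [measurable]: "\<And>i j. (\<lambda>z. a z $ i $ j) \<in> borel_measurable borel"
      "b \<in> borel_measurable borel" "c \<in> borel_measurable borel"
    and bd: "\<And>z i j. \<bar>a z $ i $ j\<bar> \<le> B" "\<And>z. norm (b z) \<le> B" "\<And>z. \<bar>c z\<bar> \<le> B"
    and est: "\<And>\<theta> u. 0 \<le> \<theta> \<Longrightarrow> \<theta> \<le> 1 \<Longrightarrow> C2c u \<Longrightarrow>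
        pint p u \<le> ennreal N * pint p (\<lambda>z. heat_op e_x e_t K lam u z + \<theta> * lowop a b c K u z) \<and>
        pint p (hessx u) \<le> ennreal N * pint p (\<lambda>z. heat_op e_x e_t K lam u z + \<theta> * lowop a b c K u z)"
  shows "Lp_dense p (opL a b c lam)"
proof -
  define L where "L \<theta> u z = heat_op e_x e_t K lam u z + \<theta> * lowop a b c K u z" for \<theta> u z
  have p0: "0 < p" using p by simp
  define N' where "N' = max N 0"
  have N': "ennreal N = ennreal N'" "0 \<le> N'" by (auto simp: N'_def max_def ennreal_neg)
  obtain Cg where Cg: "0 < Cg" "\<And>u::'n pt \<Rightarrow> real. C2c u \<Longrightarrow> pint p (gradx u) \<le> ennreal Cg * (pint p u + pint p (hessx u))"
    by (rule gradx_interpolation[OF p]) blast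
  define Cl where "Cl = (real (CARD('n) * CARD('n)) * (B + K)) powr p * (2 powr p * 2 powr p)"
  have Cl: "0 \<le> Cl" by (simp add: Cl_def)
  have low_fin: "pint p (lowop a b c K u) < \<infinity>" if u: "C2c u" for u
  proof -
    have "pint p (hessx u) + pint p (gradx u) + pint p u < \<infinity>"
      using C2c_grad_finite[OF u p0] C2c_hess_finite[OF u p0] Cc_pint_finite[OF C2c_Cc[OF u] p0] by simp
    then show ?thesis
      by (intro le_less_trans[OF lowop_pint[OF u p bd K]]) (simp add: ennreal_mult_less_top)
  qed
  have lowm: "lowop a b c K u \<in> borel_measurable borel" if "C2c u" for u
    using that by (intro lowop_measurable) auto
  have op: "C2c_operator p (L \<theta>)" for \<theta>
    unfolding C2c_operator_def
  proof (intro conjI allI impI)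
    fix u v :: "'n pt \<Rightarrow> real" and z k
    assume u: "C2c u"
    note h = heat_op_operator[OF p0, of e_x e_t K lam]
    note [measurable] = lowm[OF u] C2c_operatorD(1)[OF h u]
    show "L \<theta> u \<in> borel_measurable borel" unfolding L_def by measurable
    have "pint p (L \<theta> u) \<le> ennreal (2 powr p) * (pint p (heat_op e_x e_t K lam u) + pint p (\<lambda>z. \<theta> * lowop a b c K u z))"
      unfolding L_def using p0 by (intro pint_add) auto
    also have "\<dots> < \<infinity>"
      using C2c_operatorD(2)[OF h u] low_fin[OF u] by (auto simp: pint_cmult ennreal_mult_less_top)
    finally show "pint p (L \<theta> u) < \<infinity>" .
    show "L \<theta> (\<lambda>z. k * u z) z = k * L \<theta> u z"
      using C2c_operatorD(4)[OF h u] by (simp add: L_def lowop_linear[OF u] algebra_simps)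
    assume v: "C2c v"
    show "L \<theta> (\<lambda>z. u z + v z) z = L \<theta> u z + L \<theta> v z"
      using C2c_operatorD(3)[OF h u v] by (simp add: L_def lowop_linear(2)[OF u v] algebra_simps)
  qed
  \<comment> \<open>Bounds \<open>lowop\<close> by the operator at \<theta>, uniformly in \<theta>:
    N' once for D2u and once for u, both from the estimate, and Cg (N' + N') for the gradient by
    interpolation.\<close>
  define C3 where "C3 = Cl * (N' + Cg * (N' + N') + N')"
  have C3: "0 \<le> C3" unfolding C3_def using Cl Cg N' by (intro mult_nonneg_nonneg add_nonneg_nonneg) auto
  have low: "pint p (lowop a b c K u) \<le> ennreal C3 * pint p (L \<theta> u)" if "0 \<le> \<theta>" "\<theta> \<le> 1" and u: "C2c u" for \<theta> u
  proof -
    have e: "pint p u \<le> ennreal N' * pint p (L \<theta> u)" "pint p (hessx u) \<le> ennreal N' * pint p (L \<theta> u)"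
      using est[OF that] by (auto simp: N' L_def[abs_def])
    have "pint p (lowop a b c K u) \<le> ennreal Cl * (pint p (hessx u) + pint p (gradx u) + pint p u)"
      unfolding Cl_def by (rule lowop_pint[OF u p bd K])
    also have "\<dots> \<le> ennreal Cl * (ennreal N' * pint p (L \<theta> u) + ennreal Cg * (ennreal N' * pint p (L \<theta> u) + ennreal N' * pint p (L \<theta> u)) + ennreal N' * pint p (L \<theta> u))"
      using e by (intro mult_left_mono add_mono order.trans[OF Cg(2)[OF u]]) auto
    also have "\<dots> = ennreal C3 * pint p (L \<theta> u)"
    proof -
      obtain x where x: "pint p (L \<theta> u) = ennreal x" "0 \<le> x"
        using C2c_operatorD(2)[OF op u, of \<theta>] by (cases "pint p (L \<theta> u)") auto
      show ?thesis
        unfolding x C3_def using Cl Cg(1) N' x(2)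
        by (simp add: ennreal_mult[symmetric] ennreal_plus[symmetric] algebra_simps del: ennreal_plus)
    qed
    finally show ?thesis .
  qed
  define r where "r = 1 / (8 * 2 powr p * 2 powr p)"
  have r: "0 < r" by (simp add: r_def)
  \<comment> \<open>As p > 1, the factor (1/m)^p may be replaced by 1/m, so any m > C3/r + 1 works;
    r is the threshold in \<open>Lp_dense_perturb\<close>.\<close>
  obtain m :: nat where m: "0 < m" "(1 / real m) powr p * C3 \<le> r"
  proof -
    obtain m :: nat where m: "C3 / r + 1 < real m" using reals_Archimedean2 by blast
    have m1: "1 < real m" using m C3 r by (smt (verit) divide_nonneg_pos)
    have "(1 / real m) powr p \<le> (1 / real m) powr 1" using m1 p by (intro powr_mono') auto
    then have "(1 / real m) powr p * C3 \<le> 1 / real m * C3" using C3 m1 by (intro mult_right_mono) auto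
    also have "\<dots> \<le> r" using m r m1 by (simp add: field_simps)
    finally show ?thesis using that[of m] m1 by simp
  qed
  have step: "Lp_dense p (L (real k / real m))" if "k \<le> m" for k
    using that
  proof (induction k)
    case 0
    have "L 0 = heat_op e_x e_t K lam" by (simp add: L_def fun_eq_iff)
    then show ?case using heat_op_dense[OF K lam, of p e_x e_t] p by simp
  next
    case (Suc k)
    have d: "Lp_dense p (L (real k / real m))" using Suc by simp
    show ?case
    proof (rule Lp_dense_perturb[OF op op d, where \<kappa> = "(1 / real m) powr p * C3"])
      fix u :: "'n pt \<Rightarrow> real" assume u: "C2c u"
      have "L (real (Suc k) / real m) u z - L (real k / real m) u z = (1 / real m) * lowop a b c K u z" for z
        by (simp add: L_def add_divide_distrib algebra_simps)
      then have "pint p (\<lambda>z. L (real (Suc k) / real m) u z - L (real k / real m) u z)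
          = ennreal ((1 / real m) powr p) * pint p (lowop a b c K u)"
        using pint_cmult[OF lowm[OF u], of p "1 / real m"] by simp
      also have "\<dots> \<le> ennreal ((1 / real m) powr p) * (ennreal C3 * pint p (L (real k / real m) u))"
        using Suc.prems by (intro mult_left_mono low u) auto
      finally show "pint p (\<lambda>z. L (real (Suc k) / real m) u z - L (real k / real m) u z)
          \<le> ennreal ((1 / real m) powr p * C3) * pint p (L (real k / real m) u)"
        using C3 by (simp add: ennreal_mult mult.assoc)
    qed (use p C3 m in \<open>auto simp: r_def\<close>)
  qed
  have "L 1 = opL a b c lam" using opL_lowop[of a b c lam _ _ K] by (simp add: L_def fun_eq_iff)
  with step[of m] m show ?thesis by simp
qed

subsection \<open>Local estimates of the drift term\<close>

text \<open>With X = \<beta>^q, Y = g^p and \<theta> = 1/q + 1/p - 1 > 0, the product is (X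
  Y)^\<theta> X^(1-1/p) Y^(1-1/q), with exponents of sum 1. The weights \<rho>^(d-\<sigma>) and
  \<rho>^(-\<sigma>) cancel in this geometric mean for \<sigma> = d \<theta>. They are the ones for
  which both terms cost \<rho>^(-\<sigma>) once g^p is averaged at scale \<rho>, since such an
  average is only bounded by a multiple of \<rho>^(-d). For \<theta> \<le> 0 there is no loss and
  \<sigma> = 0.\<close>

lemma young_interpolated:
  fixes \<beta> g \<rho> d p q :: real
  assumes "0 \<le> \<beta>" "0 \<le> g" "1 < p" "1 < q" "0 < \<rho>" "\<rho> \<le> 1" "0 \<le> d"
  defines "\<sigma> \<equiv> max 0 (d * (1 / q + 1 / p - 1))"
  shows "\<beta> * g \<le> \<rho> powr (d - \<sigma>) * (\<beta> powr q * g powr p) + \<rho> powr (- \<sigma>) * (1 + \<beta> powr q + g powr p)"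
proof (cases "\<beta> = 0 \<or> g = 0")
  case True
  then show ?thesis by auto
next
  case False
  define X where "X = \<beta> powr q"
  define Y where "Y = g powr p"
  have X: "0 < X" "\<beta> = X powr (1 / q)" using False assms(1,4) by (auto simp: X_def powr_powr)
  have Y: "0 < Y" "g = Y powr (1 / p)" using False assms(2,3) by (auto simp: Y_def powr_powr)
  define \<theta> where "\<theta> = 1 / q + 1 / p - 1"
  show ?thesis
  proof (cases "\<theta> \<le> 0")
    case True
    then have s: "\<sigma> = 0" unfolding \<sigma>_def \<theta>_def[symmetric] using mult_nonneg_nonpos[OF assms(7) True] by simp
    define m where "m = max 1 (max X Y)"
    have m: "1 \<le> m" "X \<le> m" "Y \<le> m" by (auto simp: m_def)
    have "\<beta> * g \<le> m powr (1 / q) * m powr (1 / p)"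
      unfolding X(2) Y(2) using m X Y assms(3,4) by (intro mult_mono powr_mono2) auto
    also have "\<dots> = m powr (1 + \<theta>)" using m by (simp add: powr_add[symmetric] \<theta>_def)
    also have "\<dots> \<le> m powr 1" using m True by (intro powr_mono) auto
    also have "\<dots> \<le> 1 + X + Y" using m X Y by (auto simp: m_def)
    also have "\<dots> \<le> \<rho> powr (d - \<sigma>) * (X * Y) + \<rho> powr (- \<sigma>) * (1 + X + Y)"
      using X Y assms(5) by (simp add: s)
    finally show ?thesis by (simp add: X_def Y_def)
  next
    case False
    then have th: "0 < \<theta>" by simp
    have s: "\<sigma> = d * \<theta>" unfolding \<sigma>_def \<theta>_def[symmetric] using th assms(7) by (simp add: max_def)
    define s1 where "s1 = \<rho> powr (d - \<sigma>)"
    define s2 where "s2 = \<rho> powr (- \<sigma>)"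
    have s12: "0 < s1" "0 < s2" using assms(5) by (auto simp: s1_def s2_def)
    define \<theta>2 where "\<theta>2 = 1 - 1 / p"
    define \<theta>3 where "\<theta>3 = 1 - 1 / q"
    have t23: "0 \<le> \<theta>2" "0 \<le> \<theta>3" "\<theta> + \<theta>2 + \<theta>3 = 1" "\<theta> + \<theta>2 = 1 / q" "\<theta> + \<theta>3 = 1 / p"
      using assms(3,4) by (auto simp: \<theta>2_def \<theta>3_def \<theta>_def)
    \<comment> \<open>The geometric mean is bounded by the largest of the three weighted terms,
      which in turn is below their sum.\<close>
    define m where "m = max (s1 * (X * Y)) (max (s2 * X) (s2 * Y))"
    have m: "s1 * (X * Y) \<le> m" "s2 * X \<le> m" "s2 * Y \<le> m" "0 < m"
      using s12 X Y by (auto simp: m_def less_max_iff_disj)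
    have one: "s1 powr \<theta> * s2 powr \<theta>2 * s2 powr \<theta>3 = 1"
    proof -
      have "(d - \<sigma>) * \<theta> + (- \<sigma>) * \<theta>2 + (- \<sigma>) * \<theta>3 = d * \<theta> - \<sigma> * (\<theta> + \<theta>2 + \<theta>3)"
        by (simp add: algebra_simps)
      also have "\<dots> = 0" using t23(3) s by simp
      finally show ?thesis
        using assms(5) by (simp add: s1_def s2_def powr_powr powr_add[symmetric])
    qed
    have "\<beta> * g = (X powr \<theta> * X powr \<theta>2) * (Y powr \<theta> * Y powr \<theta>3)"
      unfolding X(2) Y(2) t23(4,5)[symmetric] by (simp add: powr_add)
    also have "\<dots> = (s1 powr \<theta> * s2 powr \<theta>2 * s2 powr \<theta>3) * ((X powr \<theta> * X powr \<theta>2) * (Y powr \<theta> * Y powr \<theta>3))"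
      by (simp add: one)
    also have "\<dots> = (s1 * (X * Y)) powr \<theta> * (s2 * X) powr \<theta>2 * (s2 * Y) powr \<theta>3"
      by (simp add: powr_mult mult_ac)
    also have "\<dots> \<le> m powr \<theta> * m powr \<theta>2 * m powr \<theta>3"
      using m s12 X Y th t23 by (intro mult_mono powr_mono2) auto
    also have "\<dots> = m" using m t23(3) by (simp add: powr_add[symmetric])
    also have "m \<le> s1 * (X * Y) + s2 * (1 + X + Y)"
      using s12 X Y by (auto simp: m_def algebra_simps add_increasing add_increasing2 mult_pos_pos less_imp_le)
    finally show ?thesis by (simp add: X_def Y_def s1_def s2_def)
  qed
qed

lemma ball_volume:
  obtains V where "emeasure lborel (ball (x::'a::euclidean_space) R) = ennreal V" "0 \<le> V"
  using emeasure_lborel_ball_finite[of x R] by (cases "emeasure lborel (ball x R)") auto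

text \<open>A hand-made Young convolution inequality: y in the unit ball moves the argument of g
  over a ball of radius \<rho>, and the cost of small \<rho> is of order \<rho>^(-\<sigma>). The
  integrals are normalised to 1 so that the inhomogeneous bound of \<open>young_interpolated\<close>
  can be integrated term by term.\<close>

lemma averaged_pairing:
  fixes \<beta> g :: "'a::euclidean_space \<Rightarrow> real"
  assumes pq: "1 < p" "1 < q" and [measurable]: "\<beta> \<in> borel_measurable borel" "g \<in> borel_measurable borel"
    and nn: "\<And>x. 0 \<le> \<beta> x" "\<And>x. 0 \<le> g x"
    and b1: "(\<integral>\<^sup>+x\<in>ball 0 R. ennreal (\<beta> x powr q) \<partial>lborel) \<le> 1"
    and g1: "(\<integral>\<^sup>+x. ennreal (g x powr p) \<partial>lborel) \<le> 1"
    and r: "0 < \<rho>" "\<rho> \<le> 1"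
    and V: "emeasure lborel (ball (0::'a) R) = ennreal V" "0 \<le> V"
    and W: "emeasure lborel (ball (0::'a) 1) = ennreal W" "0 \<le> W"
  defines "\<sigma> \<equiv> max 0 (real DIM('a) * (1 / q + 1 / p - 1))"
  shows "(\<integral>\<^sup>+x\<in>ball 0 R. (\<integral>\<^sup>+y\<in>ball 0 1. ennreal (\<beta> x * g (x + \<rho> *\<^sub>R y)) \<partial>lborel) \<partial>lborel)
     \<le> ennreal ((1 + W * V + 2 * W) * \<rho> powr (- \<sigma>))"
proof -
  define d where "d = real DIM('a)"
  define I where "I x = (\<integral>\<^sup>+y\<in>ball 0 1. ennreal (g (x + \<rho> *\<^sub>R y) powr p) \<partial>lborel)" for x
  have [measurable]: "I \<in> borel_measurable borel" unfolding I_def by measurable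
  define s2 where "s2 = \<rho> powr (- \<sigma>)"
  have s2: "0 \<le> s2" by (simp add: s2_def)
  \<comment> \<open>\<open>I\<close> is bounded in two ways: pointwise by \<rho>^(-d), from the
    change of variables, which uses up the weight \<rho>^(d-\<sigma>); and by W after integration in
    x, from translation invariance.\<close>
  have I_le: "I x \<le> ennreal (\<rho> powr (- d))" for x
  proof -
    have "I x \<le> (\<integral>\<^sup>+y. ennreal (g (x + \<rho> *\<^sub>R y) powr p) \<partial>lborel)"
      unfolding I_def by (intro nn_integral_mono) (auto simp: indicator_def)
    also have "\<dots> = ennreal (\<rho> powr (- d)) * (\<integral>\<^sup>+x. ennreal (g x powr p) \<partial>lborel)"
      unfolding d_def using r by (intro nn_integral_affine) auto
    also have "\<dots> \<le> ennreal (\<rho> powr (- d)) * 1" by (intro mult_left_mono g1) auto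
    finally show ?thesis by simp
  qed
  have inner: "(\<integral>\<^sup>+y\<in>ball 0 1. ennreal (\<beta> x * g (x + \<rho> *\<^sub>R y)) \<partial>lborel)
     \<le> ennreal s2 * (ennreal (1 + W) * ennreal (\<beta> x powr q) + (ennreal W + I x))" for x
  proof -
    have "(\<integral>\<^sup>+y\<in>ball 0 1. ennreal (\<beta> x * g (x + \<rho> *\<^sub>R y)) \<partial>lborel)
      \<le> (\<integral>\<^sup>+y. ennreal (\<rho> powr (d - \<sigma>) * \<beta> x powr q + s2) * (ennreal (g (x + \<rho> *\<^sub>R y) powr p) * indicator (ball 0 1) y)
           + ennreal (s2 * (1 + \<beta> x powr q)) * indicator (ball 0 1) y \<partial>lborel)"
    proof (intro nn_integral_mono)
      fix y :: 'a
      have "\<beta> x * g (x + \<rho> *\<^sub>R y) \<le> (\<rho> powr (d - \<sigma>) * \<beta> x powr q + s2) * g (x + \<rho> *\<^sub>R y) powr p + s2 * (1 + \<beta> x powr q)"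
        using young_interpolated[OF nn(1)[of x] nn(2)[of "x + \<rho> *\<^sub>R y"] pq r, of d]
        by (simp add: \<sigma>_def d_def s2_def algebra_simps)
      then have "ennreal (\<beta> x * g (x + \<rho> *\<^sub>R y)) \<le> ennreal (\<rho> powr (d - \<sigma>) * \<beta> x powr q + s2) * ennreal (g (x + \<rho> *\<^sub>R y) powr p) + ennreal (s2 * (1 + \<beta> x powr q))"
        using s2 by (simp add: ennreal_mult[symmetric] ennreal_plus[symmetric] ennreal_leI del: ennreal_plus)
      then show "ennreal (\<beta> x * g (x + \<rho> *\<^sub>R y)) * indicator (ball 0 1) y
        \<le> ennreal (\<rho> powr (d - \<sigma>) * \<beta> x powr q + s2) * (ennreal (g (x + \<rho> *\<^sub>R y) powr p) * indicator (ball 0 1) y)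
           + ennreal (s2 * (1 + \<beta> x powr q)) * indicator (ball 0 1) y"
        by (auto simp: indicator_def)
    qed
    also have "\<dots> = ennreal (\<rho> powr (d - \<sigma>) * \<beta> x powr q + s2) * I x + ennreal (s2 * (1 + \<beta> x powr q)) * ennreal W"
      by (simp add: nn_integral_add nn_integral_cmult nn_integral_cmult_indicator I_def W)
    also have "\<dots> = ennreal (\<rho> powr (d - \<sigma>) * \<beta> x powr q) * I x + ennreal s2 * I x + ennreal (s2 * (1 + \<beta> x powr q)) * ennreal W"
      using s2 by (subst ennreal_plus) (auto simp: distrib_right)
    also have "\<dots> \<le> ennreal (\<rho> powr (d - \<sigma>) * \<beta> x powr q) * ennreal (\<rho> powr (- d)) + ennreal s2 * I x + ennreal (s2 * (1 + \<beta> x powr q)) * ennreal W"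
      by (intro add_mono mult_left_mono I_le) auto
    also have "ennreal (\<rho> powr (d - \<sigma>) * \<beta> x powr q) * ennreal (\<rho> powr (- d)) = ennreal s2 * ennreal (\<beta> x powr q)"
      using r by (simp add: ennreal_mult[symmetric] s2_def mult.commute mult.left_commute powr_add[symmetric])
    also have "ennreal s2 * ennreal (\<beta> x powr q) + ennreal s2 * I x + ennreal (s2 * (1 + \<beta> x powr q)) * ennreal W
       = ennreal s2 * (ennreal (1 + W) * ennreal (\<beta> x powr q) + (ennreal W + I x))"
      using s2 W by (simp add: ennreal_mult ennreal_plus distrib_left distrib_right mult_ac add_ac)
    finally show ?thesis .
  qed
  have Ix: "(\<integral>\<^sup>+x. I x \<partial>lborel) \<le> ennreal W"
  proof -
    have "(\<integral>\<^sup>+x. I x \<partial>lborel) = (\<integral>\<^sup>+y. (\<integral>\<^sup>+x. ennreal (g (x + \<rho> *\<^sub>R y) powr p) * indicator (ball 0 1) y \<partial>lborel) \<partial>lborel)"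
      unfolding I_def by (intro lborel_pair.Fubini') simp
    also have "\<dots> \<le> (\<integral>\<^sup>+y. 1 * indicator (ball (0::'a) 1) y \<partial>lborel)"
    proof (intro nn_integral_mono)
      fix y :: 'a
      have "(\<integral>\<^sup>+x. ennreal (g (x + \<rho> *\<^sub>R y) powr p) * indicator (ball 0 1) y \<partial>lborel) = (\<integral>\<^sup>+x. ennreal (g x powr p) \<partial>lborel) * indicator (ball 0 1) y"
        using nn_integral_shift[of "\<lambda>x. ennreal (g x powr p)" "\<rho> *\<^sub>R y"] by (subst nn_integral_multc) auto
      then show "(\<integral>\<^sup>+x. ennreal (g (x + \<rho> *\<^sub>R y) powr p) * indicator (ball 0 1) y \<partial>lborel) \<le> 1 * indicator (ball 0 1) y"
        using g1 by (auto simp: indicator_def)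
    qed
    also have "\<dots> = ennreal W" by (simp add: W)
    finally show ?thesis .
  qed
  have "(\<integral>\<^sup>+x\<in>ball 0 R. (\<integral>\<^sup>+y\<in>ball 0 1. ennreal (\<beta> x * g (x + \<rho> *\<^sub>R y)) \<partial>lborel) \<partial>lborel)
     \<le> (\<integral>\<^sup>+x. ennreal s2 * (ennreal (1 + W) * (ennreal (\<beta> x powr q) * indicator (ball 0 R) x) + (ennreal W * indicator (ball 0 R) x + I x)) \<partial>lborel)"
    by (intro nn_integral_mono) (use inner in \<open>auto simp: indicator_def\<close>)
  also have "\<dots> = ennreal s2 * (ennreal (1 + W) * (\<integral>\<^sup>+x\<in>ball 0 R. ennreal (\<beta> x powr q) \<partial>lborel) + (ennreal W * ennreal V + (\<integral>\<^sup>+x. I x \<partial>lborel)))"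
    by (simp add: nn_integral_add nn_integral_cmult nn_integral_cmult_indicator V)
  also have "\<dots> \<le> ennreal s2 * (ennreal (1 + W) * 1 + (ennreal W * ennreal V + ennreal W))"
    by (intro mult_left_mono add_mono b1 Ix) auto
  also have "\<dots> = ennreal ((1 + W * V + 2 * W) * \<rho> powr (- \<sigma>))"
    using s2 V W by (simp add: s2_def ennreal_mult[symmetric] ennreal_plus[symmetric] algebra_simps del: ennreal_plus)
  finally show ?thesis .
qed

text \<open>Sobolev's embedding in the form needed here: v(x) is compared with v(x + y) along the
  segment, and the comparison is averaged over y in the unit ball. For fixed \<rho> the gradient
  term costs \<rho>^(-\<sigma>) by \<open>averaged_pairing\<close>, which is integrable on (0,1)
  because \<sigma> < 1. The term with v(x + y) is the case \<rho> = 1.\<close>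

lemma spatial_pairing_unit:
  fixes \<beta> v gv :: "'a::euclidean_space \<Rightarrow> real"
  assumes pq: "1 < p" "1 < q" and [measurable]: "\<beta> \<in> borel_measurable borel" "v \<in> borel_measurable borel" "gv \<in> borel_measurable borel"
    and nn: "\<And>x. 0 \<le> \<beta> x" "\<And>x. 0 \<le> gv x"
    and rep: "\<And>x y. norm y < 1 \<Longrightarrow> ennreal \<bar>v x\<bar> \<le> ennreal \<bar>v (x + y)\<bar> + (\<integral>\<^sup>+\<rho>\<in>{0..1}. ennreal (gv (x + \<rho> *\<^sub>R y)) \<partial>lborel)"
    and b1: "(\<integral>\<^sup>+x\<in>ball 0 R. ennreal (\<beta> x powr q) \<partial>lborel) \<le> 1"
    and v1: "(\<integral>\<^sup>+x. ennreal (\<bar>v x\<bar> powr p) \<partial>lborel) \<le> 1"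
    and g1: "(\<integral>\<^sup>+x. ennreal (gv x powr p) \<partial>lborel) \<le> 1"
    and V: "emeasure lborel (ball (0::'a) R) = ennreal V" "0 \<le> V"
    and W: "emeasure lborel (ball (0::'a) 1) = ennreal W" "0 \<le> W"
  defines "\<sigma> \<equiv> max 0 (real DIM('a) * (1 / q + 1 / p - 1))"
  assumes sig: "\<sigma> < 1"
  shows "ennreal W * (\<integral>\<^sup>+x\<in>ball 0 R. ennreal (\<beta> x * \<bar>v x\<bar>) \<partial>lborel) \<le> ennreal ((1 + W * V + 2 * W) * (1 + 1 / (1 - \<sigma>)))"
proof -
  define C where "C = 1 + W * V + 2 * W"
  have C: "0 \<le> C" using V W by (simp add: C_def)
  have T1: "(\<integral>\<^sup>+x\<in>ball 0 R. (\<integral>\<^sup>+y\<in>ball 0 1. ennreal (\<beta> x * \<bar>v (x + y)\<bar>) \<partial>lborel) \<partial>lborel) \<le> ennreal C"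
    using averaged_pairing[OF pq, of \<beta> "\<lambda>x. \<bar>v x\<bar>" R 1 V W] nn b1 v1 V W by (simp add: C_def)
  have T2: "(\<integral>\<^sup>+x\<in>ball 0 R. (\<integral>\<^sup>+y\<in>ball 0 1. (\<integral>\<^sup>+\<rho>\<in>{0..1::real}. ennreal (\<beta> x * gv (x + \<rho> *\<^sub>R y)) \<partial>lborel) \<partial>lborel) \<partial>lborel)
     \<le> ennreal (C * (1 / (1 - \<sigma>)))" (is "?T \<le> _")
  proof -
    have "?T = (\<integral>\<^sup>+x. (\<integral>\<^sup>+y. (\<integral>\<^sup>+\<rho>. ennreal (\<beta> x * gv (x + \<rho> *\<^sub>R y)) * indicator {0..1} \<rho> * indicator (ball 0 1) y * indicator (ball 0 R) x \<partial>(lborel :: real measure)) \<partial>lborel) \<partial>lborel)"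
      by (simp add: nn_integral_multc)
    also have "\<dots> = (\<integral>\<^sup>+x. (\<integral>\<^sup>+\<rho>. (\<integral>\<^sup>+y. ennreal (\<beta> x * gv (x + \<rho> *\<^sub>R y)) * indicator {0..1} \<rho> * indicator (ball 0 1) y * indicator (ball 0 R) x \<partial>lborel) \<partial>(lborel :: real measure)) \<partial>lborel)"
      by (intro nn_integral_cong lborel_pair.Fubini') simp
    also have "\<dots> = (\<integral>\<^sup>+\<rho>. (\<integral>\<^sup>+x. (\<integral>\<^sup>+y. ennreal (\<beta> x * gv (x + \<rho> *\<^sub>R y)) * indicator {0..1} \<rho> * indicator (ball 0 1) y * indicator (ball 0 R) x \<partial>lborel) \<partial>lborel) \<partial>(lborel :: real measure))"
      by (intro lborel_pair.Fubini') simp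
    also have "\<dots> \<le> (\<integral>\<^sup>+\<rho>. ennreal C * (ennreal (\<rho> powr (- \<sigma>)) * indicator {0..1} \<rho>) \<partial>(lborel :: real measure))"
    proof (intro nn_integral_mono_AE)
      \<comment> \<open>The point \<rho> = 0 is null and is left out, since
        \<open>averaged_pairing\<close> needs \<rho> > 0.\<close>
      show "AE \<rho> in (lborel :: real measure). (\<integral>\<^sup>+x. (\<integral>\<^sup>+y. ennreal (\<beta> x * gv (x + \<rho> *\<^sub>R y)) * indicator {0..1} \<rho> * indicator (ball 0 1) y * indicator (ball 0 R) x \<partial>lborel) \<partial>lborel)
         \<le> ennreal C * (ennreal (\<rho> powr (- \<sigma>)) * indicator {0..1} \<rho>)"
        using AE_lborel_singleton[of "0::real"]
      proof eventually_elim
        case (elim \<rho>)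
        show ?case
        proof (cases "\<rho> \<in> {0..1}")
          case True
          with elim have r: "0 < \<rho>" "\<rho> \<le> 1" by auto
          have "(\<integral>\<^sup>+x. (\<integral>\<^sup>+y. ennreal (\<beta> x * gv (x + \<rho> *\<^sub>R y)) * indicator {0..1} \<rho> * indicator (ball 0 1) y * indicator (ball 0 R) x \<partial>lborel) \<partial>lborel)
            = (\<integral>\<^sup>+x\<in>ball 0 R. (\<integral>\<^sup>+y\<in>ball 0 1. ennreal (\<beta> x * gv (x + \<rho> *\<^sub>R y)) \<partial>lborel) \<partial>lborel)"
            using True by (simp add: nn_integral_multc)
          also have "\<dots> \<le> ennreal (C * \<rho> powr (- \<sigma>))"
            unfolding C_def \<sigma>_def by (rule averaged_pairing[OF pq]) (use nn b1 g1 V W r in auto)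
          finally show ?thesis using True C by (simp add: ennreal_mult)
        qed simp
      qed
    qed
    also have "\<dots> = ennreal C * (\<integral>\<^sup>+\<rho>. ennreal (\<rho> powr (- \<sigma>)) * indicator {0..1} \<rho> \<partial>(lborel :: real measure))"
      by (rule nn_integral_cmult) simp
    also have "(\<integral>\<^sup>+\<rho>. ennreal (\<rho> powr (- \<sigma>)) * indicator {0..1} \<rho> \<partial>(lborel :: real measure)) = ennreal (1 powr (- \<sigma> + 1) / (- \<sigma> + 1))"
      using sig by (intro nn_integral_has_integral_lebesgue' has_integral_powr_from_0) auto
    finally show ?thesis using C sig by (simp add: ennreal_mult[symmetric])
  qed
  \<comment> \<open>Multiplication by the volume W is integration over y in the unit ball of a
    quantity that does not depend on y.\<close>
  have "ennreal W * (\<integral>\<^sup>+x\<in>ball 0 R. ennreal (\<beta> x * \<bar>v x\<bar>) \<partial>lborel)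
     = (\<integral>\<^sup>+x\<in>ball 0 R. (\<integral>\<^sup>+y\<in>ball (0::'a) 1. ennreal (\<beta> x * \<bar>v x\<bar>) \<partial>lborel) \<partial>lborel)"
  proof -
    have "(\<integral>\<^sup>+y\<in>ball (0::'a) 1. ennreal k \<partial>lborel) = ennreal W * ennreal k" for k
      by (simp add: nn_integral_cmult_indicator W mult.commute)
    then show ?thesis by (simp add: nn_integral_cmult mult.assoc)
  qed
  also have "\<dots> \<le> (\<integral>\<^sup>+x\<in>ball 0 R. ((\<integral>\<^sup>+y\<in>ball 0 1. ennreal (\<beta> x * \<bar>v (x + y)\<bar>) \<partial>lborel)
        + (\<integral>\<^sup>+y\<in>ball 0 1. (\<integral>\<^sup>+\<rho>\<in>{0..1::real}. ennreal (\<beta> x * gv (x + \<rho> *\<^sub>R y)) \<partial>lborel) \<partial>lborel)) \<partial>lborel)"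
  proof (intro nn_integral_mono mult_right_mono)
    fix x
    have "(\<integral>\<^sup>+y\<in>ball (0::'a) 1. ennreal (\<beta> x * \<bar>v x\<bar>) \<partial>lborel)
      \<le> (\<integral>\<^sup>+y. ennreal (\<beta> x * \<bar>v (x + y)\<bar>) * indicator (ball 0 1) y + (\<integral>\<^sup>+\<rho>\<in>{0..1::real}. ennreal (\<beta> x * gv (x + \<rho> *\<^sub>R y)) \<partial>lborel) * indicator (ball 0 1) y \<partial>lborel)"
    proof (intro nn_integral_mono)
      fix y :: 'a
      have "ennreal (\<beta> x * \<bar>v x\<bar>) \<le> ennreal (\<beta> x * \<bar>v (x + y)\<bar>) + (\<integral>\<^sup>+\<rho>\<in>{0..1::real}. ennreal (\<beta> x * gv (x + \<rho> *\<^sub>R y)) \<partial>lborel)" if "norm y < 1"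
      proof -
        have "(\<integral>\<^sup>+\<rho>\<in>{0..1::real}. ennreal (\<beta> x * gv (x + \<rho> *\<^sub>R y)) \<partial>lborel) = ennreal (\<beta> x) * (\<integral>\<^sup>+\<rho>\<in>{0..1}. ennreal (gv (x + \<rho> *\<^sub>R y)) \<partial>lborel)"
          using nn by (simp add: ennreal_mult mult.assoc nn_integral_cmult)
        then show ?thesis
          using mult_left_mono[OF rep[OF that, of x], of "ennreal (\<beta> x)"] nn by (simp add: ennreal_mult distrib_left)
      qed
      then show "ennreal (\<beta> x * \<bar>v x\<bar>) * indicator (ball 0 1) y \<le> ennreal (\<beta> x * \<bar>v (x + y)\<bar>) * indicator (ball 0 1) y
         + (\<integral>\<^sup>+\<rho>\<in>{0..1::real}. ennreal (\<beta> x * gv (x + \<rho> *\<^sub>R y)) \<partial>lborel) * indicator (ball 0 1) y"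
        by (auto simp: indicator_def)
    qed
    also have "\<dots> = (\<integral>\<^sup>+y\<in>ball 0 1. ennreal (\<beta> x * \<bar>v (x + y)\<bar>) \<partial>lborel)
        + (\<integral>\<^sup>+y\<in>ball 0 1. (\<integral>\<^sup>+\<rho>\<in>{0..1::real}. ennreal (\<beta> x * gv (x + \<rho> *\<^sub>R y)) \<partial>lborel) \<partial>lborel)"
      by (rule nn_integral_add) auto
    finally show "(\<integral>\<^sup>+y\<in>ball (0::'a) 1. ennreal (\<beta> x * \<bar>v x\<bar>) \<partial>lborel) \<le> \<dots>" .
  qed simp
  also have "\<dots> = (\<integral>\<^sup>+x\<in>ball 0 R. (\<integral>\<^sup>+y\<in>ball 0 1. ennreal (\<beta> x * \<bar>v (x + y)\<bar>) \<partial>lborel) \<partial>lborel)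
     + (\<integral>\<^sup>+x\<in>ball 0 R. (\<integral>\<^sup>+y\<in>ball 0 1. (\<integral>\<^sup>+\<rho>\<in>{0..1::real}. ennreal (\<beta> x * gv (x + \<rho> *\<^sub>R y)) \<partial>lborel) \<partial>lborel) \<partial>lborel)"
    unfolding distrib_right by (rule nn_integral_add) auto
  also have "\<dots> \<le> ennreal C + ennreal (C * (1 / (1 - \<sigma>)))" by (intro add_mono T1 T2)
  also have "\<dots> = ennreal (C * (1 + 1 / (1 - \<sigma>)))"
    using C sig by (simp add: ennreal_plus[symmetric] distrib_left del: ennreal_plus)
  finally show ?thesis by (simp add: C_def)
qed

text \<open>\<sigma> < 1 because d/q \<le> 1 and d (1 - 1/p) > 0; it is p > 1 that admits the
  borderline exponent q = d. The general case follows from the normalised one on dividing by B0 and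
  V0.\<close>

lemma spatial_pairing:
  assumes pq: "1 < p" "1 < q" "real DIM('a::euclidean_space) \<le> q"
  obtains C where "0 < C"
    "\<And>(\<beta>::'a \<Rightarrow> real) v gv B0 V0. \<beta> \<in> borel_measurable borel \<Longrightarrow> v \<in> borel_measurable borel \<Longrightarrow> gv \<in> borel_measurable borel \<Longrightarrow>
      (\<And>x. 0 \<le> \<beta> x) \<Longrightarrow> (\<And>x. 0 \<le> gv x) \<Longrightarrow>
      (\<And>x y. norm y < 1 \<Longrightarrow> ennreal \<bar>v x\<bar> \<le> ennreal \<bar>v (x + y)\<bar> + (\<integral>\<^sup>+\<rho>\<in>{0..1}. ennreal (gv (x + \<rho> *\<^sub>R y)) \<partial>lborel)) \<Longrightarrow>
      0 < B0 \<Longrightarrow> 0 < V0 \<Longrightarrow> (\<integral>\<^sup>+x\<in>ball 0 R. ennreal (\<beta> x powr q) \<partial>lborel) \<le> ennreal (B0 powr q) \<Longrightarrow>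
      (\<integral>\<^sup>+x. ennreal (\<bar>v x\<bar> powr p) \<partial>lborel) \<le> ennreal (V0 powr p) \<Longrightarrow>
      (\<integral>\<^sup>+x. ennreal (gv x powr p) \<partial>lborel) \<le> ennreal (V0 powr p) \<Longrightarrow>
      (\<integral>\<^sup>+x\<in>ball 0 R. ennreal (\<beta> x * \<bar>v x\<bar>) \<partial>lborel) \<le> ennreal (C * (B0 * V0))"
proof -
  define \<sigma> where "\<sigma> = max 0 (real DIM('a) * (1 / q + 1 / p - 1))"
  have sig: "\<sigma> < 1"
  proof -
    have "real DIM('a) / q \<le> 1" using pq by simp
    moreover have "0 < real DIM('a) * (1 - 1 / p)" using pq by (intro mult_pos_pos) auto
    ultimately show ?thesis by (simp add: \<sigma>_def algebra_simps)
  qed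
  obtain V where V: "emeasure lborel (ball (0::'a) R) = ennreal V" "0 \<le> V" by (rule ball_volume)
  obtain W where W: "emeasure lborel (ball (0::'a) 1) = ennreal W" "0 \<le> W" by (rule ball_volume)
  have "W \<noteq> 0"
  proof
    assume "W = 0"
    then have "emeasure lborel (ball (0::'a) 1) = 0" using W by simp
    then show False using emeasure_ball[of 1 "0::'a"] unit_ball_vol_pos[of "real DIM('a)"] by simp
  qed
  with W have W0: "0 < W" by simp
  define D where "D = (1 + W * V + 2 * W) * (1 + 1 / (1 - \<sigma>))"
  have D: "0 < D" unfolding D_def using V W sig by (intro mult_pos_pos add_pos_nonneg) auto
  show ?thesis
  proof (rule that[of "D / W"])
    show "0 < D / W" using D W0 by simp
    fix \<beta> v gv :: "'a \<Rightarrow> real" and B0 V0 :: real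
    assume [measurable]: "\<beta> \<in> borel_measurable borel" "v \<in> borel_measurable borel" "gv \<in> borel_measurable borel"
      and nn: "\<And>x. 0 \<le> \<beta> x" "\<And>x. 0 \<le> gv x"
      and rep: "\<And>x y. norm y < 1 \<Longrightarrow> ennreal \<bar>v x\<bar> \<le> ennreal \<bar>v (x + y)\<bar> + (\<integral>\<^sup>+\<rho>\<in>{0..1}. ennreal (gv (x + \<rho> *\<^sub>R y)) \<partial>lborel)"
      and BV: "0 < B0" "0 < V0"
      and b: "(\<integral>\<^sup>+x\<in>ball 0 R. ennreal (\<beta> x powr q) \<partial>lborel) \<le> ennreal (B0 powr q)"
      and v: "(\<integral>\<^sup>+x. ennreal (\<bar>v x\<bar> powr p) \<partial>lborel) \<le> ennreal (V0 powr p)"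
      and g: "(\<integral>\<^sup>+x. ennreal (gv x powr p) \<partial>lborel) \<le> ennreal (V0 powr p)"
    have scale: "ennreal (inverse (c powr s)) * X \<le> 1" if "X \<le> ennreal (c powr s)" "0 < c" for X c s
    proof -
      have "ennreal (inverse (c powr s)) * X \<le> ennreal (inverse (c powr s)) * ennreal (c powr s)"
        using that by (intro mult_left_mono) auto
      also have "\<dots> = 1" using that by (simp add: ennreal_mult[symmetric])
      finally show ?thesis .
    qed
    have 1: "(\<integral>\<^sup>+x\<in>ball 0 R. ennreal ((\<beta> x / B0) powr q) \<partial>lborel) \<le> 1"
    proof -
      have "(\<integral>\<^sup>+x\<in>ball 0 R. ennreal ((\<beta> x / B0) powr q) \<partial>lborel) = (\<integral>\<^sup>+x. ennreal (inverse (B0 powr q)) * (ennreal (\<beta> x powr q) * indicator (ball 0 R) x) \<partial>lborel)"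
      proof (intro nn_integral_cong)
        fix x
        have "ennreal ((\<beta> x / B0) powr q) = ennreal (inverse (B0 powr q)) * ennreal (\<beta> x powr q)"
          using nn BV by (simp add: powr_divide ennreal_mult[symmetric] field_simps)
        then show "ennreal ((\<beta> x / B0) powr q) * indicator (ball 0 R) x = ennreal (inverse (B0 powr q)) * (ennreal (\<beta> x powr q) * indicator (ball 0 R) x)"
          by (simp add: mult.assoc)
      qed
      then show ?thesis using scale[OF b BV(1)] by (simp add: nn_integral_cmult)
    qed
    have 2: "(\<integral>\<^sup>+x. ennreal (\<bar>v x / V0\<bar> powr p) \<partial>lborel) \<le> 1"
    proof -
      have "(\<integral>\<^sup>+x. ennreal (\<bar>v x / V0\<bar> powr p) \<partial>lborel) = (\<integral>\<^sup>+x. ennreal (inverse (V0 powr p)) * ennreal (\<bar>v x\<bar> powr p) \<partial>lborel)"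
        using BV by (intro nn_integral_cong) (simp add: powr_divide ennreal_mult[symmetric] field_simps)
      then show ?thesis using scale[OF v BV(2)] by (simp add: nn_integral_cmult)
    qed
    have 3: "(\<integral>\<^sup>+x. ennreal ((gv x / V0) powr p) \<partial>lborel) \<le> 1"
    proof -
      have "(\<integral>\<^sup>+x. ennreal ((gv x / V0) powr p) \<partial>lborel) = (\<integral>\<^sup>+x. ennreal (inverse (V0 powr p)) * ennreal (gv x powr p) \<partial>lborel)"
        using nn BV by (intro nn_integral_cong) (simp add: powr_divide ennreal_mult[symmetric] field_simps)
      then show ?thesis using scale[OF g BV(2)] by (simp add: nn_integral_cmult)
    qed
    have rep': "ennreal \<bar>v x / V0\<bar> \<le> ennreal \<bar>v (x + y) / V0\<bar> + (\<integral>\<^sup>+\<rho>\<in>{0..1}. ennreal (gv (x + \<rho> *\<^sub>R y) / V0) \<partial>lborel)" if "norm y < 1" for x y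
    proof -
      have "(\<integral>\<^sup>+\<rho>\<in>{0..1::real}. ennreal (gv (x + \<rho> *\<^sub>R y) / V0) \<partial>lborel) = ennreal (1 / V0) * (\<integral>\<^sup>+\<rho>\<in>{0..1}. ennreal (gv (x + \<rho> *\<^sub>R y)) \<partial>lborel)"
        using nn BV by (subst nn_integral_cmult[symmetric]) (auto simp: ennreal_mult[symmetric] mult.assoc[symmetric] intro!: nn_integral_cong)
      moreover have "ennreal \<bar>w / V0\<bar> = ennreal (1 / V0) * ennreal \<bar>w\<bar>" for w
        using BV by (simp add: ennreal_mult[symmetric])
      ultimately show ?thesis
        using mult_left_mono[OF rep[OF that, of x], of "ennreal (1 / V0)"] by (simp add: distrib_left)
    qed
    have X1: "ennreal W * (\<integral>\<^sup>+x\<in>ball 0 R. ennreal (\<beta> x / B0 * \<bar>v x / V0\<bar>) \<partial>lborel) \<le> ennreal D"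
      unfolding D_def \<sigma>_def
      by (rule spatial_pairing_unit[OF pq(1,2), where gv = "\<lambda>x. gv x / V0"])
        (use nn BV rep' 1 2 3 V W sig in \<open>auto simp: \<sigma>_def\<close>)
    have X2: "(\<integral>\<^sup>+x\<in>ball 0 R. ennreal (\<beta> x * \<bar>v x\<bar>) \<partial>lborel) = ennreal (B0 * V0) * (\<integral>\<^sup>+x\<in>ball 0 R. ennreal (\<beta> x / B0 * \<bar>v x / V0\<bar>) \<partial>lborel)"
      using nn BV by (subst nn_integral_cmult[symmetric]) (auto simp: ennreal_mult[symmetric] mult.assoc[symmetric] intro!: nn_integral_cong)
    have "ennreal W * (\<integral>\<^sup>+x\<in>ball 0 R. ennreal (\<beta> x * \<bar>v x\<bar>) \<partial>lborel) \<le> ennreal (B0 * V0) * ennreal D"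
      by (subst X2, subst mult.left_commute, rule mult_left_mono[OF X1]) simp
    then have "ennreal (1 / W) * (ennreal W * (\<integral>\<^sup>+x\<in>ball 0 R. ennreal (\<beta> x * \<bar>v x\<bar>) \<partial>lborel)) \<le> ennreal (1 / W) * (ennreal (B0 * V0) * ennreal D)"
      by (rule mult_left_mono) simp
    moreover have "ennreal (1 / W) * ennreal W = 1" using W0 by (simp add: ennreal_mult[symmetric])
    moreover have "ennreal (1 / W) * (ennreal (B0 * V0) * ennreal D) = ennreal (D / W * (B0 * V0))"
      using W0 BV D by (simp add: ennreal_mult[symmetric] mult_ac)
    ultimately show "(\<integral>\<^sup>+x\<in>ball 0 R. ennreal (\<beta> x * \<bar>v x\<bar>) \<partial>lborel) \<le> ennreal (D / W * (B0 * V0))"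
      by (simp add: mult.assoc[symmetric])
  qed
qed

section \<open>The drift in mixed norms over time and space\<close>

lemma enn_powr_measurable [measurable]:
  assumes [measurable]: "f \<in> borel_measurable M"
  shows "(\<lambda>x. enn_powr (f x) r) \<in> borel_measurable M"
  unfolding enn_powr_def by measurable

lemma enn_powr_add_one:
  assumes "0 \<le> r"
  shows "enn_powr (x + 1) r \<le> ennreal (2 powr r) * (enn_powr x r + 1)"
proof (cases x)
  case (real s)
  have "enn_powr (x + 1) r = ennreal ((s + 1) powr r)"
    using real enn_powr_ennreal[of "s + 1" r] by (simp add: ennreal_plus)
  also have "\<dots> \<le> ennreal (2 powr r * (s powr r + 1 powr r))"
    using real assms by (intro ennreal_leI powr_add_le) auto
  also have "\<dots> = ennreal (2 powr r) * (enn_powr x r + 1)"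
    using real by (simp add: enn_powr_ennreal ennreal_mult ennreal_plus)
  finally show ?thesis .
qed (simp add: enn_powr_def ennreal_mult_top)

text \<open>With p' = p/(p-1), this is the p'-th power of the norm of \<beta> in L_p' in time with
  values in L_q in space, over a cylinder; p' is dual to the exponent p of the function that \<beta>
  is paired with.\<close>

definition drift_norm :: "real \<Rightarrow> real \<Rightarrow> real \<Rightarrow> (real \<times> 'a::euclidean_space \<Rightarrow> real) \<Rightarrow> ennreal" where
  "drift_norm p q R \<beta> = (\<integral>\<^sup>+t\<in>{-R..R}. enn_powr (\<integral>\<^sup>+x\<in>ball 0 R. ennreal (\<beta> (t, x) powr q) \<partial>lborel) (p / (p - 1) / q) \<partial>lborel)"

lemma dd_spatial:
  fixes v :: "'n::finite pt \<Rightarrow> real"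
  assumes "C1 v"
  shows "dd (0, y) v z = y \<bullet> gradx v z"
proof -
  interpret bounded_linear "\<lambda>h. dd h v z" by (rule dd_linear[OF assms])
  have "(0, y) = (\<Sum>j\<in>UNIV. (y $ j) *\<^sub>R (e_x j :: 'n pt))"
  proof (rule prod_eqI)
    show "fst (0, y) = fst (\<Sum>j\<in>UNIV. (y $ j) *\<^sub>R (e_x j :: 'n pt))" by (simp add: fst_sum e_x_def)
    have "(\<Sum>j\<in>UNIV. (y $ j) *\<^sub>R axis j (1::real)) = y"
      using basis_expansion[of y] by (simp add: scalar_mult_eq_scaleR)
    then show "snd (0, y) = snd (\<Sum>j\<in>UNIV. (y $ j) *\<^sub>R (e_x j :: 'n pt))" by (simp add: snd_sum e_x_def)
  qed
  then have "dd (0, y) v z = (\<Sum>j\<in>UNIV. (y $ j) *\<^sub>R dd (e_x j) v z)"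
    by (simp only: sum scaleR)
  then show ?thesis by (simp add: inner_vec_def gradx_def)
qed

text \<open>The fundamental theorem of calculus along a segment within one time slice. It provides
  the hypothesis under which \<open>spatial_pairing\<close> applies to v and the norm of its
  gradient.\<close>

lemma C1_slice_representation:
  fixes v :: "'n::finite pt \<Rightarrow> real"
  assumes v: "C1 v" and y: "norm y < 1"
  shows "ennreal \<bar>v (t, x)\<bar> \<le> ennreal \<bar>v (t, x + y)\<bar> + (\<integral>\<^sup>+\<rho>\<in>{0..1}. ennreal (norm (gradx v (t, x + \<rho> *\<^sub>R y))) \<partial>lborel)"
proof -
  have cg: "continuous_on UNIV (gradx v)"
    unfolding gradx_def[abs_def] using C1_dd_continuous[OF v] by (intro continuous_on_vec_lambda)
  have c1: "continuous_on {0..1} (\<lambda>s. norm (gradx v (t, x + s *\<^sub>R y)))"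
    by (intro continuous_on_norm continuous_on_compose2[OF cg]) (auto intro!: continuous_intros)
  have c2: "continuous_on {0..1} (\<lambda>s. dd (0, y) v ((t, x) + s *\<^sub>R (0, y)))"
    by (intro continuous_on_compose2[OF C1_dd_continuous[OF v]]) (auto intro!: continuous_intros)
  define I where "I = integral {0..1} (\<lambda>s. norm (gradx v (t, x + s *\<^sub>R y)))"
  have hI: "((\<lambda>s. norm (gradx v (t, x + s *\<^sub>R y))) has_integral I) {0..1}"
    unfolding I_def by (intro integrable_integral integrable_continuous_real c1)
  have nnI: "(\<integral>\<^sup>+\<rho>\<in>{0..1}. ennreal (norm (gradx v (t, x + \<rho> *\<^sub>R y))) \<partial>lborel) = ennreal I"
    by (rule nn_integral_has_integral_lebesgue'[OF _ hI]) simp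
  have "((\<lambda>s. dd (0, y) v ((t, x) + s *\<^sub>R (0, y))) has_integral (v ((t, x) + 1 *\<^sub>R (0, y)) - v ((t, x) + 0 *\<^sub>R (0, y)))) {0..1}"
    using dd_line[OF v, of "(t, x)" "(0, y)"]
    by (intro fundamental_theorem_of_calculus) (auto simp: has_real_derivative_iff_has_vector_derivative[symmetric] intro: has_field_derivative_at_within)
  then have eq: "v (t, x + y) - v (t, x) = integral {0..1} (\<lambda>s. dd (0, y) v ((t, x) + s *\<^sub>R (0, y)))"
    by (simp add: integral_unique)
  have "norm (integral {0..1} (\<lambda>s. dd (0, y) v ((t, x) + s *\<^sub>R (0, y)))) \<le> I"
    unfolding I_def
  proof (rule integral_norm_bound_integral)
    fix s :: real
    have "\<bar>y \<bullet> gradx v (t, x + s *\<^sub>R y)\<bar> \<le> norm y * norm (gradx v (t, x + s *\<^sub>R y))" by (rule Cauchy_Schwarz_ineq2)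
    also have "\<dots> \<le> 1 * norm (gradx v (t, x + s *\<^sub>R y))" using y by (intro mult_right_mono) auto
    finally show "norm (dd (0, y) v ((t, x) + s *\<^sub>R (0, y))) \<le> norm (gradx v (t, x + s *\<^sub>R y))"
      by (simp add: dd_spatial[OF v])
  qed (intro integrable_continuous_real c1 c2)+
  then have "\<bar>v (t, x)\<bar> \<le> \<bar>v (t, x + y)\<bar> + I" unfolding eq[symmetric] by simp
  moreover have "0 \<le> I" unfolding I_def by (intro integral_nonneg integrable_continuous_real c1) auto
  ultimately show ?thesis
    unfolding nnI by (simp add: ennreal_plus[symmetric] ennreal_leI del: ennreal_plus)
qed

lemma nn_integral_pt:
  fixes f :: "real \<times> 'a::euclidean_space \<Rightarrow> ennreal"
  assumes "f \<in> borel_measurable borel"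
  shows "(\<integral>\<^sup>+z. f z \<partial>lborel) = (\<integral>\<^sup>+t. (\<integral>\<^sup>+x. f (t, x) \<partial>lborel) \<partial>lborel)"
  using lborel.nn_integral_fst[of f lborel] assms unfolding lborel_prod by simp

text \<open>In each time slice the spatial pairing gives a product B0 V0, and Young's inequality
  with the exponents p' and p splits it into terms that integrate over time to
  \<open>drift_norm\<close> and to L_p integrals.\<close>

theorem drift_pairing:
  assumes p: "1 < p" and q: "1 < q" "real CARD('n::finite) \<le> q" and R: "0 < R"
  obtains C where "0 < C"
    "\<And>\<beta> v :: 'n pt \<Rightarrow> real. \<beta> \<in> borel_measurable borel \<Longrightarrow> (\<And>z. 0 \<le> \<beta> z) \<Longrightarrow> C1 v \<Longrightarrow>
      (\<integral>\<^sup>+t\<in>{-R..R}. (\<integral>\<^sup>+x\<in>ball 0 R. ennreal (\<beta> (t, x) * \<bar>v (t, x)\<bar>) \<partial>lborel) \<partial>lborel)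
        \<le> ennreal C * (drift_norm p q R \<beta> + ennreal (2 * R) + pint p v + pint p (gradx v))"
proof -
  have dim: "real DIM(real ^ 'n) \<le> q" using q(2) by simp
  show ?thesis
  proof (rule spatial_pairing[where R = R, OF p q(1) dim])
  fix C0 :: real
  assume C0: "0 < C0"
    "\<And>(\<beta>::real ^ 'n \<Rightarrow> real) v gv B0 V0. \<beta> \<in> borel_measurable borel \<Longrightarrow> v \<in> borel_measurable borel \<Longrightarrow> gv \<in> borel_measurable borel \<Longrightarrow>
      (\<And>x. 0 \<le> \<beta> x) \<Longrightarrow> (\<And>x. 0 \<le> gv x) \<Longrightarrow>
      (\<And>x y. norm y < 1 \<Longrightarrow> ennreal \<bar>v x\<bar> \<le> ennreal \<bar>v (x + y)\<bar> + (\<integral>\<^sup>+\<rho>\<in>{0..1}. ennreal (gv (x + \<rho> *\<^sub>R y)) \<partial>lborel)) \<Longrightarrow>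
      0 < B0 \<Longrightarrow> 0 < V0 \<Longrightarrow> (\<integral>\<^sup>+x\<in>ball 0 R. ennreal (\<beta> x powr q) \<partial>lborel) \<le> ennreal (B0 powr q) \<Longrightarrow>
      (\<integral>\<^sup>+x. ennreal (\<bar>v x\<bar> powr p) \<partial>lborel) \<le> ennreal (V0 powr p) \<Longrightarrow>
      (\<integral>\<^sup>+x. ennreal (gv x powr p) \<partial>lborel) \<le> ennreal (V0 powr p) \<Longrightarrow>
      (\<integral>\<^sup>+x\<in>ball 0 R. ennreal (\<beta> x * \<bar>v x\<bar>) \<partial>lborel) \<le> ennreal (C0 * (B0 * V0))"
  define p' where "p' = p / (p - 1)"
  define r where "r = p' / q"
  have p': "0 < p'" "1 < p'" "1 / p' + 1 / p = 1" using p by (auto simp: p'_def field_simps)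
  have r: "0 < r" using p' q by (simp add: r_def)
  define C where "C = C0 * (2 powr r + 1)"
  have C: "0 < C" using C0 by (simp add: C_def add_pos_pos)
  show ?thesis
  proof (rule that[OF C])
    fix \<beta> v :: "'n pt \<Rightarrow> real"
    assume [measurable]: "\<beta> \<in> borel_measurable borel" and nn: "\<And>z. 0 \<le> \<beta> z" and v: "C1 v"
    have mb [measurable]: "\<beta> \<in> borel_measurable (borel \<Otimes>\<^sub>M borel)" by (simp add: borel_prod)
    have mv [measurable]: "v \<in> borel_measurable borel" using borel_measurable_continuous_onI[OF C1_continuous[OF v]] .
    have mg [measurable]: "gradx v \<in> borel_measurable borel"
      unfolding gradx_def[abs_def] using C1_dd_continuous[OF v] by (intro borel_measurable_continuous_onI continuous_on_vec_lambda)
    have [measurable]: "v \<in> borel_measurable (borel \<Otimes>\<^sub>M borel)" "gradx v \<in> borel_measurable (borel \<Otimes>\<^sub>M borel)"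
      by (simp_all add: borel_prod)
    define B where "B t = (\<integral>\<^sup>+x\<in>ball 0 R. ennreal (\<beta> (t, x) powr q) \<partial>lborel)" for t
    define V where "V t = (\<integral>\<^sup>+x. ennreal (\<bar>v (t, x)\<bar> powr p) \<partial>lborel)" for t
    define G where "G t = (\<integral>\<^sup>+x. ennreal (norm (gradx v (t, x)) powr p) \<partial>lborel)" for t
    have [measurable]: "B \<in> borel_measurable borel" "V \<in> borel_measurable borel" "G \<in> borel_measurable borel"
      unfolding B_def V_def G_def by measurable
    have J: "(\<integral>\<^sup>+x\<in>ball 0 R. ennreal (\<beta> (t, x) * \<bar>v (t, x)\<bar>) \<partial>lborel) \<le> ennreal C * (enn_powr (B t) r + 1 + V t + G t)" for t
    proof (cases "B t = \<infinity> \<or> V t = \<infinity> \<or> G t = \<infinity>")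
      case True
      then have inf: "enn_powr (B t) r + 1 + V t + G t = \<infinity>" by (auto simp: enn_powr_def)
      show ?thesis unfolding inf using C by (simp add: ennreal_mult_top)
    next
      case False
      obtain b where b: "B t = ennreal b" "0 \<le> b" using False by (cases "B t") auto
      obtain w where w: "V t = ennreal w" "0 \<le> w" using False by (cases "V t") auto
      obtain g where g: "G t = ennreal g" "0 \<le> g" using False by (cases "G t") auto
      \<comment> \<open>The summand 1 makes B0, and likewise V0, positive as the spatial pairing
        demands, even when a slice vanishes. Integrated over time it becomes the term 2 R.\<close>
      define B0 where "B0 = (b + 1) powr (1 / q)"
      define V0 where "V0 = (w + g + 1) powr (1 / p)"
      have B0: "0 < B0" "B0 powr q = b + 1" using b q by (auto simp: B0_def powr_powr)
      have V0: "0 < V0" "V0 powr p = w + g + 1" using w g p by (auto simp: V0_def powr_powr)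
      have "(\<integral>\<^sup>+x\<in>ball 0 R. ennreal (\<beta> (t, x) * \<bar>v (t, x)\<bar>) \<partial>lborel) \<le> ennreal (C0 * (B0 * V0))"
      proof (rule C0(2)[of "\<lambda>x. \<beta> (t, x)" "\<lambda>x. v (t, x)" "\<lambda>x. norm (gradx v (t, x))"])
        show "(\<integral>\<^sup>+x\<in>ball 0 R. ennreal (\<beta> (t, x) powr q) \<partial>lborel) \<le> ennreal (B0 powr q)"
          using b by (simp add: B_def B0(2) ennreal_leI)
        show "(\<integral>\<^sup>+x. ennreal (\<bar>v (t, x)\<bar> powr p) \<partial>lborel) \<le> ennreal (V0 powr p)"
          using w g by (simp add: V_def V0(2) ennreal_leI)
        show "(\<integral>\<^sup>+x. ennreal (norm (gradx v (t, x)) powr p) \<partial>lborel) \<le> ennreal (V0 powr p)"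
          using w g by (simp add: G_def V0(2) ennreal_leI)
      qed (use nn B0 V0 C1_slice_representation[OF v] in simp_all)
      also have "\<dots> \<le> ennreal (C0 * (B0 powr p' / p' + V0 powr p / p))"
        using C0(1) B0 V0 Youngs_inequality[of p' p B0 V0] p p' by (intro ennreal_leI mult_left_mono) auto
      also have "\<dots> \<le> ennreal (C0 * (B0 powr p' + V0 powr p))"
      proof (intro ennreal_leI mult_left_mono add_mono)
        have *: "x / y \<le> x" if "0 \<le> x" "1 < y" for x y :: real
          using that mult_right_mono[of 1 y x] by (simp add: field_simps)
        show "B0 powr p' / p' \<le> B0 powr p'" "V0 powr p / p \<le> V0 powr p" using * p p' by auto
      qed (use C0 in auto)
      also have "B0 powr p' = (b + 1) powr r" by (simp add: B0_def powr_powr r_def)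
      also have "V0 powr p = w + g + 1" by (rule V0(2))
      also have "ennreal (C0 * ((b + 1) powr r + (w + g + 1))) \<le> ennreal (C0 * ((2 powr r + 1) * (b powr r + 1 + w + g)))"
      proof (intro ennreal_leI mult_left_mono)
        have "(b + 1) powr r \<le> 2 powr r * (b powr r + 1)" using powr_add_le[of b 1 r] b r by simp
        moreover have "0 \<le> 2 powr r * w" "0 \<le> 2 powr r * g" "0 \<le> b powr r" using w g by auto
        ultimately show "(b + 1) powr r + (w + g + 1) \<le> (2 powr r + 1) * (b powr r + 1 + w + g)"
          unfolding distrib_left distrib_right mult_1 mult_1_right by linarith
      qed (use C0 in auto)
      also have "\<dots> = ennreal C * (enn_powr (B t) r + 1 + V t + G t)"
      proof -
        have *: "enn_powr (B t) r + 1 + V t + G t = ennreal (b powr r + 1 + w + g)"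
          using b w g by (simp add: enn_powr_ennreal)
        have "ennreal C * ennreal (b powr r + 1 + w + g) = ennreal (C * (b powr r + 1 + w + g))"
          using C w g b by (intro ennreal_mult[symmetric]) auto
        then show ?thesis unfolding * by (simp only: C_def mult.assoc)
      qed
      finally show ?thesis .
    qed
    have "(\<integral>\<^sup>+t\<in>{-R..R}. (\<integral>\<^sup>+x\<in>ball 0 R. ennreal (\<beta> (t, x) * \<bar>v (t, x)\<bar>) \<partial>lborel) \<partial>lborel)
       \<le> (\<integral>\<^sup>+t. ennreal C * ((enn_powr (B t) r * indicator {-R..R} t + 1 * indicator {-R..R} t) + (V t + G t)) \<partial>lborel)"
      by (intro nn_integral_mono) (use J in \<open>auto simp: indicator_def add.assoc\<close>)
    also have "\<dots> = ennreal C * (((\<integral>\<^sup>+t\<in>{-R..R}. enn_powr (B t) r \<partial>lborel) + emeasure lborel {-R..R}) + ((\<integral>\<^sup>+t. V t \<partial>lborel) + (\<integral>\<^sup>+t. G t \<partial>lborel)))"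
      by (simp add: nn_integral_add nn_integral_cmult)
    also have "(\<integral>\<^sup>+t. V t \<partial>lborel) = pint p v"
      unfolding V_def pint_def by (subst nn_integral_pt) simp_all
    also have "(\<integral>\<^sup>+t. G t \<partial>lborel) = pint p (gradx v)"
      unfolding G_def pint_def by (subst nn_integral_pt) simp_all
    also have "(\<integral>\<^sup>+t\<in>{-R..R}. enn_powr (B t) r \<partial>lborel) = drift_norm p q R \<beta>"
      by (simp add: drift_norm_def B_def r_def p'_def)
    also have "emeasure lborel {-R..R} = ennreal (2 * R)" using R by simp
    finally show "(\<integral>\<^sup>+t\<in>{-R..R}. (\<integral>\<^sup>+x\<in>ball 0 R. ennreal (\<beta> (t, x) * \<bar>v (t, x)\<bar>) \<partial>lborel) \<partial>lborel)
        \<le> ennreal C * (drift_norm p q R \<beta> + ennreal (2 * R) + pint p v + pint p (gradx v))"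
      by (simp add: add.assoc)
  qed
  qed
qed

text \<open>Assumption B controls an oscillation in L_q, Assumption P a mean in L_1; comparing f(x +
  y) with one well-chosen value f(x + y0) turns the two into an L_q bound.\<close>

lemma local_drift_bound:
  assumes q: "1 < q" and \<alpha>: "0 < \<alpha>" and g: "0 \<le> g"
  obtains C where "0 < C"
    "\<And>(f :: 'a::euclidean_space \<Rightarrow> 'b::euclidean_space) x. f \<in> borel_measurable borel \<Longrightarrow>
      (\<integral>\<^sup>+y\<in>ball 0 \<alpha>. \<integral>\<^sup>+w\<in>ball 0 \<alpha>. ennreal (norm (f (x + y) - f (x + w)) powr q) \<partial>lborel \<partial>lborel) \<le> ennreal g \<Longrightarrow>
      (\<integral>\<^sup>+y\<in>ball 0 \<alpha>. ennreal (norm (f (x + y)) powr q) \<partial>lborel)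
        \<le> ennreal C * (1 + enn_powr (\<integral>\<^sup>+y\<in>ball 0 \<alpha>. ennreal (norm (f (x + y))) \<partial>lborel) q)"
proof -
  obtain W where W: "emeasure lborel (ball (0::'a) \<alpha>) = ennreal W" "0 \<le> W" by (rule ball_volume)
  have "W \<noteq> 0"
  proof
    assume "W = 0"
    then have "emeasure lborel (ball (0::'a) \<alpha>) = 0" using W by simp
    then show False using emeasure_ball[of \<alpha> "0::'a"] unit_ball_vol_pos[of "real DIM('a)"] \<alpha> by simp
  qed
  with W have W0: "0 < W" by simp
  \<comment> \<open>Divided by H + 1 and g + 1, the values and the oscillations each integrate over
    the ball to at most 1; a sum exceeding 3 / W throughout would integrate to at least 3.\<close>
  define k where "k = 3 / W"
  have k: "0 < k" using W0 by (simp add: k_def)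
  define C where "C = 2 powr q * (k * (g + 1) + W * (k powr q * 2 powr q))"
  have C: "0 < C" unfolding C_def using k g W0 by (intro mult_pos_pos add_pos_pos[of "k * (g + 1)"] add_nonneg_pos) auto
  show ?thesis
  proof (rule that[OF C])
    fix f :: "'a \<Rightarrow> 'b" and x
    assume [measurable]: "f \<in> borel_measurable borel"
      and I: "(\<integral>\<^sup>+y\<in>ball 0 \<alpha>. \<integral>\<^sup>+w\<in>ball 0 \<alpha>. ennreal (norm (f (x + y) - f (x + w)) powr q) \<partial>lborel \<partial>lborel) \<le> ennreal g"
    define h where "h = (\<integral>\<^sup>+y\<in>ball 0 \<alpha>. ennreal (norm (f (x + y))) \<partial>lborel)"
    define E where "E y = (\<integral>\<^sup>+w\<in>ball 0 \<alpha>. ennreal (norm (f (x + y) - f (x + w)) powr q) \<partial>lborel)" for y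
    have [measurable]: "E \<in> borel_measurable borel" unfolding E_def by measurable
    have "(\<integral>\<^sup>+y\<in>ball 0 \<alpha>. ennreal (norm (f (x + y)) powr q) \<partial>lborel) \<le> ennreal C * (1 + enn_powr h q)"
    proof (cases "h = \<infinity>")
      case True
      then have "1 + enn_powr h q = \<infinity>" by (simp add: enn_powr_def)
      then show ?thesis using C by (simp add: ennreal_mult_top)
    next
      case False
      then obtain H where H: "h = ennreal H" "0 \<le> H" by (cases h) auto
      txt \<open>Chebyshev: some point of the ball has both small oscillation and small value.\<close>
      have "\<exists>y\<in>ball 0 \<alpha>. ennreal (1 / (H + 1)) * ennreal (norm (f (x + y))) + ennreal (1 / (g + 1)) * E y \<le> ennreal k"
      proof (rule ccontr)
        assume "\<not> ?thesis"
        then have "ennreal k * indicator (ball 0 \<alpha>) y \<le> ennreal (1 / (H + 1)) * (ennreal (norm (f (x + y))) * indicator (ball 0 \<alpha>) y) + ennreal (1 / (g + 1)) * (E y * indicator (ball 0 \<alpha>) y)" for y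
          by (cases "y \<in> ball 0 \<alpha>") (auto simp: not_le less_imp_le)
        then have "(\<integral>\<^sup>+y. ennreal k * indicator (ball (0::'a) \<alpha>) y \<partial>lborel)
          \<le> (\<integral>\<^sup>+y. ennreal (1 / (H + 1)) * (ennreal (norm (f (x + y))) * indicator (ball 0 \<alpha>) y) + ennreal (1 / (g + 1)) * (E y * indicator (ball 0 \<alpha>) y) \<partial>lborel)"
          by (intro nn_integral_mono)
        also have "\<dots> = ennreal (1 / (H + 1)) * h + ennreal (1 / (g + 1)) * (\<integral>\<^sup>+y\<in>ball 0 \<alpha>. E y \<partial>lborel)"
          by (simp add: nn_integral_add nn_integral_cmult h_def)
        also have "\<dots> \<le> ennreal (1 / (H + 1)) * ennreal H + ennreal (1 / (g + 1)) * ennreal g"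
          using I H unfolding E_def by (intro add_mono mult_left_mono) auto
        also have "\<dots> = ennreal (H / (H + 1) + g / (g + 1))"
          using H g by (simp add: ennreal_mult[symmetric] ennreal_plus[symmetric] del: ennreal_plus)
        also have "\<dots> \<le> ennreal 2"
        proof (rule ennreal_leI)
          have "H / (H + 1) \<le> 1" "g / (g + 1) \<le> 1" using H g by auto
          then show "H / (H + 1) + g / (g + 1) \<le> 2" by linarith
        qed
        also have "(\<integral>\<^sup>+y. ennreal k * indicator (ball (0::'a) \<alpha>) y \<partial>lborel) = ennreal 3"
          using W0 by (simp add: nn_integral_cmult_indicator W k_def ennreal_mult[symmetric] del: ennreal_numeral)
        finally show False by (simp del: ennreal_numeral)
      qed
      then obtain y0 where y0: "y0 \<in> ball 0 \<alpha>" "ennreal (1 / (H + 1)) * ennreal (norm (f (x + y0))) + ennreal (1 / (g + 1)) * E y0 \<le> ennreal k" by blast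
      have "ennreal (1 / (H + 1)) * ennreal (norm (f (x + y0))) \<le> ennreal k"
        using y0(2) by (rule order.trans[rotated]) simp
      then have f0: "norm (f (x + y0)) \<le> k * (H + 1)"
        using H k by (simp add: ennreal_mult[symmetric] field_simps)
      have "ennreal (1 / (g + 1)) * E y0 \<le> ennreal k"
        using y0(2) by (rule order.trans[rotated]) simp
      then have "ennreal (g + 1) * (ennreal (1 / (g + 1)) * E y0) \<le> ennreal (g + 1) * ennreal k"
        by (rule mult_left_mono) simp
      moreover have "ennreal (g + 1) * (ennreal (1 / (g + 1)) * E y0) = E y0"
        unfolding mult.assoc[symmetric] using g by (subst ennreal_mult[symmetric]) auto
      moreover have "ennreal (g + 1) * ennreal k = ennreal (k * (g + 1))"
        using g k by (subst ennreal_mult[symmetric]) (auto simp: mult.commute)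
      ultimately have E0: "E y0 \<le> ennreal (k * (g + 1))"
        by (simp only:)
      have "(\<integral>\<^sup>+y\<in>ball 0 \<alpha>. ennreal (norm (f (x + y)) powr q) \<partial>lborel)
        \<le> (\<integral>\<^sup>+y. ennreal (2 powr q) * (ennreal (norm (f (x + y0) - f (x + y)) powr q) * indicator (ball 0 \<alpha>) y + ennreal ((k * (H + 1)) powr q) * indicator (ball 0 \<alpha>) y) \<partial>lborel)"
      proof (intro nn_integral_mono)
        fix y
        have "norm (f (x + y)) \<le> norm (f (x + y0) - f (x + y)) + norm (f (x + y0))"
          using norm_triangle_ineq4[of "f (x + y0)" "f (x + y0) - f (x + y)"] by simp
        then have "norm (f (x + y)) powr q \<le> (norm (f (x + y0) - f (x + y)) + k * (H + 1)) powr q"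
          using f0 q by (intro powr_mono2) auto
        also have "\<dots> \<le> 2 powr q * (norm (f (x + y0) - f (x + y)) powr q + (k * (H + 1)) powr q)"
          using k H q by (intro powr_add_le) auto
        finally have "ennreal (norm (f (x + y)) powr q) \<le> ennreal (2 powr q) * (ennreal (norm (f (x + y0) - f (x + y)) powr q) + ennreal ((k * (H + 1)) powr q))"
          by (simp add: ennreal_mult[symmetric] ennreal_plus[symmetric] ennreal_leI del: ennreal_plus)
        then show "ennreal (norm (f (x + y)) powr q) * indicator (ball 0 \<alpha>) y \<le> ennreal (2 powr q) * (ennreal (norm (f (x + y0) - f (x + y)) powr q) * indicator (ball 0 \<alpha>) y + ennreal ((k * (H + 1)) powr q) * indicator (ball 0 \<alpha>) y)"
          by (auto simp: indicator_def)
      qed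
      also have "\<dots> = ennreal (2 powr q) * (E y0 + ennreal ((k * (H + 1)) powr q) * ennreal W)"
        by (simp add: nn_integral_cmult nn_integral_add nn_integral_cmult_indicator E_def W)
      also have "\<dots> \<le> ennreal (2 powr q) * (ennreal (k * (g + 1)) + ennreal ((k * (H + 1)) powr q) * ennreal W)"
        by (intro mult_left_mono add_mono E0) auto
      also have "\<dots> = ennreal (2 powr q * (k * (g + 1) + (k * (H + 1)) powr q * W))"
        using k g W by (simp add: ennreal_mult[symmetric] ennreal_plus[symmetric] del: ennreal_plus)
      also have "\<dots> \<le> ennreal (C * (1 + H powr q))"
      proof (rule ennreal_leI)
        have "(k * (H + 1)) powr q \<le> k powr q * (2 powr q * (H powr q + 1))"
          using powr_add_le[of H 1 q] H q k by (simp add: powr_mult mult_left_mono)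
        then have "(k * (H + 1)) powr q * W \<le> W * (k powr q * 2 powr q) * (1 + H powr q)"
          using W0 by (simp add: mult_right_mono algebra_simps) (metis W(2) distrib_left mult.commute mult.left_commute mult_left_mono)
        moreover have "k * (g + 1) \<le> k * (g + 1) * (1 + H powr q)"
          using mult_left_mono[of 1 "1 + H powr q" "k * (g + 1)"] mult_nonneg_nonneg[of k "g + 1"] k g by simp
        ultimately have "k * (g + 1) + (k * (H + 1)) powr q * W \<le> (k * (g + 1) + W * (k powr q * 2 powr q)) * (1 + H powr q)"
          by (simp add: distrib_right)
        then show "2 powr q * (k * (g + 1) + (k * (H + 1)) powr q * W) \<le> C * (1 + H powr q)"
          unfolding C_def mult.assoc by (intro mult_left_mono) auto
      qed
      also have "\<dots> = ennreal C * (1 + enn_powr h q)"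
        using H C by (simp add: enn_powr_ennreal ennreal_mult ennreal_plus)
      finally show ?thesis .
    qed
    then show "(\<integral>\<^sup>+y\<in>ball 0 \<alpha>. ennreal (norm (f (x + y)) powr q) \<partial>lborel)
        \<le> ennreal C * (1 + enn_powr (\<integral>\<^sup>+y\<in>ball 0 \<alpha>. ennreal (norm (f (x + y))) \<partial>lborel) q)"
      by (simp add: h_def)
  qed
qed

lemma enn_powr_sum_le:
  assumes "finite F" "0 \<le> r"
  shows "enn_powr (\<Sum>i\<in>F. f i) r \<le> ennreal (real (card F) powr r) * (\<Sum>i\<in>F. enn_powr (f i) r)"
proof (cases "F = {}")
  case False
  show ?thesis
  proof (cases "\<exists>i\<in>F. f i = \<infinity>")
    case True
    then obtain i where i: "i \<in> F" "f i = \<infinity>" by blast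
    have "enn_powr (f i) r \<le> (\<Sum>i\<in>F. enn_powr (f i) r)"
      using assms(1) i by (intro member_le_sum) auto
    then have "(\<Sum>i\<in>F. enn_powr (f i) r) = \<infinity>"
      using i by (simp add: enn_powr_def top_unique)
    moreover have "0 < real (card F) powr r" using False assms(1) by (simp add: card_gt_0_iff)
    ultimately show ?thesis by (simp add: ennreal_mult_top)
  next
    case fin: False
    define g where "g i = enn2real (f i)" for i
    have g: "f i = ennreal (g i)" "0 \<le> g i" if "i \<in> F" for i
    proof -
      have "f i \<noteq> top" using fin that by auto
      then have "f i < top" unfolding less_top .
      then show "f i = ennreal (g i)" unfolding g_def by (rule ennreal_enn2real[symmetric])
    qed (simp add: g_def)
    define m where "m = Max (g ` F)"
    have "m \<in> g ` F" unfolding m_def using assms(1) False by (intro Max_in) auto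
    then obtain j where j: "j \<in> F" "m = g j" by auto
    have le: "g i \<le> m" if "i \<in> F" for i unfolding m_def using assms(1) that by auto
    have "(\<Sum>i\<in>F. f i) = (\<Sum>i\<in>F. ennreal (g i))" by (rule sum.cong[OF refl g(1)])
    also have "\<dots> = ennreal (\<Sum>i\<in>F. g i)" by (rule sum_ennreal[OF g(2)])
    finally have "enn_powr (\<Sum>i\<in>F. f i) r = ennreal ((\<Sum>i\<in>F. g i) powr r)"
      using g by (simp add: enn_powr_ennreal sum_nonneg)
    also have "\<dots> \<le> ennreal ((real (card F) * m) powr r)"
      using g le assms by (intro ennreal_leI powr_mono2 sum_bounded_above) (auto intro: sum_nonneg)
    also have "\<dots> = ennreal (real (card F) powr r) * enn_powr (f j) r"
      using j g by (simp add: powr_mult ennreal_mult enn_powr_ennreal)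
    also have "\<dots> \<le> ennreal (real (card F) powr r) * (\<Sum>i\<in>F. enn_powr (f i) r)"
      using j assms by (intro mult_left_mono member_le_sum) auto
    finally show ?thesis .
  qed
qed simp

lemma enn_powr_mult:
  assumes "0 < c"
  shows "enn_powr (ennreal c * x) r = ennreal (c powr r) * enn_powr x r"
proof (cases x)
  case (real s)
  then show ?thesis
    using assms by (simp add: ennreal_mult[symmetric] enn_powr_ennreal powr_mult)
qed (use assms in \<open>simp add: enn_powr_def ennreal_mult_top\<close>)

lemma enn_powr_powr:
  assumes "0 \<le> r" "0 < s"
  shows "enn_powr (enn_powr x s) r = enn_powr x (s * r)"
proof (cases x)
  case (real y)
  then show ?thesis by (simp add: enn_powr_ennreal powr_powr)
qed (simp add: enn_powr_def)

lemma AE_shift: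
  fixes x :: "'a::euclidean_space"
  assumes "AE y in lborel. Q y"
  shows "AE y in lborel. Q (x + y)"
proof -
  have "AE y in distr lborel borel ((+) x). Q y" unfolding lborel_distr_plus by (rule assms)
  then show ?thesis by (rule AE_distrD[rotated]) simp
qed

text \<open>Exchanging the two quantifiers needs a measurable set, and Q is arbitrary; it is
  replaced by the complement of a measurable null set.\<close>

lemma AE_slice:
  fixes Q :: "real \<times> 'a::euclidean_space \<Rightarrow> bool"
  assumes "AE z in lborel. Q z"
  shows "AE t in lborel. AE x in lborel. Q (t, x)" "AE x in lborel. AE t in lborel. Q (t, x)"
proof -
  have "AE z in (lborel \<Otimes>\<^sub>M lborel :: (real \<times> 'a) measure). Q z" unfolding lborel_prod by (rule assms)
  then obtain N where N: "{z \<in> space (lborel \<Otimes>\<^sub>M lborel). \<not> Q z} \<subseteq> N" "N \<in> null_sets (lborel \<Otimes>\<^sub>M lborel :: (real \<times> 'a) measure)"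
    by (auto elim!: AE_E simp: null_sets_def)
  have NQ: "z \<notin> N \<Longrightarrow> Q z" for z using N(1) by (auto simp: space_pair_measure)
  have 1: "AE z in (lborel \<Otimes>\<^sub>M lborel :: (real \<times> 'a) measure). z \<notin> N" using N(2) by (rule AE_not_in)
  have 2: "AE t in lborel. AE x in lborel. (t, x) \<notin> N" using lborel_pair.AE_pair[OF 1] .
  show "AE t in lborel. AE x in lborel. Q (t, x)" using 2 NQ by (auto elim!: eventually_mono)
  have "{z \<in> space (lborel \<Otimes>\<^sub>M lborel). (fst z, snd z) \<notin> N} = space (lborel \<Otimes>\<^sub>M lborel) - N" by auto
  moreover have "N \<in> sets (lborel \<Otimes>\<^sub>M lborel)" using N(2) by blast
  ultimately have "{z \<in> space (lborel \<Otimes>\<^sub>M lborel). (fst z, snd z) \<notin> N} \<in> sets (lborel \<Otimes>\<^sub>M lborel)"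
    by (simp only: sets.compl_sets)
  from lborel_pair.AE_commute[OF this] 2 have "AE x in lborel. AE t in lborel. (t, x) \<notin> N" by blast
  then show "AE x in lborel. AE t in lborel. Q (t, x)" using NQ by (auto elim!: eventually_mono)
qed

text \<open>Assumption B holds at almost every (t, x), whereas a covering centre has to be good for
  almost every t. By Fubini almost every x is good, so good centres are dense and finitely many
  balls of radius \<alpha> about them cover the ball of radius R. In each of them
  \<open>local_drift_bound\<close> applies slice by slice, and P makes the resulting power of the
  L_1 mean summable in time.\<close>

lemma drift_norm_finite:
  fixes b bb :: "'n::finite pt \<Rightarrow> real ^ 'n"
  assumes p: "1 < p" and q: "1 < q" and [measurable]: "bb \<in> borel_measurable borel"
    and eq: "AE z in lborel. b z = bb z"
    and P2: "\<And>x \<alpha> s t. 0 < \<alpha> \<Longrightarrow> \<alpha> \<le> 1 \<Longrightarrow>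
         (\<integral>\<^sup>+ \<tau>\<in>{s..t}. enn_powr (\<integral>\<^sup>+ y\<in>ball 0 \<alpha>. ennreal (norm (b (\<tau>, x + y))) \<partial>lebesgue) (p / (p - 1)) \<partial>lebesgue) < \<infinity>"
    and B: "AssumpB q \<alpha> \<gamma>b b" and g0: "0 \<le> \<gamma>b"
  shows "drift_norm p q R (\<lambda>z. norm (bb z)) < \<infinity>"
proof -
  have [measurable]: "bb \<in> borel_measurable (borel \<Otimes>\<^sub>M borel)" by (simp add: borel_prod)
  have al: "0 < \<alpha>" "\<alpha> \<le> 1" using B by (auto simp: AssumpB_def)
  define d where "d = real CARD('n)"
  define p' where "p' = p / (p - 1)"
  have p': "0 < p'" using p by (simp add: p'_def)
  define r where "r = p' / q"
  have r: "0 \<le> r" using p' q by (simp add: r_def)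
  \<comment> \<open>The averaging factor \<alpha>^(-d) of Assumption B, moved to the right-hand
    side.\<close>
  define g where "g = \<alpha> powr d * \<gamma>b"
  have g: "0 \<le> g" using g0 by (simp add: g_def)
  define Q where "Q z \<longleftrightarrow> (\<integral>\<^sup>+ y\<in>ball 0 \<alpha>. \<integral>\<^sup>+ w\<in>ball 0 \<alpha>.
             ennreal (norm (b (fst z, snd z + y) - b (fst z, snd z + w)) powr q) \<partial>lborel \<partial>lborel) \<le> ennreal g" for z
  have "AE z in lborel. Q z"
  proof -
    have "AE z in lborel. ennreal (\<alpha> powr (- d)) *
         (\<integral>\<^sup>+ y\<in>ball 0 \<alpha>. \<integral>\<^sup>+ w\<in>ball 0 \<alpha>.
             ennreal (norm (b (fst z, snd z + y) - b (fst z, snd z + w)) powr q) \<partial>lborel \<partial>lborel) \<le> ennreal \<gamma>b"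
      using B by (simp add: AssumpB_def AE_completion_iff nn_integral_completion d_def)
    then show ?thesis
    proof (rule eventually_mono)
      fix z
      let ?I = "(\<integral>\<^sup>+ y\<in>ball 0 \<alpha>. \<integral>\<^sup>+ w\<in>ball 0 \<alpha>. ennreal (norm (b (fst z, snd z + y) - b (fst z, snd z + w)) powr q) \<partial>lborel \<partial>lborel)"
      assume "ennreal (\<alpha> powr (- d)) * ?I \<le> ennreal \<gamma>b"
      then have "ennreal (\<alpha> powr d) * (ennreal (\<alpha> powr (- d)) * ?I) \<le> ennreal (\<alpha> powr d) * ennreal \<gamma>b"
        by (rule mult_left_mono) simp
      moreover have "ennreal (\<alpha> powr d) * ennreal (\<alpha> powr (- d)) = 1"
        using al by (simp add: ennreal_mult[symmetric] powr_add[symmetric])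
      ultimately show "Q z" unfolding Q_def g_def using g0 by (simp add: mult.assoc[symmetric] ennreal_mult)
    qed
  qed
  from AE_slice(2)[OF this] have aeX: "AE x in lborel. AE t in lborel. Q (t, x)" .
  define X where "X = {x. AE t in lborel. Q (t, x)}"
  \<comment> \<open>A ball consisting of bad centres would be a null set of positive volume.\<close>
  have dense: "\<exists>x\<in>X. dist x x0 < \<alpha>" for x0
  proof (rule ccontr)
    assume "\<not> ?thesis"
    then have sub: "x \<in> ball x0 \<alpha> \<Longrightarrow> x \<notin> X" for x by (auto simp: dist_commute)
    have "AE x in lborel. x \<notin> ball x0 \<alpha>"
      using aeX by (rule eventually_mono) (use sub in \<open>auto simp: X_def\<close>)
    then have "emeasure lborel (ball x0 \<alpha>) = 0"
      by (subst (asm) AE_iff_measurable[of "ball x0 \<alpha>"]) auto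
    then show False using emeasure_ball[of \<alpha> x0] unit_ball_vol_pos[of "real DIM(real ^ 'n)"] al by simp
  qed
  obtain F where F: "F \<subseteq> X" "finite F" "cball 0 R \<subseteq> (\<Union>x\<in>F. ball x \<alpha>)"
  proof (rule compactE_image[of "cball (0::real ^ 'n) R" X "\<lambda>x. ball x \<alpha>"])
    show "cball 0 R \<subseteq> (\<Union>x\<in>X. ball x \<alpha>)" using dense by auto
  qed auto
  show ?thesis
  proof (rule local_drift_bound[OF q al(1) g, where ?'a = "real ^ 'n" and ?'b = "real ^ 'n"])
  fix C :: real
  assume C: "0 < C"
    "\<And>(f :: real ^ 'n \<Rightarrow> real ^ 'n) x. f \<in> borel_measurable borel \<Longrightarrow>
      (\<integral>\<^sup>+y\<in>ball 0 \<alpha>. \<integral>\<^sup>+w\<in>ball 0 \<alpha>. ennreal (norm (f (x + y) - f (x + w)) powr q) \<partial>lborel \<partial>lborel) \<le> ennreal g \<Longrightarrow>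
      (\<integral>\<^sup>+y\<in>ball 0 \<alpha>. ennreal (norm (f (x + y)) powr q) \<partial>lborel)
        \<le> ennreal C * (1 + enn_powr (\<integral>\<^sup>+y\<in>ball 0 \<alpha>. ennreal (norm (f (x + y))) \<partial>lborel) q)"
  define h where "h x t = (\<integral>\<^sup>+y\<in>ball 0 \<alpha>. ennreal (norm (bb (t, x + y))) \<partial>lborel)" for x t
  have [measurable]: "h x \<in> borel_measurable borel" for x unfolding h_def by measurable
  \<comment> \<open>P and B are stated for b. They pass to integrals of the Borel representative bb
    because almost every time slice of the exceptional set is null, and remains so after translation
    in x.\<close>
  have aet: "AE t in lborel. AE x in lborel. b (t, x) = bb (t, x)" using AE_slice(1)[OF eq] .
  have hfin: "(\<integral>\<^sup>+t\<in>{-R..R}. enn_powr (h x t) p' \<partial>lborel) < \<infinity>" for x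
  proof -
    have "(\<integral>\<^sup>+t\<in>{-R..R}. enn_powr (h x t) p' \<partial>lborel)
       = (\<integral>\<^sup>+ \<tau>\<in>{-R..R}. enn_powr (\<integral>\<^sup>+ y\<in>ball 0 \<alpha>. ennreal (norm (b (\<tau>, x + y))) \<partial>lborel) p' \<partial>lborel)"
    proof (intro nn_integral_cong_AE)
      show "AE t in lborel. enn_powr (h x t) p' * indicator {-R..R} t = enn_powr (\<integral>\<^sup>+ y\<in>ball 0 \<alpha>. ennreal (norm (b (t, x + y))) \<partial>lborel) p' * indicator {-R..R} t"
        using aet
      proof (rule eventually_mono)
        fix t assume "AE x in lborel. b (t, x) = bb (t, x)"
        from AE_shift[OF this, of x] have "h x t = (\<integral>\<^sup>+ y\<in>ball 0 \<alpha>. ennreal (norm (b (t, x + y))) \<partial>lborel)"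
          unfolding h_def by (intro nn_integral_cong_AE) (auto elim!: eventually_mono)
        then show "enn_powr (h x t) p' * indicator {-R..R} t = enn_powr (\<integral>\<^sup>+ y\<in>ball 0 \<alpha>. ennreal (norm (b (t, x + y))) \<partial>lborel) p' * indicator {-R..R} t"
          by simp
      qed
    qed
    also have "\<dots> < \<infinity>" using P2[OF al, where s = "-R" and t = R and x = x] by (simp add: nn_integral_completion p'_def)
    finally show ?thesis .
  qed
  have slice: "AE t in lborel. (\<integral>\<^sup>+y\<in>ball 0 \<alpha>. ennreal (norm (bb (t, x + y)) powr q) \<partial>lborel) \<le> ennreal C * (1 + enn_powr (h x t) q)"
    if "x \<in> X" for x
  proof -
    have "AE t in lborel. Q (t, x)" using that by (simp add: X_def)
    with aet show ?thesis
    proof eventually_elim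
      case (elim t)
      note ae = AE_shift[OF elim(1), of x]
      have "(\<integral>\<^sup>+y\<in>ball 0 \<alpha>. \<integral>\<^sup>+w\<in>ball 0 \<alpha>. ennreal (norm (bb (t, x + y) - bb (t, x + w)) powr q) \<partial>lborel \<partial>lborel)
        = (\<integral>\<^sup>+ y\<in>ball 0 \<alpha>. \<integral>\<^sup>+ w\<in>ball 0 \<alpha>. ennreal (norm (b (t, x + y) - b (t, x + w)) powr q) \<partial>lborel \<partial>lborel)"
      proof (intro nn_integral_cong_AE, rule eventually_mono[OF ae])
        fix y assume y: "b (t, x + y) = bb (t, x + y)"
        have "(\<integral>\<^sup>+w\<in>ball 0 \<alpha>. ennreal (norm (bb (t, x + y) - bb (t, x + w)) powr q) \<partial>lborel)
          = (\<integral>\<^sup>+w\<in>ball 0 \<alpha>. ennreal (norm (b (t, x + y) - b (t, x + w)) powr q) \<partial>lborel)"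
          by (intro nn_integral_cong_AE, rule eventually_mono[OF ae]) (simp add: y)
        then show "(\<integral>\<^sup>+w\<in>ball 0 \<alpha>. ennreal (norm (bb (t, x + y) - bb (t, x + w)) powr q) \<partial>lborel) * indicator (ball 0 \<alpha>) y
          = (\<integral>\<^sup>+w\<in>ball 0 \<alpha>. ennreal (norm (b (t, x + y) - b (t, x + w)) powr q) \<partial>lborel) * indicator (ball 0 \<alpha>) y"
          by simp
      qed
      also have "\<dots> \<le> ennreal g" using elim(2) by (simp add: Q_def)
      finally show ?case
        unfolding h_def by (intro C(2)) measurable
    qed
  qed
  have main: "AE t in lborel. enn_powr (\<integral>\<^sup>+x\<in>ball 0 R. ennreal (norm (bb (t, x)) powr q) \<partial>lborel) r
      \<le> ennreal (real (card F) powr r * (C powr r * 2 powr r)) * (\<Sum>x\<in>F. 1 + enn_powr (h x t) p')"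
  proof -
    have "AE t in lborel. \<forall>x\<in>F. (\<integral>\<^sup>+y\<in>ball 0 \<alpha>. ennreal (norm (bb (t, x + y)) powr q) \<partial>lborel) \<le> ennreal C * (1 + enn_powr (h x t) q)"
      using F slice by (intro AE_finite_allI) auto
    then show ?thesis
    proof (rule eventually_mono)
      fix t
      assume *: "\<forall>x\<in>F. (\<integral>\<^sup>+y\<in>ball 0 \<alpha>. ennreal (norm (bb (t, x + y)) powr q) \<partial>lborel) \<le> ennreal C * (1 + enn_powr (h x t) q)"
      have "(\<integral>\<^sup>+x\<in>ball 0 R. ennreal (norm (bb (t, x)) powr q) \<partial>lborel)
        \<le> (\<integral>\<^sup>+x'. (\<Sum>x\<in>F. ennreal (norm (bb (t, x')) powr q) * indicator (ball x \<alpha>) x') \<partial>lborel)"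
      proof (intro nn_integral_mono)
        fix x'
        show "ennreal (norm (bb (t, x')) powr q) * indicator (ball 0 R) x' \<le> (\<Sum>x\<in>F. ennreal (norm (bb (t, x')) powr q) * indicator (ball x \<alpha>) x')"
        proof (cases "x' \<in> ball 0 R")
          case True
          then have "x' \<in> cball 0 R" by auto
          then obtain x where x: "x \<in> F" "x' \<in> ball x \<alpha>" using F(3) by blast
          have "ennreal (norm (bb (t, x')) powr q) * indicator (ball x \<alpha>) x' \<le> (\<Sum>x\<in>F. ennreal (norm (bb (t, x')) powr q) * indicator (ball x \<alpha>) x')"
            using F(2) x by (intro member_le_sum) auto
          with True x show ?thesis by (simp add: indicator_def)
        qed (simp add: indicator_def)
      qed
      also have "\<dots> = (\<Sum>x\<in>F. \<integral>\<^sup>+x'\<in>ball x \<alpha>. ennreal (norm (bb (t, x')) powr q) \<partial>lborel)"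
        by (rule nn_integral_sum) simp
      also have "\<dots> = (\<Sum>x\<in>F. \<integral>\<^sup>+y\<in>ball 0 \<alpha>. ennreal (norm (bb (t, x + y)) powr q) \<partial>lborel)"
      proof (intro sum.cong refl)
        fix x :: "real ^ 'n"
        have "indicator (ball x \<alpha>) (y + x) = (indicator (ball 0 \<alpha>) y :: ennreal)" for y
          by (auto simp: indicator_def dist_norm)
        then show "(\<integral>\<^sup>+x'\<in>ball x \<alpha>. ennreal (norm (bb (t, x')) powr q) \<partial>lborel) = (\<integral>\<^sup>+y\<in>ball 0 \<alpha>. ennreal (norm (bb (t, x + y)) powr q) \<partial>lborel)"
          using nn_integral_shift[of "\<lambda>x'. ennreal (norm (bb (t, x')) powr q) * indicator (ball x \<alpha>) x'" x]
          by (simp add: add.commute)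
      qed
      also have "\<dots> \<le> (\<Sum>x\<in>F. ennreal C * (1 + enn_powr (h x t) q))"
        using * by (intro sum_mono) auto
      finally have "enn_powr (\<integral>\<^sup>+x\<in>ball 0 R. ennreal (norm (bb (t, x)) powr q) \<partial>lborel) r \<le> enn_powr (\<Sum>x\<in>F. ennreal C * (1 + enn_powr (h x t) q)) r"
        using r by (rule enn_powr_mono)
      also have "\<dots> \<le> ennreal (real (card F) powr r) * (\<Sum>x\<in>F. enn_powr (ennreal C * (1 + enn_powr (h x t) q)) r)"
        using F r by (intro enn_powr_sum_le) auto
      also have "\<dots> \<le> ennreal (real (card F) powr r) * (\<Sum>x\<in>F. ennreal (C powr r * 2 powr r) * (1 + enn_powr (h x t) p'))"
      proof (intro mult_left_mono sum_mono)
        fix x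
        have "enn_powr (ennreal C * (1 + enn_powr (h x t) q)) r = ennreal (C powr r) * enn_powr (enn_powr (h x t) q + 1) r"
          using C by (simp add: enn_powr_mult add.commute)
        also have "\<dots> \<le> ennreal (C powr r) * (ennreal (2 powr r) * (enn_powr (enn_powr (h x t) q) r + 1))"
          using r by (intro mult_left_mono enn_powr_add_one) auto
        also have "enn_powr (enn_powr (h x t) q) r = enn_powr (h x t) p'"
          using r q by (simp add: enn_powr_powr r_def)
        finally show "enn_powr (ennreal C * (1 + enn_powr (h x t) q)) r \<le> ennreal (C powr r * 2 powr r) * (1 + enn_powr (h x t) p')"
          by (simp add: ennreal_mult mult.assoc add.commute)
      qed simp
      also have "\<dots> = ennreal (real (card F) powr r * (C powr r * 2 powr r)) * (\<Sum>x\<in>F. 1 + enn_powr (h x t) p')"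
        by (simp add: sum_distrib_left[symmetric] ennreal_mult mult.assoc)
      finally show "enn_powr (\<integral>\<^sup>+x\<in>ball 0 R. ennreal (norm (bb (t, x)) powr q) \<partial>lborel) r
        \<le> ennreal (real (card F) powr r * (C powr r * 2 powr r)) * (\<Sum>x\<in>F. 1 + enn_powr (h x t) p')" .
    qed
  qed
  define M where "M = real (card F) powr r * (C powr r * 2 powr r)"
  have "drift_norm p q R (\<lambda>z. norm (bb z)) \<le> (\<integral>\<^sup>+t. ennreal M * (\<Sum>x\<in>F. 1 * indicator {-R..R} t + enn_powr (h x t) p' * indicator {-R..R} t) \<partial>lborel)"
    unfolding drift_norm_def p'_def[symmetric] r_def[symmetric]
  proof (intro nn_integral_mono_AE, rule eventually_mono[OF main])
    fix t
    assume "enn_powr (\<integral>\<^sup>+x\<in>ball 0 R. ennreal (norm (bb (t, x)) powr q) \<partial>lborel) r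
      \<le> ennreal (real (card F) powr r * (C powr r * 2 powr r)) * (\<Sum>x\<in>F. 1 + enn_powr (h x t) p')"
    then show "enn_powr (\<integral>\<^sup>+x\<in>ball 0 R. ennreal (norm (bb (t, x)) powr q) \<partial>lborel) r * indicator {-R..R} t
      \<le> ennreal M * (\<Sum>x\<in>F. 1 * indicator {-R..R} t + enn_powr (h x t) p' * indicator {-R..R} t)"
      by (auto simp: M_def indicator_def)
  qed
  also have "\<dots> = ennreal M * (\<Sum>x\<in>F. emeasure lborel {-R..R} + (\<integral>\<^sup>+t\<in>{-R..R}. enn_powr (h x t) p' \<partial>lborel))"
    by (simp add: nn_integral_cmult nn_integral_sum nn_integral_add)
  also have "\<dots> < \<infinity>"
    using hfin F(2) by (auto simp: ennreal_mult_less_top emeasure_lborel_Icc_eq)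
  finally show "drift_norm p q R (\<lambda>z. norm (bb z)) < \<infinity>" .
  qed
qed

text \<open>Dominated convergence twice: in x at the times where the slice of the majorant is
  finite, then in t. Finiteness of the norm of \<open>B\<close> makes almost every time in the
  interval of this kind.\<close>

lemma drift_norm_tendsto:
  fixes \<beta> :: "nat \<Rightarrow> real \<times> 'a::euclidean_space \<Rightarrow> real"
  assumes p: "1 < p" and q: "1 < q" and meas [measurable]: "\<And>n. \<beta> n \<in> borel_measurable borel" "B \<in> borel_measurable borel"
    and le: "\<And>n z. 0 \<le> \<beta> n z" "\<And>n z. \<beta> n z \<le> B z" and lim: "\<And>z. (\<lambda>n. \<beta> n z) \<longlonglongrightarrow> 0"
    and fin: "drift_norm p q R B < \<infinity>"
  shows "(\<lambda>n. drift_norm p q R (\<beta> n)) \<longlonglongrightarrow> 0"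
proof -
  have [measurable]: "\<beta> n \<in> borel_measurable (borel \<Otimes>\<^sub>M borel)" "B \<in> borel_measurable (borel \<Otimes>\<^sub>M borel)" for n
    by (simp_all add: borel_prod)
  define r where "r = p / (p - 1) / q"
  have r: "0 < r" using p q by (simp add: r_def)
  define F where "F n t = (\<integral>\<^sup>+x\<in>ball 0 R. ennreal (\<beta> n (t, x) powr q) \<partial>lborel)" for n t
  define G where "G t = (\<integral>\<^sup>+x\<in>ball 0 R. ennreal (B (t, x) powr q) \<partial>lborel)" for t
  have [measurable]: "F n \<in> borel_measurable borel" "G \<in> borel_measurable borel" for n
    unfolding F_def G_def by measurable
  have FG: "F n t \<le> G t" for n t
    unfolding F_def G_def using le q by (intro nn_integral_mono mult_right_mono ennreal_leI powr_mono2) auto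
  have "(\<lambda>n. \<integral>\<^sup>+t\<in>{-R..R}. enn_powr (F n t) r \<partial>lborel) \<longlonglongrightarrow> (\<integral>\<^sup>+(t::real). 0 \<partial>lborel)"
  proof (rule nn_integral_dominated_convergence[where w = "\<lambda>t. enn_powr (G t) r * indicator {-R..R} t"])
    show "AE t in lborel. enn_powr (F j t) r * indicator {-R..R} t \<le> enn_powr (G t) r * indicator {-R..R} t" for j
      using FG r by (intro always_eventually allI mult_right_mono enn_powr_mono) auto
    show fin': "(\<integral>\<^sup>+t. enn_powr (G t) r * indicator {-R..R} t \<partial>lborel) < \<infinity>"
      using fin by (simp add: drift_norm_def G_def r_def)
    have "AE t in lborel. enn_powr (G t) r * indicator {-R..R} t \<noteq> \<infinity>"
      using fin' by (intro nn_integral_PInf_AE) auto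
    then show "AE t in lborel. (\<lambda>n. enn_powr (F n t) r * indicator {-R..R} t) \<longlonglongrightarrow> 0"
    proof (rule eventually_mono)
      fix t assume t: "enn_powr (G t) r * indicator {-R..R} t \<noteq> \<infinity>"
      show "(\<lambda>n. enn_powr (F n t) r * indicator {-R..R} t) \<longlonglongrightarrow> 0"
      proof (cases "t \<in> {-R..R}")
        case True
        then have Gt: "G t < \<infinity>" using t by (auto simp: enn_powr_def less_top split: if_splits)
        have "(\<lambda>n. F n t) \<longlonglongrightarrow> (\<integral>\<^sup>+(x::'a). 0 \<partial>lborel)"
          unfolding F_def
        proof (rule nn_integral_dominated_convergence[where w = "\<lambda>x. ennreal (B (t, x) powr q) * indicator (ball 0 R) x"])
          show "AE x in lborel. ennreal (\<beta> j (t, x) powr q) * indicator (ball 0 R) x \<le> ennreal (B (t, x) powr q) * indicator (ball 0 R) x" for j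
            using le q by (intro always_eventually allI mult_right_mono ennreal_leI powr_mono2) auto
          show "(\<integral>\<^sup>+x. ennreal (B (t, x) powr q) * indicator (ball 0 R) x \<partial>lborel) < \<infinity>" using Gt by (simp add: G_def)
          show "AE x in lborel. (\<lambda>n. ennreal (\<beta> n (t, x) powr q) * indicator (ball 0 R) x) \<longlonglongrightarrow> 0"
          proof (intro always_eventually allI)
            fix x
            have "(\<lambda>n. \<beta> n (t, x) powr q) \<longlonglongrightarrow> 0 powr q"
              using tendsto_powr'[OF lim tendsto_const[of q]] le q by auto
            then have "(\<lambda>n. ennreal (\<beta> n (t, x) powr q)) \<longlonglongrightarrow> ennreal 0"
              using tendsto_ennrealI by fastforce
            then show "(\<lambda>n. ennreal (\<beta> n (t, x) powr q) * indicator (ball 0 R) x) \<longlonglongrightarrow> 0"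
              by (cases "x \<in> ball 0 R") auto
          qed
        qed auto
        then have F0: "(\<lambda>n. F n t) \<longlonglongrightarrow> 0" by simp
        have Ffin: "F n t \<noteq> \<infinity>" for n using FG[of n t] Gt by (auto simp: top_unique)
        have "(\<lambda>n. enn2real (F n t)) \<longlonglongrightarrow> enn2real 0"
          by (rule tendsto_enn2real) (use F0 in auto)
        then have "(\<lambda>n. enn2real (F n t) powr r) \<longlonglongrightarrow> 0"
          using tendsto_powr'[of "\<lambda>n. enn2real (F n t)" 0 sequentially "\<lambda>_. r" r] r by auto
        then have "(\<lambda>n. ennreal (enn2real (F n t) powr r)) \<longlonglongrightarrow> ennreal 0" by (rule tendsto_ennrealI)
        then show ?thesis using True Ffin by (simp add: enn_powr_def)
      qed simp
    qed
  qed auto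
  then show ?thesis by (simp add: drift_norm_def F_def r_def)
qed

subsection \<open>Uniform convexity and near-minimisers\<close>

text \<open>The increments of x^p over the two halves of [a,b] are compared by the mean value
  theorem, the derivative being strictly increasing. For a = 0 a direct computation is used, the
  derivative formula being available at positive points.\<close>

lemma powr_midpoint_strict:
  fixes a b p :: real
  assumes "0 \<le> a" "a < b" "1 < p"
  shows "((a + b) / 2) powr p < (a powr p + b powr p) / 2"
proof (cases "a = 0")
  case True
  have "2 powr 1 < 2 powr p" using assms by (intro powr_less_mono) auto
  then have "b powr p / 2 powr p < b powr p / 2" using assms by (intro divide_strict_left_mono) auto
  then show ?thesis using True assms by (simp add: powr_divide)
next
  case False
  then have a: "0 < a" using assms by simp
  define m where "m = (a + b) / 2"
  have m: "a < m" "m < b" using assms by (auto simp: m_def)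
  have der: "((\<lambda>x. x powr p) has_real_derivative p * x powr (p - 1)) (at x)" if "a \<le> x" for x
    using a that by (intro has_real_derivative_powr) auto
  obtain c1 where c1: "a < c1" "c1 < m" "m powr p - a powr p = (m - a) * (p * c1 powr (p - 1))"
    using MVT2[of a m "\<lambda>x. x powr p" "\<lambda>x. p * x powr (p - 1)"] m der by auto
  obtain c2 where c2: "m < c2" "c2 < b" "b powr p - m powr p = (b - m) * (p * c2 powr (p - 1))"
    using MVT2[of m b "\<lambda>x. x powr p" "\<lambda>x. p * x powr (p - 1)"] m der by auto
  have "c1 powr (p - 1) < c2 powr (p - 1)"
    using c1 c2 a assms by (intro powr_less_mono2) auto
  then have "(m - a) * (p * c1 powr (p - 1)) < (m - a) * (p * c2 powr (p - 1))"
    using m assms by (intro mult_strict_left_mono) auto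
  also have "m - a = b - m" by (simp add: m_def field_simps)
  finally have "m powr p - a powr p < b powr p - m powr p" using c1(3) c2(3) by (simp add: m_def field_simps)
  then show ?thesis unfolding m_def[symmetric] by (simp add: field_simps)
qed

text \<open>For vectors of equal norm the strictness comes from the parallelogram law, for different
  norms from strict convexity of the power.\<close>

lemma norm_powr_midpoint_strict:
  fixes x y :: "'b::euclidean_space"
  assumes "x \<noteq> y" "1 < p"
  shows "norm ((1 / 2) *\<^sub>R (x + y)) powr p < (norm x powr p + norm y powr p) / 2"
proof (cases "norm x = norm y")
  case True
  have "(norm (x + y))\<^sup>2 + (norm (x - y))\<^sup>2 = 2 * (norm x)\<^sup>2 + 2 * (norm y)\<^sup>2"
    by (simp add: power2_norm_eq_inner inner_add inner_diff inner_commute algebra_simps)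
  moreover have "0 < (norm (x - y))\<^sup>2" using assms by simp
  moreover have "(2 * norm x)\<^sup>2 = 2 * (norm x)\<^sup>2 + 2 * (norm y)\<^sup>2" using True by (simp add: power_mult_distrib)
  ultimately have "(norm (x + y))\<^sup>2 < (2 * norm x)\<^sup>2" by linarith
  then have "norm (x + y) < 2 * norm x" by (rule power_less_imp_less_base) simp
  then have "norm ((1 / 2) *\<^sub>R (x + y)) < norm x" by simp
  then have "norm ((1 / 2) *\<^sub>R (x + y)) powr p < norm x powr p"
    using assms by (intro powr_less_mono2) auto
  then show ?thesis using True by simp
next
  case False
  have "norm ((1 / 2) *\<^sub>R (x + y)) \<le> (norm x + norm y) / 2"
    using norm_triangle_ineq[of x y] by simp
  then have "norm ((1 / 2) *\<^sub>R (x + y)) powr p \<le> ((norm x + norm y) / 2) powr p"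
    using assms by (intro powr_mono2) auto
  also have "\<dots> < (norm x powr p + norm y powr p) / 2"
    using powr_midpoint_strict[of "norm x" "norm y" p] powr_midpoint_strict[of "norm y" "norm x" p] False assms
    by (cases "norm x < norm y") (auto simp: add.commute)
  finally show ?thesis .
qed

text \<open>By homogeneity it suffices to treat |x|^p + |y|^p = 1. On the compact part where |x -
  y|^p \<ge> \<epsilon> the convexity defect \<open>D\<close> has a positive minimum; elsewhere the
  term with \<epsilon> suffices. Compactness replaces Clarkson's inequalities, which differ for p
  below and above 2. The midpoint stands on the left so that no subtraction occurs when the
  inequality is integrated in \<open>ennreal\<close>.\<close>

lemma uniform_convexity_pointwise:
  assumes p: "1 < p" and eps: "0 < \<epsilon>"
  obtains C where "0 \<le> C"
    "\<And>x y :: 'b::euclidean_space. norm (x - y) powr p + C * norm ((1 / 2) *\<^sub>R (x + y)) powr p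
       \<le> (\<epsilon> + C / 2) * (norm x powr p + norm y powr p)"
proof -
  define D where "D z = (norm (fst z) powr p + norm (snd z) powr p) / 2 - norm ((1 / 2) *\<^sub>R (fst z + snd z)) powr p" for z :: "'b \<times> 'b"
  define S where "S = {z :: 'b \<times> 'b. norm (fst z) powr p + norm (snd z) powr p = 1 \<and> \<epsilon> \<le> norm (fst z - snd z) powr p}"
  have cont: "continuous_on UNIV (\<lambda>z :: 'b \<times> 'b. norm (fst z) powr p + norm (snd z) powr p)"
    "continuous_on UNIV (\<lambda>z :: 'b \<times> 'b. norm (fst z - snd z) powr p)"
    "continuous_on UNIV D"
    unfolding D_def using p by (auto intro!: continuous_intros continuous_on_powr')
  have "closed S"
    unfolding S_def by (intro closed_Collect_conj closed_Collect_eq closed_Collect_le cont continuous_on_const)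
  moreover have "bounded S"
  proof -
    have "norm z \<le> 2" if "z \<in> S" for z
    proof -
      have "w \<le> 1" if "w powr p \<le> 1" "0 \<le> w" for w
      proof (rule ccontr)
        assume "\<not> w \<le> 1"
        then have "1 powr p < w powr p" using p by (intro powr_less_mono2) auto
        then show False using that by simp
      qed
      moreover have "norm (fst z) powr p \<le> 1" "norm (snd z) powr p \<le> 1"
        using that by (auto simp: S_def) (metis add_increasing order_refl powr_ge_zero add.commute)+
      ultimately have "norm (fst z) \<le> 1" "norm (snd z) \<le> 1" by auto
      then show ?thesis using norm_Pair_le[of "fst z" "snd z"] by simp
    qed
    then show ?thesis unfolding bounded_iff by blast
  qed
  ultimately have "compact S" by (simp add: compact_eq_bounded_closed)
  have Dpos: "0 < D z" if "z \<in> S" for z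
  proof -
    have "fst z \<noteq> snd z" using that eps p by (auto simp: S_def)
    then show ?thesis using norm_powr_midpoint_strict[of "fst z" "snd z" p] p by (simp add: D_def)
  qed
  obtain m where m: "0 < m" "\<And>z. z \<in> S \<Longrightarrow> m \<le> D z"
  proof (cases "S = {}")
    case False
    then obtain z0 where "z0 \<in> S" "\<And>z. z \<in> S \<Longrightarrow> D z0 \<le> D z"
      using continuous_attains_inf[OF \<open>compact S\<close>, of D] continuous_on_subset[OF cont(3)] by auto
    then show ?thesis using that[of "D z0"] Dpos by auto
  qed (use that[of 1] in auto)
  \<comment> \<open>On the normalised set |x - y|^p is at most 2^p, so this C makes C D \<ge> 2^p
    wherever D \<ge> m.\<close>
  define C where "C = 2 powr p / m"
  have C: "0 \<le> C" using m by (simp add: C_def)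
  have D0: "0 \<le> D z" for z
    using norm_powr_midpoint_strict[of "fst z" "snd z" p] p
    by (cases "fst z = snd z") (auto simp: D_def simp flip: scaleR_2)
  have unit: "norm (fst z - snd z) powr p \<le> \<epsilon> + C * D z" if "norm (fst z) powr p + norm (snd z) powr p = 1" for z
  proof (cases "\<epsilon> \<le> norm (fst z - snd z) powr p")
    case True
    then have "m \<le> D z" using that by (intro m) (auto simp: S_def)
    then have "2 powr p / m * m \<le> C * D z" unfolding C_def using m(1) by (intro mult_left_mono) auto
    moreover have "norm (fst z - snd z) powr p \<le> 2 powr p * (norm (fst z) powr p + norm (snd z) powr p)"
      using p by (intro order.trans[OF powr_mono2[OF _ _ norm_triangle_ineq4] powr_add_le]) auto
    ultimately show ?thesis using m(1) that eps by simp
  qed (use mult_nonneg_nonneg[OF C D0[of z]] in auto)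
  show ?thesis
  proof (rule that[OF C])
    fix x y :: 'b
    define s where "s = norm x powr p + norm y powr p"
    show "norm (x - y) powr p + C * norm ((1 / 2) *\<^sub>R (x + y)) powr p \<le> (\<epsilon> + C / 2) * (norm x powr p + norm y powr p)"
    proof (cases "s = 0")
      case True
      then have "norm x powr p = 0" "norm y powr p = 0" unfolding s_def by (smt (verit) powr_ge_zero)+
      then show ?thesis using p by simp
    next
      case False
      then have s: "0 < s" unfolding s_def by (smt (verit) powr_ge_zero)
      define k where "k = (1 / s) powr (1 / p)"
      have k: "0 < k" "k powr p = 1 / s" using s p by (auto simp: k_def powr_powr)
      have sc: "norm (k *\<^sub>R w) powr p = norm w powr p / s" for w :: 'b
        using k by (simp add: powr_mult)
      have "norm (fst (k *\<^sub>R x, k *\<^sub>R y)) powr p + norm (snd (k *\<^sub>R x, k *\<^sub>R y)) powr p = 1"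
        unfolding fst_conv snd_conv sc using s by (simp add: s_def add_divide_distrib[symmetric])
      from unit[OF this] have "norm (k *\<^sub>R (x - y)) powr p \<le> \<epsilon> + C * ((norm (k *\<^sub>R x) powr p + norm (k *\<^sub>R y) powr p) / 2 - norm (k *\<^sub>R ((1 / 2) *\<^sub>R (x + y))) powr p)"
        by (simp add: D_def scaleR_right_diff_distrib scaleR_right_distrib mult.commute)
      then have "norm (x - y) powr p / s \<le> \<epsilon> + C * ((norm x powr p / s + norm y powr p / s) / 2 - norm ((1 / 2) *\<^sub>R (x + y)) powr p / s)"
        unfolding sc .
      then have "norm (x - y) powr p \<le> \<epsilon> * s + C * (s / 2 - norm ((1 / 2) *\<^sub>R (x + y)) powr p)"
        using s unfolding s_def[symmetric] add_divide_distrib[symmetric] by (simp add: field_simps)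
      then show ?thesis unfolding s_def[symmetric] by (simp add: algebra_simps)
    qed
  qed
qed

lemma pint_uniform_convexity:
  assumes p: "1 < p" and eps: "0 < \<epsilon>"
  obtains C where "0 \<le> C"
    "\<And>f g :: 'a::euclidean_space \<Rightarrow> 'b::euclidean_space. f \<in> borel_measurable borel \<Longrightarrow> g \<in> borel_measurable borel \<Longrightarrow>
      pint p (\<lambda>z. f z - g z) + ennreal C * pint p (\<lambda>z. (1 / 2) *\<^sub>R (f z + g z)) \<le> ennreal (\<epsilon> + C / 2) * (pint p f + pint p g)"
proof (rule uniform_convexity_pointwise[OF p eps, where 'b = 'b])
  fix C :: real
  assume C: "0 \<le> C" and le: "\<And>x y :: 'b. norm (x - y) powr p + C * norm ((1 / 2) *\<^sub>R (x + y)) powr p \<le> (\<epsilon> + C / 2) * (norm x powr p + norm y powr p)"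
  show thesis
  proof (rule that[OF C])
    fix f g :: "'a \<Rightarrow> 'b"
    assume [measurable]: "f \<in> borel_measurable borel" "g \<in> borel_measurable borel"
    have "pint p (\<lambda>z. f z - g z) + ennreal C * pint p (\<lambda>z. (1 / 2) *\<^sub>R (f z + g z))
      = (\<integral>\<^sup>+z. ennreal (norm (f z - g z) powr p) + ennreal C * ennreal (norm ((1 / 2) *\<^sub>R (f z + g z)) powr p) \<partial>lborel)"
      unfolding pint_def by (subst nn_integral_add) (auto simp: nn_integral_cmult)
    also have "\<dots> \<le> (\<integral>\<^sup>+z. ennreal (\<epsilon> + C / 2) * (ennreal (norm (f z) powr p) + ennreal (norm (g z) powr p)) \<partial>lborel)"
    proof (intro nn_integral_mono)
      fix z
      show "ennreal (norm (f z - g z) powr p) + ennreal C * ennreal (norm ((1 / 2) *\<^sub>R (f z + g z)) powr p) \<le> ennreal (\<epsilon> + C / 2) * (ennreal (norm (f z) powr p) + ennreal (norm (g z) powr p))"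
        using le[of "f z" "g z"] C eps
        by (simp add: ennreal_mult[symmetric] ennreal_plus[symmetric] ennreal_leI del: ennreal_plus)
    qed
    also have "\<dots> = ennreal (\<epsilon> + C / 2) * (pint p f + pint p g)"
      unfolding pint_def by (simp add: nn_integral_cmult nn_integral_add)
    finally show "pint p (\<lambda>z. f z - g z) + ennreal C * pint p (\<lambda>z. (1 / 2) *\<^sub>R (f z + g z)) \<le> ennreal (\<epsilon> + C / 2) * (pint p f + pint p g)" .
  qed
qed

text \<open>Near-minimisers of the norm over a decreasing sequence of convex sets form a Cauchy sequence;
  this replaces weak compactness.\<close>

lemma near_minimizers_Cauchy:
  fixes F :: "nat \<Rightarrow> ('a::euclidean_space \<Rightarrow> 'b::euclidean_space) set"
  assumes p: "1 < p" and ne: "\<And>n. F n \<noteq> {}" and dec: "\<And>n. F (Suc n) \<subseteq> F n"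
    and meas: "\<And>f. f \<in> F 0 \<Longrightarrow> f \<in> borel_measurable borel"
    and mid: "\<And>n f g. f \<in> F n \<Longrightarrow> g \<in> F n \<Longrightarrow> (\<lambda>z. (1 / 2) *\<^sub>R (f z + g z)) \<in> F n"
    and bd: "\<And>f. f \<in> F 0 \<Longrightarrow> pint p f \<le> ennreal M" and M: "0 \<le> M"
  obtains v where "\<And>n. v n \<in> F n" "\<And>\<epsilon>. 0 < \<epsilon> \<Longrightarrow> \<exists>N. \<forall>n\<ge>N. \<forall>m\<ge>N. pint p (\<lambda>z. v n z - v m z) \<le> ennreal \<epsilon>"
proof -
  have dec': "F m \<subseteq> F n" if "n \<le> m" for n m
    using that dec by (metis lift_Suc_antimono_le)
  define A where "A f = enn2real (pint p f)" for f :: "'a \<Rightarrow> 'b"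
  have A: "pint p f = ennreal (A f)" "0 \<le> A f" "A f \<le> M" if "f \<in> F n" for f n
  proof -
    have "pint p f \<le> ennreal M" using that dec'[of 0 n] by (intro bd) auto
    then show "pint p f = ennreal (A f)" "0 \<le> A f" "A f \<le> M"
      unfolding A_def using M by (cases "pint p f"; auto simp: top_unique)+
  qed
  \<comment> \<open>The infima increase with n, since the sets shrink, and stay below M; hence they
    converge.\<close>
  define I where "I n = Inf (A ` F n)" for n
  have bb: "bdd_below (A ` F n)" for n using A by (intro bdd_belowI[of _ 0]) auto
  have Ile: "I n \<le> A f" if "f \<in> F n" for f n
    unfolding I_def using bb that by (intro cInf_lower) auto
  have I_mono: "I n \<le> I m" if "n \<le> m" for n m
    unfolding I_def[of m] using ne Ile dec'[OF that] by (intro cInf_greatest) auto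
  have I_le: "I n \<le> M" for n
    using ne[of n] Ile A(3) by (meson all_not_in_conv order.trans)
  have I0: "0 \<le> I n" for n
    unfolding I_def using ne A(2) by (intro cInf_greatest) auto
  have "Bseq I" by (rule BseqI'[of I M]) (use I0 I_le in auto)
  then have "convergent I"
    using I_mono by (intro Bseq_mono_convergent) auto
  have "\<exists>f. f \<in> F n \<and> A f < I n + 1 / real (Suc n)" for n
    using cInf_lessD[of "A ` F n" "I n + 1 / real (Suc n)"] ne[of n] by (auto simp: I_def)
  then obtain v where v: "\<And>n. v n \<in> F n" "\<And>n. A (v n) < I n + 1 / real (Suc n)" by metis
  show ?thesis
  proof (rule that[OF v(1)])
    fix \<epsilon> :: real assume eps: "0 < \<epsilon>"
    \<comment> \<open>This e gives e (2 M) \<le> \<epsilon>/2; the constant k, chosen after C, gives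
      3/2 C k \<le> 3\<epsilon>/8.\<close>
    define e where "e = \<epsilon> / (4 * (M + 1))"
    have e: "0 < e" using eps M by (simp add: e_def)
    show "\<exists>N. \<forall>n\<ge>N. \<forall>m\<ge>N. pint p (\<lambda>z. v n z - v m z) \<le> ennreal \<epsilon>"
    proof (rule pint_uniform_convexity[OF p e, where 'a = 'a and 'b = 'b])
      fix C :: real
      assume C: "0 \<le> C" and uc: "\<And>f g :: 'a \<Rightarrow> 'b. f \<in> borel_measurable borel \<Longrightarrow> g \<in> borel_measurable borel \<Longrightarrow>
        pint p (\<lambda>z. f z - g z) + ennreal C * pint p (\<lambda>z. (1 / 2) *\<^sub>R (f z + g z)) \<le> ennreal (e + C / 2) * (pint p f + pint p g)"
      define k where "k = \<epsilon> / (4 * (C + 1))"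
      have k: "0 < k" using eps C by (simp add: k_def)
      obtain N1 where N1: "\<And>n m. N1 \<le> n \<Longrightarrow> N1 \<le> m \<Longrightarrow> \<bar>I n - I m\<bar> < k"
        using \<open>convergent I\<close> k unfolding Cauchy_convergent_iff[symmetric] Cauchy_def dist_real_def by meson
      obtain N2 :: nat where N2: "1 / k < real N2" using reals_Archimedean2 by blast
      have inv: "1 / real (Suc n) < k" if "N2 \<le> n" for n
      proof -
        have "1 / k < real (Suc n)" using N2 that by simp
        then show ?thesis using k by (simp add: field_simps)
      qed
      \<comment> \<open>For n \<le> m both functions lie in F n. Their midpoint lies there too, so
        its integral is at least I n, while the integrals of the two functions exceed I n by little;
        uniform convexity then forces them together.\<close>
      have key: "pint p (\<lambda>z. v n z - v m z) \<le> ennreal \<epsilon>" if nm: "n \<le> m" "max N1 N2 \<le> n" for n m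
      proof -
        have vm: "v m \<in> F n" using v(1)[of m] dec'[OF nm(1)] by auto
        define g where "g = (\<lambda>z. (1 / 2) *\<^sub>R (v n z + v m z))"
        have g: "g \<in> F n" unfolding g_def using v(1) vm by (intro mid)
        have ms: "v i \<in> borel_measurable borel" for i using v(1)[of i] dec'[of 0 i] by (intro meas) auto
        have main: "pint p (\<lambda>z. v n z - v m z) + ennreal C * ennreal (A g) \<le> ennreal (e + C / 2) * (ennreal (A (v n)) + ennreal (A (v m)))"
          using uc[OF ms[of n] ms[of m]] A(1)[OF v(1)] A(1)[OF g] by (simp add: g_def)
        also have "\<dots> = ennreal ((e + C / 2) * (A (v n) + A (v m)))"
          using C e A(2)[OF v(1)] by (simp add: ennreal_mult[symmetric] ennreal_plus[symmetric] del: ennreal_plus)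
        finally have main: "pint p (\<lambda>z. v n z - v m z) + ennreal (C * A g) \<le> ennreal ((e + C / 2) * (A (v n) + A (v m)))"
          using C A(2)[OF g] by (simp add: ennreal_mult)
        have "pint p (\<lambda>z. v n z - v m z) \<le> \<infinity>" by simp
        have "pint p (\<lambda>z. v n z - v m z) \<noteq> \<infinity>" using main by (auto simp: top_unique)
        then obtain x where x: "pint p (\<lambda>z. v n z - v m z) = ennreal x" "0 \<le> x" by (cases "pint p (\<lambda>z. v n z - v m z)") auto
        have xle: "x + C * A g \<le> (e + C / 2) * (A (v n) + A (v m))"
        proof -
          have "0 \<le> (e + C / 2) * (A (v n) + A (v m))" using C e A(2)[OF v(1)] by simp
          moreover have "ennreal (x + C * A g) \<le> ennreal ((e + C / 2) * (A (v n) + A (v m)))"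
            using main x C A(2)[OF g] by (simp add: ennreal_plus[symmetric] del: ennreal_plus)
          ultimately show ?thesis by (simp add: ennreal_le_iff)
        qed
        have "A (v n) < I n + k" using v(2)[of n] inv[of n] nm by auto
        moreover have "A (v m) < I m + k" using v(2)[of m] inv[of m] nm by auto
        moreover have "I m < I n + k" using N1[of n m] nm by auto
        moreover have "I n \<le> A g" by (rule Ile[OF g])
        ultimately have "A (v n) + A (v m) \<le> 2 * A g + 3 * k" by linarith
        then have "C / 2 * (A (v n) + A (v m)) \<le> C / 2 * (2 * A g + 3 * k)" using C by (intro mult_left_mono) auto
        moreover have "e * (A (v n) + A (v m)) \<le> e * (2 * M)"
          using A(3)[OF v(1)[of n]] A(3)[OF v(1)[of m]] e by (intro mult_left_mono) auto
        ultimately have "x \<le> e * (2 * M) + 3 / 2 * (C * k)"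
          using xle by (simp add: algebra_simps)
        also have "e * (2 * M) \<le> \<epsilon> / 2" using eps M by (simp add: e_def field_simps)
        also have "C * k \<le> \<epsilon> / 4" using eps C by (simp add: k_def field_simps)
        finally have "x \<le> \<epsilon>" using eps by simp
        then show ?thesis using x by (simp add: ennreal_leI)
      qed
      show ?thesis
      proof (intro exI[of _ "max N1 N2"] allI impI)
        fix n m assume "max N1 N2 \<le> n" "max N1 N2 \<le> m"
        then show "pint p (\<lambda>z. v n z - v m z) \<le> ennreal \<epsilon>"
          using key[of n m] key[of m n] pint_minus[of p "v n" "v m"] by (cases "n \<le> m") auto
      qed
    qed
  qed
qed

text \<open>Riesz-Fischer in terms of \<open>pint\<close>: along the subsequence the increments are
  below 4^(-k), so the sum of 2^k |\<Delta> k|^p is finite almost everywhere, which bounds the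
  increments by a geometric sequence without Minkowski's inequality. The subsequence is returned as
  well, since its pointwise convergence serves a Fatou argument for the drift term.\<close>

lemma Lp_complete:
  fixes v :: "nat \<Rightarrow> 'a::euclidean_space \<Rightarrow> 'b::euclidean_space"
  assumes p: "1 \<le> p" and [measurable]: "\<And>n. v n \<in> borel_measurable borel"
    and cau: "\<And>\<epsilon>. 0 < \<epsilon> \<Longrightarrow> \<exists>N. \<forall>n\<ge>N. \<forall>m\<ge>N. pint p (\<lambda>z. v n z - v m z) \<le> ennreal \<epsilon>"
  obtains w r where "w \<in> borel_measurable borel" "(\<lambda>n. pint p (\<lambda>z. v n z - w z)) \<longlonglongrightarrow> 0"
    "strict_mono r" "AE z in lborel. (\<lambda>k. v (r k) z) \<longlonglongrightarrow> w z"
proof -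
  have "\<exists>N. \<forall>n\<ge>N. \<forall>m\<ge>N. pint p (\<lambda>z. v n z - v m z) \<le> ennreal ((1 / 4) ^ k)" for k
    by (intro cau) simp
  then obtain N where N: "\<And>k n m. N k \<le> n \<Longrightarrow> N k \<le> m \<Longrightarrow> pint p (\<lambda>z. v n z - v m z) \<le> ennreal ((1 / 4) ^ k)" by metis
  define r where "r = rec_nat (N 0) (\<lambda>k s. max (Suc s) (N (Suc k)))"
  have r0: "r 0 = N 0" and rS: "r (Suc k) = max (Suc (r k)) (N (Suc k))" for k by (auto simp: r_def)
  have rN: "N k \<le> r k" for k by (cases k) (auto simp: r0 rS)
  have sm: "strict_mono r" by (rule strict_monoI_Suc) (auto simp: rS)
  define \<Delta> where "\<Delta> k z = v (r (Suc k)) z - v (r k) z" for k z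
  have [measurable]: "\<Delta> k \<in> borel_measurable borel" for k unfolding \<Delta>_def by measurable
  have D: "pint p (\<Delta> k) \<le> ennreal ((1 / 4) ^ k)" for k
    unfolding \<Delta>_def by (rule N) (auto intro: rN order.trans[OF rN] simp: rS less_imp_le)
  have "(\<integral>\<^sup>+z. (\<Sum>k. ennreal (2 ^ k) * ennreal (norm (\<Delta> k z) powr p)) \<partial>lborel) = (\<Sum>k. ennreal (2 ^ k) * pint p (\<Delta> k))"
    by (subst nn_integral_suminf) (auto simp: nn_integral_cmult pint_def)
  also have "\<dots> \<le> (\<Sum>k. ennreal ((1 / 2) ^ k))"
  proof (intro suminf_le)
    fix k
    have "ennreal (2 ^ k) * pint p (\<Delta> k) \<le> ennreal (2 ^ k) * ennreal ((1 / 4) ^ k)"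
      by (intro mult_left_mono D) auto
    also have "\<dots> = ennreal ((1 / 2) ^ k)"
      by (subst ennreal_mult[symmetric]) (auto simp: power_mult_distrib[symmetric])
    finally show "ennreal (2 ^ k) * pint p (\<Delta> k) \<le> ennreal ((1 / 2) ^ k)" .
  qed auto
  also have "\<dots> = ennreal (\<Sum>k. (1 / 2) ^ k)"
    by (intro suminf_ennreal_eq summable_sums) auto
  also have "\<dots> < \<infinity>" by simp
  finally have fin: "(\<integral>\<^sup>+z. (\<Sum>k. ennreal (2 ^ k) * ennreal (norm (\<Delta> k z) powr p)) \<partial>lborel) < \<infinity>" .
  have "AE z in lborel. (\<Sum>k. ennreal (2 ^ k) * ennreal (norm (\<Delta> k z) powr p)) \<noteq> \<infinity>"
    using fin by (intro nn_integral_PInf_AE) auto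
  then have conv: "AE z in lborel. convergent (\<lambda>k. v (r k) z)"
  proof (rule eventually_mono)
    fix z assume z: "(\<Sum>k. ennreal (2 ^ k) * ennreal (norm (\<Delta> k z) powr p)) \<noteq> \<infinity>"
    then obtain S where S: "(\<Sum>k. ennreal (2 ^ k) * ennreal (norm (\<Delta> k z) powr p)) = ennreal S" "0 \<le> S"
      by (cases "(\<Sum>k. ennreal (2 ^ k) * ennreal (norm (\<Delta> k z) powr p))") auto
    define \<theta> :: real where "\<theta> = (1 / 2) powr (1 / p)"
    have th: "0 < \<theta>" "\<theta> < 1" using p powr_less_mono2[of "1 / p" "1/2" 1] by (auto simp: \<theta>_def)
    have bd: "norm (\<Delta> k z) \<le> S powr (1 / p) * \<theta> ^ k" for k
    proof -
      have "ennreal (2 ^ k * norm (\<Delta> k z) powr p) \<le> ennreal S"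
      proof -
        have "sum (\<lambda>k. ennreal (2 ^ k) * ennreal (norm (\<Delta> k z) powr p)) {k} \<le> (\<Sum>k. ennreal (2 ^ k) * ennreal (norm (\<Delta> k z) powr p))"
          by (intro sum_le_suminf) auto
        then show ?thesis using S by (simp add: ennreal_mult)
      qed
      then have "norm (\<Delta> k z) powr p \<le> S * (1 / 2) ^ k"
        using S by (simp add: field_simps power_divide)
      then have "(norm (\<Delta> k z) powr p) powr (1 / p) \<le> (S * (1 / 2) ^ k) powr (1 / p)"
        using p by (intro powr_mono2) auto
      moreover have "((1 / 2) ^ k) powr (1 / p) = \<theta> ^ k"
        by (simp add: \<theta>_def powr_realpow[symmetric] powr_powr mult.commute)
      ultimately show ?thesis using p S by (simp add: powr_powr powr_mult)
    qed
    have "summable (\<lambda>k. norm (\<Delta> k z))"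
    proof (rule summable_comparison_test')
      show "summable (\<lambda>k. S powr (1 / p) * \<theta> ^ k)" using th by (intro summable_mult summable_geometric) auto
      show "norm (norm (\<Delta> k z)) \<le> S powr (1 / p) * \<theta> ^ k" if "0 \<le> k" for k using bd[of k] by simp
    qed
    then have "summable (\<lambda>k. \<Delta> k z)" by (rule summable_norm_cancel)
    then have "convergent (\<lambda>n. \<Sum>k<n. \<Delta> k z)" by (simp add: summable_iff_convergent)
    moreover have "(\<Sum>k<n. \<Delta> k z) = v (r n) z - v (r 0) z" for n
      unfolding \<Delta>_def using sum_lessThan_telescope[of "\<lambda>k. v (r k) z" n] by simp
    ultimately have "convergent (\<lambda>n. v (r n) z - v (r 0) z)" by simp
    from convergent_add[OF this convergent_const[of "v (r 0) z"]]
    show "convergent (\<lambda>k. v (r k) z)" by simp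
  qed
  define w where "w z = lim (\<lambda>k. v (r k) z)" for z
  have wm [measurable]: "w \<in> borel_measurable borel" unfolding w_def by measurable
  have lim: "AE z in lborel. (\<lambda>k. v (r k) z) \<longlonglongrightarrow> w z"
    using conv by (rule eventually_mono) (simp add: w_def convergent_LIMSEQ_iff)
  have fatou: "pint p (\<lambda>z. v n z - w z) \<le> ennreal \<epsilon>" if "\<forall>n\<ge>K. \<forall>m\<ge>K. pint p (\<lambda>z. v n z - v m z) \<le> ennreal \<epsilon>" "K \<le> n" for n K \<epsilon>
  proof -
    have "pint p (\<lambda>z. v n z - w z) = (\<integral>\<^sup>+z. liminf (\<lambda>k. ennreal (norm (v n z - v (r k) z) powr p)) \<partial>lborel)"
      unfolding pint_def
    proof (intro nn_integral_cong_AE, rule eventually_mono[OF lim])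
      fix z assume "(\<lambda>k. v (r k) z) \<longlonglongrightarrow> w z"
      then have "(\<lambda>k. norm (v n z - v (r k) z) powr p) \<longlonglongrightarrow> norm (v n z - w z) powr p"
        using p by (intro tendsto_powr' tendsto_intros) auto
      then have "(\<lambda>k. ennreal (norm (v n z - v (r k) z) powr p)) \<longlonglongrightarrow> ennreal (norm (v n z - w z) powr p)"
        by (rule tendsto_ennrealI)
      then show "ennreal (norm (v n z - w z) powr p) = liminf (\<lambda>k. ennreal (norm (v n z - v (r k) z) powr p))"
        by (intro lim_imp_Liminf[symmetric]) auto
    qed
    also have "\<dots> \<le> liminf (\<lambda>k. pint p (\<lambda>z. v n z - v (r k) z))"
      unfolding pint_def by (intro nn_integral_liminf) simp
    also have "\<dots> \<le> ennreal \<epsilon>"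
    proof (rule Liminf_le)
      show "\<forall>\<^sub>F k in sequentially. pint p (\<lambda>z. v n z - v (r k) z) \<le> ennreal \<epsilon>"
        using that order.trans[OF _ seq_suble[OF sm]] by (auto simp: eventually_sequentially intro!: exI[of _ K])
    qed simp
    finally show ?thesis .
  qed
  have "(\<lambda>n. pint p (\<lambda>z. v n z - w z)) \<longlonglongrightarrow> 0"
  proof (rule order_tendstoI)
    fix e :: ennreal assume e: "0 < e"
    obtain \<epsilon> where eps: "0 < \<epsilon>" "ennreal \<epsilon> < e"
    proof -
      obtain y where "0 < y" "y < e" using dense[OF e] by auto
      then show ?thesis using that[of "enn2real y"] by (cases y) (auto simp: less_top[symmetric])
    qed
    obtain K where "\<forall>n\<ge>K. \<forall>m\<ge>K. pint p (\<lambda>z. v n z - v m z) \<le> ennreal \<epsilon>" using cau[OF eps(1)] by blast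
    then have "\<forall>n\<ge>K. pint p (\<lambda>z. v n z - w z) < e" using fatou eps(2) by (blast intro: le_less_trans)
    then show "\<forall>\<^sub>F n in sequentially. pint p (\<lambda>z. v n z - w z) < e" by (auto simp: eventually_sequentially)
  qed auto
  with that wm sm lim show ?thesis by blast
qed

text \<open>The pairing is applied to the components of the gradient, whose own gradients are rows
  of the Hessian. The radius R + 1 fits the closed space-time ball of radius R into the open spatial
  ball of the cylinder.\<close>

lemma drift_estimate:
  assumes p: "1 < p" and q: "1 < q" "real CARD('n::finite) \<le> q" and R: "0 < R"
  obtains C where "0 < C"
    "\<And>(\<beta> :: 'n pt \<Rightarrow> real) u. \<beta> \<in> borel_measurable borel \<Longrightarrow> (\<And>z. 0 \<le> \<beta> z) \<Longrightarrow> C2c u \<Longrightarrow>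
      lint R (\<lambda>z. \<beta> z * norm (gradx u z)) \<le> ennreal C * (drift_norm p q (R + 1) \<beta> + ennreal (2 * (R + 1)) + pint p (gradx u) + pint p (hessx u))"
proof (rule drift_pairing[OF p q, of "R + 1"])
  fix C :: real
  assume C: "0 < C" and le: "\<And>\<beta> v :: 'n pt \<Rightarrow> real. \<beta> \<in> borel_measurable borel \<Longrightarrow> (\<And>z. 0 \<le> \<beta> z) \<Longrightarrow> C1 v \<Longrightarrow>
      (\<integral>\<^sup>+t\<in>{-(R+1)..R+1}. (\<integral>\<^sup>+x\<in>ball 0 (R+1). ennreal (\<beta> (t, x) * \<bar>v (t, x)\<bar>) \<partial>lborel) \<partial>lborel)
        \<le> ennreal C * (drift_norm p q (R+1) \<beta> + ennreal (2 * (R+1)) + pint p v + pint p (gradx v))"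
  define n where "n = real CARD('n)"
  have n: "0 < n" by (simp add: n_def)
  show thesis
  proof (rule that[of "n * C"])
    show "0 < n * C" using n C by simp
    fix \<beta> u :: "'n pt \<Rightarrow> real"
    assume [measurable]: "\<beta> \<in> borel_measurable borel" and nn: "\<And>z. 0 \<le> \<beta> z" and u: "C2c u"
    note [measurable] = C2c_measurable[OF u]
    define X where "X = drift_norm p q (R + 1) \<beta> + ennreal (2 * (R + 1)) + pint p (gradx u) + pint p (hessx u)"
    have comp: "lint R (\<lambda>z. \<beta> z * \<bar>dd (e_x i) u z\<bar>) \<le> ennreal C * X" for i
    proof -
      have c1: "C1 (dd (e_x i) u)" using u C2_C1_dd by (auto simp: C2c_def)
      have "lint R (\<lambda>z. \<beta> z * \<bar>dd (e_x i) u z\<bar>)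
        = (\<integral>\<^sup>+t. (\<integral>\<^sup>+x. ennreal (\<beta> (t, x) * \<bar>dd (e_x i) u (t, x)\<bar>) * indicator (cball 0 R) (t, x) \<partial>lborel) \<partial>lborel)"
        unfolding lint_def using nn by (subst nn_integral_pt) (simp_all add: abs_mult)
      also have "\<dots> \<le> (\<integral>\<^sup>+t. (\<integral>\<^sup>+x. ennreal (\<beta> (t, x) * \<bar>dd (e_x i) u (t, x)\<bar>) * indicator (ball 0 (R + 1)) x * indicator {-(R+1)..R+1} t \<partial>lborel) \<partial>lborel)"
      proof (intro nn_integral_mono)
        fix t :: real and x :: "real ^ 'n"
        have "\<bar>t\<bar> \<le> norm (t, x)" "norm x \<le> norm (t, x)"
          using norm_fst_le[of t x] norm_snd_le[of x t] by auto
        then show "ennreal (\<beta> (t, x) * \<bar>dd (e_x i) u (t, x)\<bar>) * indicator (cball 0 R) (t, x)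
          \<le> ennreal (\<beta> (t, x) * \<bar>dd (e_x i) u (t, x)\<bar>) * indicator (ball 0 (R + 1)) x * indicator {-(R+1)..R+1} t"
          by (cases "norm (t, x) \<le> R") (auto simp: indicator_def)
      qed
      also have "\<dots> = (\<integral>\<^sup>+t\<in>{-(R+1)..R+1}. (\<integral>\<^sup>+x\<in>ball 0 (R+1). ennreal (\<beta> (t, x) * \<bar>dd (e_x i) u (t, x)\<bar>) \<partial>lborel) \<partial>lborel)"
      proof -
        have [measurable]: "\<beta> \<in> borel_measurable (borel \<Otimes>\<^sub>M borel)" "dd (e_x i) u \<in> borel_measurable (borel \<Otimes>\<^sub>M borel)" for i
          by (simp_all add: borel_prod)
        show ?thesis by (simp add: nn_integral_multc)
      qed
      also have "\<dots> \<le> ennreal C * (drift_norm p q (R+1) \<beta> + ennreal (2 * (R+1)) + pint p (dd (e_x i) u) + pint p (gradx (dd (e_x i) u)))"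
        by (rule le[OF _ nn c1]) simp
      also have "\<dots> \<le> ennreal C * X"
        unfolding X_def
      proof (intro mult_left_mono add_mono pint_mono order_refl)
        show "norm (dd (e_x i) u z) \<le> norm (gradx u z)" for z
          using component_le_norm_cart[of "gradx u z" i] by (simp add: gradx_def)
        have "gradx (dd (e_x i) u) z = hessx u z $ i" for z by (simp add: gradx_def hessx_def vec_eq_iff)
        then show "norm (gradx (dd (e_x i) u) z) \<le> norm (hessx u z)" for z
          using Finite_Cartesian_Product.norm_nth_le[of "hessx u z" i] by simp
      qed (use p in auto)
      finally show ?thesis .
    qed
    have "lint R (\<lambda>z. \<beta> z * norm (gradx u z)) \<le> (\<integral>\<^sup>+z. (\<Sum>i\<in>UNIV. ennreal (norm (\<beta> z * \<bar>dd (e_x i) u z\<bar>)) * indicator (cball 0 R) z) \<partial>lborel)"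
      unfolding lint_def
    proof (intro nn_integral_mono)
      fix z
      have "\<beta> z * norm (gradx u z) \<le> \<beta> z * (\<Sum>i\<in>UNIV. \<bar>dd (e_x i) u z\<bar>)"
        using norm_vec_le_sum[of "gradx u z"] nn by (intro mult_left_mono) (auto simp: gradx_def)
      then have "ennreal (norm (\<beta> z * norm (gradx u z))) \<le> ennreal (\<Sum>i\<in>UNIV. norm (\<beta> z * \<bar>dd (e_x i) u z\<bar>))"
        using nn by (intro ennreal_leI) (simp add: abs_mult sum_distrib_left)
      also have "\<dots> = (\<Sum>i\<in>UNIV. ennreal (norm (\<beta> z * \<bar>dd (e_x i) u z\<bar>)))"
        by (rule sum_ennreal[symmetric]) simp
      finally show "ennreal (norm (\<beta> z * norm (gradx u z))) * indicator (cball 0 R) z \<le> (\<Sum>i\<in>UNIV. ennreal (norm (\<beta> z * \<bar>dd (e_x i) u z\<bar>)) * indicator (cball 0 R) z)"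
        unfolding sum_distrib_right[symmetric] by (rule mult_right_mono) simp
    qed
    also have "\<dots> = (\<Sum>i\<in>UNIV. lint R (\<lambda>z. \<beta> z * \<bar>dd (e_x i) u z\<bar>))"
      unfolding lint_def by (rule nn_integral_sum) simp
    also have "\<dots> \<le> (\<Sum>i\<in>(UNIV::'n set). ennreal C * X)" by (intro sum_mono comp)
    also have "\<dots> = ennreal (n * C) * X"
      using n C by (simp add: n_def ennreal_mult ennreal_of_nat_eq_real_of_nat mult.assoc)
    finally show "lint R (\<lambda>z. \<beta> z * norm (gradx u z)) \<le> ennreal (n * C) * (drift_norm p q (R + 1) \<beta> + ennreal (2 * (R + 1)) + pint p (gradx u) + pint p (hessx u))"
      by (simp add: X_def)
  qed
qed (use R in simp)

section \<open>Smallness of the drift term by rescaling\<close>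

lemma drift_norm_scale:
  assumes s: "0 < s" and p: "1 < p" and q: "1 < q"
    and [measurable]: "\<beta> \<in> borel_measurable borel" and nn: "\<And>z. 0 \<le> \<beta> z"
  shows "drift_norm p q R (\<lambda>z. s * \<beta> z) = ennreal (s powr (p / (p - 1))) * drift_norm p q R \<beta>"
proof -
  have [measurable]: "\<beta> \<in> borel_measurable (borel \<Otimes>\<^sub>M borel)" by (simp add: borel_prod)
  have "enn_powr (\<integral>\<^sup>+x\<in>ball 0 R. ennreal ((s * \<beta> (t, x)) powr q) \<partial>lborel) (p / (p - 1) / q)
     = ennreal (s powr (p / (p - 1))) * enn_powr (\<integral>\<^sup>+x\<in>ball 0 R. ennreal (\<beta> (t, x) powr q) \<partial>lborel) (p / (p - 1) / q)" for t
  proof -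
    have "(\<integral>\<^sup>+x\<in>ball 0 R. ennreal ((s * \<beta> (t, x)) powr q) \<partial>lborel) = ennreal (s powr q) * (\<integral>\<^sup>+x\<in>ball 0 R. ennreal (\<beta> (t, x) powr q) \<partial>lborel)"
      by (simp add: powr_mult ennreal_mult mult.assoc nn_integral_cmult)
    then show ?thesis using s q by (simp add: enn_powr_mult powr_powr)
  qed
  then show ?thesis unfolding drift_norm_def by (simp add: mult.assoc nn_integral_cmult)
qed

lemma ennreal_plus4:
  assumes "0 \<le> a" "0 \<le> b" "0 \<le> c" "0 \<le> d"
  shows "ennreal a + ennreal b + ennreal c + ennreal d = ennreal (a + b + c + d)"
  using assms by (simp add: ennreal_plus[symmetric] del: ennreal_plus)

text \<open>\<open>drift_estimate\<close> has a constant term and gives no smallness by itself. It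
  is applied to s \<beta> k with a large fixed s: eventually the \<open>drift_norm\<close> of s
  \<beta> k is at most 1, the right-hand side is at most C Y, and division by s leaves
  \<epsilon>.\<close>

lemma drift_vanishing:
  fixes \<beta> :: "nat \<Rightarrow> 'n::finite pt \<Rightarrow> real"
  assumes p: "1 < p" and q: "1 < q" "real CARD('n) \<le> q" and R: "0 < R"
    and [measurable]: "\<And>k. \<beta> k \<in> borel_measurable borel" and nn: "\<And>k z. 0 \<le> \<beta> k z" and u: "\<And>k. C2c (u k)"
    and M: "\<And>k. pint p (gradx (u k)) \<le> ennreal M" "\<And>k. pint p (hessx (u k)) \<le> ennreal M" "0 \<le> M"
    and lim: "(\<lambda>k. drift_norm p q (R + 1) (\<beta> k)) \<longlonglongrightarrow> 0" and eps: "0 < \<epsilon>"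
  shows "\<forall>\<^sub>F k in sequentially. lint R (\<lambda>z. \<beta> k z * norm (gradx (u k) z)) \<le> ennreal \<epsilon>"
proof (rule drift_estimate[OF p q R])
  fix C :: real
  assume C: "0 < C" and le: "\<And>(\<beta> :: 'n pt \<Rightarrow> real) u. \<beta> \<in> borel_measurable borel \<Longrightarrow> (\<And>z. 0 \<le> \<beta> z) \<Longrightarrow> C2c u \<Longrightarrow>
      lint R (\<lambda>z. \<beta> z * norm (gradx u z)) \<le> ennreal C * (drift_norm p q (R + 1) \<beta> + ennreal (2 * (R + 1)) + pint p (gradx u) + pint p (hessx u))"
  define p' where "p' = p / (p - 1)"
  define Y where "Y = 1 + 2 * (R + 1) + M + M"
  have Y: "0 < Y" using R M by (simp add: Y_def)
  define s where "s = C * Y / \<epsilon>"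
  have s: "0 < s" using C Y eps by (simp add: s_def)
  have "\<forall>\<^sub>F k in sequentially. drift_norm p q (R + 1) (\<beta> k) < ennreal (1 / s powr p')"
    using s by (intro order_tendstoD(2)[OF lim]) simp
  then show ?thesis
  proof (rule eventually_mono)
    fix k assume k: "drift_norm p q (R + 1) (\<beta> k) < ennreal (1 / s powr p')"
    note [measurable] = gradx_measurable[OF u[of k]]
    have "drift_norm p q (R + 1) (\<lambda>z. s * \<beta> k z) = ennreal (s powr p') * drift_norm p q (R + 1) (\<beta> k)"
      unfolding p'_def by (rule drift_norm_scale[OF s p q(1) _ nn]) simp
    also have "\<dots> \<le> ennreal (s powr p') * ennreal (1 / s powr p')" using k by (intro mult_left_mono) auto
    also have "\<dots> = ennreal 1" using s by (subst ennreal_mult[symmetric]) auto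
    finally have dn: "drift_norm p q (R + 1) (\<lambda>z. s * \<beta> k z) \<le> ennreal 1" .
    have "lint R (\<lambda>z. (s * \<beta> k z) * norm (gradx (u k) z)) \<le> ennreal C * (drift_norm p q (R + 1) (\<lambda>z. s * \<beta> k z) + ennreal (2 * (R + 1)) + pint p (gradx (u k)) + pint p (hessx (u k)))"
      using s nn u by (intro le) auto
    also have "\<dots> \<le> ennreal C * (ennreal 1 + ennreal (2 * (R + 1)) + ennreal M + ennreal M)"
      by (intro mult_left_mono add_mono dn M order_refl) simp
    also have "\<dots> = ennreal (C * Y)"
    proof -
      have "ennreal 1 + ennreal (2 * (R + 1)) + ennreal M + ennreal M = ennreal Y"
        unfolding Y_def using R M by (intro ennreal_plus4) auto
      then show ?thesis using C Y by (simp only: ennreal_mult less_imp_le)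
    qed
    finally have "lint R (\<lambda>z. s * (\<beta> k z * norm (gradx (u k) z))) \<le> ennreal (C * Y)" by (simp add: mult.assoc)
    then have "ennreal s * lint R (\<lambda>z. \<beta> k z * norm (gradx (u k) z)) \<le> ennreal (C * Y)"
      using s by (subst (asm) lint_cmult) auto
    then have "ennreal (1 / s) * (ennreal s * lint R (\<lambda>z. \<beta> k z * norm (gradx (u k) z))) \<le> ennreal (1 / s) * ennreal (C * Y)"
      by (rule mult_left_mono) simp
    moreover have "ennreal (1 / s) * (ennreal s * x) = x" for x
      using s unfolding mult.assoc[symmetric] by (subst ennreal_mult[symmetric]) auto
    moreover have "ennreal (1 / s) * ennreal (C * Y) = ennreal \<epsilon>"
      using s C Y eps by (subst ennreal_mult[symmetric]) (auto simp: s_def)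
    ultimately show "lint R (\<lambda>z. \<beta> k z * norm (gradx (u k) z)) \<le> ennreal \<epsilon>" by (simp only:)
  qed
qed

text \<open>The inhomogeneous estimate is exploited by scaling u: if the derivatives of u are small,
  those of s u are still at most 1 in \<open>pint\<close>, and dividing the estimate for s u by s
  leaves \<epsilon>.\<close>

lemma drift_continuity:
  fixes B :: "'n::finite pt \<Rightarrow> real"
  assumes p: "1 < p" and q: "1 < q" "real CARD('n) \<le> q" and R: "0 < R"
    and [measurable]: "B \<in> borel_measurable borel" and nn: "\<And>z. 0 \<le> B z"
    and fin: "drift_norm p q (R + 1) B < \<infinity>" and eps: "0 < \<epsilon>"
  obtains \<eta> where "0 < \<eta>" "\<And>u. C2c u \<Longrightarrow> pint p (gradx u) \<le> ennreal \<eta> \<Longrightarrow> pint p (hessx u) \<le> ennreal \<eta> \<Longrightarrow>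
      lint R (\<lambda>z. B z * norm (gradx u z)) \<le> ennreal \<epsilon>"
proof (rule drift_estimate[OF p q R])
  fix C :: real
  assume C: "0 < C" and le: "\<And>(\<beta> :: 'n pt \<Rightarrow> real) u. \<beta> \<in> borel_measurable borel \<Longrightarrow> (\<And>z. 0 \<le> \<beta> z) \<Longrightarrow> C2c u \<Longrightarrow>
      lint R (\<lambda>z. \<beta> z * norm (gradx u z)) \<le> ennreal C * (drift_norm p q (R + 1) \<beta> + ennreal (2 * (R + 1)) + pint p (gradx u) + pint p (hessx u))"
  obtain D where D: "drift_norm p q (R + 1) B = ennreal D" "0 \<le> D" using fin by (cases "drift_norm p q (R + 1) B") auto
  define Y where "Y = D + 2 * (R + 1) + 1 + 1"
  have Y: "0 < Y" using R D by (simp add: Y_def)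
  define s where "s = C * Y / \<epsilon>"
  have s: "0 < s" using C Y eps by (simp add: s_def)
  show thesis
  proof (rule that[of "1 / s powr p"])
    show "0 < 1 / s powr p" using s by simp
    fix u :: "'n pt \<Rightarrow> real"
    assume u: "C2c u" and small: "pint p (gradx u) \<le> ennreal (1 / s powr p)" "pint p (hessx u) \<le> ennreal (1 / s powr p)"
    note [measurable] = gradx_measurable[OF u] hessx_measurable[OF u]
    have one: "ennreal (s powr p) * ennreal (1 / s powr p) = ennreal 1" using s by (subst ennreal_mult[symmetric]) auto
    have g: "pint p (gradx (\<lambda>z. s * u z)) \<le> ennreal 1"
    proof -
      have "gradx (\<lambda>z. s * u z) = (\<lambda>z. s *\<^sub>R gradx u z)" using gradx_cmult[OF u] by blast
      then have "pint p (gradx (\<lambda>z. s * u z)) = ennreal (s powr p) * pint p (gradx u)" using s by (simp add: pint_scaleR)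
      also have "\<dots> \<le> ennreal (s powr p) * ennreal (1 / s powr p)" using small by (intro mult_left_mono) auto
      finally show ?thesis using one by simp
    qed
    have h: "pint p (hessx (\<lambda>z. s * u z)) \<le> ennreal 1"
    proof -
      have "hessx (\<lambda>z. s * u z) = (\<lambda>z. s *\<^sub>R hessx u z)" using hessx_cmult[OF u] by blast
      then have "pint p (hessx (\<lambda>z. s * u z)) = ennreal (s powr p) * pint p (hessx u)" using s by (simp add: pint_scaleR)
      also have "\<dots> \<le> ennreal (s powr p) * ennreal (1 / s powr p)" using small by (intro mult_left_mono) auto
      finally show ?thesis using one by simp
    qed
    have "lint R (\<lambda>z. B z * norm (gradx (\<lambda>z. s * u z) z)) \<le> ennreal C * (ennreal D + ennreal (2 * (R + 1)) + pint p (gradx (\<lambda>z. s * u z)) + pint p (hessx (\<lambda>z. s * u z)))"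
      unfolding D(1)[symmetric] using nn C2c_cmult[OF u] by (intro le) auto
    also have "\<dots> \<le> ennreal C * (ennreal D + ennreal (2 * (R + 1)) + ennreal 1 + ennreal 1)"
      by (intro mult_left_mono add_mono g h order_refl) simp
    also have "\<dots> = ennreal (C * Y)"
    proof -
      have "ennreal D + ennreal (2 * (R + 1)) + ennreal 1 + ennreal 1 = ennreal Y"
        unfolding Y_def using R D by (intro ennreal_plus4) auto
      then show ?thesis using C Y by (simp only: ennreal_mult less_imp_le)
    qed
    also have "lint R (\<lambda>z. B z * norm (gradx (\<lambda>z. s * u z) z)) = lint R (\<lambda>z. s * (B z * norm (gradx u z)))"
      using s by (simp add: gradx_cmult[OF u] mult.left_commute)
    finally have "ennreal s * lint R (\<lambda>z. B z * norm (gradx u z)) \<le> ennreal (C * Y)"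
      using s by (subst (asm) lint_cmult) auto
    then have "ennreal (1 / s) * (ennreal s * lint R (\<lambda>z. B z * norm (gradx u z))) \<le> ennreal (1 / s) * ennreal (C * Y)"
      by (rule mult_left_mono) simp
    moreover have "ennreal (1 / s) * (ennreal s * x) = x" for x
      using s unfolding mult.assoc[symmetric] by (subst ennreal_mult[symmetric]) auto
    moreover have "ennreal (1 / s) * ennreal (C * Y) = ennreal \<epsilon>"
      using s C Y eps by (subst ennreal_mult[symmetric]) (auto simp: s_def)
    ultimately show "lint R (\<lambda>z. B z * norm (gradx u z)) \<le> ennreal \<epsilon>" by (simp only:)
  qed
qed

subsection \<open>Existence on the whole space\<close>

lemma ennreal_squeeze_zero:
  fixes f g :: "nat \<Rightarrow> ennreal"
  assumes "\<And>n. f n \<le> g n" "g \<longlonglongrightarrow> 0"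
  shows "f \<longlonglongrightarrow> 0"
  by (rule tendsto_sandwich[OF always_eventually[rule_format] always_eventually[rule_format] tendsto_const assms(2)])
    (use assms(1) in simp_all)

lemma ennreal_tendsto_zeroI:
  fixes f :: "nat \<Rightarrow> ennreal"
  assumes "\<And>\<epsilon>. 0 < \<epsilon> \<Longrightarrow> \<forall>\<^sub>F n in sequentially. f n \<le> ennreal \<epsilon>"
  shows "f \<longlonglongrightarrow> 0"
proof (rule order_tendstoI)
  fix e :: ennreal assume e: "0 < e"
  obtain y where y: "0 < y" "y < e" using dense[OF e] by auto
  then obtain \<epsilon> where eps: "y = ennreal \<epsilon>" "0 < \<epsilon>" by (cases y) (auto simp: less_top[symmetric])
  show "\<forall>\<^sub>F n in sequentially. f n < e"
    using assms[OF eps(2)] by (rule eventually_mono) (use y eps in auto)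
qed auto

lemma lint_mono_radius: "R \<le> S \<Longrightarrow> lint R f \<le> lint S f"
  unfolding lint_def by (intro nn_integral_mono) (auto simp: indicator_def)

lemma lint_tendsto_add:
  fixes f g :: "nat \<Rightarrow> 'a::euclidean_space \<Rightarrow> real"
  assumes "\<And>n. f n \<in> borel_measurable borel" "\<And>n. g n \<in> borel_measurable borel"
    "(\<lambda>n. lint R (f n)) \<longlonglongrightarrow> 0" "(\<lambda>n. lint R (g n)) \<longlonglongrightarrow> 0"
  shows "(\<lambda>n. lint R (\<lambda>z. f n z + g n z)) \<longlonglongrightarrow> 0"
proof (rule ennreal_squeeze_zero)
  show "lint R (\<lambda>z. f n z + g n z) \<le> lint R (f n) + lint R (g n)" for n using assms by (intro lint_add) auto
  show "(\<lambda>n. lint R (f n) + lint R (g n)) \<longlonglongrightarrow> 0" using tendsto_add[OF assms(3,4)] by simp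
qed

lemma lint_tendsto_cmult:
  fixes f :: "nat \<Rightarrow> 'a::euclidean_space \<Rightarrow> real"
  assumes "\<And>n. f n \<in> borel_measurable borel" "(\<lambda>n. lint R (f n)) \<longlonglongrightarrow> 0"
  shows "(\<lambda>n. lint R (\<lambda>z. c * f n z)) \<longlonglongrightarrow> 0"
proof -
  have "(\<lambda>n. ennreal \<bar>c\<bar> * lint R (f n)) \<longlonglongrightarrow> ennreal \<bar>c\<bar> * 0"
    by (rule ennreal_tendsto_cmult[OF _ assms(2)]) simp
  then show ?thesis using assms(1) by (simp add: lint_cmult)
qed

lemma opL_linear:
  assumes "C2c u"
  shows "opL a b c lam (\<lambda>z. k * u z) z = k * opL a b c lam u z"
    and "C2c v \<Longrightarrow> opL a b c lam (\<lambda>z. u z + v z) z = opL a b c lam u z + opL a b c lam v z"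
  unfolding opL_lowop[of a b c lam _ _ 0]
  using C2c_operatorD(3,4)[OF heat_op_operator[of 1] assms] lowop_linear[OF assms]
  by (simp_all add: distrib_left)

lemma opL_drift_diff: "opL a b c lam u z = opL a b' c lam u z + (b z - b' z) \<bullet> gradx u z"
  by (simp add: opL_def Lop_def inner_diff_left)

lemma opL_measurable:
  assumes "C2c u" "\<And>i j. (\<lambda>z. a z $ i $ j) \<in> borel_measurable borel" "b \<in> borel_measurable borel" "c \<in> borel_measurable borel"
  shows "opL a b c lam u \<in> borel_measurable borel"
proof -
  have "opL a b c lam u = (\<lambda>z. heat_op e_x e_t 0 lam u z + lowop a b c 0 u z)" using opL_lowop by blast
  then show ?thesis
    using C2c_operatorD(1)[OF heat_op_operator[of 1] assms(1), of e_x e_t 0 lam] lowop_measurable[OF assms, of 0] by simp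
qed

lemma norm_triple_components:
  fixes v :: "'a::real_normed_vector \<times> 'b::real_normed_vector \<times> 'c::real_normed_vector"
  shows "norm (fst v) \<le> norm v" "norm (fst (snd v)) \<le> norm v" "norm (snd (snd v)) \<le> norm v"
proof -
  show "norm (fst v) \<le> norm v" using norm_fst_le[of "fst v" "snd v"] by simp
  have 1: "norm (snd v) \<le> norm v" using norm_snd_le[of "snd v" "fst v"] by simp
  have 2: "norm (fst (snd v)) \<le> norm (snd v)" using norm_fst_le[of "fst (snd v)" "snd (snd v)"] by simp
  have 3: "norm (snd (snd v)) \<le> norm (snd v)" using norm_snd_le[of "snd (snd v)" "fst (snd v)"] by simp
  from 1 2 show "norm (fst (snd v)) \<le> norm v" by linarith
  from 1 3 show "norm (snd (snd v)) \<le> norm v" by linarith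
qed

lemma ennreal_halves:
  assumes "0 \<le> M"
  shows "ennreal (1 / 2) * ennreal M + ennreal (1 / 2) * ennreal M = ennreal M"
proof -
  have "ennreal (1 / 2) * ennreal M = ennreal (M / 2)" using assms by (subst ennreal_mult[symmetric]) auto
  moreover have "ennreal (M / 2) + ennreal (M / 2) = ennreal M"
    using assms by (subst ennreal_plus[symmetric]) auto
  ultimately show ?thesis by (simp only:)
qed

theorem existence_whole_space:
  fixes a :: "'n::finite pt \<Rightarrow> real ^ 'n ^ 'n" and b :: "'n pt \<Rightarrow> real ^ 'n" and c f :: "'n pt \<Rightarrow> real"
  assumes p: "1 < p" and q: "1 < q" "real CARD('n) \<le> q" and lam: "0 < lam" and K: "0 \<le> K"
    and am: "\<And>i j. (\<lambda>z. a z $ i $ j) \<in> borel_measurable borel" and bm: "b \<in> borel_measurable borel"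
    and cm: "c \<in> borel_measurable borel" and fm: "f \<in> borel_measurable borel"
    and bd: "\<And>z i j. \<bar>a z $ i $ j\<bar> \<le> B" "\<And>z. \<bar>c z\<bar> \<le> B"
    and drift: "\<And>R. drift_norm p q R (\<lambda>z. norm (b z)) < \<infinity>"
    and est: "\<And>n \<theta> u. 0 \<le> \<theta> \<Longrightarrow> \<theta> \<le> 1 \<Longrightarrow> C2c u \<Longrightarrow>
        pint p u \<le> ennreal N * pint p (\<lambda>z. heat_op e_x e_t K lam u z + \<theta> * lowop a (\<lambda>z. closest_point (cball 0 (real n)) (b z)) c K u z) \<and>
        pint p (hessx u) \<le> ennreal N * pint p (\<lambda>z. heat_op e_x e_t K lam u z + \<theta> * lowop a (\<lambda>z. closest_point (cball 0 (real n)) (b z)) c K u z)"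
    and f: "pint p f < \<infinity>"
  shows "\<exists>u ut Du D2u. W2p p (-\<infinity>) u ut Du D2u \<and> (\<forall>z. ut z + Lop a b c u Du D2u z - lam * u z = f z)"
proof -
  note [measurable] = am bm cm fm
  have p0: "0 < p" "1 \<le> p" using p by auto
  have B0: "0 \<le> B" using bd(2)[of undefined] by linarith
  define bn where "bn n z = closest_point (cball 0 (real n)) (b z)" for n z
  have bn_eq: "bn n = (\<lambda>z. closest_point (cball 0 (real n)) (b z))" for n by (simp add: bn_def fun_eq_iff)
  have cp_cont: "continuous_on UNIV (closest_point (cball (0::real ^ 'n) (real n)))" for n
    by (intro continuous_on_closest_point) auto
  have bnm [measurable]: "bn n \<in> borel_measurable borel" for n
    unfolding bn_def using measurable_compose[OF bm borel_measurable_continuous_onI[OF cp_cont]] by simp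
  have bn_le: "norm (bn n z) \<le> real n" for n z
    using closest_point_in_set[of "cball (0::real ^ 'n) (real n)" "b z"] by (auto simp: bn_def)
  have bn_diff: "norm (b z - bn n z) \<le> norm (b z)" for n z
    using closest_point_le[of "cball (0::real ^ 'n) (real n)" 0 "b z"] by (simp add: bn_def dist_norm)
  have bn_lim: "(\<lambda>n. norm (b z - bn n z)) \<longlonglongrightarrow> 0" for z
  proof -
    obtain m :: nat where "norm (b z) \<le> real m" using real_arch_simple by blast
    then have "\<forall>\<^sub>F n in sequentially. norm (b z - bn n z) = 0"
      unfolding eventually_sequentially bn_def by (intro exI[of _ m]) (auto simp: closest_point_self)
    then show ?thesis by (rule tendsto_eventually)
  qed
  have dense: "Lp_dense p (opL a (bn n) c lam)" for n
  proof (rule dense_bounded_coefficients[OF p lam K am bnm cm, where B = "B + real n" and N = N])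
    show "\<bar>a z $ i $ j\<bar> \<le> B + real n" "norm (bn n z) \<le> B + real n" "\<bar>c z\<bar> \<le> B + real n" for z i j
      using bd(1)[of z i j] bd(2)[of z] bn_le[of n z] B0 by auto
  qed (rule est[of _ _ n, folded bn_eq])
  have "\<exists>u. C2c u \<and> pint p (\<lambda>z. opL a (bn n) c lam u z - f z) < ennreal (1 / real (Suc n))" for n
    using dense[of n] f fm unfolding Lp_dense_def by simp
  then obtain y where y: "\<And>n. C2c (y n)" "\<And>n. pint p (\<lambda>z. opL a (bn n) c lam (y n) z - f z) < ennreal (1 / real (Suc n))"
    by metis
  have opm [measurable]: "opL a (bn n) c lam u \<in> borel_measurable borel" "opL a b c lam u \<in> borel_measurable borel" if "C2c u" for u n
    using that by (auto intro!: opL_measurable)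
  obtain Fr where Fr: "pint p f = ennreal Fr" "0 \<le> Fr" using f by (cases "pint p f") auto
  define M1 where "M1 = 2 powr p * (1 + Fr)"
  have M1: "0 \<le> M1" using Fr by (simp add: M1_def)
  have op_bd: "pint p (opL a (bn n) c lam (y n)) \<le> ennreal M1" for n
  proof -
    have "pint p (opL a (bn n) c lam (y n)) = pint p (\<lambda>z. (opL a (bn n) c lam (y n) z - f z) + f z)" by simp
    also have "\<dots> \<le> ennreal (2 powr p) * (pint p (\<lambda>z. opL a (bn n) c lam (y n) z - f z) + pint p f)"
      using p0 y(1) by (intro pint_add) auto
    also have "\<dots> \<le> ennreal (2 powr p) * (ennreal 1 + ennreal Fr)"
    proof (intro mult_left_mono add_mono)
      have "ennreal (1 / real (Suc n)) \<le> ennreal 1" by (intro ennreal_leI) simp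
      then show "pint p (\<lambda>z. opL a (bn n) c lam (y n) z - f z) \<le> ennreal 1" using y(2)[of n] by order
    qed (use Fr in auto)
    also have "\<dots> = ennreal M1"
    proof -
      have "ennreal 1 + ennreal Fr = ennreal (1 + Fr)" using Fr by (intro ennreal_plus[symmetric]) auto
      then show ?thesis unfolding M1_def using Fr by (simp only: ennreal_mult powr_ge_zero add_nonneg_nonneg zero_le_one)
    qed
    finally show ?thesis .
  qed
  define N' where "N' = max N 0"
  have N': "ennreal N = ennreal N'" "0 \<le> N'" by (auto simp: N'_def max_def ennreal_neg)
  obtain Cg where Cg: "0 < Cg" "\<And>u::'n pt \<Rightarrow> real. C2c u \<Longrightarrow> pint p (gradx u) \<le> ennreal Cg * (pint p u + pint p (hessx u))"
    by (rule gradx_interpolation[OF p]) blast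
  \<comment> \<open>One bound for u, Du and D2u, independent of the truncation level because N
    is.\<close>
  define M0 where "M0 = N' * M1 + Cg * (N' * M1 + N' * M1)"
  have M0: "0 \<le> M0" "N' * M1 \<le> M0" "Cg * (N' * M1 + N' * M1) \<le> M0" using N' M1 Cg by (auto simp: M0_def)
  have est1: "pint p (y n) \<le> ennreal (N' * M1)" "pint p (hessx (y n)) \<le> ennreal (N' * M1)" for n
  proof -
    have "(\<lambda>z. heat_op e_x e_t K lam (y n) z + 1 * lowop a (\<lambda>z. closest_point (cball 0 (real n)) (b z)) c K (y n) z) = opL a (bn n) c lam (y n)"
      using opL_lowop[of a "bn n" c lam "y n" _ K] by (auto simp: bn_def[abs_def])
    then have "pint p (y n) \<le> ennreal N' * pint p (opL a (bn n) c lam (y n))" "pint p (hessx (y n)) \<le> ennreal N' * pint p (opL a (bn n) c lam (y n))"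
      using est[of 1 "y n" n] y(1)[of n] by (simp_all add: N')
    moreover have "ennreal N' * pint p (opL a (bn n) c lam (y n)) \<le> ennreal N' * ennreal M1"
      by (intro mult_left_mono op_bd) simp
    ultimately show "pint p (y n) \<le> ennreal (N' * M1)" "pint p (hessx (y n)) \<le> ennreal (N' * M1)"
      using N' M1 by (auto simp: ennreal_mult)
  qed
  have yM: "pint p (y n) \<le> ennreal M0" "pint p (hessx (y n)) \<le> ennreal M0" "pint p (gradx (y n)) \<le> ennreal M0" for n
  proof -
    show "pint p (y n) \<le> ennreal M0" "pint p (hessx (y n)) \<le> ennreal M0"
      using est1[of n] ennreal_leI[OF M0(2)] by (auto intro: order.trans)
    have "pint p (gradx (y n)) \<le> ennreal Cg * (ennreal (N' * M1) + ennreal (N' * M1))"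
      by (intro order.trans[OF Cg(2)[OF y(1)]] mult_left_mono add_mono est1) simp
    also have "\<dots> = ennreal (Cg * (N' * M1 + N' * M1))"
      using Cg(1) N' M1 by (simp add: ennreal_mult[symmetric] ennreal_plus[symmetric] del: ennreal_plus)
    also have "\<dots> \<le> ennreal M0" by (rule ennreal_leI[OF M0(3)])
    finally show "pint p (gradx (y n)) \<le> ennreal M0" .
  qed
  \<comment> \<open>These sets decrease for two reasons, the growing radius and the shrinking
    tolerance, and every condition is convex in u. The residual is that of the untruncated operator,
    hence measured in local L_1 instead of L_p.\<close>
  define CC where "CC n = {u. C2c u \<and> pint p u \<le> ennreal M0 \<and> pint p (gradx u) \<le> ennreal M0 \<and> pint p (hessx u) \<le> ennreal M0 \<and>
      lint (real n) (\<lambda>z. opL a b c lam u z - f z) \<le> ennreal (1 / real (Suc n))}" for n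
  \<comment> \<open>For fixed n a far member of the sequence y works: its residual for the truncated
    operator tends to 0 in L_p, and the truncation error (b - bn k) . Du is small by
    \<open>drift_vanishing\<close>, the gradients and Hessians being bounded.\<close>
  have CC_ne: "CC n \<noteq> {}" for n
  proof -
    define e where "e = 1 / real (Suc n) / 2"
    have e: "0 < e" by (simp add: e_def)
    have "(\<lambda>k. ennreal (1 / real (Suc k))) \<longlonglongrightarrow> ennreal 0"
      by (intro tendsto_ennrealI LIMSEQ_Suc[OF lim_1_over_n])
    then have l0: "(\<lambda>k. ennreal (1 / real (Suc k))) \<longlonglongrightarrow> 0" by (simp only: ennreal_0)
    have "(\<lambda>k. pint p (\<lambda>z. opL a (bn k) c lam (y k) z - f z)) \<longlonglongrightarrow> 0"
      by (rule ennreal_squeeze_zero[OF less_imp_le[OF y(2)] l0])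
    \<comment> \<open>The radius n + 1 is positive also for n = 0, as \<open>drift_vanishing\<close>
      requires.\<close>
    then have "(\<lambda>k. lint (real n + 1) (\<lambda>z. opL a (bn k) c lam (y k) z - f z)) \<longlonglongrightarrow> 0"
      using y(1) by (intro lint_tendsto_pint[OF _ p0(2)]) auto
    then have ev1: "\<forall>\<^sub>F k in sequentially. lint (real n + 1) (\<lambda>z. opL a (bn k) c lam (y k) z - f z) < ennreal e"
      using e by (intro order_tendstoD(2)) auto
    have "(\<lambda>k. drift_norm p q (real n + 1 + 1) (\<lambda>z. norm (b z - bn k z))) \<longlonglongrightarrow> 0"
      by (rule drift_norm_tendsto[OF p q(1), where B = "\<lambda>z. norm (b z)"]) (use bn_diff bn_lim drift in auto)
    then have ev2: "\<forall>\<^sub>F k in sequentially. lint (real n + 1) (\<lambda>z. norm (b z - bn k z) * norm (gradx (y k) z)) \<le> ennreal e"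
      by (intro drift_vanishing[OF p q, where M = M0]) (use y yM M0 e in auto)
    obtain k where k: "lint (real n + 1) (\<lambda>z. opL a (bn k) c lam (y k) z - f z) < ennreal e"
      "lint (real n + 1) (\<lambda>z. norm (b z - bn k z) * norm (gradx (y k) z)) \<le> ennreal e"
      using eventually_happens'[OF sequentially_bot eventually_conj[OF ev1 ev2]] by blast
    have gm [measurable]: "gradx (y k) \<in> borel_measurable borel" by (rule gradx_measurable[OF y(1)])
    have "lint (real n) (\<lambda>z. opL a b c lam (y k) z - f z) \<le> lint (real n + 1) (\<lambda>z. opL a b c lam (y k) z - f z)"
      by (rule lint_mono_radius) simp
    also have "\<dots> = lint (real n + 1) (\<lambda>z. (opL a (bn k) c lam (y k) z - f z) + (b z - bn k z) \<bullet> gradx (y k) z)"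
      unfolding opL_drift_diff[of a b c lam "y k" _ "bn k"] by (simp add: algebra_simps)
    also have "\<dots> \<le> lint (real n + 1) (\<lambda>z. opL a (bn k) c lam (y k) z - f z) + lint (real n + 1) (\<lambda>z. (b z - bn k z) \<bullet> gradx (y k) z)"
      using y(1) by (intro lint_add) auto
    also have "\<dots> \<le> ennreal e + ennreal e"
    proof (intro add_mono)
      have "lint (real n + 1) (\<lambda>z. (b z - bn k z) \<bullet> gradx (y k) z) \<le> lint (real n + 1) (\<lambda>z. norm (b z - bn k z) * norm (gradx (y k) z))"
        by (intro lint_mono) (simp add: Cauchy_Schwarz_ineq2)
      then show "lint (real n + 1) (\<lambda>z. (b z - bn k z) \<bullet> gradx (y k) z) \<le> ennreal e" using k(2) by order
    qed (use k(1) in simp)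
    also have "\<dots> = ennreal (1 / real (Suc n))"
    proof -
      have "e + e = 1 / real (Suc n)" unfolding e_def by (rule field_sum_of_halves)
      then show ?thesis using e by (metis ennreal_plus less_imp_le)
    qed
    finally have "y k \<in> CC n" unfolding CC_def using y(1) yM by auto
    then show ?thesis by blast
  qed
  have CC_dec: "CC (Suc n) \<subseteq> CC n" for n
  proof
    fix u assume u: "u \<in> CC (Suc n)"
    have "lint (real n) (\<lambda>z. opL a b c lam u z - f z) \<le> lint (real (Suc n)) (\<lambda>z. opL a b c lam u z - f z)"
      by (rule lint_mono_radius) simp
    also have "\<dots> \<le> ennreal (1 / real (Suc (Suc n)))" using u by (simp add: CC_def)
    also have "\<dots> \<le> ennreal (1 / real (Suc n))" by (intro ennreal_leI) (simp add: field_simps)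
    finally show "u \<in> CC n" using u by (simp add: CC_def)
  qed
  \<comment> \<open>The triple takes values in one Euclidean space, so minimisation and uniform
    convexity are applied once, to u, Du and D2u together.\<close>
  define U where "U u z = (u z, gradx u z, hessx u z)" for u :: "'n pt \<Rightarrow> real" and z
  have Um: "U u \<in> borel_measurable borel" if "C2c u" for u
  proof -
    note [measurable] = C2c_measurable(1)[OF that] gradx_measurable[OF that] hessx_measurable[OF that]
    show ?thesis unfolding U_def by measurable
  qed
  have CC_mid: "(\<lambda>z. (1 / 2) * (u z + v z)) \<in> CC n" if u: "u \<in> CC n" and v: "v \<in> CC n" for u v n
  proof -
    have cu: "C2c u" and cv: "C2c v" using u v by (auto simp: CC_def)
    have cuv: "C2c (\<lambda>z. u z + v z)" by (rule C2c_add[OF cu cv])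
    have half: "pint p (\<lambda>z. (1 / 2) *\<^sub>R (g z + h z)) \<le> ennreal M0"
      if "g \<in> borel_measurable borel" "h \<in> borel_measurable borel" "pint p g \<le> ennreal M0" "pint p h \<le> ennreal M0" for g h :: "'n pt \<Rightarrow> 'e::euclidean_space"
    proof -
      have h: "1 - 1 / 2 = (1 / 2 :: real)" by simp
      have "pint p (\<lambda>z. (1 / 2) *\<^sub>R (g z + h z)) = pint p (\<lambda>z. (1 / 2) *\<^sub>R g z + (1 / 2) *\<^sub>R h z)"
        by (simp add: scaleR_add_right)
      also have "\<dots> \<le> ennreal (1 / 2) * pint p g + ennreal (1 / 2) * pint p h"
        using pint_convex[OF that(1,2) p0(2), of "1 / 2", unfolded h] by simp
      also have "\<dots> \<le> ennreal (1 / 2) * ennreal M0 + ennreal (1 / 2) * ennreal M0"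
        using that by (intro add_mono mult_left_mono) auto
      also have "\<dots> = ennreal M0" by (rule ennreal_halves[OF M0(1)])
      finally show ?thesis .
    qed
    have 1: "pint p (\<lambda>z. (1 / 2) * (u z + v z)) \<le> ennreal M0"
      using half[of u v] u v C2c_measurable(1)[OF cu] C2c_measurable(1)[OF cv] by (simp add: CC_def)
    have "gradx (\<lambda>z. (1 / 2) * (u z + v z)) = (\<lambda>z. (1 / 2) *\<^sub>R (gradx u z + gradx v z))"
      using gradx_cmult[OF cuv, of "1 / 2"] gradx_add[OF cu cv] by auto
    then have 2: "pint p (gradx (\<lambda>z. (1 / 2) * (u z + v z))) \<le> ennreal M0"
      using half[OF gradx_measurable[OF cu] gradx_measurable[OF cv]] u v by (simp add: CC_def)
    have "hessx (\<lambda>z. (1 / 2) * (u z + v z)) = (\<lambda>z. (1 / 2) *\<^sub>R (hessx u z + hessx v z))"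
      using hessx_cmult[OF cuv, of "1 / 2"] hessx_add[OF cu cv] by auto
    then have 3: "pint p (hessx (\<lambda>z. (1 / 2) * (u z + v z))) \<le> ennreal M0"
      using half[OF hessx_measurable[OF cu] hessx_measurable[OF cv]] u v by (simp add: CC_def)
    have "lint (real n) (\<lambda>z. opL a b c lam (\<lambda>z. (1 / 2) * (u z + v z)) z - f z)
       = lint (real n) (\<lambda>z. (1 / 2) * (opL a b c lam u z - f z) + (1 / 2) * (opL a b c lam v z - f z))"
      unfolding opL_linear(1)[OF cuv] opL_linear(2)[OF cu cv] by (simp add: algebra_simps)
    also have "\<dots> \<le> lint (real n) (\<lambda>z. (1 / 2) * (opL a b c lam u z - f z)) + lint (real n) (\<lambda>z. (1 / 2) * (opL a b c lam v z - f z))"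
      using cu cv by (intro lint_add) auto
    also have "\<dots> = ennreal (1 / 2) * lint (real n) (\<lambda>z. opL a b c lam u z - f z) + ennreal (1 / 2) * lint (real n) (\<lambda>z. opL a b c lam v z - f z)"
      using cu cv by (subst (1 2) lint_cmult) auto
    also have "\<dots> \<le> ennreal (1 / 2) * ennreal (1 / real (Suc n)) + ennreal (1 / 2) * ennreal (1 / real (Suc n))"
      using u v by (intro add_mono mult_left_mono) (auto simp: CC_def)
    also have "\<dots> = ennreal (1 / real (Suc n))" by (rule ennreal_halves) simp
    finally have 4: "lint (real n) (\<lambda>z. opL a b c lam (\<lambda>z. (1 / 2) * (u z + v z)) z - f z) \<le> ennreal (1 / real (Suc n))" .
    show ?thesis using 1 2 3 4 C2c_cmult[OF cuv, of "1 / 2"] by (simp add: CC_def)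
  qed
  define M where "M = 2 powr p * (M0 + 2 powr p * (M0 + M0))"
  have M: "0 \<le> M" using M0 by (simp add: M_def)
  have UM: "pint p (U u) \<le> ennreal M" if "u \<in> CC n" for u n
  proof -
    have cu: "C2c u" using that by (simp add: CC_def)
    note [measurable] = C2c_measurable(1)[OF cu] gradx_measurable[OF cu] hessx_measurable[OF cu]
    have "pint p (U u) \<le> pint p (\<lambda>z. \<bar>u z\<bar> + (norm (gradx u z) + norm (hessx u z)))"
    proof (intro pint_mono)
      fix z
      have "norm (U u z) \<le> norm (u z) + norm (gradx u z, hessx u z)" unfolding U_def by (rule norm_Pair_le)
      then show "norm (U u z) \<le> norm (\<bar>u z\<bar> + (norm (gradx u z) + norm (hessx u z)))"
        using norm_Pair_le[of "gradx u z" "hessx u z"] by simp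
    qed (use p0 in simp)
    also have "\<dots> \<le> ennreal (2 powr p) * (pint p (\<lambda>z. \<bar>u z\<bar>) + pint p (\<lambda>z. norm (gradx u z) + norm (hessx u z)))"
      using p0 by (intro pint_add) auto
    also have "\<dots> \<le> ennreal (2 powr p) * (pint p (\<lambda>z. \<bar>u z\<bar>) + ennreal (2 powr p) * (pint p (\<lambda>z. norm (gradx u z)) + pint p (\<lambda>z. norm (hessx u z))))"
      using p0 by (intro mult_left_mono add_mono order_refl pint_add) auto
    also have "\<dots> \<le> ennreal (2 powr p) * (ennreal M0 + ennreal (2 powr p) * (ennreal M0 + ennreal M0))"
      using that by (intro mult_left_mono add_mono) (auto simp: CC_def pint_def)
    also have "\<dots> = ennreal M"
      using M0(1) by (simp add: M_def ennreal_mult[symmetric] ennreal_plus[symmetric] del: ennreal_plus)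
    finally show ?thesis .
  qed
  obtain V where V: "\<And>n. V n \<in> U ` CC n" "\<And>\<epsilon>. 0 < \<epsilon> \<Longrightarrow> \<exists>N. \<forall>n\<ge>N. \<forall>m\<ge>N. pint p (\<lambda>z. V n z - V m z) \<le> ennreal \<epsilon>"
  proof (rule near_minimizers_Cauchy[of p "\<lambda>n. U ` CC n" M, OF p _ _ _ _ _ M])
    show "U ` CC n \<noteq> {}" for n using CC_ne by simp
    show "U ` CC (Suc n) \<subseteq> U ` CC n" for n using CC_dec by (rule image_mono)
    show "g \<in> borel_measurable borel" if "g \<in> U ` CC 0" for g using that Um by (auto simp: CC_def)
    show "pint p g \<le> ennreal M" if "g \<in> U ` CC 0" for g using that UM by auto
    show "(\<lambda>z. (1 / 2) *\<^sub>R (g z + h z)) \<in> U ` CC n" if gh: "g \<in> U ` CC n" "h \<in> U ` CC n" for n g h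
    proof -
      obtain u v where uv: "u \<in> CC n" "v \<in> CC n" "g = U u" "h = U v" using gh by auto
      have cu: "C2c u" and cv: "C2c v" using uv by (auto simp: CC_def)
      have "(\<lambda>z. (1 / 2) *\<^sub>R (g z + h z)) = U (\<lambda>z. (1 / 2) * (u z + v z))"
        unfolding uv U_def using gradx_cmult[OF C2c_add[OF cu cv], of "1 / 2"] gradx_add[OF cu cv]
          hessx_cmult[OF C2c_add[OF cu cv], of "1 / 2"] hessx_add[OF cu cv]
        by (auto simp: fun_eq_iff)
      then show ?thesis using CC_mid[OF uv(1,2)] by blast
    qed
  qed blast
  have "\<exists>x. x \<in> CC n \<and> V n = U x" for n using V(1)[of n] by auto
  then obtain x where x: "\<And>n. x n \<in> CC n" "\<And>n. V n = U (x n)" by metis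
  have xc: "C2c (x n)" for n using x(1)[of n] by (simp add: CC_def)
  note xm [measurable] = C2c_measurable(1)[OF xc] gradx_measurable[OF xc] hessx_measurable[OF xc]
  have Vm: "V n \<in> borel_measurable borel" for n unfolding x(2) by (rule Um[OF xc])
  obtain w r where w: "w \<in> borel_measurable borel" "(\<lambda>n. pint p (\<lambda>z. V n z - w z)) \<longlonglongrightarrow> 0"
    "strict_mono r" "AE z in lborel. (\<lambda>k. V (r k) z) \<longlonglongrightarrow> w z"
    by (rule Lp_complete[OF p0(2) Vm V(2)])
  define u where "u z = fst (w z)" for z
  define Du where "Du z = fst (snd (w z))" for z
  define D2u where "D2u z = snd (snd (w z))" for z
  have wm: "w \<in> borel_measurable borel" by (rule w(1))
  have [measurable]: "u \<in> borel_measurable borel" "Du \<in> borel_measurable borel" "D2u \<in> borel_measurable borel"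
  proof -
    have "(fst :: real \<times> (real ^ 'n) \<times> (real ^ 'n ^ 'n) \<Rightarrow> _) \<in> borel_measurable borel"
      "(\<lambda>v :: real \<times> (real ^ 'n) \<times> (real ^ 'n ^ 'n). fst (snd v)) \<in> borel_measurable borel"
      "(\<lambda>v :: real \<times> (real ^ 'n) \<times> (real ^ 'n ^ 'n). snd (snd v)) \<in> borel_measurable borel"
      by (intro borel_measurable_continuous_onI continuous_intros)+
    from this[THEN measurable_compose[OF wm]]
    show "u \<in> borel_measurable borel" "Du \<in> borel_measurable borel" "D2u \<in> borel_measurable borel"
      by (simp_all add: u_def[abs_def] Du_def[abs_def] D2u_def[abs_def])
  qed
  have lim_u: "(\<lambda>n. pint p (\<lambda>z. x n z - u z)) \<longlonglongrightarrow> 0"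
  proof (rule ennreal_squeeze_zero[OF _ w(2)])
    show "pint p (\<lambda>z. x n z - u z) \<le> pint p (\<lambda>z. V n z - w z)" for n
    proof (intro pint_mono)
      fix z
      show "norm (x n z - u z) \<le> norm (V n z - w z)"
        using norm_triple_components[of "V n z - w z"] by (simp add: x(2) U_def u_def)
    qed (use p0 in simp)
  qed
  have lim_Du: "(\<lambda>n. pint p (\<lambda>z. gradx (x n) z - Du z)) \<longlonglongrightarrow> 0"
  proof (rule ennreal_squeeze_zero[OF _ w(2)])
    show "pint p (\<lambda>z. gradx (x n) z - Du z) \<le> pint p (\<lambda>z. V n z - w z)" for n
    proof (intro pint_mono)
      fix z
      show "norm (gradx (x n) z - Du z) \<le> norm (V n z - w z)"
        using norm_triple_components[of "V n z - w z"]
        by (simp add: x(2) U_def Du_def)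
    qed (use p0 in simp)
  qed
  have lim_D2u: "(\<lambda>n. pint p (\<lambda>z. hessx (x n) z - D2u z)) \<longlonglongrightarrow> 0"
  proof (rule ennreal_squeeze_zero[OF _ w(2)])
    show "pint p (\<lambda>z. hessx (x n) z - D2u z) \<le> pint p (\<lambda>z. V n z - w z)" for n
    proof (intro pint_mono)
      fix z
      show "norm (hessx (x n) z - D2u z) \<le> norm (V n z - w z)"
        using norm_triple_components[of "V n z - w z"]
        by (simp add: x(2) U_def D2u_def)
    qed (use p0 in simp)
  qed
  have lint_u: "(\<lambda>n. lint R (\<lambda>z. x n z - u z)) \<longlonglongrightarrow> 0" for R
    by (intro lint_tendsto_pint[OF _ p0(2) lim_u]) measurable
  have lint_Du: "(\<lambda>n. lint R (\<lambda>z. gradx (x n) z - Du z)) \<longlonglongrightarrow> 0" for R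
    by (intro lint_tendsto_pint[OF _ p0(2) lim_Du]) measurable
  have lint_D2u: "(\<lambda>n. lint R (\<lambda>z. hessx (x n) z - D2u z)) \<longlonglongrightarrow> 0" for R
    by (intro lint_tendsto_pint[OF _ p0(2) lim_D2u]) measurable
  \<comment> \<open>\<open>drift_continuity\<close> is about C2 functions and does not apply to Du.
    It bounds the differences x n - x m for large n and m, and Fatou's lemma along the almost
    everywhere convergent subsequence m = r k transfers the bound to the limit.\<close>
  have lint_drift: "(\<lambda>n. lint R (\<lambda>z. b z \<bullet> (gradx (x n) z - Du z))) \<longlonglongrightarrow> 0" for R
  proof (rule ennreal_tendsto_zeroI)
    fix \<epsilon> :: real assume eps: "0 < \<epsilon>"
    \<comment> \<open>The drift estimate needs a positive radius, while R is arbitrary.\<close>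
    define S where "S = max R 1"
    have S: "0 < S" "R \<le> S" by (auto simp: S_def)
    obtain \<eta> where eta: "0 < \<eta>" "\<And>u. C2c u \<Longrightarrow> pint p (gradx u) \<le> ennreal \<eta> \<Longrightarrow> pint p (hessx u) \<le> ennreal \<eta> \<Longrightarrow>
      lint S (\<lambda>z. norm (b z) * norm (gradx u z)) \<le> ennreal \<epsilon>"
      by (rule drift_continuity[OF p q S(1), of "\<lambda>z. norm (b z)" \<epsilon>]) (use drift eps in auto)
    obtain N where N: "\<And>n m. N \<le> n \<Longrightarrow> N \<le> m \<Longrightarrow> pint p (\<lambda>z. V n z - V m z) \<le> ennreal \<eta>"
      using V(2)[OF eta(1)] by blast
    have small: "lint S (\<lambda>z. b z \<bullet> (gradx (x n) z - gradx (x m) z)) \<le> ennreal \<epsilon>" if nm: "N \<le> n" "N \<le> m" for n m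
    proof -
      have cd: "C2c (\<lambda>z. x n z - x m z)" by (rule C2c_diff[OF xc xc])
      have "pint p (gradx (\<lambda>z. x n z - x m z)) \<le> pint p (\<lambda>z. V n z - V m z)"
      proof (intro pint_mono)
        fix z
        show "norm (gradx (\<lambda>z. x n z - x m z) z) \<le> norm (V n z - V m z)"
          using norm_triple_components[of "V n z - V m z"]
          by (simp add: x(2) U_def gradx_diff[OF xc xc])
      qed (use p0 in simp)
      then have 1: "pint p (gradx (\<lambda>z. x n z - x m z)) \<le> ennreal \<eta>" using N[OF nm] by order
      have "pint p (hessx (\<lambda>z. x n z - x m z)) \<le> pint p (\<lambda>z. V n z - V m z)"
      proof (intro pint_mono)
        fix z
        show "norm (hessx (\<lambda>z. x n z - x m z) z) \<le> norm (V n z - V m z)"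
          using norm_triple_components[of "V n z - V m z"]
          by (simp add: x(2) U_def hessx_diff[OF xc xc])
      qed (use p0 in simp)
      then have 2: "pint p (hessx (\<lambda>z. x n z - x m z)) \<le> ennreal \<eta>" using N[OF nm] by order
      have "lint S (\<lambda>z. b z \<bullet> (gradx (x n) z - gradx (x m) z)) \<le> lint S (\<lambda>z. norm (b z) * norm (gradx (\<lambda>z. x n z - x m z) z))"
        by (intro lint_mono) (simp add: gradx_diff[OF xc xc] Cauchy_Schwarz_ineq2)
      with eta(2)[OF cd 1 2] show ?thesis by order
    qed
    have "lint R (\<lambda>z. b z \<bullet> (gradx (x n) z - Du z)) \<le> ennreal \<epsilon>" if n: "N \<le> n" for n
    proof -
      have "lint R (\<lambda>z. b z \<bullet> (gradx (x n) z - Du z)) \<le> lint S (\<lambda>z. b z \<bullet> (gradx (x n) z - Du z))"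
        by (rule lint_mono_radius[OF S(2)])
      also have "\<dots> = (\<integral>\<^sup>+z. liminf (\<lambda>k. ennreal (norm (b z \<bullet> (gradx (x n) z - gradx (x (r k)) z))) * indicator (cball 0 S) z) \<partial>lborel)"
        unfolding lint_def
      proof (intro nn_integral_cong_AE, rule eventually_mono[OF w(4)])
        fix z assume "(\<lambda>k. V (r k) z) \<longlonglongrightarrow> w z"
        from tendsto_fst[OF tendsto_snd[OF this]] have "(\<lambda>k. gradx (x (r k)) z) \<longlonglongrightarrow> Du z"
          by (simp add: x(2) U_def Du_def)
        then have "(\<lambda>k. norm (b z \<bullet> (gradx (x n) z - gradx (x (r k)) z)) * indicator (cball 0 S) z) \<longlonglongrightarrow> norm (b z \<bullet> (gradx (x n) z - Du z)) * indicator (cball 0 S) z"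
          by (intro tendsto_intros)
        from tendsto_ennrealI[OF this]
        have "(\<lambda>k. ennreal (norm (b z \<bullet> (gradx (x n) z - gradx (x (r k)) z))) * indicator (cball 0 S) z) \<longlonglongrightarrow> ennreal (norm (b z \<bullet> (gradx (x n) z - Du z))) * indicator (cball 0 S) z"
          by (simp add: ennreal_mult' ennreal_indicator)
        then show "ennreal (norm (b z \<bullet> (gradx (x n) z - Du z))) * indicator (cball 0 S) z = liminf (\<lambda>k. ennreal (norm (b z \<bullet> (gradx (x n) z - gradx (x (r k)) z))) * indicator (cball 0 S) z)"
          by (intro lim_imp_Liminf[symmetric]) auto
      qed
      also have "\<dots> \<le> liminf (\<lambda>k. lint S (\<lambda>z. b z \<bullet> (gradx (x n) z - gradx (x (r k)) z)))"
        unfolding lint_def by (intro nn_integral_liminf) measurable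
      also have "\<dots> \<le> ennreal \<epsilon>"
      proof (rule Liminf_le)
        show "\<forall>\<^sub>F k in sequentially. lint S (\<lambda>z. b z \<bullet> (gradx (x n) z - gradx (x (r k)) z)) \<le> ennreal \<epsilon>"
          unfolding eventually_sequentially
          using small[OF n] order.trans[OF _ seq_suble[OF w(3)]] by (intro exI[of _ N]) auto
      qed simp
      finally show ?thesis .
    qed
    then show "\<forall>\<^sub>F n in sequentially. lint R (\<lambda>z. b z \<bullet> (gradx (x n) z - Du z)) \<le> ennreal \<epsilon>"
      unfolding eventually_sequentially by blast
  qed
  have [measurable]: "(\<lambda>z. D2u z $ i $ j) \<in> borel_measurable borel" "(\<lambda>z. hessx (x n) z $ i $ j) \<in> borel_measurable borel" for i j n
  proof -
    have "(\<lambda>H :: real ^ 'n ^ 'n. H $ i $ j) \<in> borel_measurable borel"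
      by (intro borel_measurable_continuous_onI continuous_intros)
    from measurable_compose[OF _ this] show "(\<lambda>z. D2u z $ i $ j) \<in> borel_measurable borel" "(\<lambda>z. hessx (x n) z $ i $ j) \<in> borel_measurable borel"
      by measurable
  qed
  have lint_a: "(\<lambda>n. lint R (\<lambda>z. \<Sum>i\<in>UNIV. \<Sum>j\<in>UNIV. a z $ i $ j * (hessx (x n) z - D2u z) $ i $ j)) \<longlonglongrightarrow> 0" for R
  proof (rule ennreal_squeeze_zero)
    define k where "k = real (CARD('n) * CARD('n)) * B"
    show "lint R (\<lambda>z. \<Sum>i\<in>UNIV. \<Sum>j\<in>UNIV. a z $ i $ j * (hessx (x n) z - D2u z) $ i $ j) \<le> lint R (\<lambda>z. k * norm (hessx (x n) z - D2u z))" for n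
    proof (rule lint_mono)
      fix z
      have "\<bar>\<Sum>i\<in>UNIV. \<Sum>j\<in>UNIV. a z $ i $ j * (hessx (x n) z - D2u z) $ i $ j\<bar> \<le> k * norm (hessx (x n) z - D2u z)"
        unfolding k_def by (rule mat_pairing_le[OF bd(1)])
      then show "norm (\<Sum>i\<in>UNIV. \<Sum>j\<in>UNIV. a z $ i $ j * (hessx (x n) z - D2u z) $ i $ j) \<le> norm (k * norm (hessx (x n) z - D2u z))"
        by simp
    qed
    have "(\<lambda>n. lint R (\<lambda>z. norm (hessx (x n) z - D2u z))) \<longlonglongrightarrow> 0"
      using lint_D2u[of R] by (simp add: lint_def)
    then show "(\<lambda>n. lint R (\<lambda>z. k * norm (hessx (x n) z - D2u z))) \<longlonglongrightarrow> 0"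
      by (intro lint_tendsto_cmult) measurable
  qed
  have lint_c: "(\<lambda>n. lint R (\<lambda>z. (- c z - lam) * (x n z - u z))) \<longlonglongrightarrow> 0" for R
  proof (rule ennreal_squeeze_zero)
    show "lint R (\<lambda>z. (- c z - lam) * (x n z - u z)) \<le> lint R (\<lambda>z. (B + lam) * (x n z - u z))" for n
    proof (rule lint_mono)
      fix z
      have "\<bar>- c z - lam\<bar> \<le> B + lam" using bd(2)[of z] lam by linarith
      then show "norm ((- c z - lam) * (x n z - u z)) \<le> norm ((B + lam) * (x n z - u z))"
        using B0 lam by (simp add: abs_mult mult_right_mono)
    qed
    show "(\<lambda>n. lint R (\<lambda>z. (B + lam) * (x n z - u z))) \<longlonglongrightarrow> 0"
      by (intro lint_tendsto_cmult lint_u) measurable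
  qed
  have lint_op: "(\<lambda>n. lint R (\<lambda>z. opL a b c lam (x n) z - f z)) \<longlonglongrightarrow> 0" for R
  proof (rule ennreal_tendsto_zeroI)
    fix \<epsilon> :: real assume eps: "0 < \<epsilon>"
    obtain m1 :: nat where m1: "R \<le> real m1" using real_arch_simple by blast
    obtain m2 :: nat where m2: "1 / \<epsilon> < real m2" using reals_Archimedean2 by blast
    show "\<forall>\<^sub>F n in sequentially. lint R (\<lambda>z. opL a b c lam (x n) z - f z) \<le> ennreal \<epsilon>"
      unfolding eventually_sequentially
    proof (intro exI[of _ "max m1 m2"] allI impI)
      fix n assume n: "max m1 m2 \<le> n"
      have "lint R (\<lambda>z. opL a b c lam (x n) z - f z) \<le> lint (real n) (\<lambda>z. opL a b c lam (x n) z - f z)"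
        using n m1 by (intro lint_mono_radius) auto
      also have "\<dots> \<le> ennreal (1 / real (Suc n))" using x(1)[of n] by (simp add: CC_def)
      also have "\<dots> \<le> ennreal \<epsilon>"
      proof (rule ennreal_leI)
        have "1 / \<epsilon> < real (Suc n)" using m2 n by auto
        then show "1 / real (Suc n) \<le> \<epsilon>" using eps by (simp add: field_simps)
      qed
      finally show "lint R (\<lambda>z. opL a b c lam (x n) z - f z) \<le> ennreal \<epsilon>" .
    qed
  qed
  \<comment> \<open>The equation holds everywhere by this definition; what has to be proved is that
    \<open>ut\<close> is the weak time derivative of u. This follows once the time derivatives of x
    n converge to it in local L_1.\<close>
  define ut where "ut z = f z - (Lop a b c u Du D2u z - lam * u z)" for z
  have utm [measurable]: "ut \<in> borel_measurable borel" unfolding ut_def Lop_def by measurable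
  have lint_t: "(\<lambda>n. lint R (\<lambda>z. dd e_t (x n) z - ut z)) \<longlonglongrightarrow> 0" for R
  proof -
    have eq: "dd e_t (x n) z - ut z = (opL a b c lam (x n) z - f z)
       + (-1) * ((\<Sum>i\<in>UNIV. \<Sum>j\<in>UNIV. a z $ i $ j * (hessx (x n) z - D2u z) $ i $ j)
            + (b z \<bullet> (gradx (x n) z - Du z) + (- c z - lam) * (x n z - u z)))" for n z
      by (simp add: ut_def opL_def Lop_def inner_diff_right right_diff_distrib sum_subtractf algebra_simps)
    have m1: "(\<lambda>z. opL a b c lam (x n) z - f z) \<in> borel_measurable borel" for n
      using opm(2)[OF xc] fm by (rule borel_measurable_diff)
    have m2: "(\<lambda>z. \<Sum>i\<in>UNIV. \<Sum>j\<in>UNIV. a z $ i $ j * (hessx (x n) z - D2u z) $ i $ j) \<in> borel_measurable borel" for n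
      unfolding vector_minus_component by measurable
    have m3: "(\<lambda>z. b z \<bullet> (gradx (x n) z - Du z)) \<in> borel_measurable borel" for n by measurable
    have m4: "(\<lambda>z. (- c z - lam) * (x n z - u z)) \<in> borel_measurable borel" for n by measurable
    note m5 = borel_measurable_add[OF m2 borel_measurable_add[OF m3 m4]]
    show ?thesis
      unfolding eq
      by (rule lint_tendsto_add[OF m1 borel_measurable_times[OF borel_measurable_const m5] lint_op
            lint_tendsto_cmult[OF m5 lint_tendsto_add[OF m2 borel_measurable_add[OF m3 m4] lint_a
              lint_tendsto_add[OF m3 m4 lint_drift lint_c]]]])
  qed
  have C: "C1 (x n)" "bsupp (x n)" "C1 (dd e (x n))" "bsupp (dd e (x n))" for n e
    using xc[of n] C2_C1[of "x n"] C2_C1_dd[of "x n" e] bsupp_dd[of "x n" e] by (auto simp: C2c_def)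
  have [measurable]: "(\<lambda>z. Du z $ i) \<in> borel_measurable borel" for i
    using measurable_compose[of Du borel borel "\<lambda>v. v $ i" borel]
    by (auto intro!: borel_measurable_continuous_onI continuous_intros)
  have lint_Dui: "(\<lambda>n. lint R (\<lambda>z. dd (e_x i) (x n) z - Du z $ i)) \<longlonglongrightarrow> 0" for R i
  proof (rule ennreal_squeeze_zero[OF _ lint_Du])
    show "lint R (\<lambda>z. dd (e_x i) (x n) z - Du z $ i) \<le> lint R (\<lambda>z. gradx (x n) z - Du z)" for n
      using component_le_norm_cart[of "gradx (x n) z - Du z" i for z] by (intro lint_mono) (simp add: gradx_def)
  qed
  have lint_D2uij: "(\<lambda>n. lint R (\<lambda>z. dd (e_x j) (dd (e_x i) (x n)) z - D2u z $ i $ j)) \<longlonglongrightarrow> 0" for R i j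
  proof (rule ennreal_squeeze_zero[OF _ lint_D2u])
    show "lint R (\<lambda>z. dd (e_x j) (dd (e_x i) (x n)) z - D2u z $ i $ j) \<le> lint R (\<lambda>z. hessx (x n) z - D2u z)" for n
      using mat_component_le[of "hessx (x n) z - D2u z" i j for z] by (intro lint_mono) (simp add: hessx_def)
  qed
  have w1: "weak_deriv UNIV u (e_x i) (\<lambda>z. Du z $ i)" for i
    by (rule weak_deriv_limit[where v = x, OF C(1,2)]) (use lint_u lint_Dui in auto)
  have w2: "weak_deriv UNIV (\<lambda>z. Du z $ i) (e_x j) (\<lambda>z. D2u z $ i $ j)" for i j
    by (rule weak_deriv_limit[where v = "\<lambda>n. dd (e_x i) (x n)", OF C(3,4)]) (use lint_Dui lint_D2uij in auto)
  have w3: "weak_deriv UNIV u e_t ut"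
    by (rule weak_deriv_limit[where v = x, OF C(1,2)]) (use lint_u lint_t in auto)
  have wfin: "pint p w < \<infinity>"
  proof -
    have "\<forall>\<^sub>F n in sequentially. pint p (\<lambda>z. V n z - w z) < 1" using w(2) by (intro order_tendstoD(2)) auto
    then obtain n where n: "pint p (\<lambda>z. V n z - w z) < 1" using eventually_happens by force
    have "pint p w = pint p (\<lambda>z. V n z - (V n z - w z))" by simp
    also have "\<dots> \<le> ennreal (2 powr p) * (pint p (V n) + pint p (\<lambda>z. V n z - w z))"
      using Vm[of n] w(1) p0 by (intro pint_diff borel_measurable_diff) auto
    also have "\<dots> < \<infinity>"
    proof -
      have "pint p (V n) \<le> ennreal M" using x UM by metis
      then have "pint p (V n) < \<infinity>" by (rule le_less_trans) simp
      moreover have "pint p (\<lambda>z. V n z - w z) < \<infinity>" using n by (rule less_trans) simp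
      ultimately show ?thesis by (simp add: ennreal_mult_less_top)
    qed
    finally show ?thesis .
  qed
  have fins: "pint p u < \<infinity>" "pint p Du < \<infinity>" "pint p D2u < \<infinity>"
  proof -
    have "norm (u z) \<le> norm (w z)" "norm (Du z) \<le> norm (w z)" "norm (D2u z) \<le> norm (w z)" for z
      using norm_triple_components[of "w z"]
      by (auto simp: u_def Du_def D2u_def)
    then have "pint p u \<le> pint p w" "pint p Du \<le> pint p w" "pint p D2u \<le> pint p w"
      using p0 by (auto intro!: pint_mono)
    then show "pint p u < \<infinity>" "pint p Du < \<infinity>" "pint p D2u < \<infinity>" using wfin by (auto intro: le_less_trans)
  qed
  have "set_integrable lebesgue (cball 0 R) ut" for R
    using w3 unfolding weak_deriv_def loc_integrable_def by auto
  then have "W2p p (-\<infinity>) u ut Du D2u"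
    unfolding W2p_def using w1 w2 w3 fins by (auto intro!: in_Lp_borel)
  moreover have "\<forall>z. ut z + Lop a b c u Du D2u z - lam * u z = f z" by (simp add: ut_def)
  ultimately show ?thesis by blast
qed

subsection \<open>Positivity of \<open>lam0\<close>\<close>

text \<open>With the drift \<open>- \<kappa> x\<close> and \<open>lam = \<kappa> d / p\<close>, the function below is almost a bounded solution of
  the homogeneous equation in the scale of \<open>L\<^sub>p\<close>: transport along the drift and the factor
  \<open>exp (lam t)\<close> balance, and the diffusion is negligible for small \<open>k\<close>.\<close>

definition spread_fn :: "real \<Rightarrow> real \<Rightarrow> real \<Rightarrow> real \<Rightarrow> 'n::finite pt \<Rightarrow> real" where
  "spread_fn \<epsilon> \<kappa> lam k z = max 0 (1 - \<epsilon>\<^sup>2 * (fst z)\<^sup>2) ^ 3 * exp (lam * fst z) *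
     max 0 (1 - k\<^sup>2 * exp (2 * \<kappa> * fst z) * (snd z \<bullet> snd z)) ^ 3"

lemma max0_cube_deriv: "((\<lambda>s. max 0 s ^ 3) has_real_derivative 3 * max 0 s ^ 2) (at s)" for s :: real
  using max0_power_deriv[of 1 s] by (simp add: numeral_2_eq_2 numeral_3_eq_3)

lemma max0_square_deriv: "((\<lambda>s. max 0 s ^ 2) has_real_derivative 2 * max 0 s) (at s)" for s :: real
  using max0_power_deriv[of 0 s] by (simp add: numeral_2_eq_2)

lemma C2_max0_cube:
  assumes "C2 u"
  shows "C2 (\<lambda>z. max 0 (u z) ^ 3)"
proof (rule C2_compose_real[OF assms max0_cube_deriv])
  show "((\<lambda>s. 3 * max 0 s ^ 2) has_real_derivative 6 * max 0 s) (at s)" for s :: real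
    using DERIV_cmult[OF max0_square_deriv, of 3 s] by simp
  show "continuous_on UNIV (\<lambda>s::real. 6 * max 0 s)" by (intro continuous_intros)
qed

lemma C2_exp_fst: "C2 (\<lambda>z::'n::finite pt. exp (m * fst z))"
proof -
  have "C2 (\<lambda>z::'n pt. z \<bullet> (m, 0))" by (rule C2_inner)
  then have *: "C2 (\<lambda>z::'n pt. m * fst z)" by (simp add: inner_Pair_0 inner_prod_def mult.commute)
  show ?thesis
    by (rule C2_compose_real[OF *, where \<psi>' = exp and \<psi>'' = exp]) (auto intro!: derivative_eq_intros continuous_intros)
qed

lemma C2_fst_square: "C2 (\<lambda>z::'n::finite pt. (fst z)\<^sup>2)"
proof -
  have "C2 (\<lambda>z::'n pt. z \<bullet> (1, 0))" by (rule C2_inner)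
  then have *: "C2 (\<lambda>z::'n pt. fst z)" by (simp add: inner_prod_def)
  from C2_mult[OF * *] show ?thesis by (simp add: power2_eq_square)
qed

lemma C2_snd_square: "C2 (\<lambda>z::'n::finite pt. snd z \<bullet> snd z)"
proof -
  have "C2 (\<lambda>z::'n pt. (z - 0) \<bullet> (z - 0) - (fst z)\<^sup>2)" by (rule C2_diff[OF C2_quadratic C2_fst_square])
  then show ?thesis by (simp add: inner_prod_def power2_eq_square)
qed

lemma spread_fn_C2c:
  assumes eps: "0 < \<epsilon>" and k: "0 < k" and kap: "0 \<le> \<kappa>"
  shows "C2c (spread_fn \<epsilon> \<kappa> lam k :: 'n::finite pt \<Rightarrow> real)"
proof -
  have 1: "C2 (\<lambda>z::'n pt. max 0 (1 - \<epsilon>\<^sup>2 * (fst z)\<^sup>2) ^ 3)"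
    by (rule C2_max0_cube[OF C2_diff[OF C2_const C2_cmult[OF C2_fst_square]]])
  have "C2 (\<lambda>z::'n pt. k\<^sup>2 * (exp ((2 * \<kappa>) * fst z) * (snd z \<bullet> snd z)))"
    by (rule C2_cmult[OF C2_mult[OF C2_exp_fst C2_snd_square]])
  then have "C2 (\<lambda>z::'n pt. 1 - k\<^sup>2 * exp (2 * \<kappa> * fst z) * (snd z \<bullet> snd z))"
    using C2_diff[OF C2_const[of 1]] by (simp add: mult.assoc)
  from C2_mult[OF C2_mult[OF 1 C2_exp_fst] C2_max0_cube[OF this]]
  have c2: "C2 (spread_fn \<epsilon> \<kappa> lam k :: 'n pt \<Rightarrow> real)" unfolding spread_fn_def[abs_def] .
  \<comment> \<open>The time cut-off vanishes for |t| \<ge> 1/\<epsilon>; at the remaining times the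
    spatial radius exp (- \<kappa> t) / k is largest towards t = - 1/\<epsilon>.\<close>
  define R where "R = 1 / \<epsilon> + exp (\<kappa> / \<epsilon>) / k"
  have "spread_fn \<epsilon> \<kappa> lam k z = 0" if R: "R \<le> norm z" for z :: "'n pt"
  proof (cases "1 / \<epsilon> \<le> \<bar>fst z\<bar>")
    case True
    then have "1 \<le> \<epsilon> * \<bar>fst z\<bar>" using eps by (simp add: field_simps)
    then have "1\<^sup>2 \<le> (\<epsilon> * \<bar>fst z\<bar>)\<^sup>2" by (intro power_mono) auto
    then show ?thesis by (simp add: spread_fn_def power_mult_distrib)
  next
    case False
    have "norm z \<le> \<bar>fst z\<bar> + norm (snd z)" using norm_Pair_le[of "fst z" "snd z"] by simp
    then have x: "exp (\<kappa> / \<epsilon>) / k \<le> norm (snd z)" using R False by (simp add: R_def)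
    have "- (1 / \<epsilon>) \<le> fst z" using False by linarith
    then have "\<kappa> * (- (1 / \<epsilon>)) \<le> \<kappa> * fst z" using kap by (intro mult_left_mono) auto
    then have "1 \<le> exp (\<kappa> * fst z) * exp (\<kappa> / \<epsilon>)" by (simp add: exp_add[symmetric])
    also have "\<dots> \<le> exp (\<kappa> * fst z) * (k * norm (snd z))"
      using x k by (intro mult_left_mono) (auto simp: field_simps)
    finally have "1\<^sup>2 \<le> (exp (\<kappa> * fst z) * (k * norm (snd z)))\<^sup>2" by (intro power_mono) auto
    also have "\<dots> = k\<^sup>2 * exp (2 * \<kappa> * fst z) * (snd z \<bullet> snd z)"
      by (simp add: power_mult_distrib exp_double[symmetric] power2_norm_eq_inner mult_ac)
    finally show ?thesis by (simp add: spread_fn_def)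
  qed
  moreover have "0 < R" using eps k by (simp add: R_def add_pos_pos)
  ultimately have "bsupp (spread_fn \<epsilon> \<kappa> lam k :: 'n pt \<Rightarrow> real)" unfolding bsupp_def by blast
  with c2 show ?thesis by (simp add: C2c_def)
qed

lemma spread_fn_dt:
  assumes eps: "0 < \<epsilon>" and k: "0 < k" and kap: "0 \<le> \<kappa>"
  defines "Y \<equiv> \<lambda>z::'n::finite pt. 1 - k\<^sup>2 * exp (2 * \<kappa> * fst z) * (snd z \<bullet> snd z)"
  shows "dd e_t (spread_fn \<epsilon> \<kappa> lam k) z =
    (3 * max 0 (1 - \<epsilon>\<^sup>2 * (fst z)\<^sup>2) ^ 2 * (- 2 * \<epsilon>\<^sup>2 * fst z)) * exp (lam * fst z) * max 0 (Y z) ^ 3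
    + lam * spread_fn \<epsilon> \<kappa> lam k z
    - max 0 (1 - \<epsilon>\<^sup>2 * (fst z)\<^sup>2) ^ 3 * exp (lam * fst z) * (3 * max 0 (Y z) ^ 2) * (2 * \<kappa> * k\<^sup>2 * exp (2 * \<kappa> * fst z) * (snd z \<bullet> snd z))"
proof (rule dd_of_line)
  show "C1 (spread_fn \<epsilon> \<kappa> lam k)" using spread_fn_C2c[OF eps k kap] C2_C1 by (auto simp: C2c_def)
  obtain t x where z: "z = (t, x)" by (cases z)
  have 1: "((\<lambda>s. max 0 (1 - \<epsilon>\<^sup>2 * (t + s)\<^sup>2) ^ 3) has_real_derivative 3 * max 0 (1 - \<epsilon>\<^sup>2 * t\<^sup>2) ^ 2 * (- 2 * \<epsilon>\<^sup>2 * t)) (at 0)"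
  proof -
    have "((\<lambda>s. 1 - \<epsilon>\<^sup>2 * (t + s)\<^sup>2) has_real_derivative (- 2 * \<epsilon>\<^sup>2 * t)) (at 0)"
      by (auto intro!: derivative_eq_intros)
    from DERIV_chain2[OF max0_cube_deriv this] show ?thesis by simp
  qed
  have 2: "((\<lambda>s. exp (lam * (t + s))) has_real_derivative lam * exp (lam * t)) (at 0)"
    by (auto intro!: derivative_eq_intros)
  have 3: "((\<lambda>s. max 0 (1 - k\<^sup>2 * exp (2 * \<kappa> * (t + s)) * (x \<bullet> x)) ^ 3) has_real_derivative
     3 * max 0 (1 - k\<^sup>2 * exp (2 * \<kappa> * t) * (x \<bullet> x)) ^ 2 * (- (2 * \<kappa> * k\<^sup>2 * exp (2 * \<kappa> * t) * (x \<bullet> x)))) (at 0)"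
  proof -
    have "((\<lambda>s. 1 - k\<^sup>2 * exp (2 * \<kappa> * (t + s)) * (x \<bullet> x)) has_real_derivative (- (2 * \<kappa> * k\<^sup>2 * exp (2 * \<kappa> * t) * (x \<bullet> x)))) (at 0)"
      by (auto intro!: derivative_eq_intros)
    from DERIV_chain2[OF max0_cube_deriv this] show ?thesis by simp
  qed
  from DERIV_mult[OF DERIV_mult[OF 1 2] 3]
  show "((\<lambda>s. spread_fn \<epsilon> \<kappa> lam k (z + s *\<^sub>R e_t)) has_real_derivative
    (3 * max 0 (1 - \<epsilon>\<^sup>2 * (fst z)\<^sup>2) ^ 2 * (- 2 * \<epsilon>\<^sup>2 * fst z)) * exp (lam * fst z) * max 0 (Y z) ^ 3
    + lam * spread_fn \<epsilon> \<kappa> lam k z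
    - max 0 (1 - \<epsilon>\<^sup>2 * (fst z)\<^sup>2) ^ 3 * exp (lam * fst z) * (3 * max 0 (Y z) ^ 2) * (2 * \<kappa> * k\<^sup>2 * exp (2 * \<kappa> * fst z) * (snd z \<bullet> snd z))) (at 0)"
    unfolding spread_fn_def e_t_def z Y_def by (simp add: algebra_simps)
qed

lemma axis_square:
  fixes x :: "real ^ 'n"
  shows "(x + s *\<^sub>R axis i 1) \<bullet> (x + s *\<^sub>R axis i 1) = x \<bullet> x + 2 * s * x $ i + s\<^sup>2"
  by (simp add: inner_add inner_axis inner_axis' power2_eq_square algebra_simps)

lemma spread_fn_dx:
  assumes eps: "0 < \<epsilon>" and k: "0 < k" and kap: "0 \<le> \<kappa>"
  defines "Y \<equiv> \<lambda>z::'n::finite pt. 1 - k\<^sup>2 * exp (2 * \<kappa> * fst z) * (snd z \<bullet> snd z)"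
  shows "dd (e_x i) (spread_fn \<epsilon> \<kappa> lam k) z =
    max 0 (1 - \<epsilon>\<^sup>2 * (fst z)\<^sup>2) ^ 3 * exp (lam * fst z) * (3 * max 0 (Y z) ^ 2 * (- 2 * k\<^sup>2 * exp (2 * \<kappa> * fst z) * snd z $ i))"
proof (rule dd_of_line)
  show "C1 (spread_fn \<epsilon> \<kappa> lam k)" using spread_fn_C2c[OF eps k kap] C2_C1 by (auto simp: C2c_def)
  obtain t x where z: "z = (t, x)" by (cases z)
  have "((\<lambda>s. 1 - k\<^sup>2 * exp (2 * \<kappa> * t) * (x \<bullet> x + 2 * s * x $ i + s\<^sup>2)) has_real_derivative (- 2 * k\<^sup>2 * exp (2 * \<kappa> * t) * x $ i)) (at 0)"
    by (auto intro!: derivative_eq_intros)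
  from DERIV_cmult[OF DERIV_chain2[OF max0_cube_deriv this], of "max 0 (1 - \<epsilon>\<^sup>2 * t\<^sup>2) ^ 3 * exp (lam * t)"]
  show "((\<lambda>s. spread_fn \<epsilon> \<kappa> lam k (z + s *\<^sub>R e_x i)) has_real_derivative
     max 0 (1 - \<epsilon>\<^sup>2 * (fst z)\<^sup>2) ^ 3 * exp (lam * fst z) * (3 * max 0 (Y z) ^ 2 * (- 2 * k\<^sup>2 * exp (2 * \<kappa> * fst z) * snd z $ i))) (at 0)"
    unfolding spread_fn_def e_x_def z Y_def by (simp add: axis_square)
qed

lemma spread_fn_dxx:
  assumes eps: "0 < \<epsilon>" and k: "0 < k" and kap: "0 \<le> \<kappa>"
  defines "Y \<equiv> \<lambda>z::'n::finite pt. 1 - k\<^sup>2 * exp (2 * \<kappa> * fst z) * (snd z \<bullet> snd z)"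
  shows "dd (e_x i) (dd (e_x i) (spread_fn \<epsilon> \<kappa> lam k)) z =
    max 0 (1 - \<epsilon>\<^sup>2 * (fst z)\<^sup>2) ^ 3 * exp (lam * fst z) *
      (6 * max 0 (Y z) * (2 * k\<^sup>2 * exp (2 * \<kappa> * fst z) * snd z $ i)\<^sup>2 - 6 * max 0 (Y z) ^ 2 * (k\<^sup>2 * exp (2 * \<kappa> * fst z)))"
proof (rule dd_of_line)
  show "C1 (dd (e_x i) (spread_fn \<epsilon> \<kappa> lam k))" using spread_fn_C2c[OF eps k kap] C2_C1_dd by (auto simp: C2c_def)
  obtain t x where z: "z = (t, x)" by (cases z)
  have 1: "((\<lambda>s. 1 - k\<^sup>2 * exp (2 * \<kappa> * t) * (x \<bullet> x + 2 * s * x $ i + s\<^sup>2)) has_real_derivative (- 2 * k\<^sup>2 * exp (2 * \<kappa> * t) * x $ i)) (at 0)"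
    by (auto intro!: derivative_eq_intros)
  have 2: "((\<lambda>s. - 2 * k\<^sup>2 * exp (2 * \<kappa> * t) * (x $ i + s)) has_real_derivative (- 2 * k\<^sup>2 * exp (2 * \<kappa> * t))) (at 0)"
    by (auto intro!: derivative_eq_intros)
  define Y0 where "Y0 = 1 - k\<^sup>2 * exp (2 * \<kappa> * t) * (x \<bullet> x)"
  define G where "G = max 0 (1 - \<epsilon>\<^sup>2 * t\<^sup>2) ^ 3 * exp (lam * t)"
  define h where "h = k\<^sup>2 * exp (2 * \<kappa> * t)"
  have line: "(\<lambda>s. dd (e_x i) (spread_fn \<epsilon> \<kappa> lam k) (z + s *\<^sub>R e_x i))
    = (\<lambda>s. G * (3 * max 0 (1 - k\<^sup>2 * exp (2 * \<kappa> * t) * (x \<bullet> x + 2 * s * x $ i + s\<^sup>2)) ^ 2 * (- 2 * k\<^sup>2 * exp (2 * \<kappa> * t) * (x $ i + s))))"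
    unfolding spread_fn_dx[OF eps k kap] unfolding e_x_def z G_def by (simp add: axis_square)
  show "((\<lambda>s. dd (e_x i) (spread_fn \<epsilon> \<kappa> lam k) (z + s *\<^sub>R e_x i)) has_real_derivative
     max 0 (1 - \<epsilon>\<^sup>2 * (fst z)\<^sup>2) ^ 3 * exp (lam * fst z) *
      (6 * max 0 (Y z) * (2 * k\<^sup>2 * exp (2 * \<kappa> * fst z) * snd z $ i)\<^sup>2 - 6 * max 0 (Y z) ^ 2 * (k\<^sup>2 * exp (2 * \<kappa> * fst z)))) (at 0)"
    unfolding line
  proof (rule DERIV_cong[OF DERIV_cmult[OF DERIV_mult[OF DERIV_cmult[OF DERIV_chain2[OF max0_square_deriv 1], of 3] 2], of G]])
    have "G * (3 * (2 * max 0 Y0 * (- 2 * h * x $ i)) * (- 2 * h * (x $ i)) + (- 2 * h) * (3 * max 0 Y0 ^ 2))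
      = G * (6 * max 0 Y0 * (2 * h * x $ i)\<^sup>2 - 6 * max 0 Y0 ^ 2 * h)"
      by (simp add: power2_eq_square algebra_simps)
    then show "G * (3 * (2 * max 0 (1 - k\<^sup>2 * exp (2 * \<kappa> * t) * (x \<bullet> x + 2 * 0 * x $ i + 0\<^sup>2)) * (- 2 * k\<^sup>2 * exp (2 * \<kappa> * t) * x $ i)) * (- 2 * k\<^sup>2 * exp (2 * \<kappa> * t) * (x $ i + 0))
        + - 2 * k\<^sup>2 * exp (2 * \<kappa> * t) * (3 * max 0 (1 - k\<^sup>2 * exp (2 * \<kappa> * t) * (x \<bullet> x + 2 * 0 * x $ i + 0\<^sup>2)) ^ 2))
      = max 0 (1 - \<epsilon>\<^sup>2 * (fst z)\<^sup>2) ^ 3 * exp (lam * fst z) *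
      (6 * max 0 (Y z) * (2 * k\<^sup>2 * exp (2 * \<kappa> * fst z) * snd z $ i)\<^sup>2 - 6 * max 0 (Y z) ^ 2 * (k\<^sup>2 * exp (2 * \<kappa> * fst z)))"
      by (simp add: z Y_def Y0_def G_def h_def mult.assoc)
  qed
qed

text \<open>The drift - \<kappa> x acting on the profile cancels the time derivative of the factor
  exp (2 \<kappa> t) inside it, and the term - lam u cancels that of exp (lam t). Only the
  derivative of the time cut-off and the diffusion remain.\<close>

lemma spread_fn_equation:
  fixes z :: "'n::finite pt"
  assumes eps: "0 < \<epsilon>" and k: "0 < k" and kap: "0 \<le> \<kappa>"
  shows "heat_op e_x e_t K lam (spread_fn \<epsilon> \<kappa> lam k) z + (- \<kappa> *\<^sub>R snd z) \<bullet> gradx (spread_fn \<epsilon> \<kappa> lam k) z =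
    (3 * max 0 (1 - \<epsilon>\<^sup>2 * (fst z)\<^sup>2) ^ 2 * (- 2 * \<epsilon>\<^sup>2 * fst z)) * exp (lam * fst z) * max 0 (1 - k\<^sup>2 * exp (2 * \<kappa> * fst z) * (snd z \<bullet> snd z)) ^ 3
    + (\<Sum>i\<in>UNIV. K * dd (e_x i) (dd (e_x i) (spread_fn \<epsilon> \<kappa> lam k)) z)"
proof -
  define G where "G = max 0 (1 - \<epsilon>\<^sup>2 * (fst z)\<^sup>2) ^ 3 * exp (lam * fst z) * (3 * max 0 (1 - k\<^sup>2 * exp (2 * \<kappa> * fst z) * (snd z \<bullet> snd z)) ^ 2) * (2 * k\<^sup>2 * exp (2 * \<kappa> * fst z))"
  have "gradx (spread_fn \<epsilon> \<kappa> lam k) z = (- G) *\<^sub>R snd z"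
    unfolding gradx_def vec_eq_iff spread_fn_dx[OF eps k kap] G_def by (simp add: mult_ac)
  then have "(- \<kappa> *\<^sub>R snd z) \<bullet> gradx (spread_fn \<epsilon> \<kappa> lam k) z = \<kappa> * G * (snd z \<bullet> snd z)" by simp
  then show ?thesis
    unfolding heat_op_def spread_fn_dt[OF eps k kap] G_def by (simp add: mult_ac)
qed

text \<open>The spatial slices have volume proportional to exp (- \<kappa> d t), and lam p =
  \<kappa> d makes the weight exp (lam p t) compensate this exactly. So all times contribute equally
  and the integral is linear in \<tau>. This is the origin of the value of lam.\<close>

lemma spread_integral:
  assumes "0 \<le> A" "0 \<le> \<tau>" "0 \<le> \<rho>" "lam * p = \<kappa> * real CARD('n::finite)"
  defines "\<omega> \<equiv> unit_ball_vol (real CARD('n))"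
  shows "(\<integral>\<^sup>+z. ennreal ((A * exp (lam * fst z)) powr p) * indicator {z :: 'n pt. \<bar>fst z\<bar> \<le> \<tau> \<and> norm (snd z) \<le> exp (- \<kappa> * fst z) * \<rho>} z \<partial>lborel)
    = ennreal (A powr p * (\<omega> * \<rho> ^ CARD('n)) * (2 * \<tau>))"
proof -
  define S where "S = {z :: 'n pt. \<bar>fst z\<bar> \<le> \<tau> \<and> norm (snd z) \<le> exp (- \<kappa> * fst z) * \<rho>}"
  have "closed S"
    unfolding S_def by (intro closed_Collect_conj closed_Collect_le continuous_intros)
  then have [measurable]: "S \<in> sets borel" by simp
  have [measurable]: "(\<lambda>z::'n pt. exp (lam * fst z)) \<in> borel_measurable borel"
    by (intro borel_measurable_continuous_onI continuous_intros)
  have w0: "0 \<le> \<omega>" unfolding \<omega>_def by simp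
  have "(\<integral>\<^sup>+z. ennreal ((A * exp (lam * fst z)) powr p) * indicator S z \<partial>lborel)
    = (\<integral>\<^sup>+t. (\<integral>\<^sup>+x. ennreal ((A * exp (lam * t)) powr p) * indicator S (t, x) \<partial>lborel) \<partial>lborel)"
    by (subst nn_integral_pt) simp_all
  also have "\<dots> = (\<integral>\<^sup>+t. ennreal (A powr p * (\<omega> * \<rho> ^ CARD('n))) * indicator {-\<tau>..\<tau>} t \<partial>lborel)"
  proof (intro nn_integral_cong)
    fix t :: real
    have "indicator S (t, x) = (indicator {-\<tau>..\<tau>} t * indicator (cball 0 (exp (- \<kappa> * t) * \<rho>)) x :: ennreal)" for x
      by (auto simp: S_def indicator_def)
    then have "(\<integral>\<^sup>+x. ennreal ((A * exp (lam * t)) powr p) * indicator S (t, x) \<partial>lborel)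
      = (\<integral>\<^sup>+x. (ennreal ((A * exp (lam * t)) powr p) * indicator {-\<tau>..\<tau>} t) * indicator (cball (0::real ^ 'n) (exp (- \<kappa> * t) * \<rho>)) x \<partial>lborel)"
      by (simp add: mult.assoc)
    also have "\<dots> = ennreal ((A * exp (lam * t)) powr p) * indicator {-\<tau>..\<tau>} t * ennreal (\<omega> * (exp (- \<kappa> * t) * \<rho>) ^ CARD('n))"
      using assms(3) by (subst nn_integral_cmult_indicator) (simp_all add: emeasure_cball \<omega>_def)
    also have "\<dots> = ennreal ((A * exp (lam * t)) powr p * (\<omega> * (exp (- \<kappa> * t) * \<rho>) ^ CARD('n))) * indicator {-\<tau>..\<tau>} t"
      using w0 assms(3) by (simp add: ennreal_mult mult_ac)
    also have "(A * exp (lam * t)) powr p * (\<omega> * (exp (- \<kappa> * t) * \<rho>) ^ CARD('n)) = A powr p * (\<omega> * \<rho> ^ CARD('n))"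
    proof -
      have "exp (lam * t) powr p * exp (- \<kappa> * t) ^ CARD('n) = exp ((lam * p) * t - (\<kappa> * real CARD('n)) * t)"
        by (simp add: powr_def exp_of_nat_mult[symmetric] exp_add[symmetric] mult_ac)
      then have "exp (lam * t) powr p * exp (- \<kappa> * t) ^ CARD('n) = 1" using assms(4) by simp
      then show ?thesis by (simp add: powr_mult power_mult_distrib mult.left_commute[of _ \<omega>] mult.assoc[symmetric])
    qed
    finally show "(\<integral>\<^sup>+x. ennreal ((A * exp (lam * t)) powr p) * indicator S (t, x) \<partial>lborel) = ennreal (A powr p * (\<omega> * \<rho> ^ CARD('n))) * indicator {-\<tau>..\<tau>} t" .
  qed
  also have "\<dots> = ennreal (A powr p * (\<omega> * \<rho> ^ CARD('n)) * (2 * \<tau>))"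
    using w0 assms(2,3) by (simp add: nn_integral_cmult_indicator ennreal_mult)
  finally show ?thesis by (simp only: S_def)
qed

text \<open>On the region of half the size both quantities under the cubes are at least 1 - 1/4,
  which gives the factor (3/4)^3 = 27/64 twice.\<close>

lemma spread_fn_lower:
  assumes eps: "0 < \<epsilon>" and k: "0 < k" and p: "1 < p" and lp: "lam * p = \<kappa> * real CARD('n::finite)"
  shows "ennreal (((27 / 64)\<^sup>2) powr p * (unit_ball_vol (real CARD('n)) * (1 / (2 * k)) ^ CARD('n)) * (2 * (1 / (2 * \<epsilon>))))
    \<le> pint p (spread_fn \<epsilon> \<kappa> lam k :: 'n pt \<Rightarrow> real)"
proof -
  have "(\<integral>\<^sup>+z. ennreal (((27 / 64)\<^sup>2 * exp (lam * fst z)) powr p) * indicator {z :: 'n pt. \<bar>fst z\<bar> \<le> 1 / (2 * \<epsilon>) \<and> norm (snd z) \<le> exp (- \<kappa> * fst z) * (1 / (2 * k))} z \<partial>lborel)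
    \<le> pint p (spread_fn \<epsilon> \<kappa> lam k :: 'n pt \<Rightarrow> real)"
    unfolding pint_def
  proof (intro nn_integral_mono)
    fix z :: "'n pt"
    have "ennreal (((27 / 64)\<^sup>2 * exp (lam * fst z)) powr p) \<le> ennreal (norm (spread_fn \<epsilon> \<kappa> lam k z) powr p)"
      if tx: "\<bar>fst z\<bar> \<le> 1 / (2 * \<epsilon>)" "norm (snd z) \<le> exp (- \<kappa> * fst z) * (1 / (2 * k))"
    proof (intro ennreal_leI powr_mono2)
      have "\<epsilon> * \<bar>fst z\<bar> \<le> 1 / 2" using tx(1) eps by (simp add: field_simps)
      then have "(\<epsilon> * \<bar>fst z\<bar>)\<^sup>2 \<le> (1 / 2)\<^sup>2" using eps by (intro power_mono) auto
      then have a: "3 / 4 \<le> 1 - \<epsilon>\<^sup>2 * (fst z)\<^sup>2" by (simp add: power_mult_distrib power_divide)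
      have "exp (\<kappa> * fst z) * (k * norm (snd z)) \<le> exp (\<kappa> * fst z) * (k * (exp (- \<kappa> * fst z) * (1 / (2 * k))))"
        using tx(2) k by (intro mult_left_mono) auto
      also have "\<dots> = 1 / 2" using k by (simp add: exp_minus field_simps)
      finally have "(exp (\<kappa> * fst z) * (k * norm (snd z)))\<^sup>2 \<le> (1 / 2)\<^sup>2" using k by (intro power_mono) auto
      then have b: "3 / 4 \<le> 1 - k\<^sup>2 * exp (2 * \<kappa> * fst z) * (snd z \<bullet> snd z)"
        by (simp add: power_mult_distrib exp_double[symmetric] power2_norm_eq_inner mult_ac power_divide)
      have c: "27 / 64 \<le> max 0 s ^ 3" if "3 / 4 \<le> s" for s :: real
      proof -
        have "(3 / 4) ^ 3 \<le> max 0 s ^ 3" using that by (intro power_mono) auto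
        then show ?thesis by (simp add: power_divide)
      qed
      have "(27 / 64)\<^sup>2 * exp (lam * fst z) = 27 / 64 * exp (lam * fst z) * (27 / 64)" by (simp add: power2_eq_square)
      also have "\<dots> \<le> spread_fn \<epsilon> \<kappa> lam k z"
        unfolding spread_fn_def using c[OF a] c[OF b] by (intro mult_mono) auto
      finally show "(27 / 64)\<^sup>2 * exp (lam * fst z) \<le> norm (spread_fn \<epsilon> \<kappa> lam k z)" by simp
    qed (use p in auto)
    then show "ennreal (((27 / 64)\<^sup>2 * exp (lam * fst z)) powr p) * indicator {z :: 'n pt. \<bar>fst z\<bar> \<le> 1 / (2 * \<epsilon>) \<and> norm (snd z) \<le> exp (- \<kappa> * fst z) * (1 / (2 * k))} z
      \<le> ennreal (norm (spread_fn \<epsilon> \<kappa> lam k z) powr p)"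
      by (auto simp: indicator_def)
  qed
  then show ?thesis using eps k by (subst (asm) spread_integral[OF _ _ _ lp]) auto
qed

text \<open>Up to the factor exp (lam t): on the support |t| \<le> 1/\<epsilon>, so differentiating
  the time cut-off costs 6 \<epsilon>^2 |t| \<le> 6 \<epsilon>. With h = k^2 exp (2 \<kappa> t) and
  h |x|^2 < 1 the pure second derivatives are at most 24 h + 6 h = 30 h, and the smallness condition
  makes the diffusion term at most \<epsilon>. This gives the 7.\<close>

lemma spread_fn_upper:
  assumes eps: "0 < \<epsilon>" and k: "0 < k" and kap: "0 \<le> \<kappa>" and K: "0 \<le> K" and p: "1 < p" and lp: "lam * p = \<kappa> * real CARD('n::finite)"
    and small: "real CARD('n) * (K * (30 * (k\<^sup>2 * exp (2 * \<kappa> / \<epsilon>)))) \<le> \<epsilon>"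
  shows "pint p (\<lambda>z :: 'n pt. heat_op e_x e_t K lam (spread_fn \<epsilon> \<kappa> lam k) z + (- \<kappa> *\<^sub>R snd z) \<bullet> gradx (spread_fn \<epsilon> \<kappa> lam k) z)
    \<le> ennreal ((7 * \<epsilon>) powr p * (unit_ball_vol (real CARD('n)) * (1 / k) ^ CARD('n)) * (2 * (1 / \<epsilon>)))"
proof -
  define F where "F z = heat_op e_x e_t K lam (spread_fn \<epsilon> \<kappa> lam k) z + (- \<kappa> *\<^sub>R snd z) \<bullet> gradx (spread_fn \<epsilon> \<kappa> lam k) z" for z :: "'n pt"
  have bound: "\<bar>F z\<bar> \<le> 7 * \<epsilon> * exp (lam * fst z)" and zero: "F z \<noteq> 0 \<Longrightarrow> \<bar>fst z\<bar> \<le> 1 / \<epsilon> \<and> norm (snd z) \<le> exp (- \<kappa> * fst z) * (1 / k)" for z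
  proof -
    define Y where "Y = 1 - k\<^sup>2 * exp (2 * \<kappa> * fst z) * (snd z \<bullet> snd z)"
    define X where "X = 1 - \<epsilon>\<^sup>2 * (fst z)\<^sup>2"
    define h where "h = k\<^sup>2 * exp (2 * \<kappa> * fst z)"
    have h0: "0 \<le> h" by (simp add: h_def)
    have F: "F z = (3 * max 0 X ^ 2 * (- 2 * \<epsilon>\<^sup>2 * fst z)) * exp (lam * fst z) * max 0 Y ^ 3
      + (\<Sum>i\<in>UNIV. K * (max 0 X ^ 3 * exp (lam * fst z) * (6 * max 0 Y * (2 * h * snd z $ i)\<^sup>2 - 6 * max 0 Y ^ 2 * h)))"
      unfolding F_def spread_fn_equation[OF eps k kap] spread_fn_dxx[OF eps k kap] X_def Y_def h_def by (simp add: mult.assoc)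
    have X1: "max 0 X \<le> 1" by (simp add: X_def)
    have Y1: "max 0 Y \<le> 1" using h0 by (simp add: Y_def h_def[symmetric])
    have XY: "0 < X \<and> 0 < Y" if "F z \<noteq> 0"
    proof (rule ccontr)
      assume "\<not> (0 < X \<and> 0 < Y)"
      then have "max 0 X = 0 \<or> max 0 Y = 0" by auto
      then show False using that unfolding F by auto
    qed
    have tX: "\<bar>fst z\<bar> \<le> 1 / \<epsilon>" if "0 < X"
    proof -
      have "(\<epsilon> * \<bar>fst z\<bar>)\<^sup>2 < 1\<^sup>2" using that by (simp add: X_def power_mult_distrib)
      then have "\<epsilon> * \<bar>fst z\<bar> < 1" by (rule power_less_imp_less_base) simp
      then show ?thesis using eps by (simp add: field_simps)
    qed
    have xY: "h * (snd z \<bullet> snd z) < 1" if "0 < Y" using that by (simp add: Y_def h_def)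
    show "\<bar>fst z\<bar> \<le> 1 / \<epsilon> \<and> norm (snd z) \<le> exp (- \<kappa> * fst z) * (1 / k)" if "F z \<noteq> 0"
    proof
      show "\<bar>fst z\<bar> \<le> 1 / \<epsilon>" using tX XY[OF that] by simp
      have "(exp (\<kappa> * fst z) * (k * norm (snd z)))\<^sup>2 < 1\<^sup>2"
        using xY XY[OF that] by (simp add: h_def power_mult_distrib exp_double[symmetric] power2_norm_eq_inner mult_ac)
      then have "exp (\<kappa> * fst z) * (k * norm (snd z)) < 1" by (rule power_less_imp_less_base) simp
      then show "norm (snd z) \<le> exp (- \<kappa> * fst z) * (1 / k)" using k by (simp add: exp_minus field_simps)
    qed
    show "\<bar>F z\<bar> \<le> 7 * \<epsilon> * exp (lam * fst z)"
    proof (cases "F z = 0")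
      case False
      note XY = XY[OF False]
      have t: "\<bar>fst z\<bar> \<le> 1 / \<epsilon>" using tX XY by simp
      have hle: "h \<le> k\<^sup>2 * exp (2 * \<kappa> / \<epsilon>)"
      proof -
        have "\<kappa> * fst z \<le> \<kappa> * (1 / \<epsilon>)" using t kap by (intro mult_left_mono) auto
        then show ?thesis unfolding h_def by (intro mult_left_mono) auto
      qed
      have P1: "\<bar>(3 * max 0 X ^ 2 * (- 2 * \<epsilon>\<^sup>2 * fst z)) * exp (lam * fst z) * max 0 Y ^ 3\<bar> \<le> (3 * 1 * (2 * \<epsilon>\<^sup>2 * (1 / \<epsilon>))) * exp (lam * fst z) * 1"
        unfolding abs_mult using X1 Y1 t eps by (intro mult_mono power_le_one) (auto intro!: power_le_one)
      have each: "\<bar>K * (max 0 X ^ 3 * exp (lam * fst z) * (6 * max 0 Y * (2 * h * snd z $ i)\<^sup>2 - 6 * max 0 Y ^ 2 * h))\<bar> \<le> K * (1 * exp (lam * fst z) * (30 * h))" for i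
      proof -
        have "(snd z $ i)\<^sup>2 \<le> snd z \<bullet> snd z"
          using component_le_norm_cart[of "snd z" i] power_mono[of "\<bar>snd z $ i\<bar>" "norm (snd z)" 2] by (simp add: power2_norm_eq_inner)
        then have "h * (snd z $ i)\<^sup>2 \<le> h * (snd z \<bullet> snd z)" using h0 by (rule mult_left_mono)
        then have "h * (snd z $ i)\<^sup>2 \<le> 1" using xY XY by simp
        then have "(4 * h) * (h * (snd z $ i)\<^sup>2) \<le> (4 * h) * 1" using h0 by (intro mult_left_mono) auto
        then have q1: "(2 * h * snd z $ i)\<^sup>2 \<le> 4 * h" by (simp add: power2_eq_square mult_ac)
        have "6 * max 0 Y * (2 * h * snd z $ i)\<^sup>2 \<le> 6 * 1 * (4 * h)" using Y1 q1 by (intro mult_mono) auto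
        moreover have "0 \<le> 6 * max 0 Y * (2 * h * snd z $ i)\<^sup>2" by simp
        moreover have "6 * max 0 Y ^ 2 * h \<le> 6 * 1 * h" using Y1 h0 by (intro mult_mono power_le_one) auto
        moreover have "0 \<le> 6 * max 0 Y ^ 2 * h" using h0 by simp
        ultimately have "\<bar>6 * max 0 Y * (2 * h * snd z $ i)\<^sup>2 - 6 * max 0 Y ^ 2 * h\<bar> \<le> 30 * h" using h0 by linarith
        then show ?thesis unfolding abs_mult using K X1 by (intro mult_mono) (auto intro!: power_le_one)
      qed
      have "\<bar>F z\<bar> \<le> 6 * \<epsilon> * exp (lam * fst z) + (\<Sum>i\<in>(UNIV :: 'n set). K * (1 * exp (lam * fst z) * (30 * h)))"
        unfolding F
      proof (intro order.trans[OF abs_triangle_ineq] add_mono order.trans[OF sum_abs] sum_mono each)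
        have "(3 * 1 * (2 * \<epsilon>\<^sup>2 * (1 / \<epsilon>))) * exp (lam * fst z) * 1 = 6 * \<epsilon> * exp (lam * fst z)"
          using eps by (simp add: power2_eq_square)
        then show "\<bar>(3 * max 0 X ^ 2 * (- 2 * \<epsilon>\<^sup>2 * fst z)) * exp (lam * fst z) * max 0 Y ^ 3\<bar> \<le> 6 * \<epsilon> * exp (lam * fst z)" using P1 by linarith
      qed
      also have "\<dots> = (6 * \<epsilon> + real CARD('n) * (K * (30 * h))) * exp (lam * fst z)"
        by (simp add: algebra_simps)
      also have "\<dots> \<le> (6 * \<epsilon> + \<epsilon>) * exp (lam * fst z)"
      proof (intro mult_right_mono add_left_mono order.trans[OF _ small])
        show "real CARD('n) * (K * (30 * h)) \<le> real CARD('n) * (K * (30 * (k\<^sup>2 * exp (2 * \<kappa> / \<epsilon>))))"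
          using hle K by (intro mult_left_mono) auto
      qed simp
      finally show ?thesis by simp
    qed (use eps in simp)
  qed
  have "pint p F \<le> (\<integral>\<^sup>+z. ennreal ((7 * \<epsilon> * exp (lam * fst z)) powr p) * indicator {z :: 'n pt. \<bar>fst z\<bar> \<le> 1 / \<epsilon> \<and> norm (snd z) \<le> exp (- \<kappa> * fst z) * (1 / k)} z \<partial>lborel)"
    unfolding pint_def
  proof (intro nn_integral_mono)
    fix z
    have "ennreal (norm (F z) powr p) \<le> ennreal ((7 * \<epsilon> * exp (lam * fst z)) powr p)"
      using bound[of z] p by (intro ennreal_leI powr_mono2) auto
    then show "ennreal (norm (F z) powr p) \<le> ennreal ((7 * \<epsilon> * exp (lam * fst z)) powr p) * indicator {z :: 'n pt. \<bar>fst z\<bar> \<le> 1 / \<epsilon> \<and> norm (snd z) \<le> exp (- \<kappa> * fst z) * (1 / k)} z"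
      using zero[of z] by (cases "F z = 0") (auto simp: indicator_def)
  qed
  also have "\<dots> = ennreal ((7 * \<epsilon>) powr p * (unit_ball_vol (real CARD('n)) * (1 / k) ^ CARD('n)) * (2 * (1 / \<epsilon>)))"
    using eps k by (intro spread_integral[OF _ _ _ lp]) auto
  finally show ?thesis by (simp add: F_def[abs_def])
qed

text \<open>Either term on the left is dropped and the rest raised to the power p. The summand 1
  makes the constant positive, so the right-hand side is infinite when \<open>pint p g\<close> is;
  this settles the case that \<open>le_of_enn_powr_le\<close> leaves open.\<close>

lemma apriori_pint:
  assumes le: "ennreal lam * Lp_norm p UNIV u + Lp_norm p UNIV D2u \<le> ennreal N * Lp_norm p UNIV g"
    and "0 < lam" "0 < p"
  shows "pint p u \<le> ennreal ((max 0 N / lam) powr p + (max 0 N) powr p + 1) * pint p g"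
    and "pint p D2u \<le> ennreal ((max 0 N / lam) powr p + (max 0 N) powr p + 1) * pint p g"
proof -
  define C where "C = (max 0 N / lam) powr p + (max 0 N) powr p + 1"
  have C: "0 < C" by (simp add: C_def add_nonneg_pos)
  have top: "X \<le> ennreal C * pint p g" if "X \<le> ennreal c * pint p g \<or> pint p g = \<infinity>" "c \<le> C" for X c
    using that(1)
  proof
    assume "X \<le> ennreal c * pint p g"
    also have "\<dots> \<le> ennreal C * pint p g" using that(2) by (intro mult_right_mono ennreal_leI) auto
    finally show ?thesis .
  next
    assume "pint p g = \<infinity>"
    then show ?thesis using C by (simp add: ennreal_mult_top)
  qed
  have "ennreal lam * Lp_norm p UNIV u \<le> ennreal N * Lp_norm p UNIV g"
    using le by (rule order.trans[rotated]) simp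
  from le_of_enn_powr_le[OF this[unfolded Lp_norm_UNIV] assms(3,2)]
  show "pint p u \<le> ennreal ((max 0 N / lam) powr p + (max 0 N) powr p + 1) * pint p g"
    unfolding C_def[symmetric] by (rule top) (simp add: C_def)
  have "ennreal 1 * Lp_norm p UNIV D2u \<le> ennreal N * Lp_norm p UNIV g"
    using le by (rule order.trans[rotated]) simp
  from le_of_enn_powr_le[OF this[unfolded Lp_norm_UNIV] assms(3) zero_less_one]
  show "pint p D2u \<le> ennreal ((max 0 N / lam) powr p + (max 0 N) powr p + 1) * pint p g"
    unfolding C_def[symmetric] by (rule top) (simp add: C_def)
qed

lemma scalar_matrix_form:
  fixes \<xi> :: "real ^ 'n"
  shows "(\<Sum>i\<in>UNIV. \<Sum>j\<in>UNIV. (\<chi> i j. if i = j then K else 0) $ i $ j * \<xi> $ i * \<xi> $ j) = K * norm \<xi> ^ 2"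
proof -
  have "(\<Sum>i\<in>UNIV. \<Sum>j\<in>UNIV. (\<chi> i j. if i = j then K else 0) $ i $ j * \<xi> $ i * \<xi> $ j) = (\<Sum>i\<in>UNIV. \<Sum>j\<in>UNIV. if i = j then K * \<xi> $ i * \<xi> $ j else 0)"
    by (intro sum.cong) auto
  also have "\<dots> = K * norm \<xi> ^ 2"
    by (simp add: power2_norm_eq_inner inner_vec_def sum_distrib_left mult.assoc)
  finally show ?thesis .
qed

text \<open>Were \<open>lam0\<close> \<le> 0, the estimate would apply to every positive lam. For
  \<open>spread_fn\<close> both sides are of order Z, the left with a fixed factor and the right
  with the factor \<epsilon>^p, because the homogeneous equation holds up to a relative error of
  order \<epsilon>. The parameters are fixed in the order \<kappa>, lam, \<epsilon>, k; in
  particular the constant C, which involves lam, precedes \<epsilon>.\<close>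

lemma lam0_pos:
  fixes p q \<delta> K \<epsilon>0 \<alpha> \<gamma>a \<gamma>b lam0 N :: real
  assumes p: "1 < p" and q: "1 < q" and dK: "\<delta> \<le> K" "0 \<le> K" and ga: "0 < \<gamma>a" "0 < \<gamma>b" and e0: "0 < \<epsilon>0" and al: "0 < \<alpha>" "\<alpha> \<le> 1"
    and apriori: "\<And>(a' :: 'n::finite pt \<Rightarrow> real ^ 'n ^ 'n) b' c' u ut Du D2u lam.
        AssumpP p \<delta> K a' b' c' \<Longrightarrow> AssumpB q \<alpha> \<gamma>b b' \<Longrightarrow> AssumpA \<epsilon>0 \<gamma>a a' \<Longrightarrow>
        W2p p (-\<infinity>) u ut Du D2u \<Longrightarrow> lam0 \<le> lam \<Longrightarrow>
        ennreal lam * Lp_norm p UNIV u + Lp_norm p UNIV D2u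
          \<le> ennreal N * Lp_norm p UNIV (\<lambda>z. Lop a' b' c' u Du D2u z + ut z - lam * u z)"
  shows "0 < lam0"
proof (rule ccontr)
  assume "\<not> 0 < lam0"
  then have lam0: "lam0 \<le> 0" by simp
  define d where "d = real CARD('n)"
  have d: "0 < d" by (simp add: d_def)
  obtain V where V: "emeasure lborel (ball (0::real ^ 'n) \<alpha>) = ennreal V" "0 \<le> V" by (rule ball_volume)
  \<comment> \<open>On a ball of radius at most 1 the drift - \<kappa> x varies by at most 2
    \<kappa>, so Assumption B asks for \<alpha>^(-d) V^2 (2 \<kappa>)^q \<le> \<gamma>b. The summand
    1 keeps c0 positive whatever V is.\<close>
  define c0 where "c0 = \<alpha> powr (- d) * (V * V) + 1"
  have c0: "0 < c0" using V by (simp add: c0_def add_nonneg_pos)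
  define \<kappa> where "\<kappa> = (\<gamma>b / c0) powr (1 / q) / 2"
  have kap: "0 < \<kappa>" using ga c0 by (simp add: \<kappa>_def)
  have kapq: "(2 * \<kappa>) powr q = \<gamma>b / c0" using ga c0 q by (simp add: \<kappa>_def powr_powr)
  define lam where "lam = \<kappa> * d / p"
  have lam: "0 < lam" using kap d p by (simp add: lam_def)
  have lp: "lam * p = \<kappa> * real CARD('n)" using p by (simp add: lam_def d_def)
  define a' where "a' = (\<lambda>z :: 'n pt. (\<chi> i j. if i = j then K else 0) :: real ^ 'n ^ 'n)"
  define b' where "b' = (\<lambda>z :: 'n pt. - \<kappa> *\<^sub>R snd z)"
  define c' where "c' = (\<lambda>z :: 'n pt. 0 :: real)"
  have bc: "continuous_on UNIV (\<lambda>z. b' z $ i)" for i unfolding b'_def by (intro continuous_intros)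
  have AP: "AssumpP p \<delta> K a' b' c'"
    unfolding AssumpP_def
  proof (intro conjI allI impI)
    show "(\<lambda>z. a' z $ i $ j) \<in> borel_measurable lebesgue" for i j by (simp add: a'_def)
    show "(\<lambda>z. b' z $ i) \<in> borel_measurable lebesgue" for i
      using borel_measurable_continuous_onI[OF bc[of i]] by (simp add: measurable_completion)
    show "c' \<in> borel_measurable lebesgue" by (simp add: c'_def)
    show "a' z $ i $ j = a' z $ j $ i" for z i j by (simp add: a'_def)
    show "0 \<le> c' z" "c' z \<le> K" for z using dK by (auto simp: c'_def)
    show "\<delta> * norm \<xi> ^ 2 \<le> (\<Sum>i\<in>UNIV. \<Sum>j\<in>UNIV. a' z $ i $ j * \<xi> $ i * \<xi> $ j)"
      "(\<Sum>i\<in>UNIV. \<Sum>j\<in>UNIV. a' z $ i $ j * \<xi> $ i * \<xi> $ j) \<le> K * norm \<xi> ^ 2" for z \<xi>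
      unfolding a'_def scalar_matrix_form using dK by (auto intro: mult_right_mono)
    fix x :: "real ^ 'n" and \<beta> s t :: real
    assume be: "0 < \<beta> \<and> \<beta> \<le> 1"
    obtain W where W: "emeasure lborel (ball (0::real ^ 'n) \<beta>) = ennreal W" "0 \<le> W" by (rule ball_volume)
    define m where "m = \<kappa> * (norm x + 1) * W"
    have m: "0 \<le> m" using kap W by (simp add: m_def)
    have inner: "(\<integral>\<^sup>+ y\<in>ball 0 \<beta>. ennreal (norm (b' (\<tau>, x + y))) \<partial>lebesgue) \<le> ennreal m" for \<tau>
    proof -
      have "(\<integral>\<^sup>+ y\<in>ball 0 \<beta>. ennreal (norm (b' (\<tau>, x + y))) \<partial>lebesgue) \<le> (\<integral>\<^sup>+ y. ennreal (\<kappa> * (norm x + 1)) * indicator (ball (0::real ^ 'n) \<beta>) y \<partial>lborel)"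
        unfolding nn_integral_completion
      proof (intro nn_integral_mono)
        fix y :: "real ^ 'n"
        have "norm (b' (\<tau>, x + y)) \<le> \<kappa> * (norm x + 1)" if "norm y < \<beta>"
          using that be kap norm_triangle_ineq[of x y] by (auto simp: b'_def intro!: mult_left_mono)
        then show "ennreal (norm (b' (\<tau>, x + y))) * indicator (ball 0 \<beta>) y \<le> ennreal (\<kappa> * (norm x + 1)) * indicator (ball 0 \<beta>) y"
          by (auto simp: indicator_def intro!: ennreal_leI)
      qed
      also have "\<dots> = ennreal m"
        using kap W by (simp add: nn_integral_cmult_indicator m_def ennreal_mult)
      finally show ?thesis .
    qed
    have "(\<integral>\<^sup>+ \<tau>\<in>{s..t}. enn_powr (\<integral>\<^sup>+ y\<in>ball 0 \<beta>. ennreal (norm (b' (\<tau>, x + y))) \<partial>lebesgue) (p / (p - 1)) \<partial>lebesgue)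
      \<le> (\<integral>\<^sup>+ \<tau>. enn_powr (ennreal m) (p / (p - 1)) * indicator {s..t} \<tau> \<partial>lborel)"
      unfolding nn_integral_completion using p inner[unfolded nn_integral_completion]
      by (intro nn_integral_mono mult_right_mono enn_powr_mono) auto
    also have "\<dots> < \<infinity>"
      using m by (simp add: nn_integral_cmult_indicator enn_powr_ennreal ennreal_mult_less_top emeasure_lborel_Icc_eq)
    finally show "(\<integral>\<^sup>+ \<tau>\<in>{s..t}. enn_powr (\<integral>\<^sup>+ y\<in>ball 0 \<beta>. ennreal (norm (b' (\<tau>, x + y))) \<partial>lebesgue) (p / (p - 1)) \<partial>lebesgue) < \<infinity>" .
  qed
  have AB: "AssumpB q \<alpha> \<gamma>b b'"
    unfolding AssumpB_def
  proof (intro conjI al AE_I2)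
    fix z :: "'n pt"
    have "(\<integral>\<^sup>+ y\<in>ball 0 \<alpha>. \<integral>\<^sup>+ w\<in>ball 0 \<alpha>. ennreal (norm (b' (fst z, snd z + y) - b' (fst z, snd z + w)) powr q) \<partial>lebesgue \<partial>lebesgue)
      \<le> (\<integral>\<^sup>+ y. (\<integral>\<^sup>+ w. ennreal ((2 * \<kappa>) powr q) * indicator (ball (0::real ^ 'n) \<alpha>) w \<partial>lborel) * indicator (ball (0::real ^ 'n) \<alpha>) y \<partial>lborel)"
      unfolding nn_integral_completion
    proof (intro nn_integral_mono)
      fix y :: "real ^ 'n"
      have "(\<integral>\<^sup>+ w. ennreal (norm (b' (fst z, snd z + y) - b' (fst z, snd z + w)) powr q) * indicator (ball 0 \<alpha>) w \<partial>lborel)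
        \<le> (\<integral>\<^sup>+ w. ennreal ((2 * \<kappa>) powr q) * indicator (ball (0::real ^ 'n) \<alpha>) w \<partial>lborel)" if y: "norm y < \<alpha>"
      proof (intro nn_integral_mono)
        fix w :: "real ^ 'n"
        have "norm (b' (fst z, snd z + y) - b' (fst z, snd z + w)) powr q \<le> (2 * \<kappa>) powr q" if w: "norm w < \<alpha>"
        proof (intro powr_mono2)
          have "b' (fst z, snd z + y) - b' (fst z, snd z + w) = (- \<kappa>) *\<^sub>R (y - w)" by (simp add: b'_def algebra_simps)
          then have "norm (b' (fst z, snd z + y) - b' (fst z, snd z + w)) = \<kappa> * norm (y - w)" using kap by simp
          also have "\<dots> \<le> \<kappa> * 2" using y w al kap norm_triangle_ineq4[of y w] by (intro mult_left_mono) auto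
          finally show "norm (b' (fst z, snd z + y) - b' (fst z, snd z + w)) \<le> 2 * \<kappa>" by simp
        qed (use q in auto)
        then show "ennreal (norm (b' (fst z, snd z + y) - b' (fst z, snd z + w)) powr q) * indicator (ball 0 \<alpha>) w \<le> ennreal ((2 * \<kappa>) powr q) * indicator (ball 0 \<alpha>) w"
          by (auto simp: indicator_def intro!: ennreal_leI)
      qed
      then show "(\<integral>\<^sup>+ w. ennreal (norm (b' (fst z, snd z + y) - b' (fst z, snd z + w)) powr q) * indicator (ball 0 \<alpha>) w \<partial>lborel) * indicator (ball 0 \<alpha>) y
        \<le> (\<integral>\<^sup>+ w. ennreal ((2 * \<kappa>) powr q) * indicator (ball (0::real ^ 'n) \<alpha>) w \<partial>lborel) * indicator (ball 0 \<alpha>) y"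
        by (auto simp: indicator_def)
    qed
    also have "\<dots> = ennreal ((2 * \<kappa>) powr q * V * V)"
      using V by (simp add: nn_integral_cmult_indicator ennreal_mult)
    finally have "ennreal (\<alpha> powr (- real CARD('n))) * (\<integral>\<^sup>+ y\<in>ball 0 \<alpha>. \<integral>\<^sup>+ w\<in>ball 0 \<alpha>. ennreal (norm (b' (fst z, snd z + y) - b' (fst z, snd z + w)) powr q) \<partial>lebesgue \<partial>lebesgue)
      \<le> ennreal (\<alpha> powr (- d)) * ennreal ((2 * \<kappa>) powr q * V * V)"
      unfolding d_def by (rule mult_left_mono) simp
    also have "\<dots> = ennreal (\<alpha> powr (- d) * ((2 * \<kappa>) powr q * V * V))"
      using V by (subst ennreal_mult) auto
    also have "\<dots> \<le> ennreal \<gamma>b"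
    proof (rule ennreal_leI)
      have "\<alpha> powr (- d) * ((2 * \<kappa>) powr q * V * V) = \<gamma>b / c0 * (c0 - 1)" unfolding kapq by (simp add: c0_def)
      also have "\<dots> \<le> \<gamma>b / c0 * c0" using ga c0 by (intro mult_left_mono) auto
      finally show "\<alpha> powr (- d) * ((2 * \<kappa>) powr q * V * V) \<le> \<gamma>b" using c0 by simp
    qed
    finally show "ennreal (\<alpha> powr (- real CARD('n))) * (\<integral>\<^sup>+ y\<in>ball 0 \<alpha>. \<integral>\<^sup>+ w\<in>ball 0 \<alpha>. ennreal (norm (b' (fst z, snd z + y) - b' (fst z, snd z + w)) powr q) \<partial>lebesgue \<partial>lebesgue) \<le> ennreal \<gamma>b" .
  qed
  have AA: "AssumpA \<epsilon>0 \<gamma>a a'"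
    unfolding AssumpA_def a'_def using e0 by simp
  define C where "C = (max 0 N / lam) powr p + (max 0 N) powr p + 1"
  have C: "0 < C" by (simp add: C_def add_nonneg_pos)
  define c1 where "c1 = ((27 / 64)\<^sup>2 :: real) powr p * (1 / 2) ^ CARD('n)"
  have c1: "0 < c1" by (simp add: c1_def)
  \<comment> \<open>With this value the upper bound C (7 \<epsilon>)^p 2 Z is half of the lower
    bound c1 Z, which is the contradiction aimed at.\<close>
  define \<epsilon> where "\<epsilon> = (c1 / (4 * C)) powr (1 / p) / 7"
  have eps: "0 < \<epsilon>" using c1 C by (simp add: \<epsilon>_def)
  have epsp: "(7 * \<epsilon>) powr p = c1 / (4 * C)" using c1 C p by (simp add: \<epsilon>_def powr_powr)
  define Q where "Q = real CARD('n) * (K * (30 * exp (2 * \<kappa> / \<epsilon>))) + 1"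
  have Q: "0 < Q" using dK by (simp add: Q_def add_nonneg_pos)
  \<comment> \<open>\<epsilon> is fixed by now, so the large factor exp (2 \<kappa> / \<epsilon>) in
    Q is a constant that a small k outweighs.\<close>
  define k where "k = sqrt (\<epsilon> / Q)"
  have k: "0 < k" "k\<^sup>2 = \<epsilon> / Q" using eps Q by (auto simp: k_def)
  have small: "real CARD('n) * (K * (30 * (k\<^sup>2 * exp (2 * \<kappa> / \<epsilon>)))) \<le> \<epsilon>"
  proof -
    have "real CARD('n) * (K * (30 * (k\<^sup>2 * exp (2 * \<kappa> / \<epsilon>)))) = k\<^sup>2 * (Q - 1)" by (simp add: Q_def)
    also have "\<dots> \<le> k\<^sup>2 * Q" by (intro mult_left_mono) auto
    finally show ?thesis using k Q by simp
  qed
  define u where "u = (spread_fn \<epsilon> \<kappa> lam k :: 'n pt \<Rightarrow> real)"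
  have u: "C2c u" unfolding u_def using eps k kap by (intro spread_fn_C2c) auto
  have opeq: "Lop a' b' c' u (gradx u) (hessx u) z + dd e_t u z - lam * u z = heat_op e_x e_t K lam u z + (- \<kappa> *\<^sub>R snd z) \<bullet> gradx u z" for z
  proof -
    have "opL a' b' c' lam u z = heat_op e_x e_t K lam u z + lowop a' b' c' K u z" by (rule opL_lowop)
    moreover have "lowop a' b' c' K u z = (- \<kappa> *\<^sub>R snd z) \<bullet> gradx u z" by (simp add: lowop_def a'_def b'_def c'_def)
    ultimately show ?thesis by (simp add: opL_def)
  qed
  have "ennreal lam * Lp_norm p UNIV u + Lp_norm p UNIV (hessx u)
      \<le> ennreal N * Lp_norm p UNIV (\<lambda>z. Lop a' b' c' u (gradx u) (hessx u) z + dd e_t u z - lam * u z)"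
    using p lam lam0 by (intro apriori[OF AP AB AA C2c_W2p[OF u]]) auto
  from apriori_pint(1)[OF this lam] p
  have le: "pint p u \<le> ennreal C * pint p (\<lambda>z. heat_op e_x e_t K lam u z + (- \<kappa> *\<^sub>R snd z) \<bullet> gradx u z)"
    by (simp add: opeq C_def)
  define \<omega> where "\<omega> = unit_ball_vol (real CARD('n))"
  have om: "0 < \<omega>" by (simp add: \<omega>_def)
  define Z where "Z = \<omega> * (1 / k) ^ CARD('n) / \<epsilon>"
  have Z: "0 < Z" using om k eps by (simp add: Z_def)
  have "ennreal (((27 / 64)\<^sup>2) powr p * (\<omega> * (1 / (2 * k)) ^ CARD('n)) * (2 * (1 / (2 * \<epsilon>)))) \<le> pint p u"
    unfolding u_def \<omega>_def by (rule spread_fn_lower[OF eps k(1) p lp])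
  also have "((27 / 64)\<^sup>2) powr p * (\<omega> * (1 / (2 * k)) ^ CARD('n)) * (2 * (1 / (2 * \<epsilon>))) = c1 * Z"
  proof -
    have "1 / (2 * k) = (1 / 2) * (1 / k)" by simp
    then have "(1 / (2 * k)) ^ CARD('n) = (1 / 2) ^ CARD('n) * (1 / k) ^ CARD('n)" by (simp only: power_mult_distrib)
    then show ?thesis by (simp add: c1_def Z_def)
  qed
  finally have "ennreal (c1 * Z) \<le> ennreal C * pint p (\<lambda>z. heat_op e_x e_t K lam u z + (- \<kappa> *\<^sub>R snd z) \<bullet> gradx u z)"
    using le by order
  also have "\<dots> \<le> ennreal C * ennreal ((7 * \<epsilon>) powr p * (\<omega> * (1 / k) ^ CARD('n)) * (2 * (1 / \<epsilon>)))"
    unfolding u_def \<omega>_def using kap by (intro mult_left_mono spread_fn_upper[OF eps k(1) _ dK(2) p lp small]) auto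
  also have "(7 * \<epsilon>) powr p * (\<omega> * (1 / k) ^ CARD('n)) * (2 * (1 / \<epsilon>)) = c1 / (4 * C) * (2 * Z)"
    unfolding epsp by (simp add: Z_def)
  also have "ennreal C * ennreal (c1 / (4 * C) * (2 * Z)) = ennreal (c1 * Z / 2)"
    using C c1 Z by (subst ennreal_mult[symmetric]) auto
  finally have "c1 * Z \<le> c1 * Z / 2" using c1 Z by (subst (asm) ennreal_le_iff) auto
  moreover have "0 < c1 * Z" using c1 Z by simp
  ultimately show False by linarith
qed

subsection \<open>Restriction and uniqueness\<close>

lemma frechet_derivative_off_support:
  fixes \<phi> :: "'a::euclidean_space \<Rightarrow> real"
  assumes "z \<notin> closure {z. \<phi> z \<noteq> 0}"
  shows "frechet_derivative \<phi> (at z) e = 0"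
proof -
  have "(\<phi> has_derivative (\<lambda>_. 0)) (at z)"
  proof (rule has_derivative_transform_within_open[OF has_derivative_const[of 0]])
    show "open (- closure {z. \<phi> z \<noteq> 0})" by (intro open_Compl closed_closure)
    show "z \<in> - closure {z. \<phi> z \<noteq> 0}" using assms by simp
    fix x assume "x \<in> - closure {z. \<phi> z \<noteq> 0}"
    then show "0 = \<phi> x" using closure_subset[of "{z. \<phi> z \<noteq> 0}"] by auto
  qed
  from frechet_derivative_at[OF this] show ?thesis by (metis (no_types))
qed

lemma test_fn_vanishes:
  assumes "test_fn \<Omega> \<phi>" "z \<notin> \<Omega>"
  shows "\<phi> z = 0" "frechet_derivative \<phi> (at z) e = 0"
proof -
  have z: "z \<notin> closure {z. \<phi> z \<noteq> 0}" using assms by (auto simp: test_fn_def)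
  then show "frechet_derivative \<phi> (at z) e = 0" by (rule frechet_derivative_off_support)
  show "\<phi> z = 0" using z closure_subset[of "{z. \<phi> z \<noteq> 0}"] by auto
qed

text \<open>A test function on \<Omega> is, as it stands, one on the whole space, and outside
  \<Omega> both integrands vanish, so the integrals over \<Omega> and over the whole space
  agree.\<close>

lemma weak_deriv_restrict:
  assumes "weak_deriv UNIV u e g"
  shows "weak_deriv \<Omega> u e g"
  unfolding weak_deriv_def
proof (intro conjI allI impI)
  show "loc_integrable \<Omega> u" "loc_integrable \<Omega> g" using assms by (auto simp: weak_deriv_def loc_integrable_def)
  fix \<phi> assume t: "test_fn \<Omega> \<phi>"
  have "test_fn UNIV \<phi>" using t by (simp add: test_fn_def)
  then have "(LINT z:UNIV|lebesgue. u z * frechet_derivative \<phi> (at z) e) = - (LINT z:UNIV|lebesgue. g z * \<phi> z)"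
    using assms by (simp add: weak_deriv_def)
  moreover have "indicator \<Omega> z *\<^sub>R (u z * frechet_derivative \<phi> (at z) e) = u z * frechet_derivative \<phi> (at z) e"
    "indicator \<Omega> z *\<^sub>R (g z * \<phi> z) = g z * \<phi> z" for z
    using test_fn_vanishes[OF t, of z] by (auto simp: indicator_def)
  ultimately show "(LINT z:\<Omega>|lebesgue. u z * frechet_derivative \<phi> (at z) e) = - (LINT z:\<Omega>|lebesgue. g z * \<phi> z)"
    unfolding set_lebesgue_integral_def by (simp del: real_scaleR_def)
qed

lemma set_integrable_times_compact_support:
  fixes u \<psi> :: "'a::euclidean_space \<Rightarrow> real"
  assumes u: "loc_integrable \<Omega> u" and C: "compact C" "C \<subseteq> \<Omega>" and psi: "continuous_on UNIV \<psi>" "\<And>z. z \<notin> C \<Longrightarrow> \<psi> z = 0"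
  shows "set_integrable lebesgue \<Omega> (\<lambda>z. u z * \<psi> z)"
proof -
  have "set_integrable lebesgue C u" using u C by (simp add: loc_integrable_def)
  then have int: "integrable lebesgue (\<lambda>z. indicator C z *\<^sub>R u z)" by (simp add: set_integrable_def)
  have "bounded (\<psi> ` C)"
    by (rule compact_imp_bounded[OF compact_continuous_image[OF continuous_on_subset[OF psi(1)] C(1)]]) simp
  then obtain B where B: "\<And>z. z \<in> C \<Longrightarrow> \<bar>\<psi> z\<bar> \<le> B" by (auto simp: bounded_iff)
  have pm: "\<psi> \<in> borel_measurable lebesgue"
    using borel_measurable_continuous_onI[OF psi(1)] by (simp add: measurable_completion)
  have eq: "indicator \<Omega> z *\<^sub>R (u z * \<psi> z) = (indicator C z *\<^sub>R u z) * \<psi> z" for z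
    using psi(2)[of z] C(2) by (auto simp: indicator_def)
  show ?thesis
    unfolding set_integrable_def eq
  proof (rule Bochner_Integration.integrable_bound[OF integrable_mult_right[OF int, of B]])
    show "(\<lambda>z. (indicator C z *\<^sub>R u z) * \<psi> z) \<in> borel_measurable lebesgue"
      by (rule borel_measurable_times[OF borel_measurable_integrable[OF int] pm])
    have "norm (indicator C z *\<^sub>R u z * \<psi> z) \<le> norm (B * (indicator C z *\<^sub>R u z))" for z
    proof (cases "z \<in> C")
      case True
      have "\<bar>\<psi> z\<bar> \<le> \<bar>B\<bar>" using B[OF True] by linarith
      then have "\<bar>\<psi> z\<bar> * \<bar>u z\<bar> \<le> \<bar>B\<bar> * \<bar>u z\<bar>" by (rule mult_right_mono) simp
      then show ?thesis using True by (simp add: abs_mult mult.commute)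
    qed simp
    then show "AE z in lebesgue. norm (indicator C z *\<^sub>R u z * \<psi> z) \<le> norm (B * (indicator C z *\<^sub>R u z))" by simp
  qed
qed

lemma loc_integrable_diff:
  assumes "loc_integrable \<Omega> u" "loc_integrable \<Omega> v"
  shows "loc_integrable \<Omega> (\<lambda>z. u z - v z)"
  using assms unfolding loc_integrable_def by (blast intro: set_integral_diff(1))

lemma weak_deriv_diff:
  assumes u: "weak_deriv \<Omega> u e g" and v: "weak_deriv \<Omega> v e h"
  shows "weak_deriv \<Omega> (\<lambda>z. u z - v z) e (\<lambda>z. g z - h z)"
  unfolding weak_deriv_def
proof (intro conjI allI impI loc_integrable_diff)
  show "loc_integrable \<Omega> u" "loc_integrable \<Omega> v" "loc_integrable \<Omega> g" "loc_integrable \<Omega> h"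
    using u v by (auto simp: weak_deriv_def)
  fix \<phi> assume t: "test_fn \<Omega> \<phi>"
  define C where "C = closure {z. \<phi> z \<noteq> 0}"
  have C: "compact C" "C \<subseteq> \<Omega>" using t by (auto simp: C_def test_fn_def)
  have c: "continuous_on UNIV \<phi>" "continuous_on UNIV (\<lambda>z. frechet_derivative \<phi> (at z) e)"
    using C1_continuous[OF test_fn_C1(1)[OF t]] C1_dd_continuous[OF test_fn_C1(1)[OF t], of e] by (auto simp: dd_def[abs_def])
  have z: "\<phi> z = 0" "frechet_derivative \<phi> (at z) e = 0" if "z \<notin> C" for z
    using that frechet_derivative_off_support[of z \<phi> e] closure_subset[of "{z. \<phi> z \<noteq> 0}"] by (auto simp: C_def)
  have i: "set_integrable lebesgue \<Omega> (\<lambda>z. w z * \<phi> z)" "set_integrable lebesgue \<Omega> (\<lambda>z. w z * frechet_derivative \<phi> (at z) e)"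
    if "loc_integrable \<Omega> w" for w
    using set_integrable_times_compact_support[OF that C c(1) z(1)] set_integrable_times_compact_support[OF that C c(2) z(2)] by auto
  show "(LINT z:\<Omega>|lebesgue. (u z - v z) * frechet_derivative \<phi> (at z) e) = - (LINT z:\<Omega>|lebesgue. (g z - h z) * \<phi> z)"
    using u v t unfolding weak_deriv_def left_diff_distrib
    by (simp add: set_integral_diff(2) i)
qed

lemma in_Lp_iff:
  assumes "0 < p"
  shows "in_Lp p S f \<longleftrightarrow> (\<lambda>z. indicator S z *\<^sub>R f z) \<in> borel_measurable lebesgue \<and> pint p (\<lambda>z. indicator S z *\<^sub>R f z) < \<infinity>"
proof -
  have "ennreal (norm (f z) powr p) * indicator S z = ennreal (norm (indicator S z *\<^sub>R f z) powr p)" for z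
    using assms by (auto simp: indicator_def)
  then show ?thesis unfolding in_Lp_def by (simp add: pint_lebesgue del: norm_scaleR)
qed

text \<open>The argument of \<open>pint_add\<close> is repeated over \<open>lebesgue\<close>,
  because members of L_p are only Lebesgue measurable here.\<close>

lemma in_Lp_diff:
  fixes f g :: "'a::euclidean_space \<Rightarrow> 'b::euclidean_space"
  assumes p: "0 < p" and "in_Lp p S f" "in_Lp p S g"
  shows "in_Lp p S (\<lambda>z. f z - g z)"
proof -
  define F where "F z = indicator S z *\<^sub>R f z" for z
  define G where "G z = indicator S z *\<^sub>R g z" for z
  have [measurable]: "F \<in> borel_measurable lebesgue" "G \<in> borel_measurable lebesgue" and fin: "pint p F < \<infinity>" "pint p G < \<infinity>"
    using assms(2,3) by (auto simp: in_Lp_iff[OF p] F_def[abs_def] G_def[abs_def])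
  have eq: "indicator S z *\<^sub>R (f z - g z) = F z - G z" for z by (simp add: F_def G_def scaleR_diff_right)
  have "pint p (\<lambda>z. F z - G z) \<le> (\<integral>\<^sup>+z. ennreal (2 powr p) * (ennreal (norm (F z) powr p) + ennreal (norm (G z) powr p)) \<partial>lebesgue)"
    unfolding pint_lebesgue[symmetric]
  proof (intro nn_integral_mono)
    fix z
    have "norm (F z - G z) powr p \<le> (norm (F z) + norm (G z)) powr p"
      using p by (intro powr_mono2 norm_triangle_ineq4) auto
    also have "\<dots> \<le> 2 powr p * (norm (F z) powr p + norm (G z) powr p)"
      using p by (intro powr_add_le) auto
    finally show "ennreal (norm (F z - G z) powr p) \<le> ennreal (2 powr p) * (ennreal (norm (F z) powr p) + ennreal (norm (G z) powr p))"
      by (simp add: ennreal_mult[symmetric] ennreal_plus[symmetric] ennreal_leI del: ennreal_plus)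
  qed
  also have "\<dots> = ennreal (2 powr p) * (pint p F + pint p G)"
    unfolding pint_lebesgue[symmetric] by (subst nn_integral_cmult) (auto simp: nn_integral_add)
  also have "\<dots> < \<infinity>" using fin by (simp add: ennreal_mult_less_top)
  finally show ?thesis unfolding in_Lp_iff[OF p] eq by simp
qed

lemma W2p_diff:
  assumes p: "0 < p" and u: "W2p p T u ut Du D2u" and v: "W2p p T v vt Dv D2v"
  shows "W2p p T (\<lambda>z. u z - v z) (\<lambda>z. ut z - vt z) (\<lambda>z. Du z - Dv z) (\<lambda>z. D2u z - D2v z)"
  unfolding W2p_def vector_minus_component
proof (intro conjI allI)
  show "in_Lp p (dom_T T) (\<lambda>z. u z - v z)" "in_Lp p (dom_T T) (\<lambda>z. Du z - Dv z)" "in_Lp p (dom_T T) (\<lambda>z. D2u z - D2v z)"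
    using u v by (auto simp: W2p_def intro!: in_Lp_diff[OF p])
  show "weak_deriv (int_T T) (\<lambda>z. u z - v z) (e_x i) (\<lambda>z. Du z $ i - Dv z $ i)"
    "weak_deriv (int_T T) (\<lambda>z. Du z $ i - Dv z $ i) (e_x j) (\<lambda>z. D2u z $ i $ j - D2v z $ i $ j)"
    "weak_deriv (int_T T) (\<lambda>z. u z - v z) e_t (\<lambda>z. ut z - vt z)" for i j
    using u v unfolding W2p_def by (simp_all add: weak_deriv_diff)
  show "set_integrable lebesgue (dom_T T \<inter> cball 0 R) (\<lambda>z. ut z - vt z)" for R
    using u v unfolding W2p_def by (simp add: set_integral_diff(1))
qed

lemma dom_T_borel: "(dom_T T :: 'n::finite pt set) \<in> sets borel"
proof -
  have "(\<lambda>z::'n pt. ereal (fst z)) \<in> borel_measurable borel"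
    by (intro borel_measurable_ereal borel_measurable_continuous_onI continuous_intros)
  then have "{z \<in> space borel. T \<le> ereal (fst (z::'n pt))} \<in> sets borel" by measurable
  then show ?thesis by (simp add: dom_T_def)
qed

lemma in_Lp_subset:
  fixes f :: "'a::euclidean_space \<Rightarrow> 'b::euclidean_space"
  assumes p: "0 < p" and "in_Lp p UNIV f" and [measurable]: "S \<in> sets borel"
  shows "in_Lp p S f"
proof -
  have f: "f \<in> borel_measurable lebesgue" and fin: "pint p f < \<infinity>" using assms(2) by (auto simp: in_Lp_iff[OF p])
  have "pint p (\<lambda>z. indicator S z *\<^sub>R f z) \<le> pint p f" using p by (intro pint_mono) (auto simp: indicator_def)
  moreover have "(\<lambda>z. indicator S z *\<^sub>R f z) \<in> borel_measurable lebesgue"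
    using f by (intro borel_measurable_scaleR borel_measurable_indicator) (auto simp: assms(3))
  ultimately show ?thesis using fin by (auto simp: in_Lp_iff[OF p] intro: le_less_trans)
qed

lemma W2p_restrict:
  fixes u :: "'n::finite pt \<Rightarrow> real"
  assumes p: "0 < p" and u: "W2p p (-\<infinity>) u ut Du D2u"
  shows "W2p p T u ut Du D2u"
proof -
  have "set_integrable lebesgue (dom_T T \<inter> cball 0 R) ut" for R
  proof (rule set_integrable_subset)
    show "set_integrable lebesgue (cball 0 R) ut" using u by (simp add: W2p_def)
    have "dom_T T \<inter> cball 0 R \<in> sets (borel :: 'n pt measure)" by (intro sets.Int dom_T_borel) simp
    then show "(dom_T T \<inter> cball 0 R :: 'n pt set) \<in> sets lebesgue" by simp
  qed simp
  then show ?thesis using u dom_T_borel[of T] unfolding W2p_def dom_T_MInf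
    by (blast intro: in_Lp_subset[OF p] weak_deriv_restrict)
qed

lemma Lop_diff:
  "Lop a b c (\<lambda>z. u z - v z) (\<lambda>z. Du z - Dv z) (\<lambda>z. D2u z - D2v z) z = Lop a b c u Du D2u z - Lop a b c v Dv D2v z"
  by (simp add: Lop_def inner_diff_right right_diff_distrib sum_subtractf)

lemma W2p_unique:
  fixes a :: "'n::finite pt \<Rightarrow> real ^ 'n ^ 'n"
  assumes p: "0 < p" and lam: "0 < lam"
    and est: "\<And>u ut Du D2u. W2p p T u ut Du D2u \<Longrightarrow>
        ennreal lam * Lp_norm p (dom_T T) u \<le> ennreal N * Lp_norm p (dom_T T) (\<lambda>z. Lop a b c u Du D2u z + ut z - lam * u z)"
    and u: "W2p p T u ut Du D2u" "AE z in lebesgue. z \<in> dom_T T \<longrightarrow> ut z + Lop a b c u Du D2u z - lam * u z = f z"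
    and v: "W2p p T v vt Dv D2v" "AE z in lebesgue. z \<in> dom_T T \<longrightarrow> vt z + Lop a b c v Dv D2v z - lam * v z = f z"
  shows "AE z in lebesgue. z \<in> dom_T T \<longrightarrow> u z = v z"
proof -
  define D where "D = (dom_T T :: 'n pt set)"
  define w where "w z = u z - v z" for z
  define g where "g z = Lop a b c w (\<lambda>z. Du z - Dv z) (\<lambda>z. D2u z - D2v z) z + (ut z - vt z) - lam * w z" for z
  have W: "W2p p T w (\<lambda>z. ut z - vt z) (\<lambda>z. Du z - Dv z) (\<lambda>z. D2u z - D2v z)"
    unfolding w_def by (rule W2p_diff[OF p u(1) v(1)])
  have "AE z in lebesgue. z \<in> D \<longrightarrow> g z = 0"
    using u(2) v(2) by eventually_elim (auto simp: g_def w_def[abs_def] Lop_diff algebra_simps D_def)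
  then have "AE z in lebesgue. ennreal (norm (g z) powr p) * indicator D z = 0"
    by eventually_elim (auto simp: indicator_def)
  then have "(\<integral>\<^sup>+z\<in>D. ennreal (norm (g z) powr p) \<partial>lebesgue) = (\<integral>\<^sup>+z. 0 \<partial>(lebesgue :: 'n pt measure))"
    by (rule nn_integral_cong_AE)
  then have g0: "Lp_norm p D g = 0" by (simp add: Lp_norm_def)
  have "ennreal lam * Lp_norm p D w \<le> ennreal N * Lp_norm p D g"
    using est[OF W] by (simp add: D_def g_def[abs_def])
  then have "Lp_norm p D w = 0" using g0 lam by simp
  then have "(\<integral>\<^sup>+z\<in>D. ennreal (norm (w z) powr p) \<partial>lebesgue) = 0"
    unfolding Lp_norm_def enn_powr_def by (auto split: if_splits simp: enn2real_eq_0_iff)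
  moreover have "ennreal (norm (w z) powr p) * indicator D z = ennreal (norm (indicator D z *\<^sub>R w z) powr p)" for z
    using p by (auto simp: indicator_def)
  ultimately have "(\<integral>\<^sup>+z. ennreal (norm (indicator D z *\<^sub>R w z) powr p) \<partial>lebesgue) = 0" by (simp del: real_scaleR_def)
  moreover have "(\<lambda>z. indicator D z *\<^sub>R w z) \<in> borel_measurable lebesgue"
    using W by (simp add: W2p_def in_Lp_def D_def)
  note borel_measurable_pint[OF this, of p]
  ultimately have "AE z in lebesgue. ennreal (norm (indicator D z *\<^sub>R w z) powr p) = 0"
    using nn_integral_0_iff_AE by blast
  then show ?thesis by eventually_elim (auto simp: D_def w_def indicator_def)
qed

subsection \<open>Admissible coefficients\<close>

lemma borel_representative:
  fixes g :: "'a::euclidean_space \<Rightarrow> real"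
  assumes "g \<in> borel_measurable lebesgue"
  obtains g' where "g' \<in> borel_measurable borel" "AE z in lborel. g z = g' z"
  using completion_ex_borel_measurable_real[OF assms] by auto

text \<open>Clamping a Borel representative to [-B, B] changes it only at points where it differs
  from g, so the bound can be had everywhere.\<close>

lemma borel_representative_bounded:
  fixes g :: "'a::euclidean_space \<Rightarrow> real"
  assumes "g \<in> borel_measurable lebesgue" "\<And>z. \<bar>g z\<bar> \<le> B"
  obtains g' where "g' \<in> borel_measurable borel" "AE z in lborel. g z = g' z" "\<And>z. \<bar>g' z\<bar> \<le> B"
proof -
  obtain h where [measurable]: "h \<in> borel_measurable borel" and h: "AE z in lborel. g z = h z"
    by (rule borel_representative[OF assms(1)])
  have B: "0 \<le> B" using assms(2)[of undefined] by linarith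
  show thesis
  proof (rule that[of "\<lambda>z. max (- B) (min B (h z))"])
    show "AE z in lborel. g z = max (- B) (min B (h z))"
      using h
    proof eventually_elim
      case (elim z)
      then show ?case using assms(2)[of z] by auto
    qed
    show "\<bar>max (- B) (min B (h z))\<bar> \<le> B" for z using B by auto
  qed measurable
qed

lemma borel_measurable_vec_components:
  fixes f :: "'a \<Rightarrow> real ^ 'n"
  assumes "\<And>i. (\<lambda>z. f z $ i) \<in> borel_measurable M"
  shows "f \<in> borel_measurable M"
proof (rule iffD2[OF borel_measurable_euclidean_space], rule ballI)
  fix e :: "real ^ 'n" assume "e \<in> Basis"
  then obtain i where "e = axis i 1" by (auto simp: Basis_vec_def)
  then show "(\<lambda>z. f z \<bullet> e) \<in> borel_measurable M" using assms[of i] by (simp add: inner_axis)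
qed

lemma quadratic_form_axis:
  fixes A :: "real ^ 'n ^ 'n"
  shows "(\<Sum>k\<in>UNIV. \<Sum>l\<in>UNIV. A $ k $ l * axis i 1 $ k * axis j 1 $ l) = A $ i $ j"
proof -
  have "(\<Sum>k\<in>UNIV. \<Sum>l\<in>UNIV. A $ k $ l * axis i 1 $ k * axis j 1 $ l) = (\<Sum>k\<in>UNIV. \<Sum>l\<in>UNIV. if l = j then (if k = i then A $ k $ l else 0) else 0)"
    by (intro sum.cong) (auto simp: axis_def)
  then show ?thesis by simp
qed

text \<open>Polarisation with two basis vectors x and y: 2 |A_ij| is at most |Q(x + y)| + |A_ii| +
  |A_jj|, and |x + y| \<le> 2 bounds this by 4 M + M + M.\<close>

lemma quadratic_form_entry_bound:
  fixes A :: "real ^ 'n ^ 'n"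
  assumes sym: "\<And>i j. A $ i $ j = A $ j $ i"
    and bd: "\<And>\<xi>. \<bar>\<Sum>i\<in>UNIV. \<Sum>j\<in>UNIV. A $ i $ j * \<xi> $ i * \<xi> $ j\<bar> \<le> M * norm \<xi> ^ 2"
  shows "\<bar>A $ i $ j\<bar> \<le> 3 * M"
proof -
  let ?Q = "\<lambda>\<xi> \<eta>. \<Sum>k\<in>UNIV. \<Sum>l\<in>UNIV. A $ k $ l * \<xi> $ k * \<eta> $ l"
  define x y :: "real ^ 'n" where "x = axis i 1" and "y = axis j 1"
  have Q: "?Q x x = A $ i $ i" "?Q x y = A $ i $ j" "?Q y x = A $ i $ j" "?Q y y = A $ j $ j"
    using sym[of i j] by (simp_all only: x_def y_def quadratic_form_axis)
  have "?Q (x + y) (x + y) = ?Q x x + ?Q x y + ?Q y x + ?Q y y"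
    by (simp add: sum.distrib algebra_simps)
  then have e: "?Q (x + y) (x + y) = A $ i $ i + 2 * A $ i $ j + A $ j $ j" using Q by simp
  have n: "norm x = 1" "norm y = 1" by (simp_all add: x_def y_def)
  have ii: "\<bar>A $ i $ i\<bar> \<le> M" "\<bar>A $ j $ j\<bar> \<le> M" using bd[of x] bd[of y] Q n by simp_all
  have "norm (x + y) \<le> 2" using norm_triangle_ineq[of x y] n by simp
  then have "norm (x + y) ^ 2 \<le> 2 ^ 2" by (intro power_mono) auto
  then have "M * norm (x + y) ^ 2 \<le> M * 4" using ii by (intro mult_left_mono) auto
  then show ?thesis using bd[of "x + y"] e ii by linarith
qed

text \<open>The range of c gives 0 \<le> K, and comparing the two ellipticity bounds at a unit
  vector gives \<delta> \<le> K. As the sign of \<delta> is left open, the two-sided bound on the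
  quadratic form uses K + |\<delta>|.\<close>

lemma AssumpP_bounds:
  fixes a :: "'n::finite pt \<Rightarrow> real ^ 'n ^ 'n"
  assumes P: "AssumpP p \<delta> K a b c"
  shows "0 \<le> K" "\<delta> \<le> K" "\<bar>a z $ i $ j\<bar> \<le> 3 * (K + \<bar>\<delta>\<bar>)" "\<bar>c z\<bar> \<le> 3 * (K + \<bar>\<delta>\<bar>)"
proof -
  have c: "0 \<le> c z" "c z \<le> K" for z using P unfolding AssumpP_def by blast+
  show K: "0 \<le> K" using c[of z] by linarith
  show "\<bar>c z\<bar> \<le> 3 * (K + \<bar>\<delta>\<bar>)" using c[of z] by simp
  have Q: "\<delta> * norm \<xi> ^ 2 \<le> (\<Sum>i\<in>UNIV. \<Sum>j\<in>UNIV. a z $ i $ j * \<xi> $ i * \<xi> $ j)"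
    "(\<Sum>i\<in>UNIV. \<Sum>j\<in>UNIV. a z $ i $ j * \<xi> $ i * \<xi> $ j) \<le> K * norm \<xi> ^ 2" for \<xi> z
    using P unfolding AssumpP_def by blast+
  have "\<delta> * norm (axis i 1 :: real ^ 'n) ^ 2 \<le> K * norm (axis i 1 :: real ^ 'n) ^ 2"
    by (rule order.trans[OF Q(1) Q(2)])
  then show "\<delta> \<le> K" by simp
  show "\<bar>a z $ i $ j\<bar> \<le> 3 * (K + \<bar>\<delta>\<bar>)"
  proof (rule quadratic_form_entry_bound)
    show "a z $ i $ j = a z $ j $ i" for i j using P unfolding AssumpP_def by blast
    fix \<xi> :: "real ^ 'n"
    define n where "n = norm \<xi> ^ 2"
    have "0 \<le> n" by (simp add: n_def)
    then have "- (K + \<bar>\<delta>\<bar>) * n \<le> \<delta> * n" "K * n \<le> (K + \<bar>\<delta>\<bar>) * n" using K by (auto intro: mult_right_mono)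
    with Q[where z = z and \<xi> = \<xi>, folded n_def]
    show "\<bar>\<Sum>i\<in>UNIV. \<Sum>j\<in>UNIV. a z $ i $ j * \<xi> $ i * \<xi> $ j\<bar> \<le> (K + \<bar>\<delta>\<bar>) * norm \<xi> ^ 2"
      unfolding n_def[symmetric] by linarith
  qed
qed

text \<open>The metric projection onto a ball is Lipschitz with constant 1 and fixes 0, so it
  increases neither oscillation nor size. Replacing b by 0 where it is large could create jumps, and
  with them oscillation that Assumption B does not bound.\<close>

lemma truncated_drift_le:
  fixes x y :: "real ^ 'n"
  assumes "0 \<le> \<theta>" "\<theta> \<le> 1"
  shows "norm (\<theta> *\<^sub>R closest_point (cball 0 (real n)) x - \<theta> *\<^sub>R closest_point (cball 0 (real n)) y) \<le> norm (x - y)"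
    and "norm (\<theta> *\<^sub>R closest_point (cball 0 (real n)) x) \<le> norm x"
proof -
  have 1: "norm (\<theta> *\<^sub>R closest_point (cball 0 (real n)) x - \<theta> *\<^sub>R closest_point (cball 0 (real n)) y) \<le> norm (x - y)" for x y :: "real ^ 'n"
  proof -
    have "norm (\<theta> *\<^sub>R closest_point (cball 0 (real n)) x - \<theta> *\<^sub>R closest_point (cball 0 (real n)) y)
      = \<theta> * dist (closest_point (cball 0 (real n)) x) (closest_point (cball 0 (real n)) y)"
      using assms by (simp add: scaleR_diff_right[symmetric] dist_norm)
    also have "\<dots> \<le> 1 * dist x y"
      using assms by (intro mult_mono closest_point_lipschitz) auto
    finally show ?thesis by (simp add: dist_norm)
  qed
  then show "norm (\<theta> *\<^sub>R closest_point (cball 0 (real n)) x - \<theta> *\<^sub>R closest_point (cball 0 (real n)) y) \<le> norm (x - y)" .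
  show "norm (\<theta> *\<^sub>R closest_point (cball 0 (real n)) x) \<le> norm x"
    using 1[of x 0] by (simp add: closest_point_self)
qed

text \<open>The ellipticity bounds describe a convex set of matrices that contains K I because
  \<delta> \<le> K; this is why the segment can start there with \<delta> and K unchanged.\<close>

lemma AssumpP_path:
  fixes a :: "'n::finite pt \<Rightarrow> real ^ 'n ^ 'n"
  assumes P: "AssumpP p \<delta> K a b c" and p: "1 < p" and th: "0 \<le> \<theta>" "\<theta> \<le> 1"
  shows "AssumpP p \<delta> K (\<lambda>z. \<chi> i j. \<theta> * a z $ i $ j + (1 - \<theta>) * (if i = j then K else 0))
     (\<lambda>z. \<theta> *\<^sub>R closest_point (cball 0 (real n)) (b z)) (\<lambda>z. \<theta> * c z)"
  unfolding AssumpP_def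
proof (intro conjI allI impI)
  have am [measurable]: "(\<lambda>z. a z $ i $ j) \<in> borel_measurable lebesgue" for i j using P by (simp add: AssumpP_def)
  have cm [measurable]: "c \<in> borel_measurable lebesgue" using P by (simp add: AssumpP_def)
  have bm: "b \<in> borel_measurable lebesgue" by (rule borel_measurable_vec_components) (use P in \<open>simp add: AssumpP_def\<close>)
  show "(\<lambda>z. (\<chi> i j. \<theta> * a z $ i $ j + (1 - \<theta>) * (if i = j then K else 0)) $ i $ j) \<in> borel_measurable lebesgue" for i j
    by simp
  show "(\<lambda>z. \<theta> * c z) \<in> borel_measurable lebesgue" by simp
  have "continuous_on UNIV (\<lambda>x. (\<theta> *\<^sub>R closest_point (cball (0::real ^ 'n) (real n)) x) $ i)" for i
    by (intro continuous_intros continuous_on_closest_point) auto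
  from measurable_compose[OF bm borel_measurable_continuous_onI[OF this]]
  show "(\<lambda>z. (\<theta> *\<^sub>R closest_point (cball 0 (real n)) (b z)) $ i) \<in> borel_measurable lebesgue" for i by simp
  show "(\<chi> i j. \<theta> * a z $ i $ j + (1 - \<theta>) * (if i = j then K else 0)) $ i $ j
      = (\<chi> i j. \<theta> * a z $ i $ j + (1 - \<theta>) * (if i = j then K else 0)) $ j $ i" for z i j
  proof -
    have "a z $ i $ j = a z $ j $ i" using P unfolding AssumpP_def by blast
    then show ?thesis by simp
  qed
  have c: "0 \<le> c z" "c z \<le> K" for z using P unfolding AssumpP_def by blast+
  show "0 \<le> \<theta> * c z" for z using c th by simp
  show "\<theta> * c z \<le> K" for z using mult_mono[OF th(2) c(2)[of z]] c[of z] th by simp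
  fix z :: "'n pt" and \<xi> :: "real ^ 'n"
  define n where "n = norm \<xi> ^ 2"
  define Q where "Q = (\<Sum>i\<in>UNIV. \<Sum>j\<in>UNIV. a z $ i $ j * \<xi> $ i * \<xi> $ j)"
  have Q: "\<delta> * n \<le> Q" "Q \<le> K * n" using P unfolding AssumpP_def Q_def n_def by blast+
  have "(\<Sum>i\<in>UNIV. \<Sum>j\<in>UNIV. (\<chi> i j. \<theta> * a z $ i $ j + (1 - \<theta>) * (if i = j then K else 0)) $ i $ j * \<xi> $ i * \<xi> $ j)
    = \<theta> * Q + (1 - \<theta>) * (\<Sum>i\<in>UNIV. \<Sum>j\<in>UNIV. (\<chi> i j. if i = j then K else 0) $ i $ j * \<xi> $ i * \<xi> $ j)"
    unfolding Q_def sum_distrib_left sum.distrib[symmetric] by (intro sum.cong) (auto simp: algebra_simps)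
  also have "\<dots> = \<theta> * Q + (1 - \<theta>) * (K * n)" unfolding scalar_matrix_form n_def ..
  finally have e: "(\<Sum>i\<in>UNIV. \<Sum>j\<in>UNIV. (\<chi> i j. \<theta> * a z $ i $ j + (1 - \<theta>) * (if i = j then K else 0)) $ i $ j * \<xi> $ i * \<xi> $ j)
    = \<theta> * Q + (1 - \<theta>) * (K * n)" .
  show "(\<Sum>i\<in>UNIV. \<Sum>j\<in>UNIV. (\<chi> i j. \<theta> * a z $ i $ j + (1 - \<theta>) * (if i = j then K else 0)) $ i $ j * \<xi> $ i * \<xi> $ j) \<le> K * norm \<xi> ^ 2"
    unfolding e using convex_bound_le[OF Q(2) order.refl th(1), of "1 - \<theta>"] th by (simp add: n_def)
  \<comment> \<open>\<open>convex_bound_le\<close> yields upper bounds, so the lower ellipticity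
    bound is obtained for the negated form.\<close>
  have "- (\<theta> * Q + (1 - \<theta>) * (K * n)) = \<theta> * (- Q) + (1 - \<theta>) * (- (K * n))" by simp
  also have "\<dots> \<le> - (\<delta> * n)"
    using Q th by (intro convex_bound_le) auto
  finally show "\<delta> * norm \<xi> ^ 2 \<le> (\<Sum>i\<in>UNIV. \<Sum>j\<in>UNIV. (\<chi> i j. \<theta> * a z $ i $ j + (1 - \<theta>) * (if i = j then K else 0)) $ i $ j * \<xi> $ i * \<xi> $ j)"
    unfolding e n_def by simp
next
  fix x :: "real ^ 'n" and \<alpha> s t :: real
  assume al: "0 < \<alpha> \<and> \<alpha> \<le> 1"
  have "(\<integral>\<^sup>+ \<tau>\<in>{s..t}. enn_powr (\<integral>\<^sup>+ y\<in>ball 0 \<alpha>. ennreal (norm (\<theta> *\<^sub>R closest_point (cball 0 (real n)) (b (\<tau>, x + y)))) \<partial>lebesgue) (p / (p - 1)) \<partial>lebesgue)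
    \<le> (\<integral>\<^sup>+ \<tau>\<in>{s..t}. enn_powr (\<integral>\<^sup>+ y\<in>ball 0 \<alpha>. ennreal (norm (b (\<tau>, x + y))) \<partial>lebesgue) (p / (p - 1)) \<partial>lebesgue)"
    using p th by (intro nn_integral_mono mult_right_mono enn_powr_mono ennreal_leI truncated_drift_le) auto
  also have "\<dots> < \<infinity>" using P al by (simp add: AssumpP_def)
  finally show "(\<integral>\<^sup>+ \<tau>\<in>{s..t}. enn_powr (\<integral>\<^sup>+ y\<in>ball 0 \<alpha>. ennreal (norm (\<theta> *\<^sub>R closest_point (cball 0 (real n)) (b (\<tau>, x + y)))) \<partial>lebesgue) (p / (p - 1)) \<partial>lebesgue) < \<infinity>" .
qed

lemma AssumpB_path:
  fixes b :: "'n::finite pt \<Rightarrow> real ^ 'n"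
  assumes B: "AssumpB q \<alpha> \<gamma>b b" and q: "0 \<le> q" and th: "0 \<le> \<theta>" "\<theta> \<le> 1"
  shows "AssumpB q \<alpha> \<gamma>b (\<lambda>z. \<theta> *\<^sub>R closest_point (cball 0 (real n)) (b z))"
proof -
  have "AE z in lebesgue. ennreal (\<alpha> powr (- real CARD('n))) *
         (\<integral>\<^sup>+ y\<in>ball 0 \<alpha>. \<integral>\<^sup>+ w\<in>ball 0 \<alpha>.
             ennreal (norm (b (fst z, snd z + y) - b (fst z, snd z + w)) powr q) \<partial>lebesgue \<partial>lebesgue) \<le> ennreal \<gamma>b"
    using B by (simp add: AssumpB_def)
  then have "AE z in lebesgue. ennreal (\<alpha> powr (- real CARD('n))) *
         (\<integral>\<^sup>+ y\<in>ball 0 \<alpha>. \<integral>\<^sup>+ w\<in>ball 0 \<alpha>.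
             ennreal (norm (\<theta> *\<^sub>R closest_point (cball 0 (real n)) (b (fst z, snd z + y)) - \<theta> *\<^sub>R closest_point (cball 0 (real n)) (b (fst z, snd z + w))) powr q) \<partial>lebesgue \<partial>lebesgue) \<le> ennreal \<gamma>b"
  proof eventually_elim
    case (elim z)
    show ?case
      by (rule order.trans[OF _ elim], intro mult_left_mono nn_integral_mono mult_right_mono ennreal_leI powr_mono2 truncated_drift_le)
        (use q th in auto)
  qed
  then show ?thesis using B by (simp add: AssumpB_def)
qed

text \<open>The constant matrix K I drops out of every difference, leaving \<theta> times the
  oscillation of a.\<close>

lemma AssumpA_path:
  fixes a :: "'n::finite pt \<Rightarrow> real ^ 'n ^ 'n"
  assumes A: "AssumpA \<epsilon>0 \<gamma>a a" and th: "0 \<le> \<theta>" "\<theta> \<le> 1"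
  shows "AssumpA \<epsilon>0 \<gamma>a (\<lambda>z. \<chi> i j. \<theta> * a z $ i $ j + (1 - \<theta>) * (if i = j then K else 0))"
  unfolding AssumpA_def
proof (intro conjI allI impI)
  show "0 < \<epsilon>0" using A by (simp add: AssumpA_def)
  fix \<epsilon> s :: real and i j :: 'n
  assume e: "0 < \<epsilon> \<and> \<epsilon> \<le> \<epsilon>0"
  define a' where "a' z = (\<chi> i j. \<theta> * a z $ i $ j + (1 - \<theta>) * (if i = j then K else 0))" for z
  have le: "\<bar>a' z $ i $ j - a' w $ i $ j\<bar> \<le> \<bar>a z $ i $ j - a w $ i $ j\<bar>" for z w
  proof -
    have "a' z $ i $ j - a' w $ i $ j = \<theta> * (a z $ i $ j - a w $ i $ j)" by (simp add: a'_def algebra_simps)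
    then show ?thesis using th by (simp add: abs_mult mult_left_le_one_le)
  qed
  have "ennreal (\<epsilon> powr (- 2 * real CARD('n) - 2)) *
         (\<integral>\<^sup>+ t\<in>{s..s + \<epsilon>\<^sup>2}.
            (SUP x. \<integral>\<^sup>+ y\<in>ball 0 \<epsilon>. \<integral>\<^sup>+ w\<in>ball 0 \<epsilon>.
                ennreal \<bar>a' (t, x + y) $ i $ j - a' (t, x + w) $ i $ j\<bar> \<partial>lebesgue \<partial>lebesgue) \<partial>lebesgue)
    \<le> ennreal (\<epsilon> powr (- 2 * real CARD('n) - 2)) *
         (\<integral>\<^sup>+ t\<in>{s..s + \<epsilon>\<^sup>2}.
            (SUP x. \<integral>\<^sup>+ y\<in>ball 0 \<epsilon>. \<integral>\<^sup>+ w\<in>ball 0 \<epsilon>.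
                ennreal \<bar>a (t, x + y) $ i $ j - a (t, x + w) $ i $ j\<bar> \<partial>lebesgue \<partial>lebesgue) \<partial>lebesgue)"
    by (intro mult_left_mono nn_integral_mono mult_right_mono SUP_mono' ennreal_leI le) auto
  also have "\<dots> \<le> ennreal \<gamma>a" using A e by (simp add: AssumpA_def)
  finally show "ennreal (\<epsilon> powr (- 2 * real CARD('n) - 2)) *
         (\<integral>\<^sup>+ t\<in>{s..s + \<epsilon>\<^sup>2}.
            (SUP x. \<integral>\<^sup>+ y\<in>ball 0 \<epsilon>. \<integral>\<^sup>+ w\<in>ball 0 \<epsilon>.
                ennreal \<bar>(\<chi> i j. \<theta> * a (t, x + y) $ i $ j + (1 - \<theta>) * (if i = j then K else 0)) $ i $ j
                  - (\<chi> i j. \<theta> * a (t, x + w) $ i $ j + (1 - \<theta>) * (if i = j then K else 0)) $ i $ j\<bar> \<partial>lebesgue \<partial>lebesgue) \<partial>lebesgue)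
    \<le> ennreal \<gamma>a" unfolding a'_def .
qed

theorem theorem2p9p1:
  fixes p q q1 r1 \<delta> K \<epsilon>0 \<alpha> \<gamma>a \<gamma>b lam0 N :: real
    and a :: "'n::finite pt \<Rightarrow> real ^ 'n ^ 'n" and b :: "'n pt \<Rightarrow> real ^ 'n" and c :: "'n pt \<Rightarrow> real"
  defines "d \<equiv> real CARD('n)"
  assumes p: "1 < p"
    and q: "(p \<noteq> d \<longrightarrow> q = max d p) \<and> (p = d \<longrightarrow> d < q)"
    and q1r1: "(p < d \<longrightarrow> q1 = p * d / ((p - 1) * d + p) \<and> r1 = ((p - 1) * d + p) / ((p - 1) * d)) \<and>
               (d \<le> p \<longrightarrow> 1 < q1 \<and> q1 < p \<and> r1 = p / ((p - 1) * q1))"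
    and \<gamma>: "0 < \<gamma>a" "0 < \<gamma>b" "0 \<le> lam0"
    and apriori: "\<And>(a' :: 'n pt \<Rightarrow> real ^ 'n ^ 'n) b' c' T u ut Du D2u lam.
        AssumpP p \<delta> K a' b' c' \<Longrightarrow> AssumpB q \<alpha> \<gamma>b b' \<Longrightarrow> AssumpA \<epsilon>0 \<gamma>a a' \<Longrightarrow>
        T \<noteq> \<infinity> \<Longrightarrow> W2p p T u ut Du D2u \<Longrightarrow> lam0 \<le> lam \<Longrightarrow>
        ennreal lam * Lp_norm p (dom_T T) u + Lp_norm p (dom_T T) D2u
          \<le> ennreal N * Lp_norm p (dom_T T)
               (\<lambda>z. Lop a' b' c' u Du D2u z + ut z - lam * u z)"
    and P: "AssumpP p \<delta> K a b c"
    and B: "AssumpB q \<alpha> \<gamma>b b"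
    and A: "AssumpA \<epsilon>0 \<gamma>a a"
    and I: "AssumpI q1 r1 b"
  shows "\<forall>lam T f. lam0 \<le> lam \<and> T \<noteq> \<infinity> \<and> in_Lp p (dom_T T) f \<longrightarrow>
           (\<exists>u ut Du D2u. W2p p T u ut Du D2u \<and>
              (AE z in lebesgue. z \<in> dom_T T \<longrightarrow> ut z + Lop a b c u Du D2u z - lam * u z = f z)) \<and>
           (\<forall>u ut Du D2u v vt Dv D2v.
              W2p p T u ut Du D2u \<and>
              (AE z in lebesgue. z \<in> dom_T T \<longrightarrow> ut z + Lop a b c u Du D2u z - lam * u z = f z) \<and>
              W2p p T v vt Dv D2v \<and>
              (AE z in lebesgue. z \<in> dom_T T \<longrightarrow> vt z + Lop a b c v Dv D2v z - lam * v z = f z)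
              \<longrightarrow> (AE z in lebesgue. z \<in> dom_T T \<longrightarrow> u z = v z))"
proof (intro allI impI, elim conjE)
  fix lam :: real and T :: ereal and f :: "'n pt \<Rightarrow> real"
  assume lam0: "lam0 \<le> lam" and T: "T \<noteq> \<infinity>" and f: "in_Lp p (dom_T T) f"
  have p0: "0 < p" using p by simp
  have q': "1 < q" "real CARD('n) \<le> q"
    using p q unfolding d_def[symmetric] by (cases "p = d"; auto)+
  note K = AssumpP_bounds(1,2)[OF P]
  define M where "M = 3 * (K + \<bar>\<delta>\<bar>)"
  have bd: "\<bar>a z $ i $ j\<bar> \<le> M" "\<bar>c z\<bar> \<le> M" for z i j
    using AssumpP_bounds(3,4)[OF P] by (auto simp: M_def)
  have al: "0 < \<alpha>" "\<alpha> \<le> 1" using B by (auto simp: AssumpB_def)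
  have e0: "0 < \<epsilon>0" using A by (simp add: AssumpA_def)
  have "0 < lam0"
    by (rule lam0_pos[OF p q'(1) K(2,1) \<gamma>(1,2) e0 al]) (use apriori[where T = "-\<infinity>"] in simp)
  then have lam: "0 < lam" using lam0 by simp
  define N' where "N' = (max 0 N / lam) powr p + (max 0 N) powr p + 1"

  \<comment> \<open>The coefficients are only Lebesgue measurable, while slices and compositions are
    well behaved for Borel functions. The existence argument is therefore run on Borel
    representatives, those of a and c keeping the pointwise bound M.\<close>
  have "\<exists>g. g \<in> borel_measurable borel \<and> (AE z in lborel. a z $ i $ j = g z) \<and> (\<forall>z. \<bar>g z\<bar> \<le> M)" for i j
  proof (rule borel_representative_bounded)
    show "(\<lambda>z. a z $ i $ j) \<in> borel_measurable lebesgue" using P unfolding AssumpP_def by blast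
  qed (use bd in auto)
  then have "\<exists>g. \<forall>i j. g i j \<in> borel_measurable borel \<and> (AE z in lborel. a z $ i $ j = g i j z) \<and> (\<forall>z. \<bar>g i j z\<bar> \<le> M)"
    by (intro choice allI) auto
  then obtain ga where "\<forall>i j. ga i j \<in> borel_measurable borel \<and> (AE z in lborel. a z $ i $ j = ga i j z) \<and> (\<forall>z. \<bar>ga i j z\<bar> \<le> M)"
    by (rule exE)
  then have ga: "ga i j \<in> borel_measurable borel" "AE z in lborel. a z $ i $ j = ga i j z" "\<bar>ga i j z\<bar> \<le> M" for i j z
    by blast+
  define a' where "a' z = (\<chi> i j. ga i j z)" for z
  have "AE z in lborel. \<forall>i\<in>UNIV. \<forall>j\<in>UNIV. a z $ i $ j = ga i j z"
    by (intro AE_finite_allI ga(2)) auto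
  then have a': "AE z in lborel. a z = a' z" by eventually_elim (simp add: a'_def vec_eq_iff)
  have "\<exists>g. g \<in> borel_measurable borel \<and> (AE z in lborel. b z $ i = g z)" for i
  proof (rule borel_representative)
    show "(\<lambda>z. b z $ i) \<in> borel_measurable lebesgue" using P unfolding AssumpP_def by blast
  qed auto
  then have "\<exists>g. \<forall>i. g i \<in> borel_measurable borel \<and> (AE z in lborel. b z $ i = g i z)"
    by (intro choice allI) auto
  then obtain gb where gb: "\<And>i. gb i \<in> borel_measurable borel" "\<And>i. AE z in lborel. b z $ i = gb i z"
    by auto
  define b' where "b' z = (\<chi> i. gb i z)" for z
  have "AE z in lborel. \<forall>i\<in>UNIV. b z $ i = gb i z"
    by (intro AE_finite_allI gb(2)) auto
  then have b': "AE z in lborel. b z = b' z" by eventually_elim (simp add: b'_def vec_eq_iff)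
  have bm: "b' \<in> borel_measurable borel"
    by (rule borel_measurable_vec_components) (simp add: b'_def gb)
  have cm: "c \<in> borel_measurable lebesgue" using P unfolding AssumpP_def by blast
  obtain c' where c': "c' \<in> borel_measurable borel" "AE z in lborel. c z = c' z" "\<forall>z. \<bar>c' z\<bar> \<le> M"
    by (rule borel_representative_bounded[OF cm bd(2)]) blast
  have fL: "(\<lambda>z. indicator (dom_T T) z *\<^sub>R f z) \<in> borel_measurable lebesgue" "pint p (\<lambda>z. indicator (dom_T T) z *\<^sub>R f z) < \<infinity>"
    using f by (simp_all add: in_Lp_iff[OF p0])
  obtain f' where f': "f' \<in> borel_measurable borel" "AE z in lborel. indicator (dom_T T) z *\<^sub>R f z = f' z"
    by (rule borel_representative[OF fL(1)])
  have ffin: "pint p f' < \<infinity>" using fL(2) pint_cong_AE[OF f'(2), of p] by simp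

  have drift: "drift_norm p q R (\<lambda>z. norm (b' z)) < \<infinity>" for R
  proof (rule drift_norm_finite[OF p q'(1) bm b' _ B])
    show "(\<integral>\<^sup>+ \<tau>\<in>{s..t}. enn_powr (\<integral>\<^sup>+ y\<in>ball 0 \<alpha>. ennreal (norm (b (\<tau>, x + y))) \<partial>lebesgue) (p / (p - 1)) \<partial>lebesgue) < \<infinity>"
      if "0 < \<alpha>" "\<alpha> \<le> 1" for x \<alpha> s t using P that by (simp add: AssumpP_def)
    show "0 \<le> \<gamma>b" using \<gamma> by simp
  qed
  \<comment> \<open>The estimate is invoked for the original coefficients and carried over by almost
    everywhere equality of the two operators on u. The representatives have not been shown to
    satisfy P, which imposes symmetry and ellipticity at every point.\<close>
  have est: "pint p u \<le> ennreal N' * pint p (\<lambda>z. heat_op e_x e_t K lam u z + \<theta> * lowop a' (\<lambda>z. closest_point (cball 0 (real n)) (b' z)) c' K u z) \<and>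
        pint p (hessx u) \<le> ennreal N' * pint p (\<lambda>z. heat_op e_x e_t K lam u z + \<theta> * lowop a' (\<lambda>z. closest_point (cball 0 (real n)) (b' z)) c' K u z)"
    if th: "0 \<le> \<theta>" "\<theta> \<le> 1" and u: "C2c u" for n \<theta> u
  proof -
    let ?a = "\<lambda>z. \<chi> i j. \<theta> * a z $ i $ j + (1 - \<theta>) * (if i = j then K else 0)"
    let ?b = "\<lambda>z. \<theta> *\<^sub>R closest_point (cball 0 (real n)) (b z)"
    let ?c = "\<lambda>z. \<theta> * c z"
    have "ennreal lam * Lp_norm p (dom_T (-\<infinity>)) u + Lp_norm p (dom_T (-\<infinity>)) (hessx u)
        \<le> ennreal N * Lp_norm p (dom_T (-\<infinity>)) (\<lambda>z. Lop ?a ?b ?c u (gradx u) (hessx u) z + dd e_t u z - lam * u z)"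
      by (rule apriori[OF AssumpP_path[OF P p th] AssumpB_path[OF B _ th] AssumpA_path[OF A th] _ C2c_W2p[OF u] lam0])
        (use q' p in auto)
    then have "ennreal lam * Lp_norm p UNIV u + Lp_norm p UNIV (hessx u) \<le> ennreal N * Lp_norm p UNIV (opL ?a ?b ?c lam u)"
      by (simp add: opL_def[abs_def])
    note e = apriori_pint[OF this lam p0, folded N'_def]
    have "pint p (opL ?a ?b ?c lam u) = pint p (\<lambda>z. heat_op e_x e_t K lam u z + \<theta> * lowop a' (\<lambda>z. closest_point (cball 0 (real n)) (b' z)) c' K u z)"
    proof (rule pint_cong_AE)
      show "AE z in lborel. opL ?a ?b ?c lam u z = heat_op e_x e_t K lam u z + \<theta> * lowop a' (\<lambda>z. closest_point (cball 0 (real n)) (b' z)) c' K u z"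
        using a' b' c'(2) by eventually_elim (simp only: opL_path lowop_def)
    qed
    with e show ?thesis by simp
  qed
  have am: "(\<lambda>z. a' z $ i $ j) \<in> borel_measurable borel" for i j by (simp add: a'_def ga)
  have ab: "\<bar>a' z $ i $ j\<bar> \<le> M" for z i j by (simp add: a'_def ga)
  obtain u ut Du D2u where u: "W2p p (-\<infinity>) u ut Du D2u" and eq: "\<And>z. ut z + Lop a' b' c' u Du D2u z - lam * u z = f' z"
    using existence_whole_space[OF p q' lam K(1) am bm c'(1) f'(1) ab c'(3)[rule_format] drift est ffin] by blast
  have "AE z in lborel. z \<in> dom_T T \<longrightarrow> ut z + Lop a b c u Du D2u z - lam * u z = f z"
    using a' b' c'(2) f'(2)
  proof eventually_elim
    case (elim z)
    show ?case
    proof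
      assume "z \<in> dom_T T"
      then have "f z = f' z" using elim by simp
      also have "\<dots> = ut z + Lop a b c u Du D2u z - lam * u z" using elim(1-3) by (simp only: eq[symmetric] Lop_def)
      finally show "ut z + Lop a b c u Du D2u z - lam * u z = f z" by simp
    qed
  qed
  then have "AE z in lebesgue. z \<in> dom_T T \<longrightarrow> ut z + Lop a b c u Du D2u z - lam * u z = f z"
    by (rule AE_completion)
  then have ex: "\<exists>u ut Du D2u. W2p p T u ut Du D2u \<and>
      (AE z in lebesgue. z \<in> dom_T T \<longrightarrow> ut z + Lop a b c u Du D2u z - lam * u z = f z)"
    using W2p_restrict[OF p0 u] by blast
  have "ennreal lam * Lp_norm p (dom_T T) u \<le> ennreal N * Lp_norm p (dom_T T) (\<lambda>z. Lop a b c u Du D2u z + ut z - lam * u z)"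
    if "W2p p T u ut Du D2u" for u ut Du D2u
    using apriori[OF P B A T that lam0] by (rule order.trans[rotated]) simp
  note uniq = W2p_unique[OF p0 lam this]
  show "(\<exists>u ut Du D2u. W2p p T u ut Du D2u \<and>
              (AE z in lebesgue. z \<in> dom_T T \<longrightarrow> ut z + Lop a b c u Du D2u z - lam * u z = f z)) \<and>
           (\<forall>u ut Du D2u v vt Dv D2v.
              W2p p T u ut Du D2u \<and>
              (AE z in lebesgue. z \<in> dom_T T \<longrightarrow> ut z + Lop a b c u Du D2u z - lam * u z = f z) \<and>
              W2p p T v vt Dv D2v \<and>
              (AE z in lebesgue. z \<in> dom_T T \<longrightarrow> vt z + Lop a b c v Dv D2v z - lam * v z = f z)
              \<longrightarrow> (AE z in lebesgue. z \<in> dom_T T \<longrightarrow> u z = v z))"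
    using ex uniq by blast
qed

end
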